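(* Let $(t,x)\in[0,T]\times K$ and suppose that $f,g$ satisfy the following conditions (for this fixed $(t,x)$). 1. $g:K\to\mathbb{R}$ is $\mathcal{K}$-measurable and $\mathbb{E}^{t,x}|g(X_T)|^2<\infty$. 2. (i) For every $s\in[0,T]$, $x'\in K$, $r\in\mathbb{R}$, $f(s,x',r,\cdot)$ is a mapping $L^2(K,\mathcal{K},\nu(s,x',dy))\to\mathbb{R}$; (ii) for every bounded $\mathcal{K}$-measurable $z:K\to\mathbb{R}$ the mapping $(s,x',r)\mapsto f(s,x',r,z(\cdot))$ is $\mathcal{B}([0,T])\otimes\mathcal{K}\otimes\mathcal{B}(\mathbb{R})$-measurable; (iii) there exist $L,L'\ge 0$ such that for all $s\in[0,T]$, $x'\in K$, $r,r'\in\mathbb{R}$, $z,z'\in L^2(K,\mathcal{K},\nu(s,x',dy))$, $$|f(s,x',r,z(\cdot))-f(s,x',r',z'(\cdot))|\le L'|r-r'|+L\Big(\int_K|z(y)-z'(y)|^2\,\nu(s,x',dy)\Big)^{1/2};$$ (iv) $\mathbb{E}^{t,x}\int_t^T|f(s,X_s,0,0)|^2\,ds<\infty$. Then there exists a unique pair $(Y,Z)$ in $\mathbb{M}^{t,x}$ which solves the backward stochastic differential equation: $\mathbb{P}^{t,x}$-a.s., $$Y_s+\int_s^T\int_K Z_r(y)\,q^t(dr\,dy)=g(X_T)+\int_s^T f(r,X_r,Y_r,Z_r(\cdot))\,dr,\qquad s\in[t,T].$$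
   Context: Setting. $T>0$ is fixed. $(K,\mathcal{K})$ is a measurable space such that $\mathcal{K}$ contains all one-point sets. $\nu(t,x,A)$ ($t\in[0,\infty)$, $x\in K$, $A\in\mathcal{K}$) is a rate measure: $A\mapsto\nu(t,x,A)$ is a positive measure on $\mathcal{K}$, $(t,x)\mapsto\nu(t,x,A)$ is $\mathcal{B}([0,\infty))\otimes\mathcal{K}$-measurable, $\sup_{t\in[0,T],x\in K}\nu(t,x,K)<\infty$, and $\nu(t,x,\{x\})=0$ for all $t,x$. Put $\lambda(t,x)=\nu(t,x,K)$, and $\pi(t,x,A)=\nu(t,x,A)/\lambda(t,x)$ if $\lambda(t,x)>0$, $\pi(t,x,A)=1_A(x)$ if $\lambda(t,x)=0$. Markov process. $X:\Omega\times[0,\infty)\to K$ is a function on a set $\Omega$; for $I\subset[0,\infty)$, $\mathcal{F}_I=\sigma(X_t,\ t\in I)$; for each $(t,x)\in[0,\infty)\times K$ a probability $\mathbb{P}^{t,x}$ (expectation $\mathbb{E}^{t,x}$) is given on $(\Omega,\mathcal{F}_{[t,\infty)})$ such that: $\mathbb{P}^{t,x}(X_t=x)=1$; for $0\le t\le s$ and $A\in\mathcal{K}$ the map $x\mapsto\mathbb{P}^{t,x}(X_s\in A)$ is $\mathcal{K}$-measurable; for $0\le u\le t\le s$, $A\in\mathcal{K}$, $\mathbb{P}^{u,x}(X_s\in A\,|\,\mathcal{F}_{[u,t]})=\mathbb{P}^{t,X_t}(X_s\in A)$, $\mathbb{P}^{u,x}$-a.s.; for every $\omega$ and $t\ge0$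 there is $\delta>0$ with $X_s(\omega)=X_t(\omega)$ for $s\in[t,t+\delta]$; every trajectory has finitely many jumps on every bounded interval. Moreover, with $T_1=\inf\{s>t: X_s\ne X_t\}$ ($\inf\emptyset=\infty$), for $0\le t\le a<b\le\infty$, $x\in K$, $A\in\mathcal{K}$, $$\mathbb{P}^{t,x}(T_1\in(a,b),\,X_{T_1}\in A)=\int_a^b\pi(s,x,A)\,\lambda(s,x)\exp\Big(-\int_t^s\lambda(r,x)\,dr\Big)ds.$$ Random measures. For fixed $t$: $\mathbb{F}^t=(\mathcal{F}_{[t,s]})_{s\ge t}$; $\mathcal{P}^t$ and $Prog^t$ are the $\mathbb{F}^t$-predictable and $\mathbb{F}^t$-progressive $\sigma$-algebras on $\Omega\times[t,T]$; $T_0^t=t$, $T_{n+1}^t=\inf\{s>T_n^t: X_s\neq X_{T_n^t}\}$ ($\inf\emptyset=\infty$); $p^t(ds\,dy)=\sum_{n\ge1,\,T_n^t<\infty}\delta_{(T_n^t,X_{T_n^t})}(ds\,dy)$ on $(t,\infty)\times K$. Its compensator under $\mathbb{P}^{t,x}$ is $\nu(s,X_{s-},dy)\,ds$, and $q^t(ds\,dy)=p^t(ds\,dy)-\nu(s,X_{s-},dy)\,ds$; integrals with respect to $q^t$ are differences of ordinary (pathwise) integrals, defined for $\mathcal{P}^t\otimes\mathcal{K}$-measurable $H$ with $\int_t^T\int_K|H_s(y)|\,\nu(s,X_s,dy)\,ds<\infty$ a.s.; $\int_a^b$ means integration over $(a,b]$. Space $\mathbb{M}^{t,x}$: pairs $(Y,Z)$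 on $[t,T]$ with $Y$ real-valued and $Prog^t$-measurable, $Z:\Omega\times[t,T]\times K\to\mathbb{R}$ $\mathcal{P}^t\otimes\mathcal{K}$-measurable, and $$\|(Y,Z)\|^2_{\mathbb{M}^{t,x}}=\mathbb{E}^{t,x}\int_t^T|Y_s|^2ds+\mathbb{E}^{t,x}\int_t^T\int_K|Z_s(y)|^2\,\nu(s,X_s,dy)\,ds<\infty;$$ pairs whose difference has norm zero are identified. *)

theory Defs
  imports "HOL-Probability.Probability"
begin

section \<open>Rate measures\<close>

definition total_rate :: "(real \<Rightarrow> 'k \<Rightarrow> 'k measure) \<Rightarrow> real \<Rightarrow> 'k \<Rightarrow> ennreal" where
  "total_rate nu t x = emeasure (nu t x) (space (nu t x))"

definition jump_law :: "(real \<Rightarrow> 'k \<Rightarrow> 'k measure) \<Rightarrow> real \<Rightarrow> 'k \<Rightarrow> 'k set \<Rightarrow> ennreal" where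
  "jump_law nu t x A =
     (if total_rate nu t x > 0 then emeasure (nu t x) A / total_rate nu t x else indicator A x)"

text \<open>The function \<open>v \<mapsto> exp (- v)\<close> on \<open>[0, \<infinity>]\<close>, with \<open>exp (- \<infinity>) = 0\<close>.\<close>

definition exp_minus :: "ennreal \<Rightarrow> ennreal" where
  "exp_minus v = (if v = \<infinity> then 0 else ennreal (exp (- enn2real v)))"

section \<open>Trajectories\<close>

text \<open>The space \<open>K\<close> carries no topology, so limits along a trajectory mean eventual constancy.
  At a right-constant trajectory, a jump at time \<open>s\<close> is therefore a failure of constancy
  on every left neighbourhood of \<open>s\<close>.\<close>

definition jump_at :: "(real \<Rightarrow> 'w \<Rightarrow> 'k) \<Rightarrow> 'w \<Rightarrow> real \<Rightarrow> bool" where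
  "jump_at X \<omega> s \<longleftrightarrow> \<not> (\<forall>\<^sub>F r in at_left s. X r \<omega> = X s \<omega>)"

definition left_limit :: "(real \<Rightarrow> 'w \<Rightarrow> 'k) \<Rightarrow> real \<Rightarrow> 'w \<Rightarrow> 'k" where
  "left_limit X s \<omega> = (THE y. \<forall>\<^sub>F r in at_left s. X r \<omega> = y)"

text \<open>The infimum is taken in the extended reals, where \<open>Inf {} = \<infinity>\<close>;
  once some jump time is infinite, all later ones are.\<close>

fun jump_time :: "(real \<Rightarrow> 'w \<Rightarrow> 'k) \<Rightarrow> real \<Rightarrow> nat \<Rightarrow> 'w \<Rightarrow> ereal" where
  "jump_time X t 0 \<omega> = ereal t"
| "jump_time X t (Suc n) \<omega> =
     Inf {ereal s | s. ereal s > jump_time X t n \<omega> \<and>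
            X s \<omega> \<noteq> X (real_of_ereal (jump_time X t n \<omega>)) \<omega>}"

definition jump_pos :: "(real \<Rightarrow> 'w \<Rightarrow> 'k) \<Rightarrow> real \<Rightarrow> nat \<Rightarrow> 'w \<Rightarrow> 'k" where
  "jump_pos X t n \<omega> = X (real_of_ereal (jump_time X t n \<omega>)) \<omega>"

section \<open>Sigma-algebras\<close>

definition history :: "'w set \<Rightarrow> 'k measure \<Rightarrow> (real \<Rightarrow> 'w \<Rightarrow> 'k) \<Rightarrow> real set \<Rightarrow> 'w measure" where
  "history Om K X I = sigma Om {X s -` A \<inter> Om | s A. s \<in> I \<and> A \<in> sets K}"

definition progressive ::
    "'w set \<Rightarrow> 'k measure \<Rightarrow> (real \<Rightarrow> 'w \<Rightarrow> 'k) \<Rightarrow> real \<Rightarrow> real \<Rightarrow> ('w \<times> real) measure" where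
  "progressive Om K X t T = sigma (Om \<times> {t..T})
     {A. A \<subseteq> Om \<times> {t..T} \<and>
         (\<forall>s\<in>{t..T}. A \<inter> (Om \<times> {t..s}) \<in>
            sets (history Om K X {t..s} \<Otimes>\<^sub>M restrict_space borel {t..s}))}"

definition predictable ::
    "'w set \<Rightarrow> 'k measure \<Rightarrow> (real \<Rightarrow> 'w \<Rightarrow> 'k) \<Rightarrow> real \<Rightarrow> real \<Rightarrow> ('w \<times> real) measure" where
  "predictable Om K X t T = sigma (Om \<times> {t..T})
     ({A \<times> {t} | A. A \<in> sets (history Om K X {t})} \<union>
      {A \<times> {r<..s} | A r s. t \<le> r \<and> r \<le> s \<and> s \<le> T \<and> A \<in> sets (history Om K X {t..r})})"

section \<open>The Markov jump process\<close>

text \<open>Beyond the horizon \<open>T\<close> the total rate is allowed to be infinite; the identity for the first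
  jump is then read with the conventions of \<^typ>\<open>ennreal\<close> for \<open>a / \<infinity>\<close> and \<open>0 * \<infinity>\<close>.
  Only times up to \<open>T\<close> matter for the backward equation. Membership of the first-jump event in
  the sigma-algebra of the law is required explicitly, because \<^const>\<open>emeasure\<close> is 0 on sets
  that are not measurable.\<close>

locale markov_jump_process =
  fixes T :: real and K :: "'k measure" and nu :: "real \<Rightarrow> 'k \<Rightarrow> 'k measure"
    and Om :: "'w set" and X :: "real \<Rightarrow> 'w \<Rightarrow> 'k" and P :: "real \<Rightarrow> 'k \<Rightarrow> 'w measure"
  assumes T_pos: "0 < T"
    and singleton_sets: "\<And>x. x \<in> space K \<Longrightarrow> {x} \<in> sets K"
    and sets_nu: "\<And>t x. 0 \<le> t \<Longrightarrow> x \<in> space K \<Longrightarrow> sets (nu t x) = sets K"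
    and measurable_nu: "\<And>A. A \<in> sets K \<Longrightarrow>
      (\<lambda>(t, x). emeasure (nu t x) A) \<in> borel_measurable (restrict_space borel {0..} \<Otimes>\<^sub>M K)"
    and bounded_nu: "(SUP (t, x)\<in>{0..T} \<times> space K. emeasure (nu t x) (space K)) < \<infinity>"
    and nu_singleton: "\<And>t x. 0 \<le> t \<Longrightarrow> x \<in> space K \<Longrightarrow> emeasure (nu t x) {x} = 0"
    and X_space: "\<And>t \<omega>. 0 \<le> t \<Longrightarrow> \<omega> \<in> Om \<Longrightarrow> X t \<omega> \<in> space K"
    and prob_P: "\<And>t x. 0 \<le> t \<Longrightarrow> x \<in> space K \<Longrightarrow> prob_space (P t x)"
    and sets_P: "\<And>t x. 0 \<le> t \<Longrightarrow> x \<in> space K \<Longrightarrow> sets (P t x) = sets (history Om K X {t..})"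
    and P_start: "\<And>t x. 0 \<le> t \<Longrightarrow> x \<in> space K \<Longrightarrow> measure (P t x) {\<omega> \<in> Om. X t \<omega> = x} = 1"
    and measurable_P: "\<And>t s A. 0 \<le> t \<Longrightarrow> t \<le> s \<Longrightarrow> A \<in> sets K \<Longrightarrow>
      (\<lambda>x. measure (P t x) {\<omega> \<in> Om. X s \<omega> \<in> A}) \<in> borel_measurable K"
    and markov: "\<And>u t s x A. 0 \<le> u \<Longrightarrow> u \<le> t \<Longrightarrow> t \<le> s \<Longrightarrow> x \<in> space K \<Longrightarrow> A \<in> sets K \<Longrightarrow>
      AE \<omega> in P u x.
        real_cond_exp (P u x) (history Om K X {u..t}) (indicator {\<omega> \<in> Om. X s \<omega> \<in> A}) \<omega> =
        measure (P t (X t \<omega>)) {\<omega>' \<in> Om. X s \<omega>' \<in> A}"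
    and right_constant: "\<And>\<omega> t. \<omega> \<in> Om \<Longrightarrow> 0 \<le> t \<Longrightarrow> \<exists>\<delta>>0. \<forall>s\<in>{t..t + \<delta>}. X s \<omega> = X t \<omega>"
    and finite_jumps: "\<And>\<omega> b. \<omega> \<in> Om \<Longrightarrow> finite {s \<in> {0<..b}. jump_at X \<omega> s}"
    and first_jump: "\<And>t a (b::ereal) x A.
      0 \<le> t \<Longrightarrow> t \<le> a \<Longrightarrow> ereal a < b \<Longrightarrow> x \<in> space K \<Longrightarrow> A \<in> sets K \<Longrightarrow>
      {\<omega> \<in> Om. jump_time X t 1 \<omega> \<in> {ereal a<..<b} \<and> jump_pos X t 1 \<omega> \<in> A} \<in> sets (P t x) \<and>
      emeasure (P t x)
        {\<omega> \<in> Om. jump_time X t 1 \<omega> \<in> {ereal a<..<b} \<and> jump_pos X t 1 \<omega> \<in> A} =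
      (\<integral>\<^sup>+s\<in>{s. a < s \<and> ereal s < b}.
        jump_law nu s x A * total_rate nu s x *
        exp_minus (\<integral>\<^sup>+r\<in>{t..s}. total_rate nu r x \<partial>lborel) \<partial>lborel)"

section \<open>Random measures and integrals\<close>

text \<open>A sum of point masses is the image of a counting measure.\<close>

definition jump_measure ::
    "'k measure \<Rightarrow> (real \<Rightarrow> 'w \<Rightarrow> 'k) \<Rightarrow> real \<Rightarrow> 'w \<Rightarrow> (real \<times> 'k) measure" where
  "jump_measure K X t \<omega> =
     distr (count_space {n. 1 \<le> n \<and> jump_time X t n \<omega> < \<infinity>})
       (restrict_space borel {t<..} \<Otimes>\<^sub>M K)
       (\<lambda>n. (real_of_ereal (jump_time X t n \<omega>), jump_pos X t n \<omega>))"

text \<open>The pathwise integral of \<open>H\<close> over \<open>{a<..b} \<times> K\<close> against the jump measure started at \<open>t\<close>,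
  minus its compensator.\<close>

definition compensated_integral ::
    "'k measure \<Rightarrow> (real \<Rightarrow> 'k \<Rightarrow> 'k measure) \<Rightarrow> (real \<Rightarrow> 'w \<Rightarrow> 'k) \<Rightarrow> real \<Rightarrow>
     real \<Rightarrow> real \<Rightarrow> ('w \<Rightarrow> real \<Rightarrow> 'k \<Rightarrow> real) \<Rightarrow> 'w \<Rightarrow> real" where
  "compensated_integral K nu X t a b H \<omega> =
     (LINT p:{a<..b} \<times> space K|jump_measure K X t \<omega>. H \<omega> (fst p) (snd p)) -
     (LINT s:{a<..b}|lborel. (LINT y|nu s (left_limit X s \<omega>). H \<omega> s y))"

section \<open>The backward equation\<close>

definition square_integrable :: "'k measure \<Rightarrow> ('k \<Rightarrow> real) \<Rightarrow> bool" where
  "square_integrable M z \<longleftrightarrow> z \<in> borel_measurable M \<and> integrable M (\<lambda>y. (z y)\<^sup>2)"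

definition bsde_norm_sq ::
    "(real \<Rightarrow> 'k \<Rightarrow> 'k measure) \<Rightarrow> (real \<Rightarrow> 'w \<Rightarrow> 'k) \<Rightarrow> 'w measure \<Rightarrow> real \<Rightarrow> real \<Rightarrow>
     ('w \<Rightarrow> real \<Rightarrow> real) \<Rightarrow> ('w \<Rightarrow> real \<Rightarrow> 'k \<Rightarrow> real) \<Rightarrow> ennreal" where
  "bsde_norm_sq nu X Q t T Y Z =
     (\<integral>\<^sup>+\<omega>. (\<integral>\<^sup>+s\<in>{t..T}. ennreal ((Y \<omega> s)\<^sup>2) \<partial>lborel) \<partial>Q) +
     (\<integral>\<^sup>+\<omega>. (\<integral>\<^sup>+s\<in>{t..T}. (\<integral>\<^sup>+y. ennreal ((Z \<omega> s y)\<^sup>2) \<partial>nu s (X s \<omega>)) \<partial>lborel) \<partial>Q)"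

text \<open>Representatives of elements of the space \<open>M\<close>; two pairs represent the same element when
  \<^const>\<open>bsde_norm_sq\<close> of their difference vanishes.\<close>

definition bsde_space ::
    "'w set \<Rightarrow> 'k measure \<Rightarrow> (real \<Rightarrow> 'k \<Rightarrow> 'k measure) \<Rightarrow> (real \<Rightarrow> 'w \<Rightarrow> 'k) \<Rightarrow> 'w measure \<Rightarrow>
     real \<Rightarrow> real \<Rightarrow> (('w \<Rightarrow> real \<Rightarrow> real) \<times> ('w \<Rightarrow> real \<Rightarrow> 'k \<Rightarrow> real)) set" where
  "bsde_space Om K nu X Q t T = {(Y, Z).
     (\<lambda>(\<omega>, s). Y \<omega> s) \<in> borel_measurable (progressive Om K X t T) \<and>
     (\<lambda>((\<omega>, s), y). Z \<omega> s y) \<in> borel_measurable (predictable Om K X t T \<Otimes>\<^sub>M K) \<and>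
     bsde_norm_sq nu X Q t T Y Z < \<infinity>}"

text \<open>The generator \<open>f\<close> is only meaningful at \<open>Z \<omega> r\<close> when this function is square integrable, which
  holds for almost every \<open>r\<close>. Integrating against the complete measure \<^const>\<open>lebesgue\<close> makes
  the values of \<open>f\<close> on the exceptional null set irrelevant also for measurability.\<close>

definition solves_bsde ::
    "'k measure \<Rightarrow> (real \<Rightarrow> 'k \<Rightarrow> 'k measure) \<Rightarrow> (real \<Rightarrow> 'w \<Rightarrow> 'k) \<Rightarrow> 'w measure \<Rightarrow>
     real \<Rightarrow> real \<Rightarrow> ('k \<Rightarrow> real) \<Rightarrow> (real \<Rightarrow> 'k \<Rightarrow> real \<Rightarrow> ('k \<Rightarrow> real) \<Rightarrow> real) \<Rightarrow>
     ('w \<Rightarrow> real \<Rightarrow> real) \<Rightarrow> ('w \<Rightarrow> real \<Rightarrow> 'k \<Rightarrow> real) \<Rightarrow> bool" where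
  "solves_bsde K nu X Q t T g f Y Z \<longleftrightarrow>
     (AE \<omega> in Q. \<forall>s\<in>{t..T}.
        Y \<omega> s + compensated_integral K nu X t s T Z \<omega> =
        g (X T \<omega>) + (LINT r:{s<..T}|lebesgue. f r (X r \<omega>) (Y \<omega> r) (Z \<omega> r)))"

end

theory Submission
  imports Defs
begin

text \<open>
  The process is Markovian, so no martingale representation theorem is needed. If \<open>g\<close> and
  \<open>f(\<cdot>,\<cdot>,0,0)\<close> are bounded, one solves the deterministic integral equation
  \<open>v(s,y) = g(y) + \<integral>\<^sub>s\<^sup>T (\<integral>(v(r,z) - v(r,y)) \<nu>(r,y,dz) + f(r,y,v(r,y),v(r,\<cdot>) - v(r,y))) dr\<close> for bounded \<open>v\<close>
  by Picard iteration. Because the trajectories are step functions, \<open>Y\<^sub>s = v(s,X\<^sub>s)\<close> and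
  \<open>Z\<^sub>s(y) = v(s,y) - v(s,X\<^sub>s\<^sub>-)\<close> then solve the backward equation along every trajectory.

  For two solutions, Ito's formula for the square of the difference, the compensation formula
  \<open>E \<Sum> H(\<tau>,X\<^sub>\<tau>) = E \<integral>\<integral> H d\<nu> ds\<close> for predictable \<open>H \<ge> 0\<close> and Gronwall's lemma bound the norm of the difference
  by that of the difference of the data. This gives uniqueness, and it makes the solutions for truncated data a Cauchy
  sequence. Along a fast subsequence they converge pathwise, and the equation passes to the limit.
  The compensation formula is derived from the law of the first jump and the Markov property by
  cutting the time interval into short pieces.
\<close>

text \<open>Two obstacles shape the development. Nothing may be cancelled before it is known to be
  finite, while the stochastic integrals are signed. Hence signed terms are split into positive and
  negative parts in \<open>ennreal\<close>, where the compensation formula holds for every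
  predictable integrand; the finiteness behind the one decisive cancellation comes from
  \<open>2 |a b| \<le> a^2 + b^2\<close> and the bounded total rate. Moreover \<open>K\<close> has
  no topology, so limits of \<open>K\<close>-valued maps become eventual equality: right constancy
  yields progressive measurability, and sampling on left-open grids yields predictability of the
  state before a jump. Real processes get predictable left limits likewise, as limits along a grid;
  they are identified with \<open>Y\<close> minus its jump only on trajectories where the equation
  holds. The driver is controlled at \<open>Z\<close> only for almost every time, so it is
  integrated against completed Lebesgue measure, and Borel versions are chosen trajectory by
  trajectory. Truncation levels are chosen from the stability constant, so that increments decay
  like \<open>16^(-n)\<close> and geometric weights turn norm bounds into pathwise limits.\<close>

abbreviation sqr :: "real \<Rightarrow> ennreal" where
  "sqr u \<equiv> ennreal (u\<^sup>2)"

section \<open>Jumps of a trajectory\<close>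

context markov_jump_process
begin

definition jumps :: "'w \<Rightarrow> real set" where
  "jumps w = {s. 0 < s \<and> jump_at X w s}"

text \<open>One step of the recursion behind \<open>jump_time\<close>, restarted at an arbitrary
  time: as long as the \<open>n\<close>-th jump time is finite, the next one is the
  \<open>first_exit\<close> from it.\<close>

definition first_exit :: "real \<Rightarrow> 'w \<Rightarrow> ereal" where
  "first_exit u w = Inf {ereal s | s. u < s \<and> X s w \<noteq> X u w}"

lemma finite_jumps_Ioc: "w \<in> Om \<Longrightarrow> 0 \<le> a \<Longrightarrow> finite (jumps w \<inter> {a<..b})"
  by (rule finite_subset[OF _ finite_jumps[of w b]]) (auto simp: jumps_def)

lemma right_constantE:
  assumes "w \<in> Om" "0 \<le> t"
  obtains \<delta> where "\<delta> > 0" "\<And>s. t \<le> s \<Longrightarrow> s \<le> t + \<delta> \<Longrightarrow> X s w = X t w"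
proof -
  obtain \<delta> where "\<delta> > 0" "\<forall>s\<in>{t..t + \<delta>}. X s w = X t w"
    using right_constant[OF assms] by blast
  then show thesis using that[of \<delta>] atLeastAtMost_iff by blast
qed

text \<open>Right constancy at \<open>u\<close> keeps the infimum away from \<open>u\<close>. At a
  finite exit time the state has already changed, for otherwise right constancy there would prolong
  the constant stretch. Together with the constant state on the left this makes the exit time a
  jump, so that exits defined by an infimum meet jumps defined by failure of left constancy.\<close>

lemma first_exit_props:
  assumes om: "w \<in> Om" and u: "0 \<le> u"
  shows first_exit_gt: "ereal u < first_exit u w"
    and first_exit_const: "\<And>s. u \<le> s \<Longrightarrow> ereal s < first_exit u w \<Longrightarrow> X s w = X u w"
    and first_exit_jump: "first_exit u w = ereal \<tau> \<Longrightarrow> \<tau> \<in> jumps w"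
    and first_exit_left: "\<And>s. u < s \<Longrightarrow> ereal s \<le> first_exit u w \<Longrightarrow> \<forall>\<^sub>F r in at_left s. X r w = X u w"
proof -
  let ?S = "{ereal s | s. u < s \<and> X s w \<noteq> X u w}"
  obtain \<delta> where d: "\<delta> > 0" "\<And>s. u \<le> s \<Longrightarrow> s \<le> u + \<delta> \<Longrightarrow> X s w = X u w"
    using right_constantE[OF om u] by blast
  have "ereal (u + \<delta>) \<le> first_exit u w"
    unfolding first_exit_def
  proof (rule Inf_greatest)
    fix e assume "e \<in> ?S"
    then obtain s where s: "e = ereal s" "u < s" "X s w \<noteq> X u w" by blast
    with d(2)[of s] have "\<not> s \<le> u + \<delta>" by auto
    with s show "ereal (u + \<delta>) \<le> e" by simp
  qed
  then show gt: "ereal u < first_exit u w"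
    by (rule less_le_trans[rotated]) (use d(1) in simp)
  show const: "X s w = X u w" if "u \<le> s" "ereal s < first_exit u w" for s
  proof (rule ccontr)
    assume ne: "X s w \<noteq> X u w"
    with that have "u < s" by (cases "u = s") auto
    with ne have "ereal s \<in> ?S" by blast
    then have "first_exit u w \<le> ereal s" unfolding first_exit_def by (rule Inf_lower)
    with that show False by simp
  qed
  show left: "\<forall>\<^sub>F r in at_left s. X r w = X u w" if "u < s" "ereal s \<le> first_exit u w" for s
  proof -
    have "X r w = X u w" if "r \<in> {u<..<s}" for r
      using that less_le_trans[OF _ \<open>ereal s \<le> first_exit u w\<close>, of "ereal r"]
      by (intro const) auto
    then show ?thesis
      using \<open>u < s\<close> by (auto simp: eventually_at_left_field)
  qed
  show "\<tau> \<in> jumps w" if fe: "first_exit u w = ereal \<tau>"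
  proof -
    have ut: "u < \<tau>" using gt fe by simp
    have ne: "X \<tau> w \<noteq> X u w"
    proof
      assume eq: "X \<tau> w = X u w"
      obtain \<delta> where d: "\<delta> > 0" "\<And>s. \<tau> \<le> s \<Longrightarrow> s \<le> \<tau> + \<delta> \<Longrightarrow> X s w = X \<tau> w"
        using right_constantE[OF om, of \<tau>] u ut by auto
      have "ereal (\<tau> + \<delta>) \<le> first_exit u w"
        unfolding first_exit_def
      proof (rule Inf_greatest)
        fix e assume "e \<in> ?S"
        then obtain s where s: "e = ereal s" "u < s" "X s w \<noteq> X u w" by blast
        have "\<tau> \<le> s" using const[of s] s fe by force
        with d(2)[of s] s eq show "ereal (\<tau> + \<delta>) \<le> e" by force
      qed
      with fe d(1) show False by simp
    qed
    have "\<forall>\<^sub>F r in at_left \<tau>. X r w = X u w" using left[of \<tau>] ut fe by simp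
    then have "\<not> (\<forall>\<^sub>F r in at_left \<tau>. X r w = X \<tau> w)"
      using ne eventually_happens[OF eventually_conj, of "\<lambda>r. X r w = X u w" "at_left \<tau>" "\<lambda>r. X r w = X \<tau> w"]
      by auto
    with u ut show ?thesis by (simp add: jumps_def jump_at_def)
  qed
qed

lemma first_exit_no_jumps:
  assumes om: "w \<in> Om" and u: "0 \<le> u" and \<tau>: "u < \<tau>" "ereal \<tau> < first_exit u w"
  shows "\<tau> \<notin> jumps w"
  using first_exit_left[OF om u, of \<tau>] first_exit_const[OF om u, of \<tau>] \<tau>
  by (auto simp: jumps_def jump_at_def less_imp_le)

text \<open>Constancy on an interval becomes emptiness of a set of jumps. This is the form in which
  finiteness of the jumps on bounded intervals can be exploited.\<close>

lemma first_exit_le_iff: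
  assumes om: "w \<in> Om" and u: "0 \<le> u"
  shows "first_exit u w \<le> ereal s \<longleftrightarrow> jumps w \<inter> {u<..s} \<noteq> {}"
proof
  assume le: "first_exit u w \<le> ereal s"
  moreover have "first_exit u w \<noteq> - \<infinity>" using first_exit_gt[OF om u] by auto
  ultimately obtain \<tau> where \<tau>: "first_exit u w = ereal \<tau>" by (cases "first_exit u w") auto
  then show "jumps w \<inter> {u<..s} \<noteq> {}"
    using first_exit_jump[OF om u \<tau>] first_exit_gt[OF om u] le by auto
next
  assume "jumps w \<inter> {u<..s} \<noteq> {}"
  then obtain \<tau> where "\<tau> \<in> jumps w" "u < \<tau>" "\<tau> \<le> s" by auto
  with first_exit_no_jumps[OF om u, of \<tau>] show "first_exit u w \<le> ereal s"
    using order_trans[of "first_exit u w" "ereal \<tau>" "ereal s"]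
    by (cases "ereal \<tau> < first_exit u w") (auto simp: not_less)
qed

lemma no_jumps_const:
  assumes "w \<in> Om" "0 \<le> a" "jumps w \<inter> {a<..b} = {}" "a \<le> r" "r \<le> b"
  shows "X r w = X a w"
proof -
  have "\<not> first_exit a w \<le> ereal r"
    using assms by (subst first_exit_le_iff) auto
  then show ?thesis using first_exit_const[of w a r] assms by auto
qed

lemma no_jumps_left:
  assumes "w \<in> Om" "0 \<le> a" "jumps w \<inter> {a<..<b} = {}" "a < b"
  shows "\<forall>\<^sub>F r in at_left b. X r w = X a w"
proof -
  have "ereal b \<le> first_exit a w"
  proof (rule ccontr)
    assume "\<not> ereal b \<le> first_exit a w"
    moreover have "first_exit a w \<noteq> - \<infinity>" using first_exit_gt[of w a] assms by auto
    ultimately obtain \<tau> where \<tau>: "first_exit a w = ereal \<tau>" "\<tau> < b" by (cases "first_exit a w") auto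
    then show False
      using first_exit_jump[of w a \<tau>] first_exit_gt[of w a] assms by auto
  qed
  then show ?thesis using first_exit_left[of w a b] assms by auto
qed

text \<open>The witness is the last jump between \<open>r\<close> and \<open>s\<close>, or
  \<open>r\<close> if there is none; finiteness of the jumps provides the maximum.\<close>

lemma gap_left:
  assumes "w \<in> Om" "0 \<le> r" "r < s"
  obtains a where "r \<le> a" "a < s" "jumps w \<inter> {a<..<s} = {}"
proof -
  let ?F = "insert r (jumps w \<inter> {r<..s} - {s})"
  have fin: "finite ?F" using finite_jumps_Ioc[of w r s] assms by auto
  show ?thesis
  proof (rule that[of "Max ?F"])
    show "r \<le> Max ?F" using fin by simp
    have "Max ?F \<in> ?F" using fin by (intro Max_in) auto
    then show "Max ?F < s" using \<open>r < s\<close> by auto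
    show "jumps w \<inter> {Max ?F<..<s} = {}"
    proof (rule ccontr)
      assume "jumps w \<inter> {Max ?F<..<s} \<noteq> {}"
      then obtain \<tau> where \<tau>: "\<tau> \<in> jumps w" "Max ?F < \<tau>" "\<tau> < s" by auto
      then have "\<tau> \<in> ?F" using \<open>r \<le> Max ?F\<close> by auto
      then have "\<tau> \<le> Max ?F" using fin by simp
      with \<tau> show False by simp
    qed
  qed
qed

lemma left_limit_eqI:
  assumes "\<forall>\<^sub>F r in at_left s. X r w = y"
  shows "left_limit X s w = y"
  unfolding left_limit_def
proof (rule the_equality[where P = "\<lambda>y. \<forall>\<^sub>F r in at_left s. X r w = y", OF assms])
  fix z assume "\<forall>\<^sub>F r in at_left s. X r w = z"
  with assms have "\<forall>\<^sub>F r in at_left s. y = z" by eventually_elim simp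
  then show "z = y" by (auto dest: eventually_happens)
qed

lemma left_limit_eventually:
  assumes "w \<in> Om" "0 < s"
  shows "\<forall>\<^sub>F r in at_left s. X r w = left_limit X s w"
proof -
  obtain a where "0 \<le> a" "a < s" "jumps w \<inter> {a<..<s} = {}"
    using gap_left[of w 0 s] assms by auto
  then have "\<forall>\<^sub>F r in at_left s. X r w = X a w"
    using no_jumps_left[of w a s] assms by auto
  then show ?thesis using left_limit_eqI by simp
qed

lemma left_limit_no_jumps:
  assumes "w \<in> Om" "0 \<le> a" "jumps w \<inter> {a<..<b} = {}" "a < b"
  shows "left_limit X b w = X a w"
  by (intro left_limit_eqI no_jumps_left assms)

lemma left_limit_space:
  assumes "w \<in> Om" "0 < s"
  shows "left_limit X s w \<in> space K"
proof -
  obtain a where "0 \<le> a" "a < s" "jumps w \<inter> {a<..<s} = {}"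
    using gap_left[of w 0 s] assms by auto
  then show ?thesis
    using left_limit_no_jumps[of w a s] X_space assms by simp
qed

lemma left_limit_not_jump:
  assumes "0 < s" "s \<notin> jumps w"
  shows "left_limit X s w = X s w"
  using assms by (intro left_limit_eqI) (auto simp: jumps_def jump_at_def)

section \<open>The jump times enumerate the jumps after the starting time\<close>

lemma jump_time_Suc:
  assumes "jump_time X t n w = ereal \<tau>"
  shows "jump_time X t (Suc n) w = first_exit \<tau> w"
  using assms by (simp add: first_exit_def)

lemma jump_time_Suc_infinite:
  assumes "jump_time X t n w = \<infinity>"
  shows "jump_time X t (Suc n) w = \<infinity>"
  using assms by (simp add: top_ereal_def)

lemma jump_time_ge: "w \<in> Om \<Longrightarrow> 0 \<le> t \<Longrightarrow> ereal t \<le> jump_time X t n w"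
proof (induction n)
  case (Suc n)
  show ?case
  proof (cases "jump_time X t n w")
    case (real \<tau>)
    then have "t \<le> \<tau>" using Suc by simp
    then show ?thesis
      using first_exit_gt[of w \<tau>] jump_time_Suc[OF real] Suc.prems
      using order_trans[of "ereal t" "ereal \<tau>"] by (auto simp del: jump_time.simps simp: less_imp_le)
  next
    case PInf
    then show ?thesis using jump_time_Suc_infinite[OF PInf] by simp
  qed (use Suc in auto)
qed simp

lemma jump_time_less_Suc:
  assumes "w \<in> Om" "0 \<le> t" "jump_time X t n w < \<infinity>"
  shows "jump_time X t n w < jump_time X t (Suc n) w"
proof (cases "jump_time X t n w")
  case (real \<tau>)
  then have "t \<le> \<tau>" using jump_time_ge[of w t n] assms by simp
  then show ?thesis
    using first_exit_gt[of w \<tau>] jump_time_Suc[OF real] assms real by simp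
qed (use jump_time_ge[of w t n] assms in auto)

lemma jump_time_mono:
  assumes "w \<in> Om" "0 \<le> t" "m \<le> n"
  shows "jump_time X t m w \<le> jump_time X t n w"
  using \<open>m \<le> n\<close>
proof (induction n rule: dec_induct)
  case (step n)
  have "jump_time X t n w \<le> jump_time X t (Suc n) w"
    using jump_time_less_Suc[of w t n] jump_time_Suc_infinite[of t n w] assms
    by (cases "jump_time X t n w < \<infinity>") auto
  with step show ?case by order
qed simp

lemma jump_time_strict:
  assumes "w \<in> Om" "0 \<le> t" "m < n" "jump_time X t m w < \<infinity>"
  shows "jump_time X t m w < jump_time X t n w"
  using jump_time_less_Suc[of w t m] jump_time_mono[of w t "Suc m" n] assms by auto

lemma jump_time_in_jumps:
  assumes "w \<in> Om" "0 \<le> t" "1 \<le> n" "jump_time X t n w = ereal \<tau>"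
  shows "\<tau> \<in> jumps w \<and> t < \<tau>"
proof -
  obtain m where n: "n = Suc m" using \<open>1 \<le> n\<close> by (cases n) auto
  have lt: "jump_time X t m w < jump_time X t n w"
    using jump_time_strict[of w t m n] assms n jump_time_Suc_infinite[of t m w]
    by (cases "jump_time X t m w") auto
  then obtain \<sigma> where \<sigma>: "jump_time X t m w = ereal \<sigma>" "t \<le> \<sigma>"
    using assms jump_time_ge[of w t m] by (cases "jump_time X t m w") auto
  then have "first_exit \<sigma> w = ereal \<tau>"
    using jump_time_Suc[OF \<sigma>(1)] n assms by simp
  then show ?thesis
    using first_exit_jump[of w \<sigma> \<tau>] first_exit_gt[of w \<sigma>] \<sigma> assms by auto
qed

text \<open>If a jump \<open>\<tau>\<close> were missed, every jump time would stay below it, and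
  the strictly increasing sequence of jump times would give infinitely many jumps in
  \<open>{t<..\<tau>}\<close>.\<close>

lemma jumps_are_jump_times:
  assumes "w \<in> Om" "0 \<le> t" "\<tau> \<in> jumps w" "t < \<tau>"
  obtains n where "1 \<le> n" "jump_time X t n w = ereal \<tau>"
proof -
  have "\<exists>n\<ge>1. jump_time X t n w = ereal \<tau>"
  proof (rule ccontr)
    assume no: "\<not> ?thesis"
    have lt: "jump_time X t n w < ereal \<tau>" for n
    proof (induction n)
      case (Suc n)
      then obtain \<sigma> where \<sigma>: "jump_time X t n w = ereal \<sigma>" "t \<le> \<sigma>" "\<sigma> < \<tau>"
        using jump_time_ge[of w t n] assms by (cases "jump_time X t n w") auto
      have "first_exit \<sigma> w \<le> ereal \<tau>"
        using \<sigma> assms by (subst first_exit_le_iff) auto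
      then show ?case
        using no[simplified, rule_format, of "Suc n"] jump_time_Suc[OF \<sigma>(1)]
        by (simp del: jump_time.simps add: less_le)
    qed (use assms in auto)
    let ?f = "\<lambda>n. real_of_ereal (jump_time X t (Suc n) w)"
    have f: "jump_time X t (Suc n) w = ereal (?f n)" for n
      using lt[of "Suc n"] jump_time_ge[of w t "Suc n"] assms
      by (cases "jump_time X t (Suc n) w") (auto simp del: jump_time.simps)
    have "strict_mono ?f"
    proof (rule strict_monoI)
      fix m n :: nat assume "m < n"
      moreover have "jump_time X t (Suc m) w < \<infinity>" by (subst f) simp
      ultimately have "jump_time X t (Suc m) w < jump_time X t (Suc n) w"
        using jump_time_strict[of w t "Suc m" "Suc n"] assms by (simp del: jump_time.simps)
      then show "?f m < ?f n" by (subst (asm) (1 2) f) simp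
    qed
    then have "infinite (range ?f)" by (simp add: range_inj_infinite strict_mono_imp_inj_on)
    moreover have "range ?f \<subseteq> jumps w \<inter> {t<..\<tau>}"
    proof
      fix s assume "s \<in> range ?f"
      then obtain n where n: "s = ?f n" by blast
      then have js: "jump_time X t (Suc n) w = ereal s" using f by metis
      then have "s < \<tau>" using lt[of "Suc n"] by (simp del: jump_time.simps)
      then show "s \<in> jumps w \<inter> {t<..\<tau>}"
        using jump_time_in_jumps[OF assms(1,2) _ js] by simp
    qed
    ultimately show False
      using finite_jumps_Ioc[of w t \<tau>] assms finite_subset by blast
  qed
  then show thesis using that by blast
qed

lemma jump_time_bij:
  assumes "w \<in> Om" "0 \<le> t" "t \<le> a"
  shows "bij_betw (\<lambda>n. real_of_ereal (jump_time X t n w))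
    {n. 1 \<le> n \<and> jump_time X t n w < \<infinity> \<and> real_of_ereal (jump_time X t n w) \<in> {a<..b}}
    (jumps w \<inter> {a<..b})"
proof -
  have r: "jump_time X t n w = ereal (real_of_ereal (jump_time X t n w))"
    if "jump_time X t n w < \<infinity>" for n
    using that jump_time_ge[of w t n] assms
    by (cases "jump_time X t n w") auto
  show ?thesis
    unfolding bij_betw_def
  proof (intro conjI inj_onI equalityI subsetI)
    fix m n
    assume mn: "m \<in> {n. 1 \<le> n \<and> jump_time X t n w < \<infinity> \<and> real_of_ereal (jump_time X t n w) \<in> {a<..b}}"
      "n \<in> {n. 1 \<le> n \<and> jump_time X t n w < \<infinity> \<and> real_of_ereal (jump_time X t n w) \<in> {a<..b}}"
      "real_of_ereal (jump_time X t m w) = real_of_ereal (jump_time X t n w)"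
    then have "jump_time X t m w = jump_time X t n w" using r[of m] r[of n] by simp
    then show "m = n"
      using jump_time_strict[of w t m n] jump_time_strict[of w t n m] mn assms
      by (cases m n rule: linorder_cases) auto
  next
    fix s assume "s \<in> (\<lambda>n. real_of_ereal (jump_time X t n w)) `
      {n. 1 \<le> n \<and> jump_time X t n w < \<infinity> \<and> real_of_ereal (jump_time X t n w) \<in> {a<..b}}"
    then obtain n where "1 \<le> n" "jump_time X t n w < \<infinity>" "s = real_of_ereal (jump_time X t n w)" "s \<in> {a<..b}"
      by blast
    then show "s \<in> jumps w \<inter> {a<..b}"
      using jump_time_in_jumps[of w t n s] r[of n] assms by auto
  next
    fix s assume s: "s \<in> jumps w \<inter> {a<..b}"
    then obtain n where "1 \<le> n" "jump_time X t n w = ereal s"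
      using jumps_are_jump_times[of w t s] assms by auto
    with s show "s \<in> (\<lambda>n. real_of_ereal (jump_time X t n w)) `
      {n. 1 \<le> n \<and> jump_time X t n w < \<infinity> \<and> real_of_ereal (jump_time X t n w) \<in> {a<..b}}"
      by (intro image_eqI[of _ _ n]) auto
  qed
qed

text \<open>The jump measure is an image of a counting measure, so only measurability of the
  integrand, cut off outside \<open>{a<..b}\<close>, is at stake. The integral collapses to a finite
  sum that no longer mentions the starting time \<open>t\<close>.\<close>

lemma set_integral_jump_measure:
  fixes h :: "real \<times> 'k \<Rightarrow> real"
  assumes om: "w \<in> Om" and t: "0 \<le> t" "t \<le> a"
    and h: "(\<lambda>p. indicator ({a<..b} \<times> space K) p *\<^sub>R h p) \<in> borel_measurable (restrict_space borel {t<..} \<Otimes>\<^sub>M K)"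
  shows "(LINT p:{a<..b} \<times> space K|jump_measure K X t w. h p) =
    (\<Sum>\<tau>\<in>jumps w \<inter> {a<..b}. h (\<tau>, X \<tau> w))"
proof -
  let ?N = "{n. 1 \<le> n \<and> jump_time X t n w < \<infinity>}"
  let ?\<tau> = "\<lambda>n. real_of_ereal (jump_time X t n w)"
  let ?B = "{n. 1 \<le> n \<and> jump_time X t n w < \<infinity> \<and> ?\<tau> n \<in> {a<..b}}"
  have r: "?\<tau> n \<in> jumps w \<and> t < ?\<tau> n" if "n \<in> ?N" for n
    using that jump_time_ge[of w t n] om t jump_time_in_jumps[of w t n]
    by (cases "jump_time X t n w") auto
  have sp: "X (?\<tau> n) w \<in> space K" if "n \<in> ?N" for n
    using r[OF that] X_space[of "?\<tau> n" w] om t by auto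
  have m: "(\<lambda>n. (?\<tau> n, jump_pos X t n w)) \<in> count_space ?N \<rightarrow>\<^sub>M restrict_space borel {t<..} \<Otimes>\<^sub>M K"
    using r sp by (auto simp: space_pair_measure space_restrict_space jump_pos_def)
  have bij: "bij_betw ?\<tau> ?B (jumps w \<inter> {a<..b})" by (rule jump_time_bij) (use om t in auto)
  have finB: "finite ?B"
    using bij_betw_finite[OF bij] finite_jumps_Ioc[of w a b] om t by auto
  have "(LINT p:{a<..b} \<times> space K|jump_measure K X t w. h p) =
    (LINT n|count_space ?N. indicator ({a<..b} \<times> space K) (?\<tau> n, jump_pos X t n w) *\<^sub>R h (?\<tau> n, jump_pos X t n w))"
    unfolding set_lebesgue_integral_def jump_measure_def
    by (rule integral_distr[OF m h])
  also have "\<dots> = (LINT n|count_space ?N. indicator ?B n *\<^sub>R h (?\<tau> n, jump_pos X t n w))"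
    using sp by (intro Bochner_Integration.integral_cong) (auto simp: indicator_def jump_pos_def)
  also have "\<dots> = (\<Sum>n\<in>?B. indicator ?B n *\<^sub>R h (?\<tau> n, jump_pos X t n w))"
    using finB
    by (subst lebesgue_integral_count_space_finite_support)
      (auto intro!: sum.mono_neutral_left elim!: finite_subset[rotated] simp: indicator_def)
  also have "\<dots> = (\<Sum>n\<in>?B. h (?\<tau> n, X (?\<tau> n) w))"
    by (intro sum.cong) (auto simp: jump_pos_def)
  also have "\<dots> = (\<Sum>\<tau>\<in>jumps w \<inter> {a<..b}. h (\<tau>, X \<tau> w))"
    by (rule sum.reindex_bij_betw[OF bij])
  finally show ?thesis .
qed

end

section \<open>Left-open time grids\<close>

definition grid :: "real \<Rightarrow> real \<Rightarrow> real \<Rightarrow> real" where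
  "grid h r v = (if v \<le> r then r else r + h * (real_of_int \<lceil>(v - r) / h\<rceil> - 1))"

text \<open>For \<open>v > r\<close>, \<open>grid h r v\<close> is the left end of the cell
  \<open>(r + h k, r + h (k + 1)]\<close> that contains \<open>v\<close>. Left-open cells make it
  strictly smaller than \<open>v\<close>, so a process sampled there is predictable and, for a fine
  grid, shows the state before a jump at \<open>v\<close>.\<close>

lemma grid_bounds:
  assumes "0 < h" "r < v"
  shows "r \<le> grid h r v" "grid h r v < v" "v - h \<le> grid h r v"
proof -
  let ?q = "(v - r) / h"
  have q: "0 < ?q" "v = r + h * ?q" using assms by auto
  have c: "1 \<le> real_of_int \<lceil>?q\<rceil>" "real_of_int \<lceil>?q\<rceil> - 1 < ?q" "?q \<le> real_of_int \<lceil>?q\<rceil>"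
  proof -
    show "1 \<le> real_of_int \<lceil>?q\<rceil>" using q(1) by (simp del: divide_pos_pos)
    show "real_of_int \<lceil>?q\<rceil> - 1 < ?q" "?q \<le> real_of_int \<lceil>?q\<rceil>" by linarith+
  qed
  have g: "grid h r v = r + h * (real_of_int \<lceil>?q\<rceil> - 1)" using assms by (simp add: grid_def)
  show "r \<le> grid h r v" using c assms by (simp add: g)
  have "h * (real_of_int \<lceil>?q\<rceil> - 1) < h * ?q" by (rule mult_strict_left_mono[OF c(2) assms(1)])
  then show "grid h r v < v" using g q by linarith
  have "h * ?q \<le> h * real_of_int \<lceil>?q\<rceil>" by (rule mult_left_mono[OF c(3)]) (use assms in simp)
  then show "v - h \<le> grid h r v" using g q(2) by (simp add: right_diff_distrib)
qed

lemma grid_eq: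
  assumes "0 < h" "r + h * real k < v" "v \<le> r + h * real (Suc k)"
  shows "grid h r v = r + h * real k"
proof -
  have "real k < (v - r) / h" "(v - r) / h \<le> real k + 1"
    using assms by (auto simp: field_simps)
  then have "\<lceil>(v - r) / h\<rceil> = int k + 1" by (intro ceiling_unique) auto
  moreover have "r < v" using assms by (smt (verit) mult_nonneg_nonneg of_nat_0_le_iff)
  ultimately show ?thesis by (simp add: grid_def)
qed

lemma grid_interval:
  assumes "0 < h" "r < v"
  obtains k :: nat where "r + h * real k < v" "v \<le> r + h * real (Suc k)"
proof -
  let ?q = "(v - r) / h"
  have q: "0 < ?q" using assms by auto
  define k where "k = nat (\<lceil>?q\<rceil> - 1)"
  have "real k = real_of_int \<lceil>?q\<rceil> - 1" using q by (simp add: k_def)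
  then have "real k < ?q" "?q \<le> real (Suc k)" by linarith+
  then show ?thesis using assms by (intro that[of k]) (auto simp: field_simps)
qed

text \<open>The filter \<open>at_left v\<close> records convergence to \<open>v\<close> as well as
  staying strictly below it; whatever holds eventually to the left of \<open>v\<close> can therefore
  be read off along the grid.\<close>

lemma grid_tendsto:
  assumes h: "\<And>n. 0 < h n" "h \<longlonglongrightarrow> 0" and rv: "r < v"
  shows "filterlim (\<lambda>n. grid (h n) r v) (at_left v) sequentially"
  unfolding at_within_def filterlim_inf filterlim_principal
proof (intro conjI)
  show "(\<lambda>n. grid (h n) r v) \<longlonglongrightarrow> v"
  proof (rule tendsto_sandwich)
    show "(\<lambda>n. v - h n) \<longlonglongrightarrow> v"
      using tendsto_diff[OF tendsto_const[of v] h(2)] by simp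
    show "\<forall>\<^sub>F n in sequentially. v - h n \<le> grid (h n) r v"
      using grid_bounds(3)[OF h(1) rv] by (intro always_eventually allI) simp
    show "\<forall>\<^sub>F n in sequentially. grid (h n) r v \<le> v"
      using grid_bounds(2)[OF h(1) rv] by (intro always_eventually allI) (simp add: less_imp_le)
  qed simp
  show "\<forall>\<^sub>F n in sequentially. grid (h n) r v \<in> {..<v} - {v}"
    using grid_bounds(2)[OF h(1) rv] by (intro always_eventually allI) (simp add: less_imp_neq)
qed

lemma inverse_Suc_tendsto: "(\<lambda>n. 1 / real (Suc n)) \<longlonglongrightarrow> 0"
  by (rule LIMSEQ_Suc[OF lim_1_over_n])

context markov_jump_process
begin

lemma space_history [simp]: "space (history Om K X I) = Om"
  unfolding history_def by (rule space_measure_of) auto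

lemma sets_history: "sets (history Om K X I) = sigma_sets Om {X s -` A \<inter> Om | s A. s \<in> I \<and> A \<in> sets K}"
  unfolding history_def by (rule sets_measure_of) auto

lemma X_history: "s \<in> I \<Longrightarrow> 0 \<le> s \<Longrightarrow> X s \<in> history Om K X I \<rightarrow>\<^sub>M K"
  by (rule measurableI) (auto simp: X_space sets_history)

lemma sets_history_mono: "I \<subseteq> J \<Longrightarrow> sets (history Om K X I) \<subseteq> sets (history Om K X J)"
  unfolding sets_history by (rule sigma_sets_mono') auto

lemma space_P [simp]: "0 \<le> t \<Longrightarrow> x \<in> space K \<Longrightarrow> space (P t x) = Om"
  using sets_eq_imp_space_eq[OF sets_P] by simp

lemma sets_history_P: "0 \<le> t \<Longrightarrow> x \<in> space K \<Longrightarrow> I \<subseteq> {t..} \<Longrightarrow> A \<in> sets (history Om K X I) \<Longrightarrow> A \<in> sets (P t x)"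
  using sets_history_mono sets_P by blast

lemma X_P: "0 \<le> t \<Longrightarrow> x \<in> space K \<Longrightarrow> t \<le> s \<Longrightarrow> X s \<in> P t x \<rightarrow>\<^sub>M K"
  using X_history[of s "{t..}"] measurable_cong_sets[OF sets_P refl, of t x K] by auto

end

section \<open>The filtration of a started process\<close>

locale started_process = markov_jump_process T K nu Om X P
  for T :: real and K :: "'k measure" and nu :: "real \<Rightarrow> 'k \<Rightarrow> 'k measure"
    and Om :: "'w set" and X :: "real \<Rightarrow> 'w \<Rightarrow> 'k" and P :: "real \<Rightarrow> 'k \<Rightarrow> 'w measure" +
  fixes t :: real and x :: 'k
  assumes t_in: "t \<in> {0..T}" and x_in: "x \<in> space K"
begin

abbreviation "\<Q> \<equiv> P t x"
abbreviation "Hist s \<equiv> history Om K X {t..s}"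
abbreviation "Prg \<equiv> progressive Om K X t T"
abbreviation "Prd \<equiv> predictable Om K X t T"
abbreviation "Leb \<equiv> restrict_space lborel {t..T}"
abbreviation "QT \<equiv> \<Q> \<Otimes>\<^sub>M Leb"
abbreviation "PK \<equiv> Prd \<Otimes>\<^sub>M K"
abbreviation "\<M> \<equiv> bsde_space Om K nu X \<Q> t T"
abbreviation "norm_sq \<equiv> bsde_norm_sq nu X \<Q> t T"

abbreviation expect :: "('w \<Rightarrow> ennreal) \<Rightarrow> ennreal" (binder "\<E>" 10) where
  "expect F \<equiv> \<integral>\<^sup>+w. F w \<partial>\<Q>"

abbreviation time_integral :: "(real \<Rightarrow> ennreal) \<Rightarrow> ennreal" (binder "\<I>" 10) where
  "time_integral F \<equiv> \<integral>\<^sup>+s\<in>{t..T}. F s \<partial>lborel"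

abbreviation square_field :: "('w \<Rightarrow> real \<Rightarrow> 'k \<Rightarrow> real) \<Rightarrow> ('w \<times> real) \<times> 'k \<Rightarrow> ennreal" where
  "square_field Z \<equiv> \<lambda>((w, s), y). sqr (Z w s y)"

abbreviation predictable_field :: "('w \<Rightarrow> real \<Rightarrow> 'k \<Rightarrow> real) \<Rightarrow> bool" where
  "predictable_field Z \<equiv> (\<lambda>((w, s), y). Z w s y) \<in> borel_measurable PK"

abbreviation progressive_field :: "('w \<Rightarrow> real \<Rightarrow> real) \<Rightarrow> bool" where
  "progressive_field Y \<equiv> (\<lambda>(w, s). Y w s) \<in> borel_measurable Prg"

lemma t_nonneg: "0 \<le> t" and t_le_T: "t \<le> T"
  using t_in by auto

sublocale Q: prob_space \<Q>
  by (rule prob_P[OF t_nonneg x_in])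

sublocale L: sigma_finite_measure Leb
  by (rule sigma_finite_measure_restrict_space[OF lborel.sigma_finite_measure_axioms]) auto

sublocale QL: pair_sigma_finite \<Q> Leb ..

lemma space_Q [simp]: "space \<Q> = Om"
  using t_nonneg x_in by simp

lemma X_Q: "t \<le> s \<Longrightarrow> X s \<in> \<Q> \<rightarrow>\<^sub>M K"
  by (rule X_P[OF t_nonneg x_in])

lemma Hist_Q: "f \<in> Hist s \<rightarrow>\<^sub>M N \<Longrightarrow> f \<in> \<Q> \<rightarrow>\<^sub>M N"
proof (rule measurableI)
  assume f: "f \<in> Hist s \<rightarrow>\<^sub>M N"
  show "f w \<in> space N" if "w \<in> space \<Q>" for w
    using measurable_space[OF f] that by simp
  show "f -` B \<inter> space \<Q> \<in> sets \<Q>" if "B \<in> sets N" for B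
    using sets_history_P[OF t_nonneg x_in _ measurable_sets[OF f that]] by simp
qed

lemma space_Leb [simp]: "space Leb = {t..T}"
  by (simp add: space_restrict_space)

lemma space_QL: "space QT = Om \<times> {t..T}"
  by (simp add: space_pair_measure)

lemma Prd_generator_subset: "{A \<times> {t} | A. A \<in> sets (history Om K X {t})} \<union>
      {A \<times> {r<..s} | A r s. t \<le> r \<and> r \<le> s \<and> s \<le> T \<and> A \<in> sets (Hist r)} \<subseteq> Pow (Om \<times> {t..T})"
proof -
  have "A \<subseteq> Om" if "A \<in> sets (history Om K X I)" for A I
    using sets.sets_into_space[OF that] by simp
  then have *: "A \<times> B \<in> Pow (Om \<times> {t..T})" if "A \<in> sets (history Om K X I)" "B \<subseteq> {t..T}" for A B I
    using that by (intro PowI Sigma_mono)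
  show ?thesis
  proof (intro Un_least subsetI; elim CollectE exE conjE; hypsubst)
    show "A \<times> {t} \<in> Pow (Om \<times> {t..T})" if "A \<in> sets (history Om K X {t})" for A
      using t_le_T by (intro *[OF that]) simp
    show "A \<times> {r<..s} \<in> Pow (Om \<times> {t..T})" if "t \<le> r" "s \<le> T" "A \<in> sets (Hist r)" for A r s
      using that by (intro *[OF that(3)]) auto
  qed
qed

lemma space_Prd [simp]: "space Prd = Om \<times> {t..T}"
  unfolding predictable_def by (rule space_measure_of[OF Prd_generator_subset])

lemma space_Prg [simp]: "space Prg = Om \<times> {t..T}"
  unfolding progressive_def by (intro space_measure_of) auto

lemma sets_Prd: "sets Prd = sigma_sets (Om \<times> {t..T})
     ({A \<times> {t} | A. A \<in> sets (history Om K X {t})} \<union>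
      {A \<times> {r<..s} | A r s. t \<le> r \<and> r \<le> s \<and> s \<le> T \<and> A \<in> sets (Hist r)})"
  unfolding predictable_def by (rule sets_measure_of[OF Prd_generator_subset])

lemma Prd_t: "A \<in> sets (history Om K X {t}) \<Longrightarrow> A \<times> {t} \<in> sets Prd"
  unfolding sets_Prd by blast

lemma Prd_Ioc: "A \<in> sets (Hist r) \<Longrightarrow> t \<le> r \<Longrightarrow> s \<le> T \<Longrightarrow> A \<times> {r<..s} \<in> sets Prd"
proof (cases "r \<le> s")
  case True
  assume "A \<in> sets (Hist r)" "t \<le> r" "s \<le> T"
  with True show ?thesis
    unfolding sets_Prd
    by (intro sigma_sets.Basic UnI2 CollectI exI[of _ A] exI[of _ r] exI[of _ s]) simp
qed simp

text \<open>Predictable sets lie in the product of the sigma-algebra of the law with the Borel sets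
  of \<open>{t..T}\<close>. The identity as a measurable map transports predictability into this
  product, where Tonelli's theorem is available.\<close>

lemma id_Prd: "(\<lambda>p. p) \<in> QT \<rightarrow>\<^sub>M Prd"
  unfolding predictable_def
proof (rule measurable_measure_of[OF Prd_generator_subset], goal_cases)
  case 2
  fix C assume C: "C \<in> {A \<times> {t} | A. A \<in> sets (history Om K X {t})} \<union>
      {A \<times> {r<..s} | A r s. t \<le> r \<and> r \<le> s \<and> s \<le> T \<and> A \<in> sets (Hist r)}"
  have Leb: "B \<in> sets borel \<Longrightarrow> B \<subseteq> {t..T} \<Longrightarrow> B \<in> sets Leb" for B
    by (subst sets_restrict_space_iff) auto
  have "C \<in> sets QT"
    using C
  proof
    assume "C \<in> {A \<times> {t} | A. A \<in> sets (history Om K X {t})}"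
    then obtain A where "C = A \<times> {t}" "A \<in> sets (history Om K X {t})" by blast
    then show ?thesis
      using sets_history_P[OF t_nonneg x_in, of "{t}" A] t_le_T by (auto intro!: pair_measureI Leb)
  next
    assume "C \<in> {A \<times> {r<..s} | A r s. t \<le> r \<and> r \<le> s \<and> s \<le> T \<and> A \<in> sets (Hist r)}"
    then obtain A r s where "C = A \<times> {r<..s}" "A \<in> sets (Hist r)" "t \<le> r" "s \<le> T" by blast
    then show ?thesis
      using sets_history_P[OF t_nonneg x_in, of "{t..r}" A] by (auto intro!: pair_measureI Leb)
  qed
  moreover from this have "C \<subseteq> space QT" by (rule sets.sets_into_space)
  ultimately show "(\<lambda>p. p) -` C \<inter> space QT \<in> sets QT"
    by (simp add: Int_absorb2)
qed (auto simp: space_QL)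

lemma sets_pair_mono:
  assumes "space M = space M'" "sets M \<subseteq> sets M'" "space N = space N'" "sets N \<subseteq> sets N'"
  shows "sets (M \<Otimes>\<^sub>M N) \<subseteq> sets (M' \<Otimes>\<^sub>M N')"
  unfolding sets_pair_measure assms(1,3) using assms(2,4) by (intro sigma_sets_mono') blast

text \<open>The condition that defines progressive sets, taken at the final time \<open>T\<close>,
  is already membership in a product sigma-algebra.\<close>

lemma id_Prg: "(\<lambda>p. p) \<in> QT \<rightarrow>\<^sub>M Prg"
  unfolding progressive_def
proof (rule measurable_measure_of, goal_cases)
  case 3
  fix C assume "C \<in> {A. A \<subseteq> Om \<times> {t..T} \<and>
         (\<forall>s\<in>{t..T}. A \<inter> (Om \<times> {t..s}) \<in> sets (Hist s \<Otimes>\<^sub>M restrict_space borel {t..s}))}"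
  then have C: "C \<subseteq> Om \<times> {t..T}" "C \<inter> (Om \<times> {t..T}) \<in> sets (Hist T \<Otimes>\<^sub>M restrict_space borel {t..T})"
    using t_le_T by auto
  have "sets (Hist T \<Otimes>\<^sub>M restrict_space borel {t..T}) \<subseteq> sets QT"
    using sets_history_P[OF t_nonneg x_in, of "{t..T}"]
    by (intro sets_pair_mono) (auto simp: space_restrict_space sets_restrict_space)
  with C show "(\<lambda>p. p) -` C \<inter> space QT \<in> sets QT"
    by (auto simp: space_QL Int_absorb2)
qed (auto simp: space_QL)

lemma Prd_QL: "f \<in> Prd \<rightarrow>\<^sub>M N \<Longrightarrow> f \<in> QT \<rightarrow>\<^sub>M N"
  by (rule measurable_compose[OF id_Prd])

lemma Prg_QL: "f \<in> Prg \<rightarrow>\<^sub>M N \<Longrightarrow> f \<in> QT \<rightarrow>\<^sub>M N"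
  by (rule measurable_compose[OF id_Prg])

text \<open>The section at time \<open>s\<close> is unchanged when the set is intersected with
  \<open>Om \<times> {t..s}\<close>, and this intersection is product measurable over the history up
  to \<open>s\<close>.\<close>

lemma Prg_adapted:
  assumes f: "f \<in> Prg \<rightarrow>\<^sub>M N" and s: "s \<in> {t..T}"
  shows "(\<lambda>w. f (w, s)) \<in> Hist s \<rightarrow>\<^sub>M N"
proof -
  have "(\<lambda>w. (w, s)) \<in> Hist s \<rightarrow>\<^sub>M Prg"
    unfolding progressive_def
  proof (rule measurable_measure_of, goal_cases)
    case 3
    fix C assume "C \<in> {A. A \<subseteq> Om \<times> {t..T} \<and>
           (\<forall>s\<in>{t..T}. A \<inter> (Om \<times> {t..s}) \<in> sets (Hist s \<Otimes>\<^sub>M restrict_space borel {t..s}))}"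
    then have "C \<inter> (Om \<times> {t..s}) \<in> sets (Hist s \<Otimes>\<^sub>M restrict_space borel {t..s})"
      using s by auto
    from sets_Pair2[OF this, of s]
    have "(\<lambda>w. (w, s)) -` (C \<inter> (Om \<times> {t..s})) \<in> sets (Hist s)" .
    also have "(\<lambda>w. (w, s)) -` (C \<inter> (Om \<times> {t..s})) = (\<lambda>w. (w, s)) -` C \<inter> space (Hist s)"
      using s by auto
    finally show "(\<lambda>w. (w, s)) -` C \<inter> space (Hist s) \<in> sets (Hist s)" .
  qed (use s in auto)
  from measurable_compose[OF this f] show ?thesis .
qed

lemma Prg_Q: "f \<in> Prg \<rightarrow>\<^sub>M N \<Longrightarrow> s \<in> {t..T} \<Longrightarrow> (\<lambda>w. f (w, s)) \<in> \<Q> \<rightarrow>\<^sub>M N"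
  by (rule Hist_Q[OF Prg_adapted])

section \<open>Predictable processes obtained from adapted ones by sampling\<close>

lemma grid_in: "0 < h \<Longrightarrow> v \<in> {t..T} \<Longrightarrow> grid h t v \<in> {t..T}"
  using grid_bounds[of h t v] by (cases "v = t") (auto simp: grid_def)

text \<open>On the cell \<open>(t + h k, t + h (k + 1)]\<close> the sampled value is known at the
  left end of the cell. Each preimage is therefore a countable union of generating rectangles
  together with a slice at time \<open>t\<close>.\<close>

lemma grid_predictable:
  assumes W: "\<And>s. s \<in> {t..T} \<Longrightarrow> W s \<in> Hist s \<rightarrow>\<^sub>M N" and h: "0 < h"
  shows "(\<lambda>(w, v). W (grid h t v) w) \<in> Prd \<rightarrow>\<^sub>M N"
proof (rule measurableI)
  show "(case p of (w, v) \<Rightarrow> W (grid h t v) w) \<in> space N" if "p \<in> space Prd" for p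
    using that grid_in[OF h] W[THEN measurable_space] by auto
next
  fix B assume B: "B \<in> sets N"
  let ?u = "\<lambda>k::nat. t + h * real k"
  have "(\<lambda>(w, v). W (grid h t v) w) -` B \<inter> space Prd =
     (W t -` B \<inter> space (Hist t)) \<times> {t} \<union>
     (\<Union>k\<in>{k. ?u k \<le> T}. (W (?u k) -` B \<inter> space (Hist (?u k))) \<times> {?u k<..min T (?u (Suc k))})"
    (is "?L = ?R")
  proof (intro set_eqI)
    fix p :: "'w \<times> real"
    obtain w v where p: "p = (w, v)" by (cases p)
    consider "v < t \<or> T < v" | "v = t" | "t < v" "v \<le> T" by linarith
    then show "p \<in> ?L \<longleftrightarrow> p \<in> ?R"
    proof cases
      case 1
      have "\<not> ?u k < v" if "v < t" for k
      proof -
        have "t \<le> ?u k" using h by simp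
        with that show ?thesis by linarith
      qed
      then have "p \<notin> ?R" using 1 t_le_T by (auto simp: p)
      with 1 show ?thesis by (auto simp: p)
    next
      case 2
      have "\<not> t + h * real k < t" for k using h by (auto simp: not_less)
      with 2 show ?thesis using t_le_T by (auto simp: p grid_def)
    next
      case 3
      obtain k where k: "?u k < v" "v \<le> ?u (Suc k)" using grid_interval[OF h 3(1)] by blast
      have uniq: "k' = k" if k': "?u k' < v" "v \<le> ?u (Suc k')" for k'
      proof -
        have "?u k' = ?u k" using grid_eq[OF h k] grid_eq[OF h k'] by simp
        then show ?thesis using h by simp
      qed
      have "p \<in> ?R \<longleftrightarrow> w \<in> Om \<and> W (?u k) w \<in> B"
      proof
        assume "p \<in> ?R"
        then obtain k' where "?u k' < v" "v \<le> ?u (Suc k')" "W (?u k') w \<in> B" "w \<in> Om"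
          using 3 by (auto simp: p)
        with uniq show "w \<in> Om \<and> W (?u k) w \<in> B" by blast
      next
        assume "w \<in> Om \<and> W (?u k) w \<in> B"
        then show "p \<in> ?R" using k 3 by (auto simp: p intro!: exI[of _ k])
      qed
      also have "\<dots> \<longleftrightarrow> p \<in> ?L" using 3 grid_eq[OF h k] by (auto simp: p)
      finally show ?thesis ..
    qed
  qed
  also have "\<dots> \<in> sets Prd"
  proof (intro sets.Un sets.countable_UN'')
    show "(W t -` B \<inter> space (Hist t)) \<times> {t} \<in> sets Prd"
      using measurable_sets[OF W[of t] B] t_le_T by (intro Prd_t) auto
    show "(W (?u k) -` B \<inter> space (Hist (?u k))) \<times> {?u k<..min T (?u (Suc k))} \<in> sets Prd"
      if "k \<in> {k. ?u k \<le> T}" for k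
      using measurable_sets[OF W[of "?u k"] B] that h by (intro Prd_Ioc) auto
  qed auto
  finally show "(\<lambda>(w, v). W (grid h t v) w) -` B \<inter> space Prd \<in> sets Prd" .
qed

text \<open>At the initial time the left limit depends on the trajectory before \<open>t\<close>, which the
  filtration does not see.\<close>

definition pre :: "real \<Rightarrow> 'w \<Rightarrow> 'k" where
  "pre s w = (if s \<le> t then X t w else left_limit X s w)"

lemma pre_space: "w \<in> Om \<Longrightarrow> pre s w \<in> space K"
  using left_limit_space[of w s] X_space[of t w] t_nonneg by (auto simp: pre_def)

lemma grid_eventually_left_limit:
  assumes "\<And>n. 0 < h n" "h \<longlonglongrightarrow> 0" "w \<in> Om" "0 \<le> r" "r < v"
  shows "\<forall>\<^sub>F n in sequentially. X (grid (h n) r v) w = left_limit X v w"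
  using left_limit_eventually[of w v] grid_tendsto[of h r v] assms
  by (auto simp: filterlim_iff)

lemma grid_eventually_pre:
  assumes "w \<in> Om"
  shows "\<forall>\<^sub>F n in sequentially. X (grid (1 / real (Suc n)) t v) w = pre v w"
proof (cases "v \<le> t")
  case False
  then show ?thesis using grid_eventually_left_limit[OF _ inverse_Suc_tendsto assms t_nonneg, of v] by (simp add: pre_def)
qed (simp add: grid_def pre_def)

text \<open>Pointwise limits in \<open>K\<close> are replaced by sequences that eventually equal
  their limit. The preimage of \<open>B\<close> then consists of the points whose approximations lie
  in \<open>B\<close> from some index on, a countable union of countable intersections.\<close>

lemma eventual_preimage_measurable:
  assumes f: "\<And>n. f n \<in> M \<rightarrow>\<^sub>M N"
    and ev: "\<And>p. p \<in> space M \<Longrightarrow> \<forall>\<^sub>F n in sequentially. f n p = g p"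
  shows "g \<in> M \<rightarrow>\<^sub>M N"
proof (rule measurableI)
  fix p assume p: "p \<in> space M"
  from ev[OF this] obtain n where "f n p = g p" by (auto simp: eventually_sequentially)
  with measurable_space[OF f p] show "g p \<in> space N" by metis
next
  fix B assume B: "B \<in> sets N"
  have "g -` B \<inter> space M = (\<Union>n. \<Inter>m. f (n + m) -` B \<inter> space M)"
  proof (intro set_eqI)
    fix p
    show "p \<in> g -` B \<inter> space M \<longleftrightarrow> p \<in> (\<Union>n. \<Inter>m. f (n + m) -` B \<inter> space M)"
    proof (cases "p \<in> space M")
      case True
      then obtain n where n: "\<And>m. m \<ge> n \<Longrightarrow> f m p = g p"
        using ev by (auto simp: eventually_sequentially)
      have "f (n' + n) p = g p" for n' using n by simp
      then have "g p \<in> B" if "\<And>m. f (n' + m) p \<in> B" for n' using that[of n] by metis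
      moreover have "f (n + m) p = g p" for m using n by simp
      ultimately show ?thesis using True by (auto intro!: exI[of _ n])
    qed auto
  qed
  also have "\<dots> \<in> sets M" using measurable_sets[OF f B]
    by (intro sets.countable_UN sets.countable_INT image_subsetI) auto
  finally show "g -` B \<inter> space M \<in> sets M" .
qed

lemma pre_predictable: "(\<lambda>(w, s). pre s w) \<in> Prd \<rightarrow>\<^sub>M K"
proof (rule eventual_preimage_measurable[where f = "\<lambda>n (w, v). X (grid (1 / real (Suc n)) t v) w"])
  show "(\<lambda>(w, v). X (grid (1 / real (Suc n)) t v) w) \<in> Prd \<rightarrow>\<^sub>M K" for n
    using t_nonneg by (intro grid_predictable X_history) auto
  show "\<forall>\<^sub>F n in sequentially. (case p of (w, v) \<Rightarrow> X (grid (1 / real (Suc n)) t v) w) =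
      (case p of (w, s) \<Rightarrow> pre s w)" if "p \<in> space Prd" for p
    using grid_eventually_pre that by auto
qed

text \<open>\<open>lim\<close> is a total function, so the limit along the grid is measurable
  whether or not the sequence converges. Where a real process has left limits this produces a
  predictable version of them; the identification is deferred to trajectories on which it can be
  proved.\<close>

lemma grid_lim_predictable:
  fixes W :: "'w \<times> real \<Rightarrow> real"
  assumes W: "W \<in> borel_measurable Prg"
  shows "(\<lambda>(w, v). lim (\<lambda>n. W (w, grid (1 / real (Suc n)) t v))) \<in> borel_measurable Prd"
proof -
  have "(\<lambda>p. lim (\<lambda>n. case p of (w, v) \<Rightarrow> W (w, grid (1 / real (Suc n)) t v))) \<in> borel_measurable Prd"
  proof (rule borel_measurable_lim_metric)
    show "(\<lambda>(w, v). W (w, grid (1 / real (Suc n)) t v)) \<in> borel_measurable Prd" for n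
      by (rule grid_predictable[of "\<lambda>s w. W (w, s)"]) (auto intro: Prg_adapted[OF W])
  qed
  then show ?thesis by (simp add: case_prod_beta')
qed

text \<open>Right constancy allows the state at \<open>v\<close> to be approximated from the right:
  rounding \<open>v\<close> up to finer and finer lattices eventually lands in the stretch on which
  the trajectory is constant.\<close>

lemma X_progressive: "(\<lambda>(w, s). X s w) \<in> Prg \<rightarrow>\<^sub>M K"
proof (rule measurableI)
  show "(case p of (w, s) \<Rightarrow> X s w) \<in> space K" if "p \<in> space Prg" for p
    using that X_space t_nonneg by auto
next
  fix B assume B: "B \<in> sets K"
  let ?S = "(\<lambda>(w, s). X s w) -` B \<inter> space Prg"
  have "?S \<inter> (Om \<times> {t..s0}) \<in> sets (Hist s0 \<Otimes>\<^sub>M restrict_space borel {t..s0})"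
    if s0: "s0 \<in> {t..T}" for s0
  proof -
    let ?M = "Hist s0 \<Otimes>\<^sub>M restrict_space borel {t..s0}"
    \<comment> \<open>The cap \<open>s0\<close> keeps the sampling time inside the history up to
      \<open>s0\<close>, as progressive measurability demands. At \<open>v = s0\<close> the
      approximation is exact.\<close>
    let ?c = "\<lambda>n v. min s0 (real_of_int \<lceil>v * real (Suc n)\<rceil> / real (Suc n))"
    have sp: "space ?M = Om \<times> {t..s0}" by (simp add: space_pair_measure space_restrict_space)
    have "(\<lambda>(w, v). X v w) \<in> ?M \<rightarrow>\<^sub>M K"
    proof (rule eventual_preimage_measurable[where f = "\<lambda>n (w, v). X (?c n v) w"])
      fix n
      have c: "t \<le> ?c n v" if "t \<le> v" "v \<le> s0" for v
      proof -
        have "v * real (Suc n) \<le> real_of_int \<lceil>v * real (Suc n)\<rceil>" by linarith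
        then have "v \<le> real_of_int \<lceil>v * real (Suc n)\<rceil> / real (Suc n)"
          by (subst pos_le_divide_eq) auto
        then show ?thesis using that by auto
      qed
      have "(\<lambda>p. X (min s0 (real_of_int (case p of (w, v) \<Rightarrow> \<lceil>v * real (Suc n)\<rceil>) / real (Suc n))) (fst p)) \<in> ?M \<rightarrow>\<^sub>M K"
      proof (rule measurable_compose_countable'[where I = "{i. t \<le> min s0 (real_of_int i / real (Suc n))}"])
        show "(\<lambda>p. X (min s0 (real_of_int i / real (Suc n))) (fst p)) \<in> ?M \<rightarrow>\<^sub>M K"
          if "i \<in> {i. t \<le> min s0 (real_of_int i / real (Suc n))}" for i
          using that t_nonneg by (intro measurable_compose[OF measurable_fst X_history]) auto
        have "(\<lambda>p. \<lceil>snd p * real (Suc n)\<rceil>) \<in> ?M \<rightarrow>\<^sub>M count_space UNIV"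
          by (rule measurable_compose[OF measurable_snd], rule measurable_restrict_space1) measurable
        then show "(\<lambda>p. case p of (w, v) \<Rightarrow> \<lceil>v * real (Suc n)\<rceil>) \<in> ?M \<rightarrow>\<^sub>M
            count_space {i. t \<le> min s0 (real_of_int i / real (Suc n))}"
          using c by (auto simp: measurable_count_space_eq2_countable sp case_prod_beta')
      qed auto
      then show "(\<lambda>(w, v). X (?c n v) w) \<in> ?M \<rightarrow>\<^sub>M K" by (simp add: case_prod_beta')
    next
      fix p assume "p \<in> space ?M"
      then obtain w v where p: "p = (w, v)" "w \<in> Om" "t \<le> v" "v \<le> s0" by (auto simp: sp)
      obtain \<delta> where d: "\<delta> > 0" "\<And>s. v \<le> s \<Longrightarrow> s \<le> v + \<delta> \<Longrightarrow> X s w = X v w"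
        using right_constantE[of w v] p t_nonneg by auto
      obtain N where N: "inverse (real (Suc N)) < \<delta>" using reals_Archimedean[OF d(1)] by blast
      have "X (?c n v) w = X v w" if "n \<ge> N" for n
      proof (rule d(2))
        have "v * real (Suc n) \<le> real_of_int \<lceil>v * real (Suc n)\<rceil>" by linarith
        then have "v \<le> real_of_int \<lceil>v * real (Suc n)\<rceil> / real (Suc n)"
          by (subst pos_le_divide_eq) auto
        then show "v \<le> ?c n v" using p by simp
        have "real_of_int \<lceil>v * real (Suc n)\<rceil> \<le> v * real (Suc n) + 1" by linarith
        then have "real_of_int \<lceil>v * real (Suc n)\<rceil> / real (Suc n) \<le> v + inverse (real (Suc n))"
          by (subst pos_divide_le_eq) (auto simp del: of_nat_Suc simp: distrib_right)
        moreover have "inverse (real (Suc n)) \<le> inverse (real (Suc N))"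
          using that by (intro le_imp_inverse_le) auto
        ultimately show "?c n v \<le> v + \<delta>" using N by linarith
      qed
      then show "\<forall>\<^sub>F n in sequentially. (case p of (w, v) \<Rightarrow> X (?c n v) w) = (case p of (w, v) \<Rightarrow> X v w)"
        by (auto simp: p eventually_sequentially)
    qed
    from measurable_sets[OF this B]
    have "(\<lambda>(w, v). X v w) -` B \<inter> space ?M \<in> sets ?M" .
    also have "(\<lambda>(w, v). X v w) -` B \<inter> space ?M = ?S \<inter> (Om \<times> {t..s0})"
      using s0 by (auto simp: sp)
    finally show ?thesis .
  qed
  then have "?S \<in> {A. A \<subseteq> Om \<times> {t..T} \<and> (\<forall>s\<in>{t..T}. A \<inter> (Om \<times> {t..s}) \<in>
            sets (Hist s \<Otimes>\<^sub>M restrict_space borel {t..s}))}"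
    by auto
  then show "?S \<in> sets Prg"
    unfolding progressive_def by (subst sets_measure_of) auto
qed

lemma X_QL: "(\<lambda>(w, s). X s w) \<in> QT \<rightarrow>\<^sub>M K"
  by (rule Prg_QL[OF X_progressive])

lemma pre_QL: "(\<lambda>(w, s). pre s w) \<in> QT \<rightarrow>\<^sub>M K"
  by (rule Prd_QL[OF pre_predictable])

lemma pre_eq: "t < s \<Longrightarrow> s \<notin> jumps w \<Longrightarrow> pre s w = X s w"
  using left_limit_not_jump[of s w] t_nonneg by (simp add: pre_def)

text \<open>The two processes differ at most at \<open>t\<close> and at the finitely many jumps, so
  the predictable version may replace the current state in every time integral.\<close>

lemma AE_pre_eq:
  assumes "w \<in> Om"
  shows "AE s in lborel. s \<in> {t..T} \<longrightarrow> pre s w = X s w"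
proof (rule AE_I'[OF finite_imp_null_set_lborel[of "insert t (jumps w \<inter> {t<..T})"]])
  show "finite (insert t (jumps w \<inter> {t<..T}))"
    using finite_jumps_Ioc[OF assms t_nonneg] by simp
  show "{s \<in> space lborel. \<not> (s \<in> {t..T} \<longrightarrow> pre s w = X s w)} \<subseteq> insert t (jumps w \<inter> {t<..T})"
    using pre_eq[of _ w] by force
qed

end

section \<open>The Markov property\<close>

text \<open>The monotone class argument behind the Markov property: an identity between a random
  variable and a kernel, known for sets and a fixed weight \<open>b\<close>, extends to nonnegative
  functions. Infinite values are allowed, so no integrability has to be carried through the
  induction.\<close>

lemma nn_integral_kernel_eq:
  assumes "\<And>A. A \<in> sets N \<Longrightarrow>
      (\<integral>\<^sup>+w. b w * indicator A (h w) \<partial>M) = (\<integral>\<^sup>+w. b w * emeasure (k w) (h' -` A \<inter> space (k w)) \<partial>M)"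
    and b: "b \<in> borel_measurable M" and h: "h \<in> M \<rightarrow>\<^sub>M N"
    and h': "\<And>w. w \<in> space M \<Longrightarrow> h' \<in> k w \<rightarrow>\<^sub>M N"
    and k: "\<And>\<phi>. \<phi> \<in> borel_measurable N \<Longrightarrow> (\<lambda>w. \<integral>\<^sup>+w'. \<phi> (h' w') \<partial>k w) \<in> borel_measurable M"
    and \<phi>: "\<phi> \<in> borel_measurable N"
  shows "(\<integral>\<^sup>+w. b w * \<phi> (h w) \<partial>M) = (\<integral>\<^sup>+w. b w * (\<integral>\<^sup>+w'. \<phi> (h' w') \<partial>k w) \<partial>M)"
  using \<phi>
proof (induction \<phi> rule: borel_measurable_induct)
  case (cong f g)
  have "f (h w) = g (h w)" if "w \<in> space M" for w
    using cong(3) measurable_space[OF h that] by simp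
  moreover have "(\<integral>\<^sup>+w'. f (h' w') \<partial>k w) = (\<integral>\<^sup>+w'. g (h' w') \<partial>k w)" if "w \<in> space M" for w
    using cong(3) measurable_space[OF h'[OF that]] by (intro nn_integral_cong) simp
  ultimately show ?case using cong(4) by (simp cong: nn_integral_cong)
next
  case (set A)
  have "(\<integral>\<^sup>+w'. indicator A (h' w') \<partial>k w) = emeasure (k w) (h' -` A \<inter> space (k w))" if "w \<in> space M" for w
  proof -
    have "(\<integral>\<^sup>+w'. indicator A (h' w') \<partial>k w) = (\<integral>\<^sup>+w'. indicator (h' -` A \<inter> space (k w)) w' \<partial>k w)"
      by (intro nn_integral_cong) (auto split: split_indicator)
    then show ?thesis using measurable_sets[OF h'[OF that] set] by simp
  qed
  then show ?case using assms(1)[OF set] by (simp cong: nn_integral_cong)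
next
  case (mult u c)
  note [measurable] = b measurable_compose[OF h mult(2)] k[OF mult(2)]
  have "(\<integral>\<^sup>+w. b w * (c * u (h w)) \<partial>M) = c * (\<integral>\<^sup>+w. b w * u (h w) \<partial>M)"
    by (subst nn_integral_cmult[symmetric]) (auto simp: mult_ac)
  also have "\<dots> = c * (\<integral>\<^sup>+w. b w * (\<integral>\<^sup>+w'. u (h' w') \<partial>k w) \<partial>M)" using mult by simp
  also have "\<dots> = (\<integral>\<^sup>+w. b w * (c * (\<integral>\<^sup>+w'. u (h' w') \<partial>k w)) \<partial>M)"
    by (subst nn_integral_cmult[symmetric]) (auto simp: mult_ac)
  also have "\<dots> = (\<integral>\<^sup>+w. b w * (\<integral>\<^sup>+w'. c * u (h' w') \<partial>k w) \<partial>M)"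
    using measurable_compose[OF h' mult(2)]
    by (intro nn_integral_cong) (simp add: nn_integral_cmult)
  finally show ?case .
next
  case (add u v)
  note [measurable] = b measurable_compose[OF h add.hyps(1)] k[OF add.hyps(1)]
    measurable_compose[OF h add.hyps(3)] k[OF add.hyps(3)]
  have "(\<integral>\<^sup>+w. b w * (v (h w) + u (h w)) \<partial>M) =
      (\<integral>\<^sup>+w. b w * v (h w) \<partial>M) + (\<integral>\<^sup>+w. b w * u (h w) \<partial>M)"
    by (subst nn_integral_add[symmetric]) (auto simp: distrib_left)
  also have "\<dots> = (\<integral>\<^sup>+w. b w * ((\<integral>\<^sup>+w'. v (h' w') \<partial>k w) + (\<integral>\<^sup>+w'. u (h' w') \<partial>k w)) \<partial>M)"
    unfolding add.IH by (subst nn_integral_add[symmetric]) (auto simp: distrib_left)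
  also have "\<dots> = (\<integral>\<^sup>+w. b w * (\<integral>\<^sup>+w'. v (h' w') + u (h' w') \<partial>k w) \<partial>M)"
    using measurable_compose[OF h' add(1)] measurable_compose[OF h' add(3)]
    by (intro nn_integral_cong) (simp add: nn_integral_add)
  finally show ?case .
next
  case (seq U)
  note [measurable] = b measurable_compose[OF h seq(1)] k[OF seq(1)]
  have inc: "incseq U" by (rule seq)
  have "(\<integral>\<^sup>+w. b w * (SUP i. U i) (h w) \<partial>M) = (\<integral>\<^sup>+w. (SUP i. b w * U i (h w)) \<partial>M)"
    unfolding SUP_apply SUP_mult_left_ennreal ..
  also have "\<dots> = (SUP i. \<integral>\<^sup>+w. b w * U i (h w) \<partial>M)"
    using inc by (intro nn_integral_monotone_convergence_SUP) (auto simp: incseq_def le_fun_def intro!: mult_left_mono)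
  also have "\<dots> = (SUP i. \<integral>\<^sup>+w. b w * (\<integral>\<^sup>+w'. U i (h' w') \<partial>k w) \<partial>M)"
    using seq by simp
  also have "\<dots> = (\<integral>\<^sup>+w. (SUP i. b w * (\<integral>\<^sup>+w'. U i (h' w') \<partial>k w)) \<partial>M)"
    using inc by (intro nn_integral_monotone_convergence_SUP[symmetric])
      (auto simp: incseq_def le_fun_def intro!: mult_left_mono nn_integral_mono)
  also have "\<dots> = (\<integral>\<^sup>+w. b w * (\<integral>\<^sup>+w'. (SUP i. U i) (h' w') \<partial>k w) \<partial>M)"
  proof (rule nn_integral_cong)
    fix w assume om: "w \<in> space M"
    have "(\<integral>\<^sup>+w'. (SUP i. U i) (h' w') \<partial>k w) = (SUP i. \<integral>\<^sup>+w'. U i (h' w') \<partial>k w)"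
      unfolding SUP_apply using inc measurable_compose[OF h'[OF om] seq(1)]
      by (intro nn_integral_monotone_convergence_SUP) (auto simp: incseq_def le_fun_def)
    then show "(SUP i. b w * (\<integral>\<^sup>+w'. U i (h' w') \<partial>k w)) = b w * (\<integral>\<^sup>+w'. (SUP i. U i) (h' w') \<partial>k w)"
      by (simp add: SUP_mult_left_ennreal)
  qed
  finally show ?case .
qed

context markov_jump_process
begin

text \<open>The axiom is about real conditional expectations. Integrated over an event of the past
  it becomes an identity of \<open>ennreal\<close> integrals, the form needed for monotone class
  arguments.\<close>

lemma markov_marginal:
  assumes ut: "0 \<le> u" "u \<le> r" "r \<le> s" and y: "y \<in> space K" and A: "A \<in> sets K"
    and F: "F \<in> sets (history Om K X {u..r})"
  shows "(\<integral>\<^sup>+w. indicator F w * indicator A (X s w) \<partial>P u y) =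
    (\<integral>\<^sup>+w. indicator F w * emeasure (P r (X r w)) (X s -` A \<inter> space (P r (X r w))) \<partial>P u y)"
proof -
  let ?M = "P u y" and ?H = "history Om K X {u..r}"
  let ?E = "{w \<in> Om. X s w \<in> A}"
  let ?g = "\<lambda>z. measure (P r z) ?E"
  interpret M: prob_space ?M using prob_P ut y by auto
  have sub: "subalgebra ?M ?H"
    unfolding subalgebra_def using ut y sets_history_P[of u y "{u..r}"] by auto
  interpret S: finite_measure_subalgebra ?M ?H
    by unfold_locales (rule sub)
  have E: "?E \<in> sets ?M"
    using measurable_sets[OF X_P[of u y s] A] ut y by (auto simp: vimage_def Int_def conj_commute)
  have FM: "F \<in> sets ?M" using sub F by (auto simp: subalgebra_def)
  have int: "integrable ?M (indicator ?E :: 'w \<Rightarrow> real)"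
    using E by (simp add: M.integrable_const_bound integrable_indicator_iff M.emeasure_finite less_top[symmetric])
  have "(LINT w:F|?M. indicator ?E w) = (LINT w:F|?M. real_cond_exp ?M ?H (indicator ?E) w)"
    by (rule S.real_cond_exp_intA[OF int F])
  also have "\<dots> = (LINT w:F|?M. ?g (X r w))"
    using markov[OF ut y A] FM
    by (intro set_lebesgue_integral_cong_AE)
      (auto intro!: measurable_compose[OF X_P measurable_P] ut order_trans[OF ut(1,2)] y A borel_measurable_cond_exp2)
  finally have eq: "(LINT w|?M. indicator F w * indicator ?E w) = (LINT w|?M. indicator F w * ?g (X r w))"
    by (simp add: set_lebesgue_integral_def)
  have gm: "(\<lambda>w. ?g (X r w)) \<in> borel_measurable ?M"
    using ut y A by (intro measurable_compose[OF X_P measurable_P]) auto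
  have g1: "?g (X r w) \<le> 1" if "w \<in> Om" for w
    using prob_P[of r "X r w"] X_space[of r w] that ut prob_space.prob_le_1 by auto
  have "(\<integral>\<^sup>+w. ennreal (indicator F w * indicator ?E w) \<partial>?M) = ennreal (LINT w|?M. indicator F w * indicator ?E w)"
    using FM E by (intro nn_integral_eq_integral M.integrable_const_bound[where B=1]) (auto split: split_indicator)
  also have "\<dots> = (\<integral>\<^sup>+w. ennreal (indicator F w * ?g (X r w)) \<partial>?M)"
    unfolding eq using FM gm g1 ut y
    by (intro nn_integral_eq_integral[symmetric] M.integrable_const_bound[where B=1])
      (auto split: split_indicator intro!: borel_measurable_times)
  finally have eq2: "(\<integral>\<^sup>+w. ennreal (indicator F w * indicator ?E w) \<partial>?M) =
      (\<integral>\<^sup>+w. ennreal (indicator F w * ?g (X r w)) \<partial>?M)" .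
  have "(\<integral>\<^sup>+w. indicator F w * indicator A (X s w) \<partial>?M) = (\<integral>\<^sup>+w. ennreal (indicator F w * indicator ?E w) \<partial>?M)"
    using ut y by (intro nn_integral_cong) (auto split: split_indicator)
  also have "\<dots> = (\<integral>\<^sup>+w. indicator F w * emeasure (P r (X r w)) (X s -` A \<inter> space (P r (X r w))) \<partial>?M)"
    unfolding eq2
  proof (intro nn_integral_cong)
    fix w assume "w \<in> space ?M"
    then have om: "X r w \<in> space K" using X_space[of r w] ut y by auto
    then interpret R: prob_space "P r (X r w)" using prob_P[of r] ut by auto
    have "X s -` A \<inter> space (P r (X r w)) = ?E" using om ut by auto
    then show "ennreal (indicator F w * ?g (X r w)) =
        indicator F w * emeasure (P r (X r w)) (X s -` A \<inter> space (P r (X r w)))"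
      by (simp add: R.emeasure_eq_measure ennreal_mult' split: split_indicator)
  qed
  finally show ?thesis .
qed

lemma marginal_kernel:
  assumes rs: "0 \<le> r" "r \<le> s" and \<phi>: "\<phi> \<in> borel_measurable K"
  shows "(\<lambda>y. \<integral>\<^sup>+w. \<phi> (X s w) \<partial>P r y) \<in> borel_measurable K"
proof -
  have "(\<lambda>y. distr (P r y) K (X s)) \<in> K \<rightarrow>\<^sub>M subprob_algebra K"
  proof (rule measurable_subprob_algebra)
    fix y assume y: "y \<in> space K"
    then interpret prob_space "P r y" using prob_P rs by auto
    show "subprob_space (distr (P r y) K (X s))"
      using X_P[of r y s] y rs by (intro prob_space_imp_subprob_space prob_space_distr) auto
  next
    fix A assume A: "A \<in> sets K"
    have "(\<lambda>y. ennreal (measure (P r y) {w \<in> Om. X s w \<in> A})) \<in> borel_measurable K"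
      using measurable_P[OF rs A] by simp
    moreover have "emeasure (distr (P r y) K (X s)) A = ennreal (measure (P r y) {w \<in> Om. X s w \<in> A})"
      if y: "y \<in> space K" for y
    proof -
      interpret prob_space "P r y" using prob_P rs y by auto
      have "X s -` A \<inter> space (P r y) = {w \<in> Om. X s w \<in> A}" using y rs by auto
      then show ?thesis using X_P[of r y s] y rs A by (simp add: emeasure_distr emeasure_eq_measure)
    qed
    ultimately show "(\<lambda>y. emeasure (distr (P r y) K (X s)) A) \<in> borel_measurable K"
      by (simp cong: measurable_cong)
  qed simp
  from nn_integral_measurable_subprob_algebra2[OF _ this, of "\<lambda>_. \<phi>"] \<phi>
  have "(\<lambda>y. integral\<^sup>N (distr (P r y) K (X s)) \<phi>) \<in> borel_measurable K"
    by (simp add: case_prod_beta')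
  moreover have "integral\<^sup>N (distr (P r y) K (X s)) \<phi> = (\<integral>\<^sup>+w. \<phi> (X s w) \<partial>P r y)" if "y \<in> space K" for y
    using X_P[of r y s] that rs \<phi> by (intro nn_integral_distr) auto
  ultimately show ?thesis by (simp cong: measurable_cong)
qed

lemma markov_functional:
  assumes ut: "0 \<le> u" "u \<le> r" "r \<le> s" and y: "y \<in> space K"
    and F: "F \<in> sets (history Om K X {u..r})" and \<phi>: "\<phi> \<in> borel_measurable K"
  shows "(\<integral>\<^sup>+w. indicator F w * \<phi> (X s w) \<partial>P u y) =
    (\<integral>\<^sup>+w. indicator F w * (\<integral>\<^sup>+w'. \<phi> (X s w') \<partial>P r (X r w)) \<partial>P u y)"
proof (rule nn_integral_kernel_eq[OF markov_marginal[OF ut y _ F] _ _ _ _ \<phi>])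
  show "indicator F \<in> borel_measurable (P u y)"
    using sets_history_P[of u y "{u..r}" F] ut y F by simp
  show "X s \<in> P u y \<rightarrow>\<^sub>M K" using X_P ut y by simp
  show "X s \<in> P r (X r w) \<rightarrow>\<^sub>M K" if "w \<in> space (P u y)" for w
    using X_P[of r "X r w" s] X_space[of r w] ut y that by simp
  show "(\<lambda>w. \<integral>\<^sup>+w'. \<phi> (X s w') \<partial>P r (X r w)) \<in> borel_measurable (P u y)" if "\<phi> \<in> borel_measurable K" for \<phi>
    using measurable_compose[OF X_P marginal_kernel[OF _ _ that]] ut y by simp
qed

text \<open>Finite-dimensional events, given by lists so that the time points can be conditioned on
  one after another.\<close>

definition cylinder :: "(real \<times> 'k set) list \<Rightarrow> 'w set" where
  "cylinder l = {w \<in> Om. \<forall>(s, A) \<in> set l. X s w \<in> A}"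

lemma cylinder_Nil: "cylinder [] = Om"
  by (simp add: cylinder_def)

lemma cylinder_Cons: "cylinder ((s, A) # l) = {w \<in> Om. X s w \<in> A} \<inter> cylinder l"
  by (auto simp: cylinder_def)

lemma event_history:
  assumes "s \<in> I" "A \<in> sets K"
  shows "{w \<in> Om. X s w \<in> A} \<in> sets (history Om K X I)"
proof -
  have "{w \<in> Om. X s w \<in> A} = X s -` A \<inter> Om" by auto
  then show ?thesis unfolding sets_history using assms by (intro sigma_sets.Basic) auto
qed

lemma cylinder_history:
  assumes "\<forall>(s, A) \<in> set l. r \<le> s \<and> A \<in> sets K"
  shows "cylinder l \<in> sets (history Om K X {r..})"
  using assms
proof (induction l)
  case Nil
  show ?case using sets.top[of "history Om K X {r..}"] by (simp add: cylinder_Nil)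
next
  case (Cons a l)
  then show ?case using event_history[of "fst a" "{r..}" "snd a"]
    by (cases a) (auto simp: cylinder_Cons)
qed

text \<open>Conditioning at the earliest time \<open>s\<close> of the list replaces the remaining
  events by a function of \<open>X s\<close>, and \<open>markov_functional\<close> moves this
  function back from \<open>s\<close> to \<open>r\<close>. Measurability in the state is proved in
  the same induction because that function must be measurable before it can be moved.\<close>

lemma markov_cylinder_sorted:
  assumes "\<forall>(s, A) \<in> set l. r \<le> s \<and> A \<in> sets K" "sorted (map fst l)" "0 \<le> r"
  shows "(\<lambda>y. emeasure (P r y) (cylinder l)) \<in> borel_measurable K \<and>
    (\<forall>u y F. 0 \<le> u \<longrightarrow> u \<le> r \<longrightarrow> y \<in> space K \<longrightarrow> F \<in> sets (history Om K X {u..r}) \<longrightarrow>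
      emeasure (P u y) (F \<inter> cylinder l) = (\<integral>\<^sup>+w. indicator F w * emeasure (P r (X r w)) (cylinder l) \<partial>P u y))"
  using assms
proof (induction l arbitrary: r)
  case Nil
  have 1: "emeasure (P r y) Om = 1" if "y \<in> space K" for y
    using prob_space.emeasure_space_1[OF prob_P[of r y]] that Nil by simp
  show ?case
    unfolding cylinder_Nil
  proof (intro conjI allI impI)
    show "(\<lambda>y. emeasure (P r y) Om) \<in> borel_measurable K"
      using 1 by (simp cong: measurable_cong)
    fix u y F assume as: "0 \<le> u" "u \<le> r" "y \<in> space K" "F \<in> sets (history Om K X {u..r})"
    then have "F \<in> sets (P u y)" using sets_history_P[of u y "{u..r}" F] by simp
    then have "emeasure (P u y) F = (\<integral>\<^sup>+w. indicator F w \<partial>P u y)" by simp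
    also have "\<dots> = (\<integral>\<^sup>+w. indicator F w * emeasure (P r (X r w)) Om \<partial>P u y)"
      using 1 X_space Nil as by (intro nn_integral_cong) simp
    finally show "emeasure (P u y) (F \<inter> Om) = (\<integral>\<^sup>+w. indicator F w * emeasure (P r (X r w)) Om \<partial>P u y)"
      using sets.sets_into_space[OF as(4)] by (simp add: Int_absorb2)
  qed
next
  case (Cons a l)
  obtain s A where a: "a = (s, A)" by (cases a)
  have rs: "r \<le> s" "0 \<le> s" and A: "A \<in> sets K" using Cons.prems by (auto simp: a)
  have "\<forall>(s', A) \<in> set l. s \<le> s' \<and> A \<in> sets K" "sorted (map fst l)"
    using Cons.prems by (auto simp: a)
  note IH = Cons.IH[OF this rs(2)]
  define \<psi> where "\<psi> z = emeasure (P s z) (cylinder l)" for z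
  have \<psi>[measurable]: "\<psi> \<in> borel_measurable K" using IH by (simp add: \<psi>_def[abs_def])
  have \<phi>: "(\<lambda>z. indicator A z * \<psi> z) \<in> borel_measurable K" using A by measurable
  have step: "emeasure (P u y) (F \<inter> cylinder (a # l)) =
      (\<integral>\<^sup>+w. indicator F w * (indicator A (X s w) * \<psi> (X s w)) \<partial>P u y)"
    if as: "0 \<le> u" "u \<le> r" "y \<in> space K" "F \<in> sets (history Om K X {u..r})" for u y F
  proof -
    have "F \<inter> {w \<in> Om. X s w \<in> A} \<in> sets (history Om K X {u..s})"
      using sets_history_mono[of "{u..r}" "{u..s}"] as rs event_history[of s "{u..s}" A] A by auto
    with IH as rs have "emeasure (P u y) (F \<inter> {w \<in> Om. X s w \<in> A} \<inter> cylinder l) =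
      (\<integral>\<^sup>+w. indicator (F \<inter> {w \<in> Om. X s w \<in> A}) w * \<psi> (X s w) \<partial>P u y)"
      by (auto simp: \<psi>_def)
    also have "\<dots> = (\<integral>\<^sup>+w. indicator F w * (indicator A (X s w) * \<psi> (X s w)) \<partial>P u y)"
      using as by (intro nn_integral_cong) (auto split: split_indicator)
    finally show ?thesis by (simp add: a cylinder_Cons Int_assoc)
  qed
  have at_r: "emeasure (P r y) (cylinder (a # l)) = (\<integral>\<^sup>+w. indicator A (X s w) * \<psi> (X s w) \<partial>P r y)"
    if y: "y \<in> space K" for y
  proof -
    have "Om \<in> sets (history Om K X {r..r})" using sets.top[of "history Om K X {r..r}"] by simp
    from step[OF _ _ y this] Cons.prems
    have "emeasure (P r y) (Om \<inter> cylinder (a # l)) =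
      (\<integral>\<^sup>+w. indicator Om w * (indicator A (X s w) * \<psi> (X s w)) \<partial>P r y)" by simp
    also have "\<dots> = (\<integral>\<^sup>+w. indicator A (X s w) * \<psi> (X s w) \<partial>P r y)"
      using Cons.prems y by (intro nn_integral_cong) simp
    finally show ?thesis by (simp add: cylinder_def Int_def conj_commute cong: conj_cong)
  qed
  show ?case
  proof (intro conjI allI impI)
    show "(\<lambda>y. emeasure (P r y) (cylinder (a # l))) \<in> borel_measurable K"
      using marginal_kernel[OF Cons.prems(3) rs(1) \<phi>] at_r by (simp cong: measurable_cong)
    fix u y F assume as: "0 \<le> u" "u \<le> r" "y \<in> space K" "F \<in> sets (history Om K X {u..r})"
    have "emeasure (P u y) (F \<inter> cylinder (a # l)) =
      (\<integral>\<^sup>+w. indicator F w * (\<integral>\<^sup>+w'. indicator A (X s w') * \<psi> (X s w') \<partial>P r (X r w)) \<partial>P u y)"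
      using step[OF as] markov_functional[OF as(1,2) rs(1) as(3,4) \<phi>] by simp
    also have "\<dots> = (\<integral>\<^sup>+w. indicator F w * emeasure (P r (X r w)) (cylinder (a # l)) \<partial>P u y)"
      using at_r X_space[of r] Cons.prems as by (intro nn_integral_cong) simp
    finally show "emeasure (P u y) (F \<inter> cylinder (a # l)) =
        (\<integral>\<^sup>+w. indicator F w * emeasure (P r (X r w)) (cylinder (a # l)) \<partial>P u y)" .
  qed
qed

text \<open>A cylinder depends only on the set of its constraints, so the list may be sorted by
  time.\<close>

lemma markov_cylinder:
  assumes "\<forall>(s, A) \<in> set l. r \<le> s \<and> A \<in> sets K" "0 \<le> r"
  shows "(\<lambda>y. emeasure (P r y) (cylinder l)) \<in> borel_measurable K"
    and "\<lbrakk>0 \<le> u; u \<le> r; y \<in> space K; F \<in> sets (history Om K X {u..r})\<rbrakk> \<Longrightarrow>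
      emeasure (P u y) (F \<inter> cylinder l) = (\<integral>\<^sup>+w. indicator F w * emeasure (P r (X r w)) (cylinder l) \<partial>P u y)"
proof -
  have "cylinder (sort_key fst l) = cylinder l" by (simp add: cylinder_def)
  moreover have "\<forall>(s, A) \<in> set (sort_key fst l). r \<le> s \<and> A \<in> sets K" using assms by simp
  moreover have "sorted (map fst (sort_key fst l))" by simp
  ultimately show "(\<lambda>y. emeasure (P r y) (cylinder l)) \<in> borel_measurable K"
    and "\<lbrakk>0 \<le> u; u \<le> r; y \<in> space K; F \<in> sets (history Om K X {u..r})\<rbrakk> \<Longrightarrow>
      emeasure (P u y) (F \<inter> cylinder l) = (\<integral>\<^sup>+w. indicator F w * emeasure (P r (X r w)) (cylinder l) \<partial>P u y)"
    using markov_cylinder_sorted[of "sort_key fst l" r] assms(2) by auto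
qed

lemma sets_history_cylinder:
  "sets (history Om K X {r..}) =
    sigma_sets Om {cylinder l | l. \<forall>(s, A) \<in> set l. r \<le> s \<and> A \<in> sets K}" (is "_ = sigma_sets Om ?G")
proof (rule antisym)
  show "sets (history Om K X {r..}) \<subseteq> sigma_sets Om ?G"
    unfolding sets_history
  proof (rule sigma_sets_mono', rule subsetI)
    fix C assume "C \<in> {X s -` A \<inter> Om | s A. s \<in> {r..} \<and> A \<in> sets K}"
    then obtain s A where "C = X s -` A \<inter> Om" "r \<le> s" "A \<in> sets K" by auto
    moreover have "X s -` A \<inter> Om = cylinder [(s, A)]" by (auto simp: cylinder_def)
    ultimately show "C \<in> ?G" by (auto intro!: exI[of _ "[(s, A)]"])
  qed
  show "sigma_sets Om ?G \<subseteq> sets (history Om K X {r..})"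
    using sets.sigma_sets_subset[of ?G "history Om K X {r..}"] cylinder_history by auto
qed

lemma Int_stable_cylinder: "Int_stable {cylinder l | l. \<forall>(s, A) \<in> set l. r \<le> s \<and> A \<in> sets K}"
proof (rule Int_stableI)
  fix C D
  assume "C \<in> {cylinder l | l. \<forall>(s, A) \<in> set l. r \<le> s \<and> A \<in> sets K}"
    "D \<in> {cylinder l | l. \<forall>(s, A) \<in> set l. r \<le> s \<and> A \<in> sets K}"
  then obtain l m where "C = cylinder l" "D = cylinder m"
    "\<forall>(s, A) \<in> set l. r \<le> s \<and> A \<in> sets K" "\<forall>(s, A) \<in> set m. r \<le> s \<and> A \<in> sets K" by blast
  moreover have "cylinder l \<inter> cylinder m = cylinder (l @ m)" by (auto simp: cylinder_def)
  ultimately show "C \<inter> D \<in> {cylinder l | l. \<forall>(s, A) \<in> set l. r \<le> s \<and> A \<in> sets K}"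
    by (auto intro!: exI[of _ "l @ m"])
qed

text \<open>Cylinders form a generator that is stable under intersection, and their probabilities
  depend measurably on the starting state; this determines measurability on the whole
  future.\<close>

lemma P_kernel:
  assumes "0 \<le> r"
  shows "P r \<in> K \<rightarrow>\<^sub>M subprob_algebra (history Om K X {r..})"
proof (rule measurable_subprob_algebra_generated[OF sets_history_cylinder Int_stable_cylinder])
  show "{cylinder l | l. \<forall>(s, A) \<in> set l. r \<le> s \<and> A \<in> sets K} \<subseteq> Pow Om" by (auto simp: cylinder_def)
  show "(\<lambda>y. emeasure (P r y) A) \<in> borel_measurable K"
    if "A \<in> {cylinder l | l. \<forall>(s, A) \<in> set l. r \<le> s \<and> A \<in> sets K}" for A
    using that markov_cylinder(1) assms by auto
  show "(\<lambda>y. emeasure (P r y) Om) \<in> borel_measurable K"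
    using markov_cylinder(1)[of "[]" r] assms by (simp add: cylinder_Nil)
qed (use assms prob_P sets_P in \<open>auto intro: prob_space_imp_subprob_space\<close>)

text \<open>Dynkin's argument extends the property from cylinders to all future events. The intended
  event is a first jump in a time interval, which looks at the trajectory at uncountably many
  times.\<close>

lemma markov_extended:
  assumes ur: "0 \<le> u" "u \<le> r" and y: "y \<in> space K" and F: "F \<in> sets (history Om K X {u..r})"
    and B: "B \<in> sets (history Om K X {r..})"
  shows "emeasure (P u y) (F \<inter> B) = (\<integral>\<^sup>+w. indicator F w * emeasure (P r (X r w)) B \<partial>P u y)"
proof -
  let ?M = "P u y" and ?H = "history Om K X {r..}"
  let ?G = "{cylinder l | l. \<forall>(s, A) \<in> set l. r \<le> s \<and> A \<in> sets K}"
  interpret M: prob_space ?M using prob_P ur y by auto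
  have FM [measurable]: "F \<in> sets ?M" using sets_history_P[of u y "{u..r}" F] ur y F by simp
  have HM: "B \<in> sets ?M" if "B \<in> sets ?H" for B
    using sets_history_P[of u y "{r..}" B] ur y that by simp
  have km: "(\<lambda>w. emeasure (P r (X r w)) B) \<in> borel_measurable ?M" if "B \<in> sets ?H" for B
    using measurable_compose[OF X_P measurable_emeasure_kernel[OF P_kernel that]] ur y by simp
  have one: "emeasure (P r (X r w)) Om = 1" if "w \<in> Om" for w
    using prob_space.emeasure_space_1[OF prob_P[of r "X r w"]] X_space[of r w] ur that by simp
  have top: "emeasure ?M (F \<inter> Om) = (\<integral>\<^sup>+w. indicator F w * emeasure (P r (X r w)) Om \<partial>?M)"
    using markov_cylinder(2)[of "[]" r u y F] ur y F by (simp add: cylinder_Nil)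
  have G: "?G \<subseteq> Pow Om" by (auto simp: cylinder_def)
  show ?thesis
    using B[unfolded sets_history_cylinder] 
  proof (induction rule: sigma_sets_induct_disjoint[OF Int_stable_cylinder G, consumes 1, case_names basic empty compl union])
    case (basic A)
    then show ?case using markov_cylinder(2) ur y F by auto
  next
    case empty
    show ?case by simp
  next
    case (compl A)
    have A: "A \<in> sets ?H" using compl by (simp add: sets_history_cylinder)
    note [measurable] = HM[OF A] km[OF A]
    have AOm: "A \<subseteq> Om" using sets.sets_into_space[OF A] by simp
    have "emeasure ?M (F \<inter> (Om - A)) = emeasure ?M (F \<inter> Om - F \<inter> A)" by (rule arg_cong[where f = "emeasure ?M"]) auto
    also have "\<dots> = emeasure ?M (F \<inter> Om) - emeasure ?M (F \<inter> A)"
      using ur y by (intro emeasure_Diff) (use AOm HM[of Om] sets.top[of ?H] in auto)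
    also have "\<dots> = (\<integral>\<^sup>+w. indicator F w * emeasure (P r (X r w)) Om \<partial>?M) -
        (\<integral>\<^sup>+w. indicator F w * emeasure (P r (X r w)) A \<partial>?M)"
      using top compl by simp
    also have "\<dots> = (\<integral>\<^sup>+w. indicator F w * emeasure (P r (X r w)) Om - indicator F w * emeasure (P r (X r w)) A \<partial>?M)"
    proof (rule nn_integral_diff[symmetric])
      have "Om \<in> sets ?H" using sets.top[of ?H] by simp
      from km[OF this] show "(\<lambda>w. indicator F w * emeasure (P r (X r w)) Om) \<in> borel_measurable ?M" by simp
      show "(\<integral>\<^sup>+w. indicator F w * emeasure (P r (X r w)) A \<partial>?M) \<noteq> \<infinity>"
        using compl(2) by (simp flip: compl(2))
      have "emeasure (P r (X r w)) A \<le> emeasure (P r (X r w)) Om" if "w \<in> Om" for w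
        using sets.top[of ?H] X_space[of r w] that ur sets_P[of r "X r w"] AOm by (intro emeasure_mono) auto
      then show "AE w in ?M. indicator F w * emeasure (P r (X r w)) A \<le> indicator F w * emeasure (P r (X r w)) Om"
        using ur y by (intro AE_I2 mult_left_mono) auto
    qed measurable
    also have "\<dots> = (\<integral>\<^sup>+w. indicator F w * emeasure (P r (X r w)) (Om - A) \<partial>?M)"
    proof (rule nn_integral_cong)
      fix w assume "w \<in> space ?M"
      then have om: "X r w \<in> space K" using X_space[of r w] ur y by simp
      then interpret R: prob_space "P r (X r w)" using prob_P ur by simp
      have "emeasure (P r (X r w)) (Om - A) = emeasure (P r (X r w)) Om - emeasure (P r (X r w)) A"
        using A AOm om ur sets_P[of r "X r w"] sets.top[of ?H] by (intro emeasure_Diff) auto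
      then show "indicator F w * emeasure (P r (X r w)) Om - indicator F w * emeasure (P r (X r w)) A =
          indicator F w * emeasure (P r (X r w)) (Om - A)"
        by (simp split: split_indicator)
    qed
    finally show ?case .
  next
    case (union A)
    have A: "A i \<in> sets ?H" for i using union by (auto simp: sets_history_cylinder)
    have "emeasure ?M (F \<inter> (\<Union>i. A i)) = emeasure ?M (\<Union>i. F \<inter> A i)" by (rule arg_cong[where f = "emeasure ?M"]) auto
    also have "\<dots> = (\<Sum>i. emeasure ?M (F \<inter> A i))"
      using union(1) HM[OF A] by (intro suminf_emeasure[symmetric]) (auto simp: disjoint_family_on_def)
    also have "\<dots> = (\<Sum>i. \<integral>\<^sup>+w. indicator F w * emeasure (P r (X r w)) (A i) \<partial>?M)"
      using union(3) by simp
    also have "\<dots> = (\<integral>\<^sup>+w. (\<Sum>i. indicator F w * emeasure (P r (X r w)) (A i)) \<partial>?M)"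
      using km[OF A] by (intro nn_integral_suminf[symmetric]) auto
    also have "\<dots> = (\<integral>\<^sup>+w. indicator F w * emeasure (P r (X r w)) (\<Union>i. A i) \<partial>?M)"
    proof (rule nn_integral_cong)
      fix w assume "w \<in> space ?M"
      then have om: "X r w \<in> space K" using X_space[of r w] ur y by simp
      have "(\<Sum>i. emeasure (P r (X r w)) (A i)) = emeasure (P r (X r w)) (\<Union>i. A i)"
        using A om ur sets_P[of r "X r w"] union(1) by (intro suminf_emeasure) auto
      then show "(\<Sum>i. indicator F w * emeasure (P r (X r w)) (A i)) =
          indicator F w * emeasure (P r (X r w)) (\<Union>i. A i)"
        by (simp add: ennreal_suminf_cmult)
    qed
    finally show ?case .
  qed
qed

end

section \<open>The law of the first jump\<close>

lemma measurable_exp_minus [measurable]: "exp_minus \<in> borel_measurable borel"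
  unfolding exp_minus_def[abs_def] by measurable

context markov_jump_process
begin

section \<open>Bounded rates and integration against them\<close>

definition rate_bound :: real where
  "rate_bound = enn2real (SUP (t, x)\<in>{0..T} \<times> space K. emeasure (nu t x) (space K))"

lemma rate_bound_nonneg: "0 \<le> rate_bound"
  by (simp add: rate_bound_def)

lemma space_nu: "0 \<le> s \<Longrightarrow> y \<in> space K \<Longrightarrow> space (nu s y) = space K"
  using sets_eq_imp_space_eq[OF sets_nu] by simp

lemma emeasure_nu_le:
  assumes "s \<in> {0..T}" "y \<in> space K"
  shows "emeasure (nu s y) A \<le> ennreal rate_bound"
proof -
  have "emeasure (nu s y) A \<le> emeasure (nu s y) (space (nu s y))" by (rule emeasure_space)
  also have "\<dots> \<le> (SUP (t, x)\<in>{0..T} \<times> space K. emeasure (nu t x) (space K))"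
    using assms space_nu[of s y] by (auto intro!: SUP_upper2[of "(s, y)"])
  also have "\<dots> = ennreal rate_bound"
    unfolding rate_bound_def using bounded_nu by (simp add: less_top)
  finally show ?thesis .
qed

lemma finite_measure_nu: "s \<in> {0..T} \<Longrightarrow> y \<in> space K \<Longrightarrow> finite_measure (nu s y)"
  using emeasure_nu_le[of s y "space (nu s y)"]
  by (intro finite_measureI) (metis ennreal_less_top infinity_ennreal_def linorder_not_less top.not_eq_extremum)

lemma measurable_nu':
  assumes p: "p \<in> \<Theta> \<rightarrow>\<^sub>M restrict_space borel {0..}" and q: "q \<in> \<Theta> \<rightarrow>\<^sub>M K" and A: "A \<in> sets K"
  shows "(\<lambda>\<theta>. emeasure (nu (p \<theta>) (q \<theta>)) A) \<in> borel_measurable \<Theta>"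
  using measurable_compose[OF measurable_Pair[OF p q] measurable_nu[OF A]] by simp

text \<open>Scaling by \<open>c = 1 / (rate_bound + 1)\<close> turns the rates into a subprobability
  kernel, for which integration depends measurably on the parameter; the factor is divided out
  afterwards. The \<open>+ 1\<close> keeps the denominator positive also when all rates up to
  \<open>T\<close> vanish.\<close>

lemma
  fixes p :: "'c \<Rightarrow> real" and q :: "'c \<Rightarrow> 'k"
  assumes p: "p \<in> \<Theta> \<rightarrow>\<^sub>M restrict_space borel {0..T}" and q: "q \<in> \<Theta> \<rightarrow>\<^sub>M K"
  shows nn_integral_nu_measurable: "(\<lambda>(\<theta>, y). H \<theta> y) \<in> borel_measurable (\<Theta> \<Otimes>\<^sub>M K) \<Longrightarrow>
      (\<lambda>\<theta>. \<integral>\<^sup>+y. H \<theta> y \<partial>nu (p \<theta>) (q \<theta>)) \<in> borel_measurable \<Theta>"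
    and integral_nu_measurable: "(\<lambda>(\<theta>, y). G \<theta> y) \<in> borel_measurable (\<Theta> \<Otimes>\<^sub>M K) \<Longrightarrow>
      (\<lambda>\<theta>. (LINT y|nu (p \<theta>) (q \<theta>). G \<theta> y) :: real) \<in> borel_measurable \<Theta>"
proof -
  define c where "c = 1 / (rate_bound + 1)"
  have c: "0 < c" "c * rate_bound \<le> 1" using rate_bound_nonneg by (auto simp: c_def field_simps)
  define \<kappa> where "\<kappa> \<theta> = density (nu (p \<theta>) (q \<theta>)) (\<lambda>_. ennreal c)" for \<theta>
  have pin: "p \<theta> \<in> {0..T}" and qin: "q \<theta> \<in> space K" if "\<theta> \<in> space \<Theta>" for \<theta>
    using measurable_space[OF p that] measurable_space[OF q that] by (auto simp: space_restrict_space)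
  have em: "emeasure (\<kappa> \<theta>) A = ennreal c * emeasure (nu (p \<theta>) (q \<theta>)) A"
    if "\<theta> \<in> space \<Theta>" "A \<in> sets K" for \<theta> A
    using that pin[of \<theta>] qin[of \<theta>] sets_nu[of "p \<theta>" "q \<theta>"]
    by (simp add: \<kappa>_def emeasure_density nn_integral_cmult_indicator)
  have sets_\<kappa>: "sets (\<kappa> \<theta>) = sets K" if "\<theta> \<in> space \<Theta>" for \<theta>
    using pin[OF that] qin[OF that] sets_nu by (simp add: \<kappa>_def)
  have p': "p \<in> \<Theta> \<rightarrow>\<^sub>M restrict_space borel {0..}"
    using p by (auto simp: measurable_restrict_space2_iff)
  have \<kappa>: "\<kappa> \<in> \<Theta> \<rightarrow>\<^sub>M subprob_algebra K"
  proof (rule measurable_subprob_algebra)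
    fix \<theta> assume \<theta>: "\<theta> \<in> space \<Theta>"
    have "emeasure (\<kappa> \<theta>) (space (\<kappa> \<theta>)) \<le> ennreal c * ennreal rate_bound"
      using em[OF \<theta> sets.top] emeasure_nu_le[OF pin[OF \<theta>] qin[OF \<theta>]] sets_eq_imp_space_eq[OF sets_\<kappa>[OF \<theta>]]
      by (simp add: mult_left_mono)
    also have "\<dots> = ennreal (c * rate_bound)" using c rate_bound_nonneg by (simp add: ennreal_mult)
    also have "\<dots> \<le> 1" using c by simp
    finally show "subprob_space (\<kappa> \<theta>)"
      using qin[OF \<theta>] sets_eq_imp_space_eq[OF sets_\<kappa>[OF \<theta>]] by (intro subprob_spaceI) auto
    show "sets (\<kappa> \<theta>) = sets K" by (rule sets_\<kappa>[OF \<theta>])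
  next
    fix A assume A: "A \<in> sets K"
    have "(\<lambda>\<theta>. ennreal c * emeasure (nu (p \<theta>) (q \<theta>)) A) \<in> borel_measurable \<Theta>"
      using measurable_nu'[OF p' q A] by measurable
    then show "(\<lambda>\<theta>. emeasure (\<kappa> \<theta>) A) \<in> borel_measurable \<Theta>"
      using em A by (simp cong: measurable_cong)
  qed
  have sets_\<nu>: "f \<in> borel_measurable (nu (p \<theta>) (q \<theta>)) \<longleftrightarrow> f \<in> borel_measurable K"
    if "\<theta> \<in> space \<Theta>" for f :: "'k \<Rightarrow> ennreal" and \<theta>
    using sets_nu[of "p \<theta>" "q \<theta>"] pin[OF that] qin[OF that] by (simp cong: measurable_cong_sets)
  have *: "(\<lambda>\<theta>. \<integral>\<^sup>+y. H \<theta> y \<partial>nu (p \<theta>) (q \<theta>)) \<in> borel_measurable \<Theta>"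
    if H: "(\<lambda>(\<theta>, y). H \<theta> y) \<in> borel_measurable (\<Theta> \<Otimes>\<^sub>M K)" for H :: "'c \<Rightarrow> 'k \<Rightarrow> ennreal"
  proof -
    have "(\<lambda>\<theta>. ennreal (1 / c) * integral\<^sup>N (\<kappa> \<theta>) (H \<theta>)) \<in> borel_measurable \<Theta>"
      using nn_integral_measurable_subprob_algebra2[OF H \<kappa>] by measurable
    moreover have "ennreal (1 / c) * integral\<^sup>N (\<kappa> \<theta>) (H \<theta>) = (\<integral>\<^sup>+y. H \<theta> y \<partial>nu (p \<theta>) (q \<theta>))"
      if \<theta>: "\<theta> \<in> space \<Theta>" for \<theta>
    proof -
      have "H \<theta> \<in> borel_measurable (nu (p \<theta>) (q \<theta>))"
        using measurable_Pair2[OF H \<theta>] sets_\<nu>[OF \<theta>] by simp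
      then have "integral\<^sup>N (\<kappa> \<theta>) (H \<theta>) = ennreal c * (\<integral>\<^sup>+y. H \<theta> y \<partial>nu (p \<theta>) (q \<theta>))"
        by (simp add: \<kappa>_def nn_integral_density nn_integral_cmult)
      then show ?thesis
        using c by (simp add: mult.assoc[symmetric] ennreal_mult[symmetric])
    qed
    ultimately show ?thesis by (simp cong: measurable_cong)
  qed
  show "(\<lambda>\<theta>. \<integral>\<^sup>+y. H \<theta> y \<partial>nu (p \<theta>) (q \<theta>)) \<in> borel_measurable \<Theta>"
    if "(\<lambda>(\<theta>, y). H \<theta> y) \<in> borel_measurable (\<Theta> \<Otimes>\<^sub>M K)"
    by (rule *[OF that])
  assume G: "(\<lambda>(\<theta>, y). G \<theta> y) \<in> borel_measurable (\<Theta> \<Otimes>\<^sub>M K)"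
  let ?I = "\<lambda>h \<theta>. \<integral>\<^sup>+y. ennreal (h (G \<theta> y)) \<partial>nu (p \<theta>) (q \<theta>)"
  have m: "?I h \<in> borel_measurable \<Theta>" if [measurable]: "h \<in> borel_measurable borel" for h
    using G by (intro *) (simp add: case_prod_beta')
  \<comment> \<open>Off the set of integrability the real integral has the default value 0; the set
    itself is measurable through the integral of the absolute value.\<close>
  have "(\<lambda>\<theta>. if ?I abs \<theta> < \<infinity> then enn2real (?I (\<lambda>r. r) \<theta>) - enn2real (?I uminus \<theta>) else 0) \<in> borel_measurable \<Theta>"
    using m[of abs] m[of uminus] m[of "\<lambda>r. r"] by measurable
  moreover have "(if ?I abs \<theta> < \<infinity> then enn2real (?I (\<lambda>r. r) \<theta>) - enn2real (?I uminus \<theta>) else 0) =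
      (LINT y|nu (p \<theta>) (q \<theta>). G \<theta> y)" if \<theta>: "\<theta> \<in> space \<Theta>" for \<theta>
  proof -
    have "G \<theta> \<in> borel_measurable (nu (p \<theta>) (q \<theta>))"
      using measurable_Pair2[OF G \<theta>] sets_nu[of "p \<theta>" "q \<theta>"] pin[OF \<theta>] qin[OF \<theta>]
      by (simp cong: measurable_cong_sets)
    then have "integrable (nu (p \<theta>) (q \<theta>)) (G \<theta>) \<longleftrightarrow> ?I abs \<theta> < \<infinity>"
      by (simp add: integrable_iff_bounded)
    then show ?thesis
      by (simp add: real_lebesgue_integral_def not_integrable_integral_eq)
  qed
  ultimately show "(\<lambda>\<theta>. (LINT y|nu (p \<theta>) (q \<theta>). G \<theta> y) :: real) \<in> borel_measurable \<Theta>"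
    by (simp cong: measurable_cong)
qed

text \<open>Closed at the right end, whereas the law of the first jump is given for open intervals:
  left-open intervals tile a time interval without losing a jump at an end point.\<close>

definition first_jump_in :: "real \<Rightarrow> real \<Rightarrow> 'k set \<Rightarrow> 'w set" where
  "first_jump_in u s A = {w \<in> Om. \<exists>\<tau>\<le>s. first_exit u w = ereal \<tau> \<and> X \<tau> w \<in> A}"

text \<open>The integrand of the first-jump law. The factor \<open>indicator {0..} s\<close> makes
  it a Borel function on the whole line, as the rates are only controlled at nonnegative
  times.\<close>

definition jump_density :: "real \<Rightarrow> 'k \<Rightarrow> 'k set \<Rightarrow> real \<Rightarrow> ennreal" where
  "jump_density u y A s = jump_law nu s y A * total_rate nu s y *
     exp_minus (\<integral>\<^sup>+r\<in>{u..s}. total_rate nu r y \<partial>lborel) * indicator {0..} s"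

lemma measurable_jump_density:
  assumes u: "0 \<le> u" and y: "y \<in> space K" and A: "A \<in> sets K"
  shows "jump_density u y A \<in> borel_measurable borel"
proof -
  have m: "(\<lambda>s. emeasure (nu s y) B * indicator {0..} s) \<in> borel_measurable borel" if "B \<in> sets K" for B
    using measurable_nu'[of "\<lambda>s. s" "restrict_space borel {0..}" "\<lambda>_. y" B] y that
    by (subst (asm) borel_measurable_restrict_space_iff_ennreal) auto
  define R where "R s = total_rate nu s y * indicator {0..} s" for s
  have R: "R \<in> borel_measurable borel"
  proof -
    have "R = (\<lambda>s. emeasure (nu s y) (space K) * indicator {0..} s)"
      using space_nu[OF _ y] by (auto simp: R_def total_rate_def fun_eq_iff split: split_indicator)
    then show ?thesis using m[OF sets.top] by simp
  qed
  define N where "N s = emeasure (nu s y) A * indicator {0..} s" for s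
  have N: "N \<in> borel_measurable borel" using m[OF A] by (simp add: N_def[abs_def])
  have I: "(\<lambda>s. \<integral>\<^sup>+r. R r * indicator {u..s} r \<partial>lborel) \<in> borel_measurable borel"
  proof (rule lborel.borel_measurable_nn_integral)
    have "(\<lambda>p. R (snd p) * indicator {p. u \<le> snd p \<and> snd p \<le> fst p} p) \<in> borel_measurable (borel \<Otimes>\<^sub>M lborel)"
      using R by measurable
    moreover have "(\<lambda>p. R (snd p) * indicator {p. u \<le> snd p \<and> snd p \<le> fst p} p) =
        (\<lambda>(s, r). R r * indicator {u..s} r)"
      by (auto simp: fun_eq_iff split: split_indicator)
    ultimately show "(\<lambda>(s, r). R r * indicator {u..s} r) \<in> borel_measurable (borel \<Otimes>\<^sub>M lborel)" by simp
  qed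
  have "jump_density u y A = (\<lambda>s. (if R s > 0 then N s / R s else indicator ({0..} \<inter> (if y \<in> A then UNIV else {})) s) * R s *
      exp_minus (\<integral>\<^sup>+r. R r * indicator {u..s} r \<partial>lborel))"
  proof
    fix s :: real
    have "(\<integral>\<^sup>+r\<in>{u..s}. total_rate nu r y \<partial>lborel) = (\<integral>\<^sup>+r. R r * indicator {u..s} r \<partial>lborel)"
      using u by (intro nn_integral_cong) (auto simp: R_def split: split_indicator)
    then show "jump_density u y A s = (if R s > 0 then N s / R s else indicator ({0..} \<inter> (if y \<in> A then UNIV else {})) s) * R s *
        exp_minus (\<integral>\<^sup>+r. R r * indicator {u..s} r \<partial>lborel)"
      by (auto simp: jump_density_def jump_law_def R_def N_def split: split_indicator)
  qed
  also have "\<dots> \<in> borel_measurable borel"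
    using R N I by measurable
  finally show ?thesis .
qed

text \<open>Normalisation and total rate cancel to \<open>emeasure (nu s y) A\<close>. What remains
  is the survival factor, which lies between \<open>exp (- rate_bound * (s' - u))\<close> and 1; the
  lower bound does not depend on \<open>s\<close>, so it can be taken out of an integral up to
  \<open>s'\<close>.\<close>

lemma jump_density_bounds:
  assumes u: "0 \<le> u" and y: "y \<in> space K" and A: "A \<in> sets K" and s: "u \<le> s" "s \<le> s'" "s' \<le> T"
  shows "jump_density u y A s \<le> emeasure (nu s y) A"
    and "ennreal (exp (- rate_bound * (s' - u))) * emeasure (nu s y) A \<le> jump_density u y A s"
proof -
  let ?I = "\<integral>\<^sup>+r\<in>{u..s}. total_rate nu r y \<partial>lborel"
  have R: "total_rate nu r y \<le> ennreal rate_bound" if "r \<in> {0..T}" for r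
    unfolding total_rate_def by (rule emeasure_nu_le[OF that y])
  have "?I \<le> (\<integral>\<^sup>+r. ennreal rate_bound * indicator {u..s} r \<partial>lborel)"
    using R u s by (intro nn_integral_mono) (auto split: split_indicator)
  also have "\<dots> = ennreal (rate_bound * (s - u))"
    using s rate_bound_nonneg by (simp add: nn_integral_cmult_indicator ennreal_mult)
  finally have I: "?I \<le> ennreal (rate_bound * (s - u))" .
  then have Ifin: "?I < \<infinity>" by (rule le_less_trans) simp
  have "enn2real ?I \<le> rate_bound * (s - u)"
    using I rate_bound_nonneg s by (intro enn2real_leI) auto
  also have "\<dots> \<le> rate_bound * (s' - u)"
    using rate_bound_nonneg s by (intro mult_left_mono) auto
  finally have e: "exp (- rate_bound * (s' - u)) \<le> exp (- enn2real ?I)" by simp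
  have em: "exp_minus ?I = ennreal (exp (- enn2real ?I))"
    using Ifin by (auto simp: exp_minus_def)
  have sT: "s \<in> {0..T}" using u s by auto
  \<comment> \<open>A positive total rate cancels because it is finite up to \<open>T\<close>. At
    total rate 0 both sides vanish, the right one because it is at most the total rate.\<close>
  have prod: "jump_law nu s y A * total_rate nu s y = emeasure (nu s y) A"
  proof (cases "total_rate nu s y > 0")
    case True
    moreover have "total_rate nu s y < \<top>" using R[OF sT] by (meson ennreal_less_top le_less_trans)
    ultimately show ?thesis by (simp add: jump_law_def ennreal_divide_times)
  next
    case False
    then have "total_rate nu s y = 0" by simp
    moreover have "emeasure (nu s y) A \<le> total_rate nu s y" unfolding total_rate_def by (rule emeasure_space)
    ultimately show ?thesis by simp
  qed
  have J: "jump_density u y A s = emeasure (nu s y) A * ennreal (exp (- enn2real ?I))"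
    using sT by (simp add: jump_density_def prod em)
  have "jump_density u y A s \<le> emeasure (nu s y) A * 1"
    unfolding J by (intro mult_left_mono) auto
  then show "jump_density u y A s \<le> emeasure (nu s y) A" by simp
  show "ennreal (exp (- rate_bound * (s' - u))) * emeasure (nu s y) A \<le> jump_density u y A s"
    unfolding J using e by (subst mult.commute) (intro mult_left_mono ennreal_leI, auto)
qed

text \<open>The closed end is reached by open intervals ending at \<open>s + 1 / (k + 1)\<close>.
  Events and integration domains both decrease to the desired ones, and continuity from above
  applies to either side.\<close>

lemma first_jump_in_law:
  assumes u: "0 \<le> u" "u < s" and y: "y \<in> space K" and A: "A \<in> sets K"
  shows "first_jump_in u s A \<in> sets (history Om K X {u..})"
    and "emeasure (P u y) (first_jump_in u s A) = (\<integral>\<^sup>+v\<in>{u<..s}. jump_density u y A v \<partial>lborel)"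
proof -
  let ?b = "\<lambda>k. s + 1 / real (Suc k)"
  define E where "E k = {w \<in> Om. jump_time X u 1 w \<in> {ereal u<..<ereal (?b k)} \<and> jump_pos X u 1 w \<in> A}" for k
  define I where "I k = {v. u < v \<and> ereal v < ereal (?b k)}" for k
  have jt: "jump_time X u 1 w = first_exit u w" for w
    using jump_time_Suc[of u 0 w u] by simp
  note jt' = jt[unfolded One_nat_def]
  have bk: "ereal u < ereal (?b k)" for k
    using u add_strict_mono[of u s 0 "1 / real (Suc k)"] by (simp del: of_nat_Suc)
  have E: "E k \<in> sets (P u y)" "emeasure (P u y) (E k) = (\<integral>\<^sup>+v\<in>I k. jump_density u y A v \<partial>lborel)" for k
  proof -
    note fj = first_jump[OF u(1) order_refl bk[of k] y A]
    show "E k \<in> sets (P u y)" using fj by (simp add: E_def)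
    have "(\<integral>\<^sup>+v\<in>I k. jump_law nu v y A * total_rate nu v y * exp_minus (\<integral>\<^sup>+r\<in>{u..v}. total_rate nu r y \<partial>lborel) \<partial>lborel)
        = (\<integral>\<^sup>+v\<in>I k. jump_density u y A v \<partial>lborel)"
      using u by (intro nn_integral_cong) (auto simp: jump_density_def I_def split: split_indicator)
    with fj show "emeasure (P u y) (E k) = (\<integral>\<^sup>+v\<in>I k. jump_density u y A v \<partial>lborel)"
      by (simp add: E_def I_def)
  qed
  have small: "v \<le> s" if "\<And>k. v < ?b k" for v
  proof (rule field_le_epsilon)
    fix e :: real assume "0 < e"
    then obtain k where "inverse (real (Suc k)) < e" using reals_Archimedean by blast
    with that[of k] show "v \<le> s + e" by (simp add: inverse_eq_divide)
  qed
  have big: "v < ?b k" if "v \<le> s" for v k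
    using that le_less_trans[of v s "?b k"] by simp
  have eqE: "first_jump_in u s A = (\<Inter>k. E k)"
  proof (intro set_eqI iffI)
    fix w assume "w \<in> first_jump_in u s A"
    then obtain \<tau> where "w \<in> Om" "\<tau> \<le> s" "first_exit u w = ereal \<tau>" "X \<tau> w \<in> A"
      by (auto simp: first_jump_in_def)
    then show "w \<in> (\<Inter>k. E k)"
      using first_exit_gt[of w u] u big by (auto simp: E_def jt' jump_pos_def simp del: jump_time.simps of_nat_Suc)
  next
    fix w assume om: "w \<in> (\<Inter>k. E k)"
    then have "w \<in> E 0" by blast
    then obtain \<tau> where \<tau>: "first_exit u w = ereal \<tau>" "w \<in> Om"
      unfolding E_def jt by (cases "first_exit u w") auto
    with om have "\<tau> < ?b k" "X \<tau> w \<in> A" for k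
      by (auto simp: E_def jt' jump_pos_def simp del: jump_time.simps of_nat_Suc)
    with \<tau> small show "w \<in> first_jump_in u s A" by (auto simp: first_jump_in_def)
  qed
  have b_anti: "?b k \<le> ?b j" if "j \<le> k" for j k using that by (simp add: frac_le)
  have decE: "decseq E"
  unfolding decseq_def
  proof (intro allI impI subsetI)
    fix j k w assume "j \<le> k" "w \<in> E k"
    moreover have "ereal (?b k) \<le> ereal (?b j)" using b_anti[OF \<open>j \<le> k\<close>] by simp
    ultimately show "w \<in> E j" unfolding E_def by (auto simp del: jump_time.simps of_nat_Suc intro: less_le_trans)
  qed
  have decI: "decseq I"
  unfolding decseq_def
  proof (intro allI impI subsetI)
    fix j k v assume "j \<le> k" "v \<in> I k"
    then show "v \<in> I j" using b_anti[OF \<open>j \<le> k\<close>] unfolding I_def by (simp del: of_nat_Suc)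
  qed
  have eqI: "(\<Inter>k. I k) = {u<..s}"
    using small big unfolding I_def by (auto simp del: of_nat_Suc)
  have sI: "I k \<in> sets lborel" for k unfolding I_def by simp
  let ?D = "density lborel (jump_density u y A)"
  have D: "emeasure ?D B = (\<integral>\<^sup>+v\<in>B. jump_density u y A v \<partial>lborel)" if "B \<in> sets lborel" for B
    using measurable_jump_density[OF u(1) y A] that by (intro emeasure_density) auto
  interpret M: prob_space "P u y" using prob_P u y by simp
  have "first_jump_in u s A \<in> sets (P u y)" unfolding eqE using E by auto
  then show "first_jump_in u s A \<in> sets (history Om K X {u..})" using sets_P u y by auto
  have "emeasure (P u y) (first_jump_in u s A) = (INF k. emeasure (P u y) (E k))"
    unfolding eqE using E(1) decE M.emeasure_finite by (intro INF_emeasure_decseq[symmetric]) auto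
  also have "\<dots> = (INF k. emeasure ?D (I k))" using E(2) D[OF sI] by simp
  also have "\<dots> = emeasure ?D (\<Inter>k. I k)"
  proof (rule INF_emeasure_decseq[OF _ decI])
    show "range I \<subseteq> sets ?D" using sI by auto
    \<comment> \<open>Beyond \<open>T\<close> the rates may be infinite, yet this integral equals a
      probability and is therefore finite.\<close>
    show "emeasure ?D (I k) \<noteq> \<infinity>" for k
      using M.emeasure_finite[of "E k"] unfolding D[OF sI] E(2)[symmetric] by simp
  qed
  also have "\<dots> = (\<integral>\<^sup>+v\<in>{u<..s}. jump_density u y A v \<partial>lborel)" unfolding eqI by (rule D) simp
  finally show "emeasure (P u y) (first_jump_in u s A) = (\<integral>\<^sup>+v\<in>{u<..s}. jump_density u y A v \<partial>lborel)" .
qed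

text \<open>On a short interval the probability of a first jump into \<open>A\<close> is, to leading
  order, the integrated rate. The relative error tends to 0 with the length of the interval,
  uniformly in the state.\<close>

lemma first_jump_in_bounds:
  assumes u: "0 \<le> u" "u < s" "s \<le> T" and y: "y \<in> space K" and A: "A \<in> sets K"
  shows "emeasure (P u y) (first_jump_in u s A) \<le> (\<integral>\<^sup>+v\<in>{u<..s}. emeasure (nu v y) A \<partial>lborel)"
    and "ennreal (exp (- rate_bound * (s - u))) * (\<integral>\<^sup>+v\<in>{u<..s}. emeasure (nu v y) A \<partial>lborel)
      \<le> emeasure (P u y) (first_jump_in u s A)"
proof -
  have m: "(\<lambda>v. emeasure (nu v y) A * indicator {u<..s} v) \<in> borel_measurable lborel"
  proof -
    have "(\<lambda>v. emeasure (nu v y) A) \<in> borel_measurable (restrict_space borel {u<..s})"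
      using u y by (intro measurable_nu'[of "\<lambda>v. v"] A)
        (auto simp: measurable_restrict_space2_iff space_restrict_space intro: measurable_restrict_space1)
    then show ?thesis by (subst (asm) borel_measurable_restrict_space_iff_ennreal) auto
  qed
  show "emeasure (P u y) (first_jump_in u s A) \<le> (\<integral>\<^sup>+v\<in>{u<..s}. emeasure (nu v y) A \<partial>lborel)"
    unfolding first_jump_in_law(2)[OF u(1,2) y A]
    using jump_density_bounds(1)[OF u(1) y A, of _ s] u
    by (intro nn_integral_mono) (auto split: split_indicator)
  have "ennreal (exp (- rate_bound * (s - u))) * (\<integral>\<^sup>+v\<in>{u<..s}. emeasure (nu v y) A \<partial>lborel) =
      (\<integral>\<^sup>+v\<in>{u<..s}. ennreal (exp (- rate_bound * (s - u))) * emeasure (nu v y) A \<partial>lborel)"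
    using m by (subst nn_integral_cmult[symmetric]) (auto simp: mult.assoc)
  also have "\<dots> \<le> emeasure (P u y) (first_jump_in u s A)"
    unfolding first_jump_in_law(2)[OF u(1,2) y A]
    using jump_density_bounds(2)[OF u(1) y A, of _ s] u
    by (intro nn_integral_mono) (auto split: split_indicator)
  finally show "ennreal (exp (- rate_bound * (s - u))) * (\<integral>\<^sup>+v\<in>{u<..s}. emeasure (nu v y) A \<partial>lborel)
      \<le> emeasure (P u y) (first_jump_in u s A)" .
qed

end

section \<open>The compensator of the jump measure\<close>

context started_process
begin

text \<open>The counting measure on the finite set of jumps makes every function measurable, so the
  rules for nonnegative integrals apply along a trajectory to arbitrary \<open>H\<close>.\<close>

definition jump_integral :: "(('w \<times> real) \<times> 'k \<Rightarrow> ennreal) \<Rightarrow> 'w \<Rightarrow> ennreal" where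
  "jump_integral H w = (\<integral>\<^sup>+\<tau>. H ((w, \<tau>), X \<tau> w) \<partial>count_space (jumps w \<inter> {t<..T}))"

text \<open>\<open>pre\<close> keeps the rate predictable. The current state would give the same
  integral, since it differs on a null set of times only.\<close>

definition rate_integral :: "(('w \<times> real) \<times> 'k \<Rightarrow> ennreal) \<Rightarrow> 'w \<Rightarrow> ennreal" where
  "rate_integral H w = (\<integral>\<^sup>+s. (\<integral>\<^sup>+y. H ((w, s), y) \<partial>nu s (pre s w)) \<partial>Leb)"

lemma finite_jumps_tT: "w \<in> Om \<Longrightarrow> finite (jumps w \<inter> {t<..T})"
  by (rule finite_jumps_Ioc[OF _ t_nonneg])

lemma jump_integral_sum:
  "w \<in> Om \<Longrightarrow> jump_integral H w = (\<Sum>\<tau>\<in>jumps w \<inter> {t<..T}. H ((w, \<tau>), X \<tau> w))"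
  unfolding jump_integral_def by (rule nn_integral_count_space_finite[OF finite_jumps_tT])

lemma jump_integral_mono: "(\<And>p. H p \<le> G p) \<Longrightarrow> jump_integral H w \<le> jump_integral G w"
  unfolding jump_integral_def by (intro nn_integral_mono) auto

lemma rate_integral_mono: "(\<And>p. H p \<le> G p) \<Longrightarrow> rate_integral H w \<le> rate_integral G w"
  unfolding rate_integral_def by (intro nn_integral_mono) auto

lemma kernel_pre_measurable:
  assumes H: "H \<in> borel_measurable PK"
  shows "(\<lambda>(w, s). \<integral>\<^sup>+y. H ((w, s), y) \<partial>nu s (pre s w)) \<in> borel_measurable QT"
proof -
  have "(\<lambda>p. \<integral>\<^sup>+y. H (p, y) \<partial>nu (snd p) (pre (snd p) (fst p))) \<in> borel_measurable QT"
  proof (rule nn_integral_nu_measurable)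
    show "snd \<in> QT \<rightarrow>\<^sub>M restrict_space borel {0..T}"
      using t_nonneg by (auto simp: measurable_restrict_space2_iff space_QL
        intro!: measurable_compose[OF measurable_snd] measurable_restrict_space1)
    show "(\<lambda>p. pre (snd p) (fst p)) \<in> QT \<rightarrow>\<^sub>M K" using pre_QL by (simp add: case_prod_beta')
    have "(\<lambda>p. H (fst p, snd p)) \<in> borel_measurable (QT \<Otimes>\<^sub>M K)"
      by (rule measurable_compose[OF measurable_Pair[OF measurable_compose[OF measurable_fst id_Prd] measurable_snd] H])
    then show "(\<lambda>(p, y). H (p, y)) \<in> borel_measurable (QT \<Otimes>\<^sub>M K)" by (simp add: case_prod_beta')
  qed
  then show ?thesis by (simp add: case_prod_beta')
qed

lemma rate_integral_measurable:
  "H \<in> borel_measurable PK \<Longrightarrow> rate_integral H \<in> borel_measurable \<Q>"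
  unfolding rate_integral_def[abs_def]
  by (rule L.borel_measurable_nn_integral[OF kernel_pre_measurable])

lemma section_measurable_nu:
  assumes H: "H \<in> borel_measurable PK" and "w \<in> Om" "s \<in> {t..T}"
  shows "(\<lambda>y. H ((w, s), y)) \<in> borel_measurable (nu s (pre s w))"
proof -
  have "(\<lambda>y. H ((w, s), y)) \<in> borel_measurable K"
    by (rule measurable_compose[OF measurable_Pair[OF measurable_const measurable_ident] H, simplified])
      (use assms in auto)
  then show ?thesis
    using sets_nu[of s "pre s w"] pre_space assms t_nonneg by (simp cong: measurable_cong_sets)
qed

lemma kernel_pre_section:
  assumes H: "H \<in> borel_measurable PK" and "w \<in> Om"
  shows "(\<lambda>s. \<integral>\<^sup>+y. H ((w, s), y) \<partial>nu s (pre s w)) \<in> borel_measurable Leb"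
  using measurable_Pair2[OF kernel_pre_measurable[OF H], of w] assms by simp

lemma rate_integral_add:
  assumes "H \<in> borel_measurable PK" "G \<in> borel_measurable PK" "w \<in> Om"
  shows "rate_integral (\<lambda>p. H p + G p) w = rate_integral H w + rate_integral G w"
  unfolding rate_integral_def
  using assms
  by (subst nn_integral_add[symmetric])
    (auto intro!: nn_integral_cong nn_integral_add kernel_pre_section section_measurable_nu)

lemma rate_integral_cmult:
  assumes "H \<in> borel_measurable PK" "w \<in> Om"
  shows "rate_integral (\<lambda>p. c * H p) w = c * rate_integral H w"
  unfolding rate_integral_def
  using assms
  by (subst nn_integral_cmult[symmetric])
    (auto intro!: nn_integral_cong nn_integral_cmult kernel_pre_section section_measurable_nu)

lemma rate_integral_SUP:
  assumes "\<And>i. U i \<in> borel_measurable PK" "incseq U" "w \<in> Om"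
  shows "rate_integral (SUP i. U i) w = (SUP i. rate_integral (U i) w)"
proof -
  have "rate_integral (SUP i. U i) w = (\<integral>\<^sup>+s. (SUP i. \<integral>\<^sup>+y. U i ((w, s), y) \<partial>nu s (pre s w)) \<partial>Leb)"
    unfolding rate_integral_def SUP_apply
    using assms section_measurable_nu[OF assms(1,3)]
    by (intro nn_integral_cong nn_integral_monotone_convergence_SUP) (auto simp: incseq_def le_fun_def)
  also have "\<dots> = (SUP i. rate_integral (U i) w)"
    unfolding rate_integral_def
    using assms kernel_pre_section[OF assms(1,3)]
    by (intro nn_integral_monotone_convergence_SUP) (auto simp: incseq_def le_fun_def intro!: nn_integral_mono)
  finally show ?thesis .
qed

text \<open>Measurability of the jump integral is included because a sum over random times is not
  evidently measurable; it emerges from the same induction as the equality of expectations.\<close>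

definition compensated :: "(('w \<times> real) \<times> 'k \<Rightarrow> ennreal) \<Rightarrow> bool" where
  "compensated H \<longleftrightarrow> jump_integral H \<in> borel_measurable \<Q> \<and>
     (\<E> w. jump_integral H w) = (\<E> w. rate_integral H w)"

text \<open>Values at time \<open>t\<close> are left free: jumps are counted on
  \<open>{t<..T}\<close>, and a single time is null for the time integral.\<close>

lemma compensated_cong:
  assumes eq: "\<And>w s y. w \<in> Om \<Longrightarrow> s \<in> {t<..T} \<Longrightarrow> y \<in> space K \<Longrightarrow> H ((w, s), y) = G ((w, s), y)"
    and G: "compensated G"
  shows "compensated H"
proof -
  have "jump_integral H w = jump_integral G w" if "w \<in> Om" for w
    unfolding jump_integral_def using eq[OF that] X_space[OF _ that] t_nonneg
    by (intro nn_integral_cong) auto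
  moreover have "rate_integral H w = rate_integral G w" if om: "w \<in> Om" for w
    unfolding rate_integral_def
  proof (rule nn_integral_cong_AE)
    have "AE s in lborel. s \<noteq> t" by (rule AE_lborel_singleton)
    then have "AE s in Leb. s \<noteq> t" by (subst AE_restrict_space_iff) auto
    with AE_space show "AE s in Leb. (\<integral>\<^sup>+y. H ((w, s), y) \<partial>nu s (pre s w)) = (\<integral>\<^sup>+y. G ((w, s), y) \<partial>nu s (pre s w))"
    proof eventually_elim
      case (elim s)
      then show ?case
        using eq[OF om, of s] space_nu[of s "pre s w"] pre_space[OF om] t_nonneg
        by (intro nn_integral_cong) auto
    qed
  qed
  ultimately show ?thesis
    using G measurable_cong[of \<Q> "jump_integral H" "jump_integral G" borel]
      nn_integral_cong[of \<Q> "jump_integral H" "jump_integral G"]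
      nn_integral_cong[of \<Q> "rate_integral H" "rate_integral G"]
    unfolding compensated_def by simp
qed

lemma compensated_add:
  assumes "H \<in> borel_measurable PK" "G \<in> borel_measurable PK"
    "compensated H" "compensated G"
  shows "compensated (\<lambda>p. H p + G p)"
proof -
  have J: "jump_integral (\<lambda>p. H p + G p) w = jump_integral H w + jump_integral G w" for w
    unfolding jump_integral_def by (intro nn_integral_add) auto
  have "(\<E> w. jump_integral (\<lambda>p. H p + G p) w) =
      (\<E> w. rate_integral H w) + (\<E> w. rate_integral G w)"
    using assms unfolding J compensated_def by (subst nn_integral_add) auto
  also have "\<dots> = (\<E> w. rate_integral (\<lambda>p. H p + G p) w)"
    using assms(1,2) by (subst nn_integral_add[symmetric])
      (auto intro!: rate_integral_measurable nn_integral_cong rate_integral_add[symmetric])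
  finally show ?thesis
    using assms(3,4) unfolding compensated_def J by (auto intro: borel_measurable_add)
qed

lemma compensated_cmult:
  assumes "H \<in> borel_measurable PK" "compensated H"
  shows "compensated (\<lambda>p. c * H p)"
proof -
  have J: "jump_integral (\<lambda>p. c * H p) w = c * jump_integral H w" for w
    unfolding jump_integral_def by (intro nn_integral_cmult) auto
  have "(\<E> w. jump_integral (\<lambda>p. c * H p) w) = c * (\<E> w. rate_integral H w)"
    using assms unfolding J compensated_def by (subst nn_integral_cmult) auto
  also have "\<dots> = (\<E> w. rate_integral (\<lambda>p. c * H p) w)"
    using assms(1) by (subst nn_integral_cmult[symmetric])
      (auto intro!: rate_integral_measurable nn_integral_cong rate_integral_cmult[symmetric])
  finally show ?thesis
    using assms(2) unfolding compensated_def J by (auto intro: borel_measurable_times)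
qed

lemma compensated_SUP:
  assumes U: "\<And>i. U i \<in> borel_measurable PK" "incseq U" and c: "\<And>i. compensated (U i)"
  shows "compensated (SUP i. U i)"
proof -
  have J: "jump_integral (SUP i. U i) w = (SUP i. jump_integral (U i) w)" for w
    unfolding jump_integral_def SUP_apply
    using U(2) by (intro nn_integral_monotone_convergence_SUP) (auto simp: incseq_def le_fun_def)
  have m: "jump_integral (U i) \<in> borel_measurable \<Q>" for i using c by (simp add: compensated_def)
  have "(\<E> w. jump_integral (SUP i. U i) w) = (SUP i. \<integral>\<^sup>+w. jump_integral (U i) w \<partial>\<Q>)"
    unfolding J using m U(2)
    by (intro nn_integral_monotone_convergence_SUP)
      (auto simp: incseq_def le_fun_def intro!: jump_integral_mono)
  also have "\<dots> = (SUP i. \<integral>\<^sup>+w. rate_integral (U i) w \<partial>\<Q>)"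
    using c by (simp add: compensated_def)
  also have "\<dots> = (\<E> w. (SUP i. rate_integral (U i) w))"
    using rate_integral_measurable[OF U(1)] U(2)
    by (intro nn_integral_monotone_convergence_SUP[symmetric])
      (auto simp: incseq_def le_fun_def intro!: rate_integral_mono)
  also have "\<dots> = (\<E> w. rate_integral (SUP i. U i) w)"
    using rate_integral_SUP[OF U] by (intro nn_integral_cong) simp
  finally show ?thesis
    unfolding compensated_def J using m by auto
qed

lemma rate_integral_le:
  assumes "w \<in> Om" "\<And>p. H p \<le> 1"
  shows "rate_integral H w \<le> ennreal (rate_bound * (T - t))"
proof -
  have "(\<integral>\<^sup>+y. H ((w, s), y) \<partial>nu s (pre s w)) \<le> ennreal rate_bound" if "s \<in> {t..T}" for s
  proof -
    have "(\<integral>\<^sup>+y. H ((w, s), y) \<partial>nu s (pre s w)) \<le> (\<integral>\<^sup>+y. 1 \<partial>nu s (pre s w))"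
      using assms by (intro nn_integral_mono) auto
    also have "\<dots> \<le> ennreal rate_bound"
      using emeasure_nu_le[of s "pre s w"] pre_space assms that t_nonneg by simp
    finally show ?thesis .
  qed
  then have "rate_integral H w \<le> (\<integral>\<^sup>+s. ennreal rate_bound \<partial>Leb)"
    unfolding rate_integral_def by (intro nn_integral_mono) simp
  also have "\<dots> = ennreal (rate_bound * (T - t))"
    using t_le_T rate_bound_nonneg by (simp add: emeasure_restrict_space ennreal_mult)
  finally show ?thesis .
qed

text \<open>Proper differences make the class a Dynkin system. Subtraction in \<open>ennreal\<close>
  needs finite terms: a trajectory has finitely many jumps, and in expectation the rate integral of
  an indicator is at most \<open>rate_bound * (T - t)\<close>.\<close>

lemma compensated_diff:
  assumes D: "D \<in> sets PK" and E: "E \<in> sets PK" and sub: "E \<subseteq> D"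
    and cD: "compensated (indicator D)" and cE: "compensated (indicator E)"
  shows "compensated (indicator (D - E))"
proof -
  have sum: "(\<lambda>p. indicator E p + indicator (D - E) p :: ennreal) = indicator D"
    using sub by (auto simp: fun_eq_iff split: split_indicator)
  have J: "jump_integral (indicator E) w + jump_integral (indicator (D - E)) w = jump_integral (indicator D) w" for w
    unfolding jump_integral_def by (subst nn_integral_add[symmetric]) (auto simp flip: sum)
  have fin: "jump_integral (indicator E) w \<noteq> \<top>" if "w \<in> Om" for w
  proof -
    have "jump_integral (indicator E) w \<le> of_nat (card (jumps w \<inter> {t<..T})) * 1"
      unfolding jump_integral_sum[OF that] by (intro sum_bounded_above) (auto simp: indicator_def)
    also have "\<dots> < \<top>" by (simp add: of_nat_less_top)
    finally show ?thesis by simp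
  qed
  have m: "jump_integral (indicator D) \<in> borel_measurable \<Q>" "jump_integral (indicator E) \<in> borel_measurable \<Q>"
    using cD cE by (auto simp: compensated_def)
  have "jump_integral (indicator (D - E)) w = jump_integral (indicator D) w - jump_integral (indicator E) w"
    if "w \<in> Om" for w
    using J[of w] fin[OF that] by (metis ennreal_add_diff_cancel_left)
  then have mDE: "jump_integral (indicator (D - E)) \<in> borel_measurable \<Q>"
    using m by (subst measurable_cong[of \<Q> _ "\<lambda>w. jump_integral (indicator D) w - jump_integral (indicator E) w"]) auto
  have "(\<E> w. jump_integral (indicator E) w) + (\<E> w. jump_integral (indicator (D - E)) w) =
      (\<E> w. jump_integral (indicator D) w)"
    using m mDE J by (subst nn_integral_add[symmetric]) auto
  also have "\<dots> = (\<E> w. rate_integral (indicator D) w)" using cD by (simp add: compensated_def)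
  also have "\<dots> = (\<E> w. rate_integral (indicator E) w + rate_integral (indicator (D - E)) w)"
    using D E rate_integral_add[of "indicator E" "indicator (D - E)"]
    by (intro nn_integral_cong) (auto simp: sum)
  also have "\<dots> = (\<E> w. rate_integral (indicator E) w) + (\<E> w. rate_integral (indicator (D - E)) w)"
    using D E by (intro nn_integral_add rate_integral_measurable) auto
  also have "(\<E> w. rate_integral (indicator E) w) = (\<E> w. jump_integral (indicator E) w)"
    using cE by (simp add: compensated_def)
  finally have eq: "(\<E> w. jump_integral (indicator E) w) + (\<E> w. jump_integral (indicator (D - E)) w) =
      (\<E> w. jump_integral (indicator E) w) + (\<E> w. rate_integral (indicator (D - E)) w)" .
  have "(\<E> w. jump_integral (indicator E) w) = (\<E> w. rate_integral (indicator E) w)"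
    using cE by (simp add: compensated_def)
  also have "\<dots> \<le> (\<E> w. ennreal (rate_bound * (T - t)))"
    by (intro nn_integral_mono rate_integral_le) (auto simp: indicator_def)
  also have "\<dots> < \<top>" using Q.emeasure_space_1 by (simp add: ennreal_mult_less_top)
  finally show ?thesis
    using eq mDE by (auto simp: compensated_def ennreal_add_left_cancel)
qed

lemma compensated_zero: "compensated (\<lambda>_. 0)"
proof -
  have "jump_integral (\<lambda>_. 0) = (\<lambda>_. 0)" "rate_integral (\<lambda>_. 0) = (\<lambda>_. 0)"
    by (auto simp: jump_integral_def rate_integral_def)
  then show ?thesis by (simp add: compensated_def)
qed

lemma compensated_empty: "compensated (indicator {})"
proof -
  have "indicator {} = (\<lambda>_ :: ('w \<times> real) \<times> 'k. 0 :: ennreal)" by auto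
  then show ?thesis using compensated_zero by simp
qed

lemma compensated_UN:
  fixes A :: "nat \<Rightarrow> (('w \<times> real) \<times> 'k) set"
  assumes disj: "disjoint_family A" and A: "\<And>i. A i \<in> sets PK"
    and c: "\<And>i. compensated (indicator (A i))"
  shows "compensated (indicator (\<Union>i. A i))"
proof -
  let ?B = "\<lambda>n. \<Union>i<n. A i"
  have B: "?B n \<in> sets PK" for n using A by auto
  have cB: "compensated (indicator (?B n))" for n
  proof (induction n)
    case 0
    show ?case using compensated_zero by simp
  next
    case (Suc n)
    have "A n \<inter> ?B n = {}" using disj by (auto dest: disjoint_family_onD[of A UNIV n])
    then have "indicator (?B (Suc n)) = (\<lambda>p. indicator (A n) p + indicator (?B n) p :: ennreal)"
      by (auto simp: fun_eq_iff lessThan_Suc split: split_indicator)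
    then show ?case
      using compensated_add[of "indicator (A n)" "indicator (?B n)"] A B c Suc by simp
  qed
  have "indicator (\<Union>i. A i) = (SUP n. indicator (?B n) :: _ \<Rightarrow> ennreal)"
  proof (rule ext)
    fix p
    show "indicator (\<Union>i. A i) p = (SUP n. indicator (?B n) :: _ \<Rightarrow> ennreal) p"
      unfolding SUP_apply
    proof (rule SUP_eqI[symmetric])
      show "indicator (?B n) p \<le> (indicator (\<Union>i. A i) p :: ennreal)" for n
        by (auto split: split_indicator)
      fix z :: ennreal assume z: "\<And>n. n \<in> UNIV \<Longrightarrow> indicator (?B n) p \<le> z"
      show "indicator (\<Union>i. A i) p \<le> z"
      proof (cases "p \<in> (\<Union>i. A i)")
        case True
        then obtain i where "p \<in> ?B (Suc i)" by auto
        then show ?thesis using z[of "Suc i"] True by simp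
      qed simp
    qed
  qed
  moreover have "incseq (\<lambda>n. indicator (?B n) :: _ \<Rightarrow> ennreal)"
    by (auto simp: incseq_def le_fun_def split: split_indicator dest: less_le_trans)
  ultimately show ?thesis
    using compensated_SUP[of "\<lambda>n. indicator (?B n)"] B cB by simp
qed

section \<open>Counting jumps by the cells of a partition\<close>

lemma sum_jumps_partition:
  fixes u :: "nat \<Rightarrow> real" and \<phi> :: "real \<Rightarrow> ennreal"
  assumes "w \<in> Om" "0 \<le> u 0" "mono u"
  shows "(\<Sum>\<tau>\<in>jumps w \<inter> {u 0<..u n}. \<phi> \<tau>) = (\<Sum>i<n. \<Sum>\<tau>\<in>jumps w \<inter> {u i<..u (Suc i)}. \<phi> \<tau>)"
proof (induction n)
  case (Suc n)
  have u: "u 0 \<le> u n" "u n \<le> u (Suc n)" using \<open>mono u\<close> by (auto simp: mono_def)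
  then have "jumps w \<inter> {u 0<..u (Suc n)} = (jumps w \<inter> {u 0<..u n}) \<union> (jumps w \<inter> {u n<..u (Suc n)})"
    by auto
  then show ?case
    using Suc u assms finite_jumps_Ioc[of w "u 0" "u n"] finite_jumps_Ioc[of w "u n" "u (Suc n)"]
    by (simp add: sum.union_disjoint disjoint_iff)
qed simp

text \<open>The first jump after \<open>a\<close>, if it falls into \<open>{a<..b}\<close>, is one
  of the summands; further jumps in the cell are overlooked, hence only an inequality.\<close>

lemma indicator_first_jump_in_le:
  assumes "w \<in> Om" "0 \<le> a"
  shows "indicator (first_jump_in a b A) w \<le> (\<Sum>\<tau>\<in>jumps w \<inter> {a<..b}. indicator A (X \<tau> w) :: ennreal)"
proof (cases "w \<in> first_jump_in a b A")
  case True
  then obtain \<tau> where \<tau>: "\<tau> \<le> b" "first_exit a w = ereal \<tau>" "X \<tau> w \<in> A"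
    by (auto simp: first_jump_in_def)
  then have "\<tau> \<in> jumps w \<inter> {a<..b}"
    using first_exit_jump[OF assms \<tau>(2)] first_exit_gt[OF assms] by auto
  then have "(indicator A (X \<tau> w) :: ennreal) \<le> (\<Sum>\<tau>\<in>jumps w \<inter> {a<..b}. indicator A (X \<tau> w))"
    using finite_jumps_Ioc[OF assms] by (intro member_le_sum) auto
  with True \<tau> show ?thesis by simp
qed simp

lemma indicator_first_jump_in_eq:
  assumes om: "w \<in> Om" "0 \<le> a"
    and single: "\<And>\<tau> \<sigma>. \<tau> \<in> jumps w \<inter> {a<..b} \<Longrightarrow> \<sigma> \<in> jumps w \<inter> {a<..b} \<Longrightarrow> \<tau> = \<sigma>"
  shows "indicator (first_jump_in a b A) w = (\<Sum>\<tau>\<in>jumps w \<inter> {a<..b}. indicator A (X \<tau> w) :: ennreal)"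
proof (cases "jumps w \<inter> {a<..b} = {}")
  case True
  then have "\<not> first_exit a w \<le> ereal b" using first_exit_le_iff[OF om] by simp
  then have "w \<notin> first_jump_in a b A" by (auto simp: first_jump_in_def)
  with True show ?thesis by simp
next
  case False
  then have "first_exit a w \<le> ereal b" using first_exit_le_iff[OF om] by simp
  then obtain \<tau> where \<tau>: "first_exit a w = ereal \<tau>" "\<tau> \<le> b"
    using first_exit_gt[OF om] by (cases "first_exit a w") auto
  then have "\<tau> \<in> jumps w \<inter> {a<..b}"
    using first_exit_jump[OF om \<tau>(1)] first_exit_gt[OF om] by auto
  with single have "jumps w \<inter> {a<..b} = {\<tau>}" by blast
  moreover have "w \<in> first_jump_in a b A \<longleftrightarrow> X \<tau> w \<in> A" using \<tau> om by (auto simp: first_jump_in_def)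
  ultimately show ?thesis by (simp add: indicator_def)
qed

text \<open>The witness is the minimum of 1 and the positive distances between points of
  \<open>F\<close>. A partition of smaller mesh has at most one point of \<open>F\<close> in each
  cell, so counting first jumps then overlooks nothing.\<close>

lemma finite_set_gap:
  fixes F :: "real set"
  assumes "finite F"
  obtains \<delta> where "\<delta> > 0" "\<And>\<sigma> \<tau>. \<sigma> \<in> F \<Longrightarrow> \<tau> \<in> F \<Longrightarrow> \<bar>\<sigma> - \<tau>\<bar> < \<delta> \<Longrightarrow> \<sigma> = \<tau>"
proof -
  let ?D = "insert 1 ((\<lambda>(\<sigma>, \<tau>). \<bar>\<sigma> - \<tau>\<bar>) ` (F \<times> F) - {0})"
  have fin: "finite ?D" using assms by simp
  show thesis
  proof (rule that[of "Min ?D"])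
    have "Min ?D \<in> ?D" using fin by (intro Min_in) auto
    then show "Min ?D > 0" by auto
    fix \<sigma> \<tau> assume st: "\<sigma> \<in> F" "\<tau> \<in> F" "\<bar>\<sigma> - \<tau>\<bar> < Min ?D"
    show "\<sigma> = \<tau>"
    proof (rule ccontr)
      assume "\<sigma> \<noteq> \<tau>"
      then have "\<bar>\<sigma> - \<tau>\<bar> \<in> ?D" using st by (auto intro!: image_eqI[of _ _ "(\<sigma>, \<tau>)"])
      then have "Min ?D \<le> \<bar>\<sigma> - \<tau>\<bar>" using fin by (rule Min_le[rotated])
      with st show False by simp
    qed
  qed
qed

text \<open>The core of the compensation formula, on a generating rectangle. Counting only the first
  jump of each cell approximates from below and is exact once the mesh is finer than the gaps
  between jumps. By the Markov property at the left ends its expectation is a sum of first-jump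
  probabilities, squeezed between the integrated rates and the same multiplied by
  \<open>exp (- rate_bound * h n)\<close>.\<close>

lemma compensated_interval:
  assumes rs: "t \<le> r" "r \<le> s" "s \<le> T" and F: "F \<in> sets (Hist r)" and A: "A \<in> sets K"
  shows "compensated (indicator ((F \<times> {r<..s}) \<times> A))"
proof (cases "r = s")
  case True
  then show ?thesis using compensated_empty by simp
next
  case False
  with rs have rs': "r < s" by simp
  have r0: "0 \<le> r" using rs t_nonneg by simp
  define h where "h n = (s - r) / real (Suc n)" for n
  define u where "u n i = r + h n * real i" for n i
  have h0: "0 < h n" for n using rs' by (simp add: h_def)
  have h_lim: "h \<longlonglongrightarrow> 0"
    using tendsto_mult[OF tendsto_const[of "s - r"] inverse_Suc_tendsto] by (simp add: h_def[abs_def])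
  have u_mono: "mono (u n)" for n using h0[of n] by (auto simp: mono_def u_def)
  have u_0: "u n 0 = r" and u_Suc: "u n (Suc n) = s" for n
    by (simp_all add: u_def h_def)
  have u_lt: "u n i < u n (Suc i)" for n i using h0[of n] by (simp add: u_def distrib_left)
  have u_r: "r \<le> u n i" for n i using h0[of n] by (simp add: u_def)
  have u_s: "u n (Suc i) \<le> s" if "i < Suc n" for n i
    using monoD[OF u_mono[of n], of "Suc i" "Suc n"] that u_Suc by simp
  have u_diff: "u n (Suc i) - u n i = h n" for n i by (simp add: u_def distrib_left)
  \<comment> \<open>\<open>N n\<close> and \<open>G n\<close> are accessible through the Markov
    property, the state being frozen at the left end of each cell. \<open>N'\<close> and
    \<open>G'\<close> are their limits: the number of jumps into \<open>A\<close>, and the rate in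
    terms of left limits.\<close>
  define N where "N n w = (\<Sum>i<Suc n. indicator (first_jump_in (u n i) (u n (Suc i)) A) w :: ennreal)" for n w
  define N' where "N' w = (\<Sum>\<tau>\<in>jumps w \<inter> {r<..s}. indicator A (X \<tau> w) :: ennreal)" for w
  define G where "G n w v = (\<Sum>i<Suc n. indicator {u n i<..u n (Suc i)} v * emeasure (nu v (X (u n i) w)) A)" for n w v
  define G' where "G' w v = indicator {r<..s} v * emeasure (nu v (left_limit X v w)) A" for w v
  have N'_sum: "N' w = (\<Sum>i<Suc n. \<Sum>\<tau>\<in>jumps w \<inter> {u n i<..u n (Suc i)}. indicator A (X \<tau> w))"
    if "w \<in> Om" for w n
    using sum_jumps_partition[of w "u n" _ "Suc n"] that r0 u_mono[of n] u_Suc[of n] u_0[of n]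
    by (simp add: N'_def)
  have N_le: "N n w \<le> N' w" if "w \<in> Om" for n w
    unfolding N'_sum[OF that, of n] N_def
    using that r0 u_r order_trans by (intro sum_mono indicator_first_jump_in_le) blast+
  have N_ev: "\<forall>\<^sub>F n in sequentially. N n w = N' w" if om: "w \<in> Om" for w
  proof -
    obtain \<delta> where \<delta>: "\<delta> > 0" "\<And>\<sigma> \<tau>. \<sigma> \<in> jumps w \<inter> {r<..s} \<Longrightarrow> \<tau> \<in> jumps w \<inter> {r<..s} \<Longrightarrow> \<bar>\<sigma> - \<tau>\<bar> < \<delta> \<Longrightarrow> \<sigma> = \<tau>"
      using finite_set_gap[OF finite_jumps_Ioc[OF om r0, of s]] by blast
    from order_tendstoD(2)[OF h_lim \<delta>(1)] show ?thesis
    proof eventually_elim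
      case (elim n)
      show ?case
        unfolding N'_sum[OF om, of n] N_def
      proof (intro sum.cong refl indicator_first_jump_in_eq[OF om])
        fix i assume i: "i \<in> {..<Suc n}"
        show "0 \<le> u n i" using u_r[of n i] r0 by simp
        fix \<tau> \<sigma> assume a: "\<tau> \<in> jumps w \<inter> {u n i<..u n (Suc i)}" "\<sigma> \<in> jumps w \<inter> {u n i<..u n (Suc i)}"
        then have "\<bar>\<tau> - \<sigma>\<bar> < \<delta>" using u_diff[of n i] elim by auto
        then show "\<tau> = \<sigma>" using a u_r[of n i] u_s[of i n] i by (intro \<delta>(2)) auto
      qed
    qed
  qed
  have FQ: "F \<in> sets \<Q>" using sets_history_P[OF t_nonneg x_in, of "{t..r}" F] F by simp
  have fQ: "first_jump_in (u n i) (u n (Suc i)) A \<in> sets \<Q>" for n i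
    using first_jump_in_law(1)[OF _ u_lt x_in A, of n i] u_r[of n i] r0 rs
      sets_history_P[OF t_nonneg x_in, of "{u n i..}"] by auto
  have mN: "(\<lambda>w. indicator F w * N n w) \<in> borel_measurable \<Q>" for n
    unfolding N_def using FQ fQ by measurable
  \<comment> \<open>Measurability of the sum over jumps originates here: along each trajectory it
    eventually equals the measurable \<open>N n\<close>.\<close>
  have mN': "(\<lambda>w. indicator F w * N' w) \<in> borel_measurable \<Q>"
  proof (rule eventual_preimage_measurable[OF mN])
    show "\<forall>\<^sub>F n in sequentially. indicator F w * N n w = indicator F w * N' w" if "w \<in> space \<Q>" for w
      using N_ev[of w] that by (auto elim: eventually_mono)
  qed
  \<comment> \<open>Exactly one cell contains \<open>v\<close>, so the sum over cells is sampling
    along the grid, and the convergence to the left limit becomes available.\<close>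
  have G_eq: "G n w v = indicator {r<..s} v * emeasure (nu v (X (grid (h n) r v) w)) A" for n w v
  proof (cases "v \<in> {r<..s}")
    case True
    then obtain k :: nat where k: "r + h n * real k < v" "v \<le> r + h n * real (Suc k)"
      using grid_interval[OF h0[of n], of r v] by auto
    have g: "grid (h n) r v = u n k" using grid_eq[OF h0 k] by (simp add: u_def)
    have kn: "k < Suc n"
    proof (rule ccontr)
      assume "\<not> k < Suc n"
      then have "s \<le> u n k" using monoD[OF u_mono[of n], of "Suc n" k] u_Suc[of n] by simp
      with True k(1) show False by (simp add: u_def)
    qed
    have z: "indicator {u n i<..u n (Suc i)} v = (if i = k then 1 else 0 :: ennreal)" for i
    proof -
      have "i = k" if "u n i < v" "v \<le> u n (Suc i)"
      proof -
        have "grid (h n) r v = u n i" using grid_eq[OF h0[of n] that[unfolded u_def]] by (simp add: u_def)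
        then have "u n i = u n k" using g by simp
        then have "h n = 0 \<or> k = i" by (auto simp: u_def)
        then show ?thesis using h0[of n] by auto
      qed
      moreover have "u n k < v" "v \<le> u n (Suc k)" using k by (simp_all add: u_def)
      ultimately show ?thesis by (cases "i = k") (auto simp: indicator_def)
    qed
    have "G n w v = (\<Sum>i<Suc n. if i = k then emeasure (nu v (X (u n i) w)) A else 0)"
      unfolding G_def z by (intro sum.cong) auto
    also have "\<dots> = emeasure (nu v (X (u n k) w)) A" using kn by simp
    finally show ?thesis using True g by simp
  next
    case False
    have "v \<notin> {u n i<..u n (Suc i)}" if "i < Suc n" for i
      using False u_r[of n i] u_s[OF that] by auto
    then show ?thesis using False by (simp add: G_def)
  qed
  have G_ev: "\<forall>\<^sub>F n in sequentially. G n w v = G' w v" if "w \<in> Om" for w v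
  proof (cases "v \<in> {r<..s}")
    case True
    then have "\<forall>\<^sub>F n in sequentially. X (grid (h n) r v) w = left_limit X v w"
      using that r0 by (intro grid_eventually_left_limit h0 h_lim) auto
    then show ?thesis by eventually_elim (simp add: G_eq G'_def)
  qed (simp add: G_eq G'_def)
  have mterm: "(\<lambda>(w, v). indicator {u n i<..u n (Suc i)} v * emeasure (nu v (X (u n i) w)) A) \<in> borel_measurable (\<Q> \<Otimes>\<^sub>M lborel)" for n i
  proof -
    \<comment> \<open>\<open>max 0\<close> sends the time into the domain on which the rates are
      measurable; on the cells it changes nothing.\<close>
    have "(\<lambda>p. emeasure (nu (max 0 (snd p)) (X (u n i) (fst p))) A) \<in> borel_measurable (\<Q> \<Otimes>\<^sub>M lborel)"
      using u_r[of n i] rs by (intro measurable_nu'[OF _ _ A])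
        (auto intro!: measurable_restrict_space2 measurable_compose[OF measurable_fst X_Q])
    moreover have "(\<lambda>p. indicator {u n i<..u n (Suc i)} (snd p) :: ennreal) \<in> borel_measurable (\<Q> \<Otimes>\<^sub>M lborel)"
      by measurable
    ultimately have "(\<lambda>p. indicator {u n i<..u n (Suc i)} (snd p) * emeasure (nu (max 0 (snd p)) (X (u n i) (fst p))) A)
        \<in> borel_measurable (\<Q> \<Otimes>\<^sub>M lborel)"
      by (intro borel_measurable_times_ennreal)
    moreover have "indicator {u n i<..u n (Suc i)} v * emeasure (nu (max 0 v) z) A = indicator {u n i<..u n (Suc i)} v * emeasure (nu v z) A" for v z
      using u_r[of n i] r0 by (auto split: split_indicator simp: max_def)
    ultimately show ?thesis by (simp add: case_prod_beta')
  qed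
  have mG1: "(\<lambda>(w, v). G n w v) \<in> borel_measurable (\<Q> \<Otimes>\<^sub>M lborel)" for n
    using mterm[of n] unfolding G_def case_prod_beta' by (intro borel_measurable_sum)
  have mG2: "G n w \<in> borel_measurable lborel" if "w \<in> Om" for n w
    using measurable_Pair2[OF mG1, of w] that by simp
  have G_le: "G n w v \<le> ennreal rate_bound * indicator {r<..s} v" if om: "w \<in> Om" for n w v
  proof (cases "v \<in> {r<..s}")
    case True
    then have "r \<le> grid (h n) r v" using grid_bounds[OF h0] by auto
    then have "X (grid (h n) r v) w \<in> space K" using X_space[OF _ om] r0 by auto
    then show ?thesis using True emeasure_nu_le[of v] rs r0 by (simp add: G_eq)
  qed (simp add: G_eq)
  have mG': "G' w \<in> borel_measurable lborel" if "w \<in> Om" for w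
    by (rule eventual_preimage_measurable[OF mG2[OF that]]) (rule G_ev[OF that])
  have bnd: "(\<integral>\<^sup>+v. ennreal rate_bound * indicator {r<..s} v \<partial>lborel) = ennreal (rate_bound * (s - r))"
    using rs' rate_bound_nonneg by (simp add: nn_integral_cmult_indicator ennreal_mult)
  have I_lim: "(\<lambda>n. \<integral>\<^sup>+v. G n w v \<partial>lborel) \<longlonglongrightarrow> (\<integral>\<^sup>+v. G' w v \<partial>lborel)" if "w \<in> Om" for w
  proof (rule nn_integral_dominated_convergence[where w = "\<lambda>v. ennreal rate_bound * indicator {r<..s} v"])
    show "(\<integral>\<^sup>+v. ennreal rate_bound * indicator {r<..s} v \<partial>lborel) < \<infinity>" unfolding bnd by simp
    show "AE v in lborel. (\<lambda>n. G n w v) \<longlonglongrightarrow> G' w v"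
      using G_ev[OF that] by (intro AE_I2 tendsto_eventually)
  qed (use mG2[OF that] mG'[OF that] G_le[OF that] in auto)
  define B where "B n = (\<E> w. indicator F w * (\<integral>\<^sup>+v. G n w v \<partial>lborel))" for n
  define B' where "B' = (\<E> w. indicator F w * (\<integral>\<^sup>+v. G' w v \<partial>lborel))"
  have mI: "(\<lambda>w. \<integral>\<^sup>+v. G n w v \<partial>lborel) \<in> borel_measurable \<Q>" for n
    by (rule lborel.borel_measurable_nn_integral[OF mG1])
  have mI': "(\<lambda>w. \<integral>\<^sup>+v. G' w v \<partial>lborel) \<in> borel_measurable \<Q>"
  proof -
    have "(\<lambda>w. liminf (\<lambda>n. \<integral>\<^sup>+v. G n w v \<partial>lborel)) \<in> borel_measurable \<Q>"
      using mI by measurable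
    moreover have "liminf (\<lambda>n. \<integral>\<^sup>+v. G n w v \<partial>lborel) = (\<integral>\<^sup>+v. G' w v \<partial>lborel)" if "w \<in> Om" for w
      using lim_imp_Liminf[OF _ I_lim[OF that]] by simp
    ultimately show ?thesis using measurable_cong[of \<Q> "\<lambda>w. liminf (\<lambda>n. \<integral>\<^sup>+v. G n w v \<partial>lborel)" "\<lambda>w. \<integral>\<^sup>+v. G' w v \<partial>lborel" borel]
      by simp
  qed
  have B_lim: "B \<longlonglongrightarrow> B'"
    unfolding B_def[abs_def] B'_def
  proof (rule nn_integral_dominated_convergence[where w = "\<lambda>_. ennreal (rate_bound * (s - r))"])
    show "AE w in \<Q>. indicator F w * (\<integral>\<^sup>+v. G n w v \<partial>lborel) \<le> ennreal (rate_bound * (s - r))" for n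
    proof (rule AE_I2)
      fix w assume "w \<in> space \<Q>"
      then have "(\<integral>\<^sup>+v. G n w v \<partial>lborel) \<le> ennreal (rate_bound * (s - r))"
        unfolding bnd[symmetric] using G_le by (intro nn_integral_mono) auto
      then show "indicator F w * (\<integral>\<^sup>+v. G n w v \<partial>lborel) \<le> ennreal (rate_bound * (s - r))"
        by (simp split: split_indicator)
    qed
    show "AE w in \<Q>. (\<lambda>n. indicator F w * (\<integral>\<^sup>+v. G n w v \<partial>lborel)) \<longlonglongrightarrow> indicator F w * (\<integral>\<^sup>+v. G' w v \<partial>lborel)"
      using I_lim by (intro AE_I2) (auto split: split_indicator)
    show "(\<E> w. ennreal (rate_bound * (s - r))) < \<infinity>"
      using Q.emeasure_space_1 by (simp add: ennreal_mult_less_top)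
  qed (use FQ mI mI' in measurable)
  have fbounds: "(\<E> w. indicator F w * N n w) \<le> B n"
    "ennreal (exp (- rate_bound * h n)) * B n \<le> (\<E> w. indicator F w * N n w)" for n
  proof -
    let ?J = "\<lambda>i w. \<integral>\<^sup>+v\<in>{u n i<..u n (Suc i)}. emeasure (nu v (X (u n i) w)) A \<partial>lborel"
    have mJ: "?J i \<in> borel_measurable \<Q>" for i
      using lborel.borel_measurable_nn_integral[OF mterm[of n i]] by (simp add: mult.commute)
    have GJ: "(\<integral>\<^sup>+v. G n w v \<partial>lborel) = (\<Sum>i<Suc n. ?J i w)" if "w \<in> Om" for w
      unfolding G_def using measurable_Pair2[OF mterm, of w] that
      by (subst nn_integral_sum) (auto simp: mult.commute)
    have B_sum: "B n = (\<Sum>i<Suc n. \<integral>\<^sup>+w. indicator F w * ?J i w \<partial>\<Q>)"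
    proof -
      have "B n = (\<E> w. (\<Sum>i<Suc n. indicator F w * ?J i w))"
        unfolding B_def using GJ by (intro nn_integral_cong) (simp only: sum_distrib_left space_Q)
      also have "\<dots> = (\<Sum>i<Suc n. \<integral>\<^sup>+w. indicator F w * ?J i w \<partial>\<Q>)"
        using mJ FQ by (intro nn_integral_sum) auto
      finally show ?thesis .
    qed
    \<comment> \<open>Each event splits at the left end of its cell: \<open>F\<close> belongs to the
      history up to there, the first jump to the future.\<close>
    have N_sum: "(\<E> w. indicator F w * N n w) =
        (\<Sum>i<Suc n. \<integral>\<^sup>+w. indicator F w * emeasure (P (u n i) (X (u n i) w)) (first_jump_in (u n i) (u n (Suc i)) A) \<partial>\<Q>)"
    proof -
      have "(\<E> w. indicator F w * N n w) =
          (\<Sum>i<Suc n. \<integral>\<^sup>+w. indicator F w * indicator (first_jump_in (u n i) (u n (Suc i)) A) w \<partial>\<Q>)"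
        unfolding N_def sum_distrib_left using FQ fQ by (intro nn_integral_sum) auto
      also have "\<dots> = (\<Sum>i<Suc n. emeasure \<Q> (F \<inter> first_jump_in (u n i) (u n (Suc i)) A))"
        using FQ fQ by (simp flip: indicator_inter_arith)
      also have "\<dots> = (\<Sum>i<Suc n. \<integral>\<^sup>+w. indicator F w * emeasure (P (u n i) (X (u n i) w)) (first_jump_in (u n i) (u n (Suc i)) A) \<partial>\<Q>)"
      proof (intro sum.cong refl markov_extended[OF t_nonneg _ x_in])
        fix i
        show "t \<le> u n i" using u_r[of n i] rs by simp
        show "F \<in> sets (history Om K X {t..u n i})"
          using sets_history_mono[of "{t..r}" "{t..u n i}"] u_r[of n i] F by auto
        show "first_jump_in (u n i) (u n (Suc i)) A \<in> sets (history Om K X {u n i..})"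
          using first_jump_in_law(1)[OF _ u_lt x_in A, of n i] u_r[of n i] r0 by simp
      qed
      finally show ?thesis .
    qed
    have up: "emeasure (P (u n i) (X (u n i) w)) (first_jump_in (u n i) (u n (Suc i)) A) \<le> ?J i w"
      and lo: "ennreal (exp (- rate_bound * h n)) * ?J i w \<le> emeasure (P (u n i) (X (u n i) w)) (first_jump_in (u n i) (u n (Suc i)) A)"
      if "i < Suc n" "w \<in> Om" for i w
      using first_jump_in_bounds[OF _ u_lt[of n i] _ _ A, of "X (u n i) w"] u_r[of n i] u_s[OF that(1)] rs r0
        X_space[of "u n i" w] that u_diff[of n i] by auto
    show "(\<E> w. indicator F w * N n w) \<le> B n"
      unfolding N_sum B_sum using up by (intro sum_mono nn_integral_mono mult_left_mono) auto
    have "ennreal (exp (- rate_bound * h n)) * B n =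
        (\<Sum>i<Suc n. \<integral>\<^sup>+w. indicator F w * (ennreal (exp (- rate_bound * h n)) * ?J i w) \<partial>\<Q>)"
      unfolding B_sum sum_distrib_left using mJ FQ
      by (intro sum.cong refl) (subst nn_integral_cmult[symmetric], auto simp: mult_ac)
    also have "\<dots> \<le> (\<E> w. indicator F w * N n w)"
      unfolding N_sum using lo by (intro sum_mono nn_integral_mono mult_left_mono) auto
    finally show "ennreal (exp (- rate_bound * h n)) * B n \<le> (\<E> w. indicator F w * N n w)" .
  qed
  \<comment> \<open>An integrable bound for the number of jumps is not known at this point, so
    Fatou's lemma gives one inequality, and \<open>N n \<le> N'\<close> with the exponential factor
    tending to 1 gives the other.\<close>
  have "(\<E> w. indicator F w * N' w) = (\<E> w. liminf (\<lambda>n. indicator F w * N n w))"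
  proof (rule nn_integral_cong)
    fix w assume "w \<in> space \<Q>"
    then have "\<forall>\<^sub>F n in sequentially. indicator F w * N n w = indicator F w * N' w"
      using N_ev[of w] by (auto elim: eventually_mono)
    then show "indicator F w * N' w = liminf (\<lambda>n. indicator F w * N n w)"
      using lim_imp_Liminf[OF _ tendsto_eventually] by force
  qed
  also have "\<dots> \<le> liminf (\<lambda>n. \<integral>\<^sup>+w. indicator F w * N n w \<partial>\<Q>)"
    by (rule nn_integral_liminf[OF mN])
  also have "\<dots> \<le> liminf B" using fbounds(1) by (intro Liminf_mono always_eventually) auto
  also have "\<dots> = B'" using lim_imp_Liminf[OF _ B_lim] by simp
  finally have le: "(\<E> w. indicator F w * N' w) \<le> B'" .
  have "(\<lambda>n. ennreal (exp (- rate_bound * h n)) * B n) \<longlonglongrightarrow> ennreal (exp (- rate_bound * 0)) * B'"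
    by (intro tendsto_mult_ennreal B_lim tendsto_ennrealI tendsto_exp tendsto_mult tendsto_const h_lim) auto
  then have "ennreal (exp (- rate_bound * 0)) * B' \<le> (\<E> w. indicator F w * N' w)"
  proof (rule LIMSEQ_le_const2, intro exI allI impI)
    fix n
    have "(\<E> w. indicator F w * N n w) \<le> (\<E> w. indicator F w * N' w)"
      using N_le by (intro nn_integral_mono mult_left_mono) auto
    with fbounds(2)[of n] show "ennreal (exp (- rate_bound * h n)) * B n \<le> (\<E> w. indicator F w * N' w)"
      by (rule order_trans)
  qed
  with le have eq: "(\<E> w. indicator F w * N' w) = B'" by simp
  have J: "jump_integral (indicator ((F \<times> {r<..s}) \<times> A)) w = indicator F w * N' w" if om: "w \<in> Om" for w
  proof -
    have "jump_integral (indicator ((F \<times> {r<..s}) \<times> A)) w =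
        (\<Sum>\<tau>\<in>jumps w \<inter> {r<..s}. indicator ((F \<times> {r<..s}) \<times> A) ((w, \<tau>), X \<tau> w))"
      unfolding jump_integral_sum[OF om] using finite_jumps_tT[OF om] rs
      by (intro sum.mono_neutral_right) (auto split: split_indicator)
    also have "\<dots> = indicator F w * N' w"
      unfolding N'_def sum_distrib_left by (intro sum.cong) (auto split: split_indicator)
    finally show ?thesis .
  qed
  have R: "rate_integral (indicator ((F \<times> {r<..s}) \<times> A)) w = indicator F w * (\<integral>\<^sup>+v. G' w v \<partial>lborel)" if om: "w \<in> Om" for w
  proof -
    have inner: "(\<integral>\<^sup>+y. indicator ((F \<times> {r<..s}) \<times> A) ((w, v), y) \<partial>nu v (pre v w)) = indicator F w * G' w v"
      if v: "v \<in> {t..T}" for v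
    proof -
      have "(\<integral>\<^sup>+y. indicator ((F \<times> {r<..s}) \<times> A) ((w, v), y) \<partial>nu v (pre v w)) =
          (\<integral>\<^sup>+y. (indicator F w * indicator {r<..s} v) * indicator A y \<partial>nu v (pre v w))"
        by (intro nn_integral_cong) (auto split: split_indicator)
      also have "\<dots> = (indicator F w * indicator {r<..s} v) * emeasure (nu v (pre v w)) A"
        using A sets_nu[of v "pre v w"] pre_space[OF om] v t_nonneg by (intro nn_integral_cmult_indicator) auto
      also have "\<dots> = indicator F w * G' w v"
        using rs by (auto simp: G'_def pre_def split: split_indicator)
      finally show ?thesis .
    qed
    have "rate_integral (indicator ((F \<times> {r<..s}) \<times> A)) w = (\<integral>\<^sup>+v. indicator F w * G' w v \<partial>Leb)"
      unfolding rate_integral_def using inner by (intro nn_integral_cong) simp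
    also have "\<dots> = (\<integral>\<^sup>+v. indicator F w * G' w v * indicator {t..T} v \<partial>lborel)"
      by (intro nn_integral_restrict_space) simp
    also have "\<dots> = (\<integral>\<^sup>+v. indicator F w * G' w v \<partial>lborel)"
      using rs by (intro nn_integral_cong) (auto simp: G'_def split: split_indicator)
    also have "\<dots> = indicator F w * (\<integral>\<^sup>+v. G' w v \<partial>lborel)"
      by (intro nn_integral_cmult mG'[OF om])
    finally show ?thesis .
  qed
  show ?thesis
    using eq mN' measurable_cong[of \<Q> "jump_integral (indicator ((F \<times> {r<..s}) \<times> A))" "\<lambda>w. indicator F w * N' w" borel]
      nn_integral_cong[of \<Q> "jump_integral (indicator ((F \<times> {r<..s}) \<times> A))" "\<lambda>w. indicator F w * N' w"]
      nn_integral_cong[of \<Q> "rate_integral (indicator ((F \<times> {r<..s}) \<times> A))" "\<lambda>w. indicator F w * (\<integral>\<^sup>+v. G' w v \<partial>lborel)"]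
    unfolding compensated_def B'_def by (simp add: J R)
qed

section \<open>Extension to all predictable integrands\<close>

lemma Int_stable_Prd: "Int_stable ({A \<times> {t} | A. A \<in> sets (history Om K X {t})} \<union>
      {A \<times> {r<..s} | A r s. t \<le> r \<and> r \<le> s \<and> s \<le> T \<and> A \<in> sets (Hist r)})" (is "Int_stable (?G1 \<union> ?G2)")
proof (rule Int_stableI)
  have empty: "{} \<in> ?G2"
    using t_le_T by (intro CollectI exI[of _ "{}"] exI[of _ t]) auto
  fix C D assume "C \<in> ?G1 \<union> ?G2" "D \<in> ?G1 \<union> ?G2"
  then consider A B where "C = A \<times> {t}" "A \<in> sets (history Om K X {t})" "D = B \<times> {t}" "B \<in> sets (history Om K X {t})"
    | "C \<in> ?G1" "D \<in> ?G2" | "C \<in> ?G2" "D \<in> ?G1"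
    | A r s B r' s' where "C = A \<times> {r<..s}" "t \<le> r" "s \<le> T" "A \<in> sets (Hist r)"
      "D = B \<times> {r'<..s'}" "t \<le> r'" "s' \<le> T" "B \<in> sets (Hist r')"
    by blast
  then show "C \<inter> D \<in> ?G1 \<union> ?G2"
  proof cases
    case 1
    then have "C \<inter> D = (A \<inter> B) \<times> {t}" by auto
    with 1 show ?thesis by blast
  next
    case 2
    then have "C \<inter> D = {}" by auto
    with empty show ?thesis by simp
  next
    case 3
    then have "C \<inter> D = {}" by auto
    with empty show ?thesis by simp
  next
    case 4
    have CD: "C \<inter> D = (A \<inter> B) \<times> {max r r'<..min s s'}" unfolding 4 by auto
    show ?thesis
    proof (cases "max r r' \<le> min s s'")
      case True
      have "A \<in> sets (Hist (max r r'))" "B \<in> sets (Hist (max r r'))"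
        using 4 sets_history_mono[of "{t..r}" "{t..max r r'}"] sets_history_mono[of "{t..r'}" "{t..max r r'}"] by auto
      then have "A \<inter> B \<in> sets (Hist (max r r'))" by auto
      with True 4 show ?thesis
        unfolding CD by (intro UnI2 CollectI exI[of _ "A \<inter> B"] exI[of _ "max r r'"] exI[of _ "min s s'"]) auto
    next
      case False
      then have "C \<inter> D = {}" unfolding CD by auto
      with empty show ?thesis by simp
    qed
  qed
qed

text \<open>Complements are taken in \<open>Om \<times> {t..T}\<close>, which differs from the
  generating rectangle over \<open>{t<..T}\<close> by the slice at \<open>t\<close>;
  \<open>compensated\<close> does not see this slice.\<close>

lemma compensated_Om:
  assumes "A \<in> sets K"
  shows "compensated (indicator ((Om \<times> {t..T}) \<times> A))"
proof (rule compensated_cong)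
  have "Om \<in> sets (Hist t)" using sets.top[of "Hist t"] by simp
  then show "compensated (indicator ((Om \<times> {t<..T}) \<times> A))"
    using t_le_T assms by (intro compensated_interval) auto
qed (auto split: split_indicator)

lemma compensated_rectangle:
  assumes C: "C \<in> sets Prd" and A: "A \<in> sets K"
  shows "compensated (indicator (C \<times> A))"
  using C[unfolded sets_Prd]
proof (induction rule: sigma_sets_induct_disjoint[OF Int_stable_Prd Prd_generator_subset, consumes 1, case_names basic empty compl union])
  case (basic C)
  then show ?case
  proof
    assume "C \<in> {A \<times> {t} | A. A \<in> sets (history Om K X {t})}"
    then show ?thesis
      by (intro compensated_cong[OF _ compensated_zero]) (auto split: split_indicator)
  next
    assume "C \<in> {A \<times> {r<..s} | A r s. t \<le> r \<and> r \<le> s \<and> s \<le> T \<and> A \<in> sets (Hist r)}"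
    then show ?thesis using compensated_interval A by auto
  qed
next
  case empty
  show ?case using compensated_zero by simp
next
  case (compl C)
  have C: "C \<in> sets Prd" using compl by (simp add: sets_Prd)
  have "C \<times> A \<subseteq> (Om \<times> {t..T}) \<times> A" using sets.sets_into_space[OF C] by auto
  then have "compensated (indicator ((Om \<times> {t..T}) \<times> A - C \<times> A))"
    using C A sets.top[of Prd] compl compensated_Om[OF A] by (intro compensated_diff) auto
  moreover have "(Om \<times> {t..T}) \<times> A - C \<times> A = (Om \<times> {t..T} - C) \<times> A" by auto
  ultimately show ?case by simp
next
  case (union C)
  have "(\<Union>i. C i) \<times> A = (\<Union>i. C i \<times> A)" by auto
  moreover have "C i \<in> sets Prd" for i using union by (auto simp: sets_Prd)
  moreover have "disjoint_family (\<lambda>i. C i \<times> A)"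
    using union(1) by (simp add: disjoint_family_on_def) blast
  ultimately show ?case
    using union(3) A compensated_UN[of "\<lambda>i. C i \<times> A"] by simp
qed

lemma compensated_set:
  assumes E: "E \<in> sets PK"
  shows "compensated (indicator E)"
proof -
  let ?G = "{a \<times> b | a b. a \<in> sets Prd \<and> b \<in> sets K}"
  have sub: "?G \<subseteq> Pow (space Prd \<times> space K)" by (rule pair_measure_closed)
  show ?thesis
    using E[unfolded sets_pair_measure]
  proof (induction rule: sigma_sets_induct_disjoint[OF Int_stable_pair_measure_generator sub, consumes 1, case_names basic empty compl union])
    case (basic E)
    then show ?case using compensated_rectangle by auto
  next
    case empty
    show ?case using compensated_zero by simp
  next
    case (compl E)
    have "E \<in> sets PK" using compl by (simp add: sets_pair_measure)
    moreover from sets.sets_into_space[OF this] have "E \<subseteq> space Prd \<times> space K"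
      by (simp add: space_pair_measure)
    moreover have "compensated (indicator (space Prd \<times> space K))"
      using compensated_rectangle[OF sets.top sets.top] .
    ultimately show ?case using compl pair_measureI[OF sets.top sets.top] by (intro compensated_diff)
  next
    case (union E)
    have "E i \<in> sets PK" for i using union by (auto simp: sets_pair_measure)
    then show ?case using union by (intro compensated_UN) auto
  qed
qed

text \<open>Both sides may be infinite. Signed integrands are treated later through their positive
  and negative parts, each of which is an instance.\<close>

theorem compensated:
  assumes "H \<in> borel_measurable PK"
  shows "compensated H"
  using assms
proof (induction rule: borel_measurable_induct)
  case (cong f g)
  have "f ((w, s), y) = g ((w, s), y)" if "w \<in> Om" "s \<in> {t<..T}" "y \<in> space K" for w s y
    using cong(3)[of "((w, s), y)"] that by (simp add: space_pair_measure)
  then show ?case by (rule compensated_cong[OF _ cong(4)])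
next
  case (seq U)
  then show ?case by (intro compensated_SUP)
qed (auto intro: compensated_set compensated_cmult compensated_add compensated_SUP)

end

section \<open>Measurability of the generator\<close>

text \<open>Measurability of a nonlinear functional \<open>\<theta> \<mapsto> f \<theta> (Z \<theta>)\<close> is only assumed for constant \<open>Z\<close>. Since
  linear combinations are not preserved, the functional monotone class theorem is not applicable
  directly; but the smallest class below is itself a vector space.\<close>

inductive_set step_class :: "'a measure \<Rightarrow> 'b measure \<Rightarrow> ('a \<Rightarrow> 'b \<Rightarrow> real) set"
  for M :: "'a measure" and N :: "'b measure" where
  const: "z \<in> borel_measurable N \<Longrightarrow> bounded (z ` space N) \<Longrightarrow> (\<lambda>_. z) \<in> step_class M N"
| ite: "Z \<in> step_class M N \<Longrightarrow> Z' \<in> step_class M N \<Longrightarrow> B \<in> sets M \<Longrightarrow>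
    (\<lambda>\<theta>. if \<theta> \<in> B then Z \<theta> else Z' \<theta>) \<in> step_class M N"
| lim: "(\<And>n. W n \<in> step_class M N) \<Longrightarrow>
    (\<And>n \<theta> y. \<theta> \<in> space M \<Longrightarrow> y \<in> space N \<Longrightarrow> \<bar>W n \<theta> y\<bar> \<le> c) \<Longrightarrow>
    (\<And>\<theta> y. \<theta> \<in> space M \<Longrightarrow> y \<in> space N \<Longrightarrow> (\<lambda>n. W n \<theta> y) \<longlonglongrightarrow> Z \<theta> y) \<Longrightarrow>
    Z \<in> step_class M N"

lemma step_class_bounded:
  "Z \<in> step_class M N \<Longrightarrow> \<exists>c. \<forall>\<theta>\<in>space M. \<forall>y\<in>space N. \<bar>Z \<theta> y\<bar> \<le> c"
proof (induction rule: step_class.induct)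
  case (const z)
  then show ?case by (auto simp: bounded_iff)
next
  case (ite Z Z' B)
  then obtain c d where "\<forall>\<theta>\<in>space M. \<forall>y\<in>space N. \<bar>Z \<theta> y\<bar> \<le> c" "\<forall>\<theta>\<in>space M. \<forall>y\<in>space N. \<bar>Z' \<theta> y\<bar> \<le> d"
    by blast
  then show ?case by (intro exI[of _ "max c d"]) (auto simp: le_max_iff_disj)
next
  case (lim W c Z)
  then have "\<bar>Z \<theta> y\<bar> \<le> c" if "\<theta> \<in> space M" "y \<in> space N" for \<theta> y
    using that by (intro LIMSEQ_le_const2[OF tendsto_rabs[OF lim(3)]]) auto
  then show ?case by blast
qed

lemma step_class_measurable:
  "Z \<in> step_class M N \<Longrightarrow> (\<lambda>(\<theta>, y). Z \<theta> y) \<in> borel_measurable (M \<Otimes>\<^sub>M N)"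
proof (induction rule: step_class.induct)
  case (const z)
  then show ?case by measurable
next
  case (ite Z Z' B)
  note [measurable] = ite
  have "(\<lambda>p. if fst p \<in> B then (\<lambda>(\<theta>, y). Z \<theta> y) p else (\<lambda>(\<theta>, y). Z' \<theta> y) p) \<in> borel_measurable (M \<Otimes>\<^sub>M N)"
    by measurable
  then show ?case by (simp add: case_prod_beta' if_distribR)
next
  case (lim W c Z)
  show ?case
    by (rule borel_measurable_LIMSEQ_real[of _ "\<lambda>n (\<theta>, y). W n \<theta> y"])
      (use lim in \<open>auto simp: space_pair_measure\<close>)
qed

text \<open>Closure under sums takes one induction for each summand. In this one the second summand
  does not depend on \<open>\<theta>\<close>; it is the base case of the other.\<close>

lemma step_class_add_const:
  assumes z: "z \<in> borel_measurable N" "bounded (z ` space N)"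
  shows "Z \<in> step_class M N \<Longrightarrow> (\<lambda>\<theta> y. Z \<theta> y + z y) \<in> step_class M N"
proof (induction rule: step_class.induct)
  case (const z')
  then show ?case using z by (intro step_class.const) (auto intro: bounded_plus_comp)
next
  case (ite Z Z' B)
  have "(\<lambda>\<theta>. if \<theta> \<in> B then (\<lambda>y. Z \<theta> y + z y) else (\<lambda>y. Z' \<theta> y + z y)) =
      (\<lambda>\<theta> y. (if \<theta> \<in> B then Z \<theta> else Z' \<theta>) y + z y)" by (auto simp: fun_eq_iff)
  with step_class.ite[OF ite(4,5,3)] show ?case by simp
next
  case (lim W c Z)
  obtain d where d: "\<forall>y\<in>space N. \<bar>z y\<bar> \<le> d" using z by (auto simp: bounded_iff)
  show ?case
  proof (rule step_class.lim[of "\<lambda>n \<theta> y. W n \<theta> y + z y" _ _ "c + d"])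
    show "\<bar>W n \<theta> y + z y\<bar> \<le> c + d" if "\<theta> \<in> space M" "y \<in> space N" for n \<theta> y
      using lim(2)[OF that, of n] d that by force
  qed (use lim in \<open>auto intro!: tendsto_intros\<close>)
qed

lemma step_class_add:
  assumes Z: "Z \<in> step_class M N"
  shows "Z' \<in> step_class M N \<Longrightarrow> (\<lambda>\<theta> y. Z \<theta> y + Z' \<theta> y) \<in> step_class M N"
proof (induction rule: step_class.induct)
  case (const z)
  then show ?case by (intro step_class_add_const Z)
next
  case (ite W W' B)
  have "(\<lambda>\<theta>. if \<theta> \<in> B then (\<lambda>y. Z \<theta> y + W \<theta> y) else (\<lambda>y. Z \<theta> y + W' \<theta> y)) =
      (\<lambda>\<theta> y. Z \<theta> y + (if \<theta> \<in> B then W \<theta> else W' \<theta>) y)" by (auto simp: fun_eq_iff)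
  with step_class.ite[OF ite(4,5,3)] show ?case by simp
next
  case (lim W c Z')
  obtain d where d: "\<forall>\<theta>\<in>space M. \<forall>y\<in>space N. \<bar>Z \<theta> y\<bar> \<le> d" using step_class_bounded[OF Z] by blast
  show ?case
  proof (rule step_class.lim[of "\<lambda>n \<theta> y. Z \<theta> y + W n \<theta> y" _ _ "d + c"])
    show "\<bar>Z \<theta> y + W n \<theta> y\<bar> \<le> d + c" if "\<theta> \<in> space M" "y \<in> space N" for n \<theta> y
      using lim(2)[OF that, of n] d that by force
  qed (use lim in \<open>auto intro!: tendsto_intros\<close>)
qed

lemma step_class_cmult:
  "Z \<in> step_class M N \<Longrightarrow> (\<lambda>\<theta> y. a * Z \<theta> y) \<in> step_class M N"
proof (induction rule: step_class.induct)
  case (const z)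
  then obtain c where "\<forall>y\<in>space N. \<bar>z y\<bar> \<le> c" by (auto simp: bounded_iff)
  then have "bounded ((\<lambda>y. a * z y) ` space N)"
    by (auto simp: bounded_iff abs_mult intro!: exI[of _ "\<bar>a\<bar> * c"] mult_left_mono)
  with const show ?case by (intro step_class.const) auto
next
  case (ite W W' B)
  have "(\<lambda>\<theta>. if \<theta> \<in> B then (\<lambda>y. a * W \<theta> y) else (\<lambda>y. a * W' \<theta> y)) =
      (\<lambda>\<theta> y. a * (if \<theta> \<in> B then W \<theta> else W' \<theta>) y)" by (auto simp: fun_eq_iff)
  with step_class.ite[OF ite(4,5,3)] show ?case by simp
next
  case (lim W c Z)
  show ?case
  proof (rule step_class.lim[of "\<lambda>n \<theta> y. a * W n \<theta> y" _ _ "\<bar>a\<bar> * c"])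
    show "\<bar>a * W n \<theta> y\<bar> \<le> \<bar>a\<bar> * c" if "\<theta> \<in> space M" "y \<in> space N" for n \<theta> y
      using lim(2)[OF that, of n] by (simp add: abs_mult mult_left_mono)
  qed (use lim in \<open>auto intro!: tendsto_intros\<close>)
qed

text \<open>With closure under linear combinations available, Dynkin's argument applies: rectangles
  come from a case distinction, countable unions from the limit rule.\<close>

lemma step_class_indicator:
  assumes E: "E \<in> sets (M \<Otimes>\<^sub>M N)"
  shows "(\<lambda>\<theta> y. indicator E (\<theta>, y)) \<in> step_class M N"
proof -
  have c: "(\<lambda>_ _. a) \<in> step_class M N" for a
    by (rule step_class.const) (auto simp: bounded_iff)
  have sub: "{a \<times> b | a b. a \<in> sets M \<and> b \<in> sets N} \<subseteq> Pow (space M \<times> space N)" by (rule pair_measure_closed)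
  show ?thesis
    using E[unfolded sets_pair_measure]
  proof (induction rule: sigma_sets_induct_disjoint[OF Int_stable_pair_measure_generator sub, consumes 1, case_names basic empty compl union])
    case (basic E)
    then obtain A B where E: "E = A \<times> B" "A \<in> sets M" "B \<in> sets N" by blast
    have "(\<lambda>_. indicator B) \<in> step_class M N"
      using E by (intro step_class.const) (auto simp: bounded_iff indicator_def)
    from step_class.ite[OF this c[of 0] E(2)]
    show ?case by (rule back_subst[where P = "\<lambda>Z. Z \<in> step_class M N"]) (auto simp: E fun_eq_iff indicator_def)
  next
    case empty
    show ?case using c[of 0] by simp
  next
    case (compl E)
    \<comment> \<open>\<open>1 - indicator E\<close> agrees with the indicator of the complement
      only on the product of the two spaces. The limit rule with a constant sequence allows a member
      of the class to be changed off these spaces.\<close>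
    from step_class_add[OF c[of 1] step_class_cmult[OF compl(2), of "-1"]]
    show ?case
    proof (rule step_class.lim[where W = "\<lambda>_ \<theta> y. 1 + -1 * indicator E (\<theta>, y)" and c = 1])
      show "(\<lambda>n. 1 + - 1 * indicator E (\<theta>, y)) \<longlonglongrightarrow> (indicator (space M \<times> space N - E) (\<theta>, y) :: real)"
        if "\<theta> \<in> space M" "y \<in> space N" for \<theta> y
        using that by (cases "(\<theta>, y) \<in> E") (simp_all add: indicator_def)
    qed (auto simp: indicator_def)
  next
    case (union E)
    have U: "(\<lambda>\<theta> y. \<Sum>i<n. indicator (E i) (\<theta>, y)) \<in> step_class M N" for n
    proof (induction n)
      case (Suc n)
      from step_class_add[OF Suc union(3)[of n]] show ?case by simp
    qed (use c[of 0] in simp)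
    have ind: "(\<Sum>i<n. indicator (E i) p) = (indicator (\<Union>i<n. E i) p :: real)" for n p
      using union(1) by (subst indicator_UN_disjoint) (auto intro: disjoint_family_on_mono)
    show ?case
    proof (rule step_class.lim[OF U])
      show "\<bar>\<Sum>i<n. indicator (E i) (\<theta>, y)\<bar> \<le> (1 :: real)" for n \<theta> y
        unfolding ind by (simp add: indicator_def)
      show "(\<lambda>n. \<Sum>i<n. indicator (E i) (\<theta>, y)) \<longlonglongrightarrow> (indicator (\<Union>i. E i) (\<theta>, y) :: real)" for \<theta> y
        unfolding ind by (rule LIMSEQ_indicator_UN)
    qed
  qed
qed

text \<open>With the lemmas on bounds and measurability this identifies the class with the bounded
  jointly measurable functions. Induction over the class thereby serves as a monotone class theorem
  for functionals that are not linear.\<close>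

lemma step_class_iff:
  assumes Z: "(\<lambda>(\<theta>, y). Z \<theta> y) \<in> borel_measurable (M \<Otimes>\<^sub>M N)"
    and c: "\<And>\<theta> y. \<theta> \<in> space M \<Longrightarrow> y \<in> space N \<Longrightarrow> \<bar>Z \<theta> y\<bar> \<le> c"
  shows "Z \<in> step_class M N"
proof -
  have k: "(\<lambda>_ _. a) \<in> step_class M N" for a
    by (rule step_class.const) (auto simp: bounded_iff)
  \<comment> \<open>Boundedness is a premise inside the induction: summands of a bounded function
    are bounded since all are nonnegative, and approximants since they stay below their
    limit.\<close>
  have nonneg: "(\<exists>c. \<forall>p\<in>space (M \<Otimes>\<^sub>M N). u p \<le> c) \<longrightarrow> (\<lambda>\<theta> y. u (\<theta>, y)) \<in> step_class M N"
    if "u \<in> borel_measurable (M \<Otimes>\<^sub>M N)" "\<And>p. 0 \<le> u p" for u :: "'a \<times> 'b \<Rightarrow> real"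
    using that
  proof (induction u rule: borel_measurable_induct_real)
    case (set A)
    then show ?case using step_class_indicator by blast
  next
    case (mult u a)
    show ?case
    proof (cases "a = 0")
      case False
      show ?thesis
      proof
        assume "\<exists>c. \<forall>p\<in>space (M \<Otimes>\<^sub>M N). a * u p \<le> c"
        then obtain c where "\<forall>p\<in>space (M \<Otimes>\<^sub>M N). a * u p \<le> c" by blast
        then have "\<forall>p\<in>space (M \<Otimes>\<^sub>M N). u p \<le> c / a"
          using False mult(1) by (auto simp: field_simps)
        with mult show "(\<lambda>\<theta> y. a * u (\<theta>, y)) \<in> step_class M N" by (intro step_class_cmult) blast
      qed
    qed (use k[of 0] in simp)
  next
    case (add u v)
    show ?case
    proof
      assume "\<exists>c. \<forall>p\<in>space (M \<Otimes>\<^sub>M N). v p + u p \<le> c"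
      then obtain c where c: "\<forall>p\<in>space (M \<Otimes>\<^sub>M N). v p + u p \<le> c" by blast
      have "\<forall>p\<in>space (M \<Otimes>\<^sub>M N). v p \<le> c" "\<forall>p\<in>space (M \<Otimes>\<^sub>M N). u p \<le> c"
      proof safe
        fix a b assume "(a, b) \<in> space (M \<Otimes>\<^sub>M N)"
        with c have "v (a, b) + u (a, b) \<le> c" by blast
        then show "v (a, b) \<le> c" "u (a, b) \<le> c" using add.hyps(2)[of "(a, b)"] add.hyps(4)[of "(a, b)"] by linarith+
      qed
      with add show "(\<lambda>\<theta> y. v (\<theta>, y) + u (\<theta>, y)) \<in> step_class M N" by (intro step_class_add) blast+
    qed
  next
    case (seq U)
    show ?case
    proof
      assume "\<exists>c. \<forall>p\<in>space (M \<Otimes>\<^sub>M N). u p \<le> c"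
      then obtain c where c: "\<forall>p\<in>space (M \<Otimes>\<^sub>M N). u p \<le> c" by blast
      have le: "U i p \<le> u p" if "p \<in> space (M \<Otimes>\<^sub>M N)" for i p
      proof (rule incseq_le[of "\<lambda>i. U i p"])
        show "incseq (\<lambda>i. U i p)" using le_funD[OF incseqD[OF \<open>incseq U\<close>]] by (auto simp: incseq_def)
      qed (use seq that in auto)
      show "(\<lambda>\<theta> y. u (\<theta>, y)) \<in> step_class M N"
      proof (rule step_class.lim[of "\<lambda>n \<theta> y. U n (\<theta>, y)" _ _ c])
        show "(\<lambda>\<theta> y. U n (\<theta>, y)) \<in> step_class M N" for n
          using seq le c by (meson order_trans)
        show "\<bar>U n (\<theta>, y)\<bar> \<le> c" if "\<theta> \<in> space M" "y \<in> space N" for n \<theta> y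
          using seq le[of "(\<theta>, y)" n] c that by (force simp: space_pair_measure)
      qed (use seq in \<open>auto simp: space_pair_measure\<close>)
    qed
  qed
  \<comment> \<open>Adding \<open>\<bar>c\<bar>\<close> makes the function nonnegative on the
    spaces; \<open>max 0\<close> takes care of the points outside.\<close>
  have "(\<lambda>\<theta> y. (\<lambda>(\<theta>, y). max 0 (Z \<theta> y + \<bar>c\<bar>)) (\<theta>, y)) \<in> step_class M N"
  proof (rule nonneg[rule_format])
    show "(\<lambda>(\<theta>, y). max 0 (Z \<theta> y + \<bar>c\<bar>)) \<in> borel_measurable (M \<Otimes>\<^sub>M N)"
      using Z by (simp add: case_prod_beta')
    have "(\<lambda>(\<theta>, y). max 0 (Z \<theta> y + \<bar>c\<bar>)) p \<le> 2 * \<bar>c\<bar>" if "p \<in> space (M \<Otimes>\<^sub>M N)" for p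
      using that c[of "fst p" "snd p"] by (auto simp: space_pair_measure)
    then show "\<exists>d. \<forall>p\<in>space (M \<Otimes>\<^sub>M N). (\<lambda>(\<theta>, y). max 0 (Z \<theta> y + \<bar>c\<bar>)) p \<le> d" by blast
  qed auto
  from step_class_add[OF this k[of "- \<bar>c\<bar>"]]
  show ?thesis
  proof (rule step_class.lim[where W = "\<lambda>_ \<theta> y. (\<lambda>(\<theta>, y). max 0 (Z \<theta> y + \<bar>c\<bar>)) (\<theta>, y) + - \<bar>c\<bar>" and c = "\<bar>c\<bar>"])
    have eq: "max 0 (Z \<theta> y + \<bar>c\<bar>) + - \<bar>c\<bar> = Z \<theta> y" if "\<theta> \<in> space M" "y \<in> space N" for \<theta> y
      using c[OF that] by simp
    show "\<bar>(\<lambda>(\<theta>, y). max 0 (Z \<theta> y + \<bar>c\<bar>)) (\<theta>, y) + - \<bar>c\<bar>\<bar> \<le> \<bar>c\<bar>" if "\<theta> \<in> space M" "y \<in> space N" for \<theta> y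
      using eq[OF that] c[OF that] by simp
    show "(\<lambda>n. (\<lambda>(\<theta>, y). max 0 (Z \<theta> y + \<bar>c\<bar>)) (\<theta>, y) + - \<bar>c\<bar>) \<longlonglongrightarrow> Z \<theta> y" if "\<theta> \<in> space M" "y \<in> space N" for \<theta> y
      using eq[OF that] by simp
  qed
qed

section \<open>Continuity and measurability of the driver\<close>

context markov_jump_process
begin

text \<open>The conditions on the driver with \<open>L\<close> and \<open>L'\<close> named, since
  the constants of all later estimates depend on them.\<close>

definition generator :: "real \<Rightarrow> real \<Rightarrow> (real \<Rightarrow> 'k \<Rightarrow> real \<Rightarrow> ('k \<Rightarrow> real) \<Rightarrow> real) \<Rightarrow> bool" where
  "generator L L' f \<longleftrightarrow> 0 \<le> L \<and> 0 \<le> L' \<and>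
     (\<forall>z. z \<in> borel_measurable K \<longrightarrow> bounded (z ` space K) \<longrightarrow>
        (\<lambda>(s, x', r). f s x' r z) \<in> borel_measurable (restrict_space borel {0..T} \<Otimes>\<^sub>M K \<Otimes>\<^sub>M borel)) \<and>
     (\<forall>s\<in>{0..T}. \<forall>x'\<in>space K. \<forall>r r' z z'.
        square_integrable (nu s x') z \<longrightarrow> square_integrable (nu s x') z' \<longrightarrow>
        \<bar>f s x' r z - f s x' r' z'\<bar> \<le> L' * \<bar>r - r'\<bar> + L * sqrt (LINT y|nu s x'. \<bar>z y - z' y\<bar>\<^sup>2))"

lemma generatorD:
  assumes "generator L L' f"
  shows "0 \<le> L" "0 \<le> L'"
    "z \<in> borel_measurable K \<Longrightarrow> bounded (z ` space K) \<Longrightarrow>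
        (\<lambda>(s, x', r). f s x' r z) \<in> borel_measurable (restrict_space borel {0..T} \<Otimes>\<^sub>M K \<Otimes>\<^sub>M borel)"
    "s \<in> {0..T} \<Longrightarrow> x' \<in> space K \<Longrightarrow> square_integrable (nu s x') z \<Longrightarrow> square_integrable (nu s x') z' \<Longrightarrow>
        \<bar>f s x' r z - f s x' r' z'\<bar> \<le> L' * \<bar>r - r'\<bar> + L * sqrt (LINT y|nu s x'. \<bar>z y - z' y\<bar>\<^sup>2)"
  using assms unfolding generator_def by blast+

lemma measurable_nu_iff: "s \<in> {0..T} \<Longrightarrow> y \<in> space K \<Longrightarrow> borel_measurable (nu s y) = borel_measurable K"
  by (rule measurable_cong_sets) (auto simp: sets_nu)

lemma square_integrable_bounded:
  assumes "s \<in> {0..T}" "y \<in> space K" "z \<in> borel_measurable K" "\<And>y. y \<in> space K \<Longrightarrow> \<bar>z y\<bar> \<le> c"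
  shows "square_integrable (nu s y) z"
proof -
  interpret N: finite_measure "nu s y" using assms by (intro finite_measure_nu)
  have "integrable (nu s y) (\<lambda>y. (z y)\<^sup>2)"
  proof (rule N.integrable_const_bound[where B = "c\<^sup>2"])
    show "AE y' in nu s y. norm ((z y')\<^sup>2) \<le> c\<^sup>2"
      using assms(4) space_nu[of s y] assms(1,2) by (intro AE_I2) (auto simp: abs_le_square_iff[symmetric] intro: order_trans[OF _ abs_ge_self])
    show "(\<lambda>y. (z y)\<^sup>2) \<in> borel_measurable (nu s y)"
      unfolding measurable_nu_iff[OF assms(1,2)] using assms(3) by simp
  qed
  then show ?thesis
    unfolding square_integrable_def measurable_nu_iff[OF assms(1,2)] using assms(3) by simp
qed

text \<open>Dominated convergence in \<open>L^2(nu s x')\<close>, combined with Lipschitz continuity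
  in the last argument. This is what the limit rule of \<open>step_class\<close> asks of the
  driver.\<close>

lemma generator_tendsto:
  assumes gen: "generator L L' f" and s: "s \<in> {0..T}" and x: "x' \<in> space K"
    and W: "\<And>n. W n \<in> borel_measurable K" and Z: "square_integrable (nu s x') Z"
    and w: "square_integrable (nu s x') w"
    and bnd: "\<And>n y. y \<in> space K \<Longrightarrow> \<bar>W n y\<bar> \<le> w y"
    and lim: "\<And>y. y \<in> space K \<Longrightarrow> (\<lambda>n. W n y) \<longlonglongrightarrow> Z y"
  shows "(\<lambda>n. f s x' r (W n)) \<longlonglongrightarrow> f s x' r Z"
proof -
  let ?N = "nu s x'"
  have sp: "space ?N = space K" using space_nu s x by simp
  have m[measurable]: "W n \<in> borel_measurable ?N" for n unfolding measurable_nu_iff[OF s x] by (rule W)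
  have mZ[measurable]: "Z \<in> borel_measurable ?N" "w \<in> borel_measurable ?N" using Z w by (auto simp: square_integrable_def)
  have Zw: "\<bar>Z y\<bar> \<le> w y" if "y \<in> space K" for y
    using bnd[OF that] by (intro LIMSEQ_le_const2[OF tendsto_rabs[OF lim[OF that]]]) auto
  have sqW: "square_integrable ?N (W n)" for n
    unfolding square_integrable_def
  proof
    have le: "\<bar>W n y\<bar>\<^sup>2 \<le> (w y)\<^sup>2" if "y \<in> space K" for y
      using bnd[OF that, of n] by (intro power_mono) auto
    show "integrable ?N (\<lambda>y. (W n y)\<^sup>2)"
    proof (rule Bochner_Integration.integrable_bound)
      show "integrable ?N (\<lambda>y. (w y)\<^sup>2)" using w by (simp add: square_integrable_def)
      show "AE y in ?N. norm ((W n y)\<^sup>2) \<le> norm ((w y)\<^sup>2)"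
        using le sp by (intro AE_I2) simp
    qed measurable
  qed (rule m)
  have "(\<lambda>n. LINT y|?N. \<bar>W n y - Z y\<bar>\<^sup>2) \<longlonglongrightarrow> (LINT y|?N. 0)"
  proof (rule integral_dominated_convergence[where w = "\<lambda>y. 4 * (w y)\<^sup>2"])
    show "integrable ?N (\<lambda>y. 4 * (w y)\<^sup>2)" using w by (simp add: square_integrable_def)
    show "AE y in ?N. (\<lambda>n. \<bar>W n y - Z y\<bar>\<^sup>2) \<longlonglongrightarrow> 0"
    proof (rule AE_I2)
      fix y assume "y \<in> space ?N"
      then have "(\<lambda>n. \<bar>W n y - Z y\<bar>\<^sup>2) \<longlonglongrightarrow> \<bar>Z y - Z y\<bar>\<^sup>2"
        using lim sp by (intro tendsto_intros) auto
      then show "(\<lambda>n. \<bar>W n y - Z y\<bar>\<^sup>2) \<longlonglongrightarrow> 0" by simp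
    qed
    show "AE y in ?N. norm (\<bar>W n y - Z y\<bar>\<^sup>2) \<le> 4 * (w y)\<^sup>2" for n
    proof (rule AE_I2)
      fix y assume "y \<in> space ?N"
      then have "\<bar>W n y - Z y\<bar> \<le> 2 * w y" using bnd[of y n] Zw[of y] sp by auto
      then have "\<bar>W n y - Z y\<bar>\<^sup>2 \<le> (2 * w y)\<^sup>2" by (intro power_mono) auto
      then show "norm (\<bar>W n y - Z y\<bar>\<^sup>2) \<le> 4 * (w y)\<^sup>2" by (simp add: power_mult_distrib)
    qed
  qed measurable
  then have "(\<lambda>n. L' * \<bar>r - r\<bar> + L * sqrt (LINT y|?N. \<bar>W n y - Z y\<bar>\<^sup>2)) \<longlonglongrightarrow> L' * \<bar>r - r\<bar> + L * sqrt 0"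
    by (intro tendsto_intros) simp
  then have "(\<lambda>n. L' * \<bar>r - r\<bar> + L * sqrt (LINT y|?N. \<bar>W n y - Z y\<bar>\<^sup>2)) \<longlonglongrightarrow> 0" by simp
  then have "(\<lambda>n. f s x' r (W n) - f s x' r Z) \<longlonglongrightarrow> 0"
    by (rule Lim_null_comparison[rotated])
      (intro always_eventually allI, unfold real_norm_def, rule generatorD(4)[OF gen s x sqW Z])
  then show ?thesis by (rule LIM_zero_cancel)
qed

text \<open>Induction over \<open>step_class\<close>: constants are covered by the measurability
  assumption on the driver, case distinctions commute with \<open>f\<close>, and bounded limits pass
  through it.\<close>

lemma generator_measurable_bounded:
  assumes gen: "generator L L' f"
    and p: "p \<in> \<Theta> \<rightarrow>\<^sub>M restrict_space borel {0..T}" and q: "q \<in> \<Theta> \<rightarrow>\<^sub>M K" and r: "r \<in> borel_measurable \<Theta>"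
    and Z: "(\<lambda>(\<theta>, y). Z \<theta> y) \<in> borel_measurable (\<Theta> \<Otimes>\<^sub>M K)"
    and c: "\<And>\<theta> y. \<theta> \<in> space \<Theta> \<Longrightarrow> y \<in> space K \<Longrightarrow> \<bar>Z \<theta> y\<bar> \<le> c"
  shows "(\<lambda>\<theta>. f (p \<theta>) (q \<theta>) (r \<theta>) (Z \<theta>)) \<in> borel_measurable \<Theta>"
proof -
  have pin: "p \<theta> \<in> {0..T}" and qin: "q \<theta> \<in> space K" if "\<theta> \<in> space \<Theta>" for \<theta>
    using measurable_space[OF p that] measurable_space[OF q that] by (auto simp: space_restrict_space)
  have "Z \<in> step_class \<Theta> K" using Z c by (rule step_class_iff)
  then show ?thesis
  proof (induction rule: step_class.induct)
    case (const z)
    show ?case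
      using measurable_compose[OF measurable_Pair[OF p measurable_Pair[OF q r]] generatorD(3)[OF gen const]] by simp
  next
    case (ite Z Z' B)
    then have "(\<lambda>\<theta>. if \<theta> \<in> B then f (p \<theta>) (q \<theta>) (r \<theta>) (Z \<theta>) else f (p \<theta>) (q \<theta>) (r \<theta>) (Z' \<theta>)) \<in> borel_measurable \<Theta>"
      by (intro measurable_If_set) auto
    then show ?case by (simp add: if_distrib cong: if_cong)
  next
    case (lim W c Z)
    have ZS: "Z \<in> step_class \<Theta> K" by (rule step_class.lim[OF lim(1,2,3)])
    have sec: "Z \<theta> \<in> borel_measurable K" if "Z \<in> step_class \<Theta> K" "\<theta> \<in> space \<Theta>" for Z \<theta>
      using measurable_Pair2[OF step_class_measurable[OF that(1)] that(2)] by simp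
    show ?case
    proof (rule borel_measurable_LIMSEQ_real[OF _ lim(4)])
      fix \<theta> assume \<theta>: "\<theta> \<in> space \<Theta>"
      obtain d where "\<forall>\<theta>\<in>space \<Theta>. \<forall>y\<in>space K. \<bar>Z \<theta> y\<bar> \<le> d" using step_class_bounded[OF ZS] by blast
      then show "(\<lambda>n. f (p \<theta>) (q \<theta>) (r \<theta>) (W n \<theta>)) \<longlonglongrightarrow> f (p \<theta>) (q \<theta>) (r \<theta>) (Z \<theta>)"
        using \<theta> lim sec[OF lim(1) \<theta>] sec[OF ZS \<theta>] pin[OF \<theta>] qin[OF \<theta>]
        by (intro generator_tendsto[OF gen, where w = "\<lambda>_. c"] square_integrable_bounded) auto
    qed
  qed
qed

text \<open>Truncation at \<open>n\<close> reduces to bounded \<open>Z\<close>; at each parameter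
  the truncations are dominated by \<open>\<bar>Z \<theta> y\<bar>\<close>, which is square
  integrable.\<close>

lemma generator_measurable:
  assumes gen: "generator L L' f"
    and p: "p \<in> \<Theta> \<rightarrow>\<^sub>M restrict_space borel {0..T}" and q: "q \<in> \<Theta> \<rightarrow>\<^sub>M K" and r: "r \<in> borel_measurable \<Theta>"
    and Z: "(\<lambda>(\<theta>, y). Z \<theta> y) \<in> borel_measurable (\<Theta> \<Otimes>\<^sub>M K)"
    and sq: "\<And>\<theta>. \<theta> \<in> space \<Theta> \<Longrightarrow> square_integrable (nu (p \<theta>) (q \<theta>)) (Z \<theta>)"
  shows "(\<lambda>\<theta>. f (p \<theta>) (q \<theta>) (r \<theta>) (Z \<theta>)) \<in> borel_measurable \<Theta>"
proof (rule borel_measurable_LIMSEQ_real)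
  let ?W = "\<lambda>n \<theta> y. max (- real n) (min (real n) (Z \<theta> y))"
  have mW: "(\<lambda>(\<theta>, y). ?W n \<theta> y) \<in> borel_measurable (\<Theta> \<Otimes>\<^sub>M K)" for n
    using Z by (simp add: case_prod_beta')
  show "(\<lambda>\<theta>. f (p \<theta>) (q \<theta>) (r \<theta>) (?W n \<theta>)) \<in> borel_measurable \<Theta>" for n
    by (rule generator_measurable_bounded[OF gen p q r mW, where c = "real n"]) auto
  fix \<theta> assume \<theta>: "\<theta> \<in> space \<Theta>"
  have pin: "p \<theta> \<in> {0..T}" and qin: "q \<theta> \<in> space K"
    using measurable_space[OF p \<theta>] measurable_space[OF q \<theta>] by (auto simp: space_restrict_space)
  show "(\<lambda>n. f (p \<theta>) (q \<theta>) (r \<theta>) (?W n \<theta>)) \<longlonglongrightarrow> f (p \<theta>) (q \<theta>) (r \<theta>) (Z \<theta>)"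
  proof (rule generator_tendsto[OF gen pin qin _ sq[OF \<theta>], where w = "\<lambda>y. \<bar>Z \<theta> y\<bar>"])
    show "?W n \<theta> \<in> borel_measurable K" for n
      using measurable_Pair2[OF mW \<theta>] by simp
    show "square_integrable (nu (p \<theta>) (q \<theta>)) (\<lambda>y. \<bar>Z \<theta> y\<bar>)"
      using sq[OF \<theta>] unfolding square_integrable_def by (auto intro: borel_measurable_abs)
    show "(\<lambda>n. ?W n \<theta> y) \<longlonglongrightarrow> Z \<theta> y" for y
    proof (rule tendsto_eventually)
      obtain N :: nat where "\<bar>Z \<theta> y\<bar> \<le> real N" using real_arch_simple by blast
      then have "?W n \<theta> y = Z \<theta> y" if "n \<ge> N" for n
        using that by (auto simp: max_def min_def)
      then show "\<forall>\<^sub>F n in sequentially. ?W n \<theta> y = Z \<theta> y" by (auto simp: eventually_sequentially)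
    qed
  qed auto
qed

end

section \<open>Square of a jump path\<close>

text \<open>Every pair of distinct times is counted from its earlier member, because in a backward
  equation the value at \<open>\<tau>\<close> contains the later jumps.\<close>

lemma square_sum_later:
  fixes c :: "'a :: linorder \<Rightarrow> real"
  assumes "finite J"
  shows "(\<Sum>\<tau>\<in>J. c \<tau>)\<^sup>2 = (\<Sum>\<tau>\<in>J. (c \<tau>)\<^sup>2) + 2 * (\<Sum>\<tau>\<in>J. c \<tau> * (\<Sum>\<sigma>\<in>J \<inter> {\<tau><..}. c \<sigma>))"
  using assms
proof (induction J rule: finite_linorder_min_induct)
  case (insert b A)
  have "b \<notin> A" using insert by auto
  moreover have "insert b A \<inter> {b<..} = A" using insert by auto
  moreover have "insert b A \<inter> {\<tau><..} = A \<inter> {\<tau><..}" if "\<tau> \<in> A" for \<tau> using insert that by auto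
  ultimately show ?case
    using insert by (simp add: power2_sum algebra_simps)
qed simp

text \<open>Continuous counterpart of \<open>square_sum_later\<close>: the square is an integral
  over the plane, the diagonal is null, and Fubini's theorem identifies the contributions of the two
  triangles.\<close>

lemma square_integral_later:
  fixes b :: "real \<Rightarrow> real"
  assumes b: "integrable lborel b"
  defines "B \<equiv> \<lambda>r. LINT q|lborel. indicator {r<..} q * b q"
  shows "(\<lambda>r. b r * B r) \<in> borel_measurable lborel" "\<And>r. \<bar>B r\<bar> \<le> (LINT q|lborel. \<bar>b q\<bar>)"
    "integrable lborel (\<lambda>r. b r * B r)"
    "(LINT q|lborel. b q)\<^sup>2 = 2 * (LINT r|lborel. b r * B r)"
proof -
  have [measurable]: "b \<in> borel_measurable borel" using b by (simp add: borel_measurable_integrable)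
  have ib: "integrable lborel (\<lambda>q. indicator A q * b q)" if "A \<in> sets borel" for A
    using integrable_mult_indicator[OF _ b, of A] that by simp
  have [measurable]: "B \<in> borel_measurable borel"
  proof -
    have "(\<lambda>(r, q). indicator {p. fst p < snd p} (r, q) * b q) \<in> borel_measurable (borel \<Otimes>\<^sub>M lborel)"
      by measurable
    moreover have "(\<lambda>(r, q). indicator {p. fst p < snd p} (r, q) * b q) = (\<lambda>(r, q). indicator {r<..} q * b q)"
      by (auto simp: fun_eq_iff indicator_def)
    ultimately show ?thesis unfolding B_def by (intro lborel.borel_measurable_lebesgue_integral) simp
  qed
  show "(\<lambda>r. b r * B r) \<in> borel_measurable lborel" by measurable
  show Ble: "\<bar>B r\<bar> \<le> (LINT q|lborel. \<bar>b q\<bar>)" for r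
  proof -
    have "\<bar>B r\<bar> \<le> (LINT q|lborel. \<bar>indicator {r<..} q * b q\<bar>)" unfolding B_def by (rule integral_abs_bound)
    also have "\<dots> \<le> (LINT q|lborel. \<bar>b q\<bar>)"
      using ib[of "{r<..}"] b by (intro integral_mono integrable_abs) (auto simp: indicator_def)
    finally show ?thesis .
  qed
  show ibB: "integrable lborel (\<lambda>r. b r * B r)"
  proof (rule Bochner_Integration.integrable_bound)
    show "integrable lborel (\<lambda>r. (LINT q|lborel. \<bar>b q\<bar>) * b r)" using b by simp
    show "AE r in lborel. norm (b r * B r) \<le> norm ((LINT q|lborel. \<bar>b q\<bar>) * b r)"
    proof (rule AE_I2)
      fix r
      have "\<bar>b r\<bar> * \<bar>B r\<bar> \<le> \<bar>b r\<bar> * (LINT q|lborel. \<bar>b q\<bar>)" by (rule mult_left_mono[OF Ble]) simp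
      then show "norm (b r * B r) \<le> norm ((LINT q|lborel. \<bar>b q\<bar>) * b r)"
        by (simp add: abs_mult mult.commute)
    qed
  qed measurable
  let ?f = "\<lambda>x y. indicator {x<..} y * b x * b y"
  have mf: "(\<lambda>(x, y). ?f x y) \<in> borel_measurable (lborel \<Otimes>\<^sub>M lborel)"
  proof -
    have "(\<lambda>p. indicator {p. fst p < snd p} p * b (fst p) * b (snd p)) \<in> borel_measurable (lborel \<Otimes>\<^sub>M lborel)"
      by measurable
    moreover have "(\<lambda>p. indicator {p. fst p < snd p} p * b (fst p) * b (snd p)) = (\<lambda>(x, y). ?f x y)"
      by (auto simp: fun_eq_iff indicator_def)
    ultimately show ?thesis by simp
  qed
  have fx: "integrable lborel (\<lambda>y. ?f x y)" for x
    using integrable_mult_right[OF ib[of "{x<..}"], of "b x"] by (simp add: mult_ac)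
  have intf: "integrable (lborel \<Otimes>\<^sub>M lborel) (\<lambda>(x, y). ?f x y)"
  proof (rule lborel_pair.Fubini_integrable[OF mf])
    show "AE x in lborel. integrable lborel (\<lambda>y. case (x, y) of (x, y) \<Rightarrow> ?f x y)" using fx by simp
    have "(\<lambda>x. LINT y|lborel. norm (?f x y)) \<in> borel_measurable lborel"
      using mf by (intro lborel.borel_measurable_lebesgue_integral) (simp add: case_prod_beta')
    moreover have "norm (LINT y|lborel. norm (?f x y)) \<le> norm ((LINT q|lborel. \<bar>b q\<bar>) * b x)" for x
    proof -
      have "(LINT y|lborel. norm (?f x y)) \<le> (LINT y|lborel. \<bar>b x\<bar> * \<bar>b y\<bar>)"
      proof (rule integral_mono)
        show "integrable lborel (\<lambda>y. norm (?f x y))" by (rule integrable_norm[OF fx])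
        show "integrable lborel (\<lambda>y. \<bar>b x\<bar> * \<bar>b y\<bar>)" using b by simp
        show "norm (?f x y) \<le> \<bar>b x\<bar> * \<bar>b y\<bar>" for y by (simp add: indicator_def abs_mult)
      qed
      also have "\<dots> = \<bar>b x\<bar> * (LINT q|lborel. \<bar>b q\<bar>)" by (rule integral_mult_right_zero)
      finally show ?thesis by (simp add: abs_mult mult.commute)
    qed
    ultimately have "integrable lborel (\<lambda>x. LINT y|lborel. norm (?f x y))"
      by (intro Bochner_Integration.integrable_bound[OF integrable_mult_right[OF b, of "LINT q|lborel. \<bar>b q\<bar>"]] AE_I2)
    then show "integrable lborel (\<lambda>x. LINT y|lborel. norm (case (x, y) of (x, y) \<Rightarrow> ?f x y))" by simp
  qed
  let ?I = "LINT q|lborel. b q"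
  have "(LINT x|lborel. LINT y|lborel. ?f x y) = (LINT r|lborel. b r * B r)"
  proof (rule Bochner_Integration.integral_cong)
    fix x
    have "(LINT y|lborel. ?f x y) = (LINT y|lborel. b x * (indicator {x<..} y * b y))" by (simp add: mult_ac)
    then show "(LINT y|lborel. ?f x y) = b x * B x" by (simp add: B_def)
  qed simp
  moreover have "(LINT y|lborel. LINT x|lborel. ?f x y) = (LINT y|lborel. b y * ?I - b y * B y)"
  proof (rule Bochner_Integration.integral_cong)
    fix y
    have "(LINT x|lborel. ?f x y) = (LINT x|lborel. b y * (b x - indicator {y<..} x * b x))"
    proof (rule integral_cong_AE)
      have "AE x in lborel. x \<noteq> y" by (rule AE_lborel_singleton)
      then show "AE x in lborel. ?f x y = b y * (b x - indicator {y<..} x * b x)"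
        by eventually_elim (auto simp: indicator_def)
      have "(\<lambda>x. indicator {..<y} x * b x * b y) \<in> borel_measurable lborel" by measurable
      moreover have "(\<lambda>x. indicator {..<y} x * b x * b y) = (\<lambda>x. ?f x y)" by (auto simp: fun_eq_iff indicator_def)
      ultimately show "(\<lambda>x. ?f x y) \<in> borel_measurable lborel" by simp
    qed measurable
    also have "\<dots> = b y * (?I - B y)"
      using b ib[of "{y<..}"] by (simp add: B_def)
    finally show "(LINT x|lborel. ?f x y) = b y * ?I - b y * B y" by (simp add: right_diff_distrib)
  qed simp
  moreover have "(LINT y|lborel. LINT x|lborel. ?f x y) = (LINT x|lborel. LINT y|lborel. ?f x y)"
    by (rule lborel_pair.Fubini_integral[OF intf])
  moreover have "(LINT y|lborel. b y * ?I - b y * B y) = ?I * ?I - (LINT r|lborel. b r * B r)"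
    using b ibB by simp
  ultimately show "?I\<^sup>2 = 2 * (LINT r|lborel. b r * B r)" by (simp add: power2_eq_square)
qed

text \<open>Ito's formula for the square, run backwards from the terminal value \<open>\<xi>\<close>.\<close>

lemma square_backward:
  fixes a c y :: "real \<Rightarrow> real"
  assumes fin: "finite J" and J: "J \<subseteq> {s<..T}" and sT: "s \<le> T"
    and a: "set_integrable lborel {s<..T} a"
    and y: "\<And>r. r \<in> {s..T} \<Longrightarrow> y r = \<xi> + (LINT q:{r<..T}|lborel. a q) - (\<Sum>\<tau>\<in>J \<inter> {r<..}. c \<tau>)"
  shows "set_integrable lborel {s<..T} (\<lambda>r. a r * y r)"
    and "(y s)\<^sup>2 + (\<Sum>\<tau>\<in>J. (c \<tau>)\<^sup>2) =
      \<xi>\<^sup>2 + 2 * (LINT r:{s<..T}|lborel. a r * y r) - 2 * (\<Sum>\<tau>\<in>J. (y \<tau> - c \<tau>) * c \<tau>)"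
proof -
  define b where "b r = indicator {s<..T} r * a r" for r
  define B where "B r = (LINT q|lborel. indicator {r<..} q * b q)" for r
  define S where "S r = (\<Sum>\<tau>\<in>J. indicator {..<\<tau>} r * c \<tau>)" for r
  have b: "integrable lborel b" using a by (simp add: set_integrable_def b_def[abs_def])
  note sq = square_integral_later[OF b, folded B_def]
  have [measurable]: "b \<in> borel_measurable borel" using b by (simp add: borel_measurable_integrable)
  have ib: "integrable lborel (\<lambda>q. indicator A q * b q)" if "A \<in> sets borel" for A
    using integrable_mult_indicator[OF _ b, of A] that by simp
  have aB: "(LINT q:{r<..T}|lborel. a q) = B r" if "r \<in> {s..T}" for r
    unfolding set_lebesgue_integral_def B_def b_def
    using that by (intro Bochner_Integration.integral_cong) (auto simp: indicator_def)
  have S_sum: "(\<Sum>\<tau>\<in>J \<inter> {r<..}. c \<tau>) = S r" for r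
    unfolding S_def using fin by (simp add: sum.inter_restrict indicator_def if_distrib cong: if_cong)
  have yr: "y r = \<xi> + B r - S r" if "r \<in> {s..T}" for r
    using y[OF that] aB[OF that] S_sum[of r] by simp
  have ibS1: "integrable lborel (\<lambda>r. c \<tau> * (indicator {..<\<tau>} r * b r))" for \<tau> using ib[of "{..<\<tau>}"] by simp
  have bS: "b r * S r = (\<Sum>\<tau>\<in>J. c \<tau> * (indicator {..<\<tau>} r * b r))" for r
    by (simp add: S_def sum_distrib_left mult_ac)
  have ibS: "integrable lborel (\<lambda>r. b r * S r)" unfolding bS by (intro Bochner_Integration.integrable_sum ibS1)
  have ay: "indicator {s<..T} r * (a r * y r) = \<xi> * b r + b r * B r - b r * S r" for r
  proof (cases "r \<in> {s<..T}")
    case True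
    then have "y r = \<xi> + B r - S r" by (intro yr) auto
    with True show ?thesis by (simp only: b_def) (simp add: algebra_simps)
  qed (simp add: b_def)
  have iby: "integrable lborel (\<lambda>r. \<xi> * b r + b r * B r - b r * S r)"
    using b sq(3) ibS by simp
  then show "set_integrable lborel {s<..T} (\<lambda>r. a r * y r)"
    by (simp add: set_integrable_def ay)
  have Bs: "B s = (LINT q|lborel. b q)"
    unfolding B_def by (intro Bochner_Integration.integral_cong) (auto simp: b_def indicator_def)
  have I: "(LINT r:{s<..T}|lborel. a r * y r) = \<xi> * B s + (B s)\<^sup>2 / 2 - (LINT r|lborel. b r * S r)"
    using b sq(3,4) ibS by (simp add: set_lebesgue_integral_def ay Bs)
  have Bdiff: "(LINT r|lborel. indicator {..<\<tau>} r * b r) = B s - B \<tau>" if "\<tau> \<in> J" for \<tau>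
  proof -
    have "(LINT r|lborel. indicator {..<\<tau>} r * b r) = (LINT r|lborel. b r - indicator {\<tau><..} r * b r)"
    proof (rule integral_cong_AE)
      have "AE r in lborel. r \<noteq> \<tau>" by (rule AE_lborel_singleton)
      then show "AE r in lborel. indicator {..<\<tau>} r * b r = b r - indicator {\<tau><..} r * b r"
        by eventually_elim (auto simp: indicator_def)
    qed measurable
    then show ?thesis using b ib[of "{\<tau><..}"] by (simp add: Bs B_def[of \<tau>])
  qed
  \<comment> \<open>The mixed term: a jump at \<open>\<tau>\<close> is seen from all earlier times,
    so it meets the integral of \<open>b\<close> over \<open>{s<..\<tau>}\<close>, which is
    \<open>B s - B \<tau>\<close>.\<close>
  have "(LINT r|lborel. b r * S r) = (\<Sum>\<tau>\<in>J. c \<tau> * (B s - B \<tau>))"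
    unfolding bS using ibS1 Bdiff by (subst Bochner_Integration.integral_sum) auto
  also have "\<dots> = S s * B s - (\<Sum>\<tau>\<in>J. c \<tau> * B \<tau>)"
  proof -
    have "S s = (\<Sum>\<tau>\<in>J. c \<tau>)" using S_sum[of s] J by (metis Int_absorb2 greaterThanAtMost_iff greaterThan_iff subset_iff)
    then show ?thesis by (simp add: right_diff_distrib sum_subtractf sum_distrib_right)
  qed
  finally have IS: "(LINT r|lborel. b r * S r) = S s * B s - (\<Sum>\<tau>\<in>J. c \<tau> * B \<tau>)" .
  have Ss: "S s = (\<Sum>\<tau>\<in>J. c \<tau>)" using S_sum[of s] J by (metis Int_absorb2 greaterThanAtMost_iff greaterThan_iff subset_iff)
  have S2: "(S s)\<^sup>2 = (\<Sum>\<tau>\<in>J. (c \<tau>)\<^sup>2) + 2 * (\<Sum>\<tau>\<in>J. c \<tau> * S \<tau>)"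
    using square_sum_later[OF fin, of c] by (simp add: Ss S_sum)
  have ys: "y s = \<xi> + B s - S s" using sT by (intro yr) auto
  have yJ: "y \<tau> = \<xi> + B \<tau> - S \<tau>" if "\<tau> \<in> J" for \<tau> using that J by (intro yr) auto
  have "(\<Sum>\<tau>\<in>J. (y \<tau> - c \<tau>) * c \<tau>) = (\<Sum>\<tau>\<in>J. \<xi> * c \<tau> + c \<tau> * B \<tau> - c \<tau> * S \<tau> - (c \<tau>)\<^sup>2)"
  proof (rule sum.cong[OF refl])
    fix \<tau> assume "\<tau> \<in> J"
    then have "(y \<tau> - c \<tau>) * c \<tau> = (\<xi> + B \<tau> - S \<tau> - c \<tau>) * c \<tau>" by (simp add: yJ)
    then show "(y \<tau> - c \<tau>) * c \<tau> = \<xi> * c \<tau> + c \<tau> * B \<tau> - c \<tau> * S \<tau> - (c \<tau>)\<^sup>2"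
      by (simp add: power2_eq_square algebra_simps)
  qed
  also have "\<dots> = \<xi> * S s + (\<Sum>\<tau>\<in>J. c \<tau> * B \<tau>) - (\<Sum>\<tau>\<in>J. c \<tau> * S \<tau>) - (\<Sum>\<tau>\<in>J. (c \<tau>)\<^sup>2)"
    by (simp add: sum.distrib sum_subtractf sum_distrib_left Ss)
  finally have sumJ: "(\<Sum>\<tau>\<in>J. (y \<tau> - c \<tau>) * c \<tau>) =
      \<xi> * S s + (\<Sum>\<tau>\<in>J. c \<tau> * B \<tau>) - (\<Sum>\<tau>\<in>J. c \<tau> * S \<tau>) - (\<Sum>\<tau>\<in>J. (c \<tau>)\<^sup>2)" .
  show "(y s)\<^sup>2 + (\<Sum>\<tau>\<in>J. (c \<tau>)\<^sup>2) =
      \<xi>\<^sup>2 + 2 * (LINT r:{s<..T}|lborel. a r * y r) - 2 * (\<Sum>\<tau>\<in>J. (y \<tau> - c \<tau>) * c \<tau>)"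
    unfolding I IS sumJ ys using S2 by (simp add: power2_eq_square algebra_simps)
qed

text \<open>The integral is continuous in its lower limit, while from the left the subtracted sum
  also contains the jump at \<open>r\<close> itself. Hence the left limit is the value at
  \<open>r\<close> minus the jump.\<close>

lemma left_limit_backward:
  fixes a c y :: "real \<Rightarrow> real"
  assumes fin: "finite J" and J: "J \<subseteq> {s<..T}"
    and a: "set_integrable lborel {s<..T} a"
    and y: "\<And>r. r \<in> {s..T} \<Longrightarrow> y r = \<xi> + (LINT q:{r<..T}|lborel. a q) - (\<Sum>\<tau>\<in>J \<inter> {r<..}. c \<tau>)"
    and r: "r \<in> {s<..T}" and u: "\<And>n. u n \<in> {s..<r}" "u \<longlonglongrightarrow> r"
  shows "(\<lambda>n. y (u n)) \<longlonglongrightarrow> y r - (if r \<in> J then c r else 0)"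
proof -
  define b where "b r = indicator {s<..T} r * a r" for r
  have b: "integrable lborel b" using a by (simp add: set_integrable_def b_def[abs_def])
  have [measurable]: "b \<in> borel_measurable borel" using b by (simp add: borel_measurable_integrable)
  have aB: "(LINT q:{r<..T}|lborel. a q) = (LINT q|lborel. indicator {r<..} q * b q)" if "r \<in> {s..T}" for r
    unfolding set_lebesgue_integral_def b_def
    using that by (intro Bochner_Integration.integral_cong) (auto simp: indicator_def)
  have "(\<lambda>n. LINT q|lborel. indicator {u n<..} q * b q) \<longlonglongrightarrow> (LINT q|lborel. indicator {r<..} q * b q)"
  proof (rule integral_dominated_convergence[where w = "\<lambda>q. \<bar>b q\<bar>"])
    have "AE q in lborel. q \<noteq> r" by (rule AE_lborel_singleton)
    then show "AE q in lborel. (\<lambda>n. indicator {u n<..} q * b q) \<longlonglongrightarrow> indicator {r<..} q * b q"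
    proof eventually_elim
      case (elim q)
      show ?case
      proof (cases "q < r")
        case True
        from order_tendstoD(1)[OF u(2) this]
        have "\<forall>\<^sub>F n in sequentially. indicator {u n<..} q * b q = indicator {r<..} q * b q"
          by eventually_elim (use True in auto)
        then show ?thesis by (rule tendsto_eventually)
      next
        case False
        then have "u n < q" for n using u(1)[of n] elim by auto
        then show ?thesis using False elim by simp
      qed
    qed
  qed (use b in \<open>auto simp: indicator_def\<close>)
  moreover have "\<forall>\<^sub>F n in sequentially. (\<Sum>\<tau>\<in>J \<inter> {u n<..}. c \<tau>) = (\<Sum>\<tau>\<in>J \<inter> {r..}. c \<tau>)"
  proof -
    have "\<forall>\<^sub>F n in sequentially. \<forall>\<tau>\<in>J. \<tau> < r \<longrightarrow> \<tau> < u n"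
      using fin order_tendstoD(1)[OF u(2)] by (intro eventually_ball_finite) (auto simp: eventually_mono)
    then show ?thesis
    proof eventually_elim
      case (elim n)
      have "J \<inter> {u n<..} = J \<inter> {r..}" using elim u(1)[of n] by force
      then show ?case by simp
    qed
  qed
  then have "(\<lambda>n. \<Sum>\<tau>\<in>J \<inter> {u n<..}. c \<tau>) \<longlonglongrightarrow> (\<Sum>\<tau>\<in>J \<inter> {r..}. c \<tau>)" by (rule tendsto_eventually)
  ultimately have "(\<lambda>n. \<xi> + (LINT q|lborel. indicator {u n<..} q * b q) - (\<Sum>\<tau>\<in>J \<inter> {u n<..}. c \<tau>)) \<longlonglongrightarrow>
      \<xi> + (LINT q|lborel. indicator {r<..} q * b q) - (\<Sum>\<tau>\<in>J \<inter> {r..}. c \<tau>)"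
    by (intro tendsto_intros)
  moreover have "y (u n) = \<xi> + (LINT q|lborel. indicator {u n<..} q * b q) - (\<Sum>\<tau>\<in>J \<inter> {u n<..}. c \<tau>)" for n
    using u(1)[of n] r y[of "u n"] aB[of "u n"] by auto
  moreover have "y r - (if r \<in> J then c r else 0) =
      \<xi> + (LINT q|lborel. indicator {r<..} q * b q) - (\<Sum>\<tau>\<in>J \<inter> {r..}. c \<tau>)"
  proof -
    have "J \<inter> {r..} = (if r \<in> J then insert r (J \<inter> {r<..}) else J \<inter> {r<..})" by (auto simp: less_le)
    then show ?thesis using y[of r] aB[of r] r fin by auto
  qed
  ultimately show ?thesis by simp
qed

text \<open>A bridge from real double integrals to the nonnegative integrals of the compensation
  formula. The inner integrand need be integrable for almost every \<open>r\<close> only; finiteness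
  of the absolute double integral justifies the difference.\<close>

lemma iterated_integral_pos_neg:
  fixes h :: "'a \<Rightarrow> 'b \<Rightarrow> real"
  assumes h: "\<And>r. r \<in> space M \<Longrightarrow> h r \<in> borel_measurable (N r)"
    and mp: "(\<lambda>r. \<integral>\<^sup>+y. ennreal (h r y) \<partial>N r) \<in> borel_measurable M"
    and mn: "(\<lambda>r. \<integral>\<^sup>+y. ennreal (- h r y) \<partial>N r) \<in> borel_measurable M"
    and mi: "(\<lambda>r. LINT y|N r. h r y) \<in> borel_measurable M"
    and fin: "(\<integral>\<^sup>+r. (\<integral>\<^sup>+y. ennreal \<bar>h r y\<bar> \<partial>N r) \<partial>M) < \<infinity>"
  shows "integrable M (\<lambda>r. LINT y|N r. h r y)"
    and "(LINT r|M. (LINT y|N r. h r y)) =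
      enn2real (\<integral>\<^sup>+r. (\<integral>\<^sup>+y. ennreal (h r y) \<partial>N r) \<partial>M) - enn2real (\<integral>\<^sup>+r. (\<integral>\<^sup>+y. ennreal (- h r y) \<partial>N r) \<partial>M)"
    and "(\<integral>\<^sup>+r. (\<integral>\<^sup>+y. ennreal (h r y) \<partial>N r) \<partial>M) < \<infinity>"
    and "(\<integral>\<^sup>+r. (\<integral>\<^sup>+y. ennreal (- h r y) \<partial>N r) \<partial>M) < \<infinity>"
proof -
  let ?p = "\<lambda>r. \<integral>\<^sup>+y. ennreal (h r y) \<partial>N r" and ?n = "\<lambda>r. \<integral>\<^sup>+y. ennreal (- h r y) \<partial>N r"
  have pn: "(\<integral>\<^sup>+y. ennreal \<bar>h r y\<bar> \<partial>N r) = ?p r + ?n r" if "r \<in> space M" for r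
  proof -
    have "(\<integral>\<^sup>+y. ennreal \<bar>h r y\<bar> \<partial>N r) = (\<integral>\<^sup>+y. ennreal (h r y) + ennreal (- h r y) \<partial>N r)"
      by (intro nn_integral_cong) (auto simp: abs_if ennreal_neg)
    also have "\<dots> = ?p r + ?n r" using h[OF that] by (intro nn_integral_add) auto
    finally show ?thesis .
  qed
  have sum: "(\<integral>\<^sup>+r. ?p r \<partial>M) + (\<integral>\<^sup>+r. ?n r \<partial>M) < \<infinity>"
    using fin mp mn pn by (subst nn_integral_add[symmetric]) (auto cong: nn_integral_cong_simp)
  then show fp: "(\<integral>\<^sup>+r. ?p r \<partial>M) < \<infinity>" and fn: "(\<integral>\<^sup>+r. ?n r \<partial>M) < \<infinity>" by auto
  have ep: "AE r in M. ?p r \<noteq> \<infinity>" "AE r in M. ?n r \<noteq> \<infinity>"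
    using nn_integral_PInf_AE[OF mp] nn_integral_PInf_AE[OF mn] fp fn by auto
  have ip: "integrable M (\<lambda>r. enn2real (?p r))"
    using fp mp by (intro integrableI_nonneg)
      (auto intro!: order.strict_trans1[OF nn_integral_mono[where v = ?p]] simp: ennreal_enn2real_if)
  have "in": "integrable M (\<lambda>r. enn2real (?n r))"
    using fn mn by (intro integrableI_nonneg)
      (auto intro!: order.strict_trans1[OF nn_integral_mono[where v = ?n]] simp: ennreal_enn2real_if)
  have eq: "AE r in M. (LINT y|N r. h r y) = enn2real (?p r) - enn2real (?n r)"
    using ep AE_space
  proof eventually_elim
    case (elim r)
    have "integrable (N r) (h r)"
      using h[OF elim(3)] pn[OF elim(3)] elim(1,2) by (simp add: integrable_iff_bounded less_top)
    then show ?case by (rule real_lebesgue_integral_def)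
  qed
  show "integrable M (\<lambda>r. LINT y|N r. h r y)"
    using integrable_cong_AE[OF mi _ eq] ip "in" by simp
  have "(LINT r|M. (LINT y|N r. h r y)) = (LINT r|M. enn2real (?p r) - enn2real (?n r))"
    using mp mn by (intro integral_cong_AE mi eq) auto
  also have "\<dots> = (LINT r|M. enn2real (?p r)) - (LINT r|M. enn2real (?n r))"
    using ip "in" by simp
  also have "(LINT r|M. enn2real (?p r)) = enn2real (\<integral>\<^sup>+r. ?p r \<partial>M)"
  proof -
    have "(LINT r|M. enn2real (?p r)) = enn2real (\<integral>\<^sup>+r. ennreal (enn2real (?p r)) \<partial>M)"
      using mp by (intro integral_eq_nn_integral) auto
    also have "(\<integral>\<^sup>+r. ennreal (enn2real (?p r)) \<partial>M) = (\<integral>\<^sup>+r. ?p r \<partial>M)"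
      using ep(1) by (intro nn_integral_cong_AE) (auto simp: less_top elim!: eventually_mono)
    finally show ?thesis .
  qed
  also have "(LINT r|M. enn2real (?n r)) = enn2real (\<integral>\<^sup>+r. ?n r \<partial>M)"
  proof -
    have "(LINT r|M. enn2real (?n r)) = enn2real (\<integral>\<^sup>+r. ennreal (enn2real (?n r)) \<partial>M)"
      using mn by (intro integral_eq_nn_integral) auto
    also have "(\<integral>\<^sup>+r. ennreal (enn2real (?n r)) \<partial>M) = (\<integral>\<^sup>+r. ?n r \<partial>M)"
      using ep(2) by (intro nn_integral_cong_AE) (auto simp: less_top elim!: eventually_mono)
    finally show ?thesis .
  qed
  finally show "(LINT r|M. (LINT y|N r. h r y)) = enn2real (\<integral>\<^sup>+r. ?p r \<partial>M) - enn2real (\<integral>\<^sup>+r. ?n r \<partial>M)" .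
qed

text \<open>Integrating the inequality against \<open>exp (2 * c * (s - t))\<close> and exchanging
  the integrals turns its last term into at most half of the weighted left-hand side, which is
  absorbed. The factor 2 of the constant is due to this absorption, the rest bounds the integral of
  the weight. In this form \<open>\<phi>\<close> may be merely integrable in time.\<close>

lemma gronwall_backward:
  fixes \<phi> :: "real \<Rightarrow> ennreal" and D :: ennreal and c :: real
  assumes \<phi>[measurable]: "\<phi> \<in> borel_measurable borel" and c: "0 < c" and tT: "t \<le> T"
    and fin: "(\<integral>\<^sup>+s\<in>{t..T}. \<phi> s \<partial>lborel) < \<infinity>"
    and le: "\<And>s. s \<in> {t..T} \<Longrightarrow> \<phi> s \<le> D + ennreal c * (\<integral>\<^sup>+r\<in>{s<..T}. \<phi> r \<partial>lborel)"
  shows "(\<integral>\<^sup>+s\<in>{t..T}. \<phi> s \<partial>lborel) \<le> ennreal (2 * exp (2 * c * (T - t)) * (T - t)) * D"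
proof -
  define w where "w s = ennreal (exp (2 * c * (s - t)))" for s
  have [measurable]: "w \<in> borel_measurable borel" unfolding w_def by measurable
  let ?W = "\<integral>\<^sup>+s\<in>{t..T}. w s \<partial>lborel"
  let ?A = "\<integral>\<^sup>+s\<in>{t..T}. w s * \<phi> s \<partial>lborel"
  have w1: "1 \<le> w s" if "t \<le> s" for s using that c by (simp add: w_def)
  have wT: "w s \<le> ennreal (exp (2 * c * (T - t)))" if "s \<le> T" for s
    using that c unfolding w_def by (intro ennreal_leI) simp
  have Wle: "?W \<le> ennreal (exp (2 * c * (T - t)) * (T - t))"
  proof -
    have "?W \<le> (\<integral>\<^sup>+s. ennreal (exp (2 * c * (T - t))) * indicator {t..T} s \<partial>lborel)"
      using wT by (intro nn_integral_mono) (auto split: split_indicator)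
    also have "\<dots> = ennreal (exp (2 * c * (T - t)) * (T - t))"
      using tT by (simp add: nn_integral_cmult_indicator ennreal_mult)
    finally show ?thesis .
  qed
  have inner: "ennreal c * (\<integral>\<^sup>+s. w s * indicator {t..<r} s \<partial>lborel) \<le> w r / 2" if "t \<le> r" for r
  proof -
    have "(\<integral>\<^sup>+s. ennreal (exp (2 * c * (s - t))) * indicator {t..r} s \<partial>lborel) =
        ennreal (exp (2 * c * (r - t)) / (2 * c) - exp (2 * c * (t - t)) / (2 * c))"
      using c that by (intro nn_integral_FTC_Icc) (auto intro!: derivative_eq_intros)
    then have eq: "(\<integral>\<^sup>+s. w s * indicator {t..r} s \<partial>lborel) = ennreal ((exp (2 * c * (r - t)) - 1) / (2 * c))"
      by (simp add: w_def diff_divide_distrib)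
    have "ennreal c * (\<integral>\<^sup>+s. w s * indicator {t..<r} s \<partial>lborel) \<le> ennreal c * (\<integral>\<^sup>+s. w s * indicator {t..r} s \<partial>lborel)"
      by (intro mult_left_mono nn_integral_mono) (auto split: split_indicator)
    also have "\<dots> = ennreal (c * ((exp (2 * c * (r - t)) - 1) / (2 * c)))"
      unfolding eq using c that by (intro ennreal_mult[symmetric]) auto
    also have "\<dots> \<le> ennreal (exp (2 * c * (r - t)) / 2)" using c by (intro ennreal_leI) (simp add: field_simps)
    also have "\<dots> = w r / 2" by (simp add: w_def divide_ennreal[symmetric])
    finally show ?thesis .
  qed
  have fA: "?A < \<infinity>"
  proof -
    have "?A \<le> (\<integral>\<^sup>+s. ennreal (exp (2 * c * (T - t))) * (\<phi> s * indicator {t..T} s) \<partial>lborel)"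
      using wT by (intro nn_integral_mono) (auto split: split_indicator intro!: mult_right_mono)
    also have "\<dots> = ennreal (exp (2 * c * (T - t))) * (\<integral>\<^sup>+s\<in>{t..T}. \<phi> s \<partial>lborel)"
      by (intro nn_integral_cmult) measurable
    also have "\<dots> < \<infinity>" using fin by (simp add: ennreal_mult_less_top)
    finally show ?thesis .
  qed
  have [measurable]: "(\<lambda>s. \<integral>\<^sup>+r\<in>{s<..T}. \<phi> r \<partial>lborel) \<in> borel_measurable borel"
  proof -
    have "(\<lambda>p. \<phi> (snd p) * indicator {p. fst p < snd p \<and> snd p \<le> T} p) \<in> borel_measurable (borel \<Otimes>\<^sub>M lborel)"
      by measurable
    moreover have "(\<lambda>p. \<phi> (snd p) * indicator {p. fst p < snd p \<and> snd p \<le> T} p) = (\<lambda>(s, r). \<phi> r * indicator {s<..T} r)"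
      by (auto simp: fun_eq_iff indicator_def)
    ultimately show ?thesis by (intro lborel.borel_measurable_nn_integral) simp
  qed
  have "?A \<le> (\<integral>\<^sup>+s. D * (w s * indicator {t..T} s) + ennreal c * (w s * (\<integral>\<^sup>+r\<in>{s<..T}. \<phi> r \<partial>lborel) * indicator {t..T} s) \<partial>lborel)"
  proof (rule nn_integral_mono)
    fix s
    have "w s * \<phi> s \<le> w s * (D + ennreal c * (\<integral>\<^sup>+r\<in>{s<..T}. \<phi> r \<partial>lborel))" if "s \<in> {t..T}"
      using le[OF that] by (intro mult_left_mono) auto
    then show "w s * \<phi> s * indicator {t..T} s \<le> D * (w s * indicator {t..T} s) +
        ennreal c * (w s * (\<integral>\<^sup>+r\<in>{s<..T}. \<phi> r \<partial>lborel) * indicator {t..T} s)"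
      by (auto split: split_indicator simp: distrib_left mult_ac)
  qed
  also have "\<dots> = D * ?W + ennreal c * (\<integral>\<^sup>+s. w s * (\<integral>\<^sup>+r\<in>{s<..T}. \<phi> r \<partial>lborel) * indicator {t..T} s \<partial>lborel)"
    by (subst nn_integral_add) (auto simp: nn_integral_cmult)
  also have "(\<integral>\<^sup>+s. w s * (\<integral>\<^sup>+r\<in>{s<..T}. \<phi> r \<partial>lborel) * indicator {t..T} s \<partial>lborel) =
      (\<integral>\<^sup>+s. \<integral>\<^sup>+r. (w s * \<phi> r * indicator {(s, r). t \<le> s \<and> s < r \<and> r \<le> T} (s, r)) \<partial>lborel \<partial>lborel)"
  proof (rule nn_integral_cong)
    fix s
    have "w s * (\<integral>\<^sup>+r\<in>{s<..T}. \<phi> r \<partial>lborel) * indicator {t..T} s =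
        (w s * indicator {t..T} s) * (\<integral>\<^sup>+r\<in>{s<..T}. \<phi> r \<partial>lborel)" by (simp add: mult_ac)
    also have "\<dots> = (\<integral>\<^sup>+r. (w s * indicator {t..T} s) * (\<phi> r * indicator {s<..T} r) \<partial>lborel)"
      by (rule nn_integral_cmult[symmetric]) measurable
    also have "\<dots> = (\<integral>\<^sup>+r. (w s * \<phi> r * indicator {(s, r). t \<le> s \<and> s < r \<and> r \<le> T} (s, r)) \<partial>lborel)"
      by (intro nn_integral_cong) (auto split: split_indicator)
    finally show "w s * (\<integral>\<^sup>+r\<in>{s<..T}. \<phi> r \<partial>lborel) * indicator {t..T} s =
        (\<integral>\<^sup>+r. (w s * \<phi> r * indicator {(s, r). t \<le> s \<and> s < r \<and> r \<le> T} (s, r)) \<partial>lborel)" .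
  qed
  also have "\<dots> = (\<integral>\<^sup>+r. \<integral>\<^sup>+s. (w s * \<phi> r * indicator {(s, r). t \<le> s \<and> s < r \<and> r \<le> T} (s, r)) \<partial>lborel \<partial>lborel)"
    by (rule lborel_pair.Fubini') (simp add: case_prod_beta')
  also have "ennreal c * \<dots> = (\<integral>\<^sup>+r. \<phi> r * indicator {t..T} r * (ennreal c * (\<integral>\<^sup>+s. w s * indicator {t..<r} s \<partial>lborel)) \<partial>lborel)"
  proof -
    have "(\<integral>\<^sup>+s. (w s * \<phi> r * indicator {(s, r). t \<le> s \<and> s < r \<and> r \<le> T} (s, r)) \<partial>lborel) =
        \<phi> r * indicator {t..T} r * (\<integral>\<^sup>+s. w s * indicator {t..<r} s \<partial>lborel)" for r
      by (subst nn_integral_cmult[symmetric]) (auto intro!: nn_integral_cong split: split_indicator simp: mult.commute)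
    moreover have "(\<lambda>r. \<phi> r * indicator {t..T} r * (\<integral>\<^sup>+s. w s * indicator {t..<r} s \<partial>lborel)) \<in> borel_measurable lborel"
    proof -
      have "(\<lambda>p. w (snd p) * indicator {p. t \<le> snd p \<and> snd p < fst p} p) \<in> borel_measurable (borel \<Otimes>\<^sub>M lborel)"
        by measurable
      moreover have "(\<lambda>p. w (snd p) * indicator {p. t \<le> snd p \<and> snd p < fst p} p) = (\<lambda>(r, s). w s * indicator {t..<r} s)"
        by (auto simp: fun_eq_iff indicator_def)
      ultimately have "(\<lambda>r. \<integral>\<^sup>+s. w s * indicator {t..<r} s \<partial>lborel) \<in> borel_measurable borel"
        by (intro lborel.borel_measurable_nn_integral) simp
      then show ?thesis by measurable
    qed
    ultimately show ?thesis by (subst nn_integral_cmult[symmetric]) (auto simp: mult_ac)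
  qed
  also have "\<dots> \<le> (\<integral>\<^sup>+r. w r * \<phi> r * indicator {t..T} r / 2 \<partial>lborel)"
  proof (rule nn_integral_mono)
    fix r
    have "\<phi> r * (ennreal c * (\<integral>\<^sup>+s. w s * indicator {t..<r} s \<partial>lborel)) \<le> \<phi> r * (w r / 2)" if "t \<le> r"
      using inner[OF that] by (intro mult_left_mono) auto
    then show "\<phi> r * indicator {t..T} r * (ennreal c * (\<integral>\<^sup>+s. w s * indicator {t..<r} s \<partial>lborel)) \<le>
        w r * \<phi> r * indicator {t..T} r / 2"
      by (auto split: split_indicator simp: ennreal_times_divide mult_ac)
  qed
  also have "\<dots> = ?A / 2" by (rule nn_integral_divide) measurable
  finally have main: "?A \<le> D * ?W + ?A / 2" by (simp add: add_left_mono)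
  \<comment> \<open>Subtracting \<open>?A / 2\<close> is legitimate because \<open>?A\<close> is
    finite; an infinite \<open>D * ?W\<close> makes the bound trivial.\<close>
  have "?A \<le> 2 * (D * ?W)"
  proof (cases "D * ?W = \<infinity>")
    case False
    then obtain d where d: "D * ?W = ennreal d" "0 \<le> d" by (cases "D * ?W") auto
    obtain a where a: "?A = ennreal a" "0 \<le> a" using fA by (cases ?A) auto
    have "ennreal a \<le> ennreal (d + a / 2)"
      using main d(2) a(2) unfolding d(1) a(1) by (simp add: divide_ennreal[symmetric] ennreal_plus)
    then have "a \<le> 2 * d" using d a by (subst (asm) ennreal_le_iff) auto
    then have "ennreal a \<le> ennreal (2 * d)" by (rule ennreal_leI)
    then show ?thesis unfolding d(1) a(1) using d(2) by (simp add: ennreal_mult)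
  next
    case True
    show ?thesis unfolding True by (simp add: ennreal_mult_top)
  qed
  also have "\<dots> \<le> 2 * (D * ennreal (exp (2 * c * (T - t)) * (T - t)))"
    using Wle by (intro mult_left_mono) auto
  also have "\<dots> = ennreal (2 * exp (2 * c * (T - t)) * (T - t)) * D"
    using tT by (simp add: ennreal_mult mult_ac)
  finally have "?A \<le> ennreal (2 * exp (2 * c * (T - t)) * (T - t)) * D" .
  moreover have "(\<integral>\<^sup>+s\<in>{t..T}. \<phi> s \<partial>lborel) \<le> ?A"
  proof (rule nn_integral_mono)
    fix s
    have "1 * \<phi> s \<le> w s * \<phi> s" if "t \<le> s" using w1[OF that] by (rule mult_right_mono) simp
    then show "\<phi> s * indicator {t..T} s \<le> w s * \<phi> s * indicator {t..T} s"
      by (auto split: split_indicator)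
  qed
  ultimately show ?thesis by (rule order_trans[rotated])
qed

text \<open>The equation integrates the driver against the completed measure, while the square
  formula is stated for \<open>lborel\<close>. A Borel version mediates, and its integrals agree on
  all Borel subsets of \<open>A\<close> at once.\<close>

lemma set_integrable_lebesgue_borel:
  fixes \<phi> :: "real \<Rightarrow> real"
  assumes A: "A \<in> sets borel" and \<phi>: "set_integrable lebesgue A \<phi>"
  obtains \<phi>' where "set_integrable lborel A \<phi>'" "AE r in lborel. r \<in> A \<longrightarrow> \<phi>' r = \<phi> r"
    "\<And>B. B \<in> sets borel \<Longrightarrow> B \<subseteq> A \<Longrightarrow> (LINT r:B|lebesgue. \<phi> r) = (LINT r:B|lborel. \<phi>' r)"
proof -
  let ?g = "\<lambda>r. indicator A r * \<phi> r"
  have g: "integrable lebesgue ?g" using \<phi> by (simp add: set_integrable_def)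
  then obtain g' where g': "g' \<in> borel_measurable lborel" "AE r in lborel. ?g r = g' r"
    using completion_ex_borel_measurable_real[of ?g lborel] by (auto simp: borel_measurable_integrable)
  have AEc: "AE r in lebesgue. ?g r = g' r" by (rule AE_completion[OF g'(2)])
  have mc: "g' \<in> borel_measurable lebesgue" by (rule measurable_completion[OF g'(1)])
  have "integrable lebesgue g'"
    using g integrable_cong_AE[OF _ mc AEc] by (auto simp: borel_measurable_integrable)
  then have ig': "integrable lborel g'" using integrable_completion[OF g'(1)] by simp
  show thesis
  proof (rule that[of g'])
    show "set_integrable lborel A g'"
      unfolding set_integrable_def using integrable_mult_indicator[OF _ ig', of A] A by simp
    show "AE r in lborel. r \<in> A \<longrightarrow> g' r = \<phi> r"
      using g'(2) by eventually_elim auto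
    fix B assume B: "B \<in> sets borel" "B \<subseteq> A"
    have "(LINT r:B|lebesgue. \<phi> r) = (LINT r|lebesgue. indicator B r * g' r)"
      unfolding set_lebesgue_integral_def
    proof (rule integral_cong_AE)
      have eq: "(\<lambda>r. indicator B r *\<^sub>R \<phi> r) = (\<lambda>r. indicator B r * ?g r)" using B by (auto simp: fun_eq_iff indicator_def)
      have Bl: "B \<in> sets lebesgue" using B by auto
      show "(\<lambda>r. indicator B r *\<^sub>R \<phi> r) \<in> borel_measurable lebesgue"
        unfolding eq using Bl by (intro borel_measurable_times[OF _ borel_measurable_integrable[OF g]]) auto
      show "(\<lambda>r. indicator B r * g' r) \<in> borel_measurable lebesgue"
        using mc Bl by (intro borel_measurable_times) auto
      show "AE r in lebesgue. indicator B r *\<^sub>R \<phi> r = indicator B r * g' r"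
        using AEc by eventually_elim (use B in \<open>auto simp: indicator_def\<close>)
    qed
    also have "\<dots> = (LINT r|lborel. indicator B r * g' r)"
      using g'(1) B by (intro integral_completion) auto
    finally show "(LINT r:B|lebesgue. \<phi> r) = (LINT r:B|lborel. g' r)"
      by (simp add: set_lebesgue_integral_def)
  qed
qed

section \<open>Ito's formula along a trajectory\<close>

context started_process
begin

lemma rate_integral_X:
  assumes om: "w \<in> Om"
  shows "rate_integral H w = (\<I> s. (\<integral>\<^sup>+y. H ((w, s), y) \<partial>nu s (X s w)))"
proof -
  have "rate_integral H w = (\<I> s. (\<integral>\<^sup>+y. H ((w, s), y) \<partial>nu s (pre s w)))"
    unfolding rate_integral_def by (rule nn_integral_restrict_space) simp
  also have "\<dots> = (\<I> s. (\<integral>\<^sup>+y. H ((w, s), y) \<partial>nu s (X s w)))"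
  proof (rule nn_integral_cong_AE)
    from AE_pre_eq[OF om] show "AE s in lborel. (\<integral>\<^sup>+y. H ((w, s), y) \<partial>nu s (pre s w)) * indicator {t..T} s =
        (\<integral>\<^sup>+y. H ((w, s), y) \<partial>nu s (X s w)) * indicator {t..T} s"
      by eventually_elim (auto split: split_indicator)
  qed
  finally show ?thesis .
qed

lemma jump_integral_measurable: "H \<in> borel_measurable PK \<Longrightarrow> jump_integral H \<in> borel_measurable \<Q>"
  and jump_integral_expectation: "H \<in> borel_measurable PK \<Longrightarrow>
    (\<E> w. jump_integral H w) = (\<E> w. rate_integral H w)"
  using compensated by (auto simp: compensated_def)

lemma section_Prd:
  assumes om: "w \<in> Om" and H: "H \<in> borel_measurable PK"
  shows "(\<lambda>(r, y). H ((w, r), y)) \<in> borel_measurable (Leb \<Otimes>\<^sub>M K)"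
proof -
  have "(\<lambda>p. (w, fst p)) \<in> Leb \<Otimes>\<^sub>M K \<rightarrow>\<^sub>M QT"
    using om by (intro measurable_Pair measurable_const measurable_fst) simp
  then have "(\<lambda>p. (w, fst p)) \<in> Leb \<Otimes>\<^sub>M K \<rightarrow>\<^sub>M Prd"
    by (rule measurable_compose[OF _ id_Prd])
  from measurable_compose[OF measurable_Pair[OF this measurable_snd] H]
  show ?thesis by (simp add: case_prod_beta')
qed

lemma pre_section: "w \<in> Om \<Longrightarrow> (\<lambda>s. pre s w) \<in> Leb \<rightarrow>\<^sub>M K"
  using measurable_Pair2[OF pre_QL, of w] by simp

lemma X_section: "w \<in> Om \<Longrightarrow> (\<lambda>s. X s w) \<in> Leb \<rightarrow>\<^sub>M K"
  using measurable_Pair2[OF X_QL, of w] by simp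

lemma id_Leb: "(\<lambda>s. s) \<in> Leb \<rightarrow>\<^sub>M restrict_space borel {0..T}"
  using t_nonneg by (auto simp: measurable_restrict_space2_iff intro: measurable_restrict_space1)

lemma kernel_real_section:
  fixes H :: "('w \<times> real) \<times> 'k \<Rightarrow> real"
  assumes om: "w \<in> Om" and H: "H \<in> borel_measurable PK"
  shows "(\<lambda>s. LINT y|nu s (pre s w). H ((w, s), y)) \<in> borel_measurable Leb"
  using section_Prd[OF om H] by (intro integral_nu_measurable[OF id_Leb pre_section[OF om]]) simp

lemma set_integral_Leb:
  fixes f :: "real \<Rightarrow> real"
  assumes "A \<subseteq> {t..T}"
  shows "(LINT s|Leb. indicator A s * f s) = (LINT s:A|lborel. f s)"
    "integrable Leb (\<lambda>s. indicator A s * f s) \<longleftrightarrow> set_integrable lborel A f"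
proof -
  have eq: "indicator {t..T} s *\<^sub>R (indicator A s * f s) = indicator A s *\<^sub>R f s" for s
    using assms by (auto simp: indicator_def)
  show "(LINT s|Leb. indicator A s * f s) = (LINT s:A|lborel. f s)"
    by (subst integral_restrict_space, simp, simp only: eq set_lebesgue_integral_def)
  show "integrable Leb (\<lambda>s. indicator A s * f s) \<longleftrightarrow> set_integrable lborel A f"
    by (subst integrable_restrict_space, simp, simp only: eq set_integrable_def)
qed

text \<open>This reduces the equation along a trajectory to a finite sum over jumps and time
  integrals. \<open>pre\<close> may replace the left limit because all times in
  \<open>{s<..T}\<close> exceed \<open>t\<close>.\<close>

lemma compensated_integral_eq:
  assumes Zm: "predictable_field Z" and om: "w \<in> Om" and s: "s \<in> {t..T}"
  shows "compensated_integral K nu X t s T Z w = (\<Sum>\<tau>\<in>jumps w \<inter> {s<..T}. Z w \<tau> (X \<tau> w)) -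
    (LINT r:{s<..T}|lborel. (LINT y|nu r (pre r w). Z w r y))"
proof -
  have sec: "(\<lambda>(r, y). Z w r y) \<in> borel_measurable (Leb \<Otimes>\<^sub>M K)"
    using section_Prd[OF om Zm] by simp
  \<comment> \<open>Predictable fields are measurable on \<open>{t..T}\<close>, whereas the jump
    measure lives on all times after \<open>t\<close>. Clamping the time extends the field without
    changing it on \<open>{s<..T}\<close>.\<close>
  let ?c = "\<lambda>r. max t (min T r)"
  have "(\<lambda>p. (?c (fst p), snd p)) \<in> restrict_space borel {t<..} \<Otimes>\<^sub>M K \<rightarrow>\<^sub>M Leb \<Otimes>\<^sub>M K"
    using t_le_T by (intro measurable_Pair measurable_restrict_space2)
      (auto intro!: measurable_compose[OF measurable_fst] measurable_restrict_space1)
  from measurable_compose[OF this sec]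
  have "(\<lambda>p. Z w (?c (fst p)) (snd p)) \<in> borel_measurable (restrict_space borel {t<..} \<Otimes>\<^sub>M K)"
    by simp
  moreover have "{s<..T} \<times> space K \<inter> space (restrict_space borel {t<..} \<Otimes>\<^sub>M K) \<in> sets (restrict_space borel {t<..} \<Otimes>\<^sub>M K)"
  proof -
    have "{s<..T} \<times> space K \<inter> space (restrict_space borel {t<..} \<Otimes>\<^sub>M K) = {s<..T} \<times> space K"
      using s by (auto simp: space_pair_measure space_restrict_space)
    also have "\<dots> \<in> sets (restrict_space borel {t<..} \<Otimes>\<^sub>M K)"
      using s by (intro pair_measureI) (auto simp: sets_restrict_space_iff)
    finally show ?thesis .
  qed
  ultimately have "(\<lambda>p. indicator ({s<..T} \<times> space K) p * Z w (?c (fst p)) (snd p)) \<in> borel_measurable (restrict_space borel {t<..} \<Otimes>\<^sub>M K)"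
    by (intro borel_measurable_times borel_measurable_indicator') (auto simp: Int_def vimage_def conj_commute)
  moreover have "indicator ({s<..T} \<times> space K) p * Z w (?c (fst p)) (snd p) =
      indicator ({s<..T} \<times> space K) p *\<^sub>R Z w (fst p) (snd p)" for p
    using s by (auto simp: indicator_def max_def min_def)
  ultimately have "(LINT p:{s<..T} \<times> space K|jump_measure K X t w. Z w (fst p) (snd p)) =
    (\<Sum>\<tau>\<in>jumps w \<inter> {s<..T}. Z w \<tau> (X \<tau> w))"
    using set_integral_jump_measure[OF om t_nonneg, of s T "\<lambda>p. Z w (fst p) (snd p)"] s by simp
  moreover have "(LINT r:{s<..T}|lborel. (LINT y|nu r (left_limit X r w). Z w r y)) =
      (LINT r:{s<..T}|lborel. (LINT y|nu r (pre r w). Z w r y))"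
    using s by (intro set_lebesgue_integral_cong) (auto simp: pre_def)
  ultimately show ?thesis by (simp add: compensated_integral_def)
qed

lemma finite_measure_Leb: "finite_measure Leb"
  using t_le_T by (intro finite_measureI) (simp add: emeasure_restrict_space)

lemma predictable_indicator_Ioc:
  assumes "s \<in> {t..T}"
  shows "(\<lambda>p. indicator {s<..T} (snd (fst p)) :: real) \<in> borel_measurable PK"
proof -
  have "Om \<times> {s<..T} \<in> sets Prd"
    using assms sets.top[of "Hist s"] by (intro Prd_Ioc) auto
  then have "(indicator (Om \<times> {s<..T}) :: _ \<Rightarrow> real) \<in> borel_measurable Prd" by simp
  from measurable_compose[OF measurable_fst this]
  have "(\<lambda>p. indicator (Om \<times> {s<..T}) (fst p) :: real) \<in> borel_measurable PK" .
  then show ?thesis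
    by (rule measurable_cong[THEN iffD1, rotated]) (auto simp: space_pair_measure indicator_def)
qed

text \<open>By \<open>\<bar>z\<bar> \<le> 1 + z^2\<close>, bounded rates and a finite time interval
  make square integrability sufficient.\<close>

lemma compensator_integrable:
  assumes om: "w \<in> Om" and Zm: "predictable_field Z"
    and Z2: "rate_integral (square_field Z) w < \<infinity>"
  shows "AE r in Leb. integrable (nu r (pre r w)) (Z w r)"
    and "integrable Leb (\<lambda>r. LINT y|nu r (pre r w). Z w r y)"
    and "s \<in> {t..T} \<Longrightarrow> set_integrable lborel {s<..T} (\<lambda>r. LINT y|nu r (pre r w). Z w r y)"
proof -
  let ?N = "\<lambda>r. nu r (pre r w)"
  have sec: "Z w r \<in> borel_measurable (?N r)" if "r \<in> {t..T}" for r
    using section_measurable_nu[OF Zm om that] by simp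
  have sec_nn: "(\<lambda>r. \<integral>\<^sup>+y. ennreal (G ((w, r), y)) \<partial>?N r) \<in> borel_measurable Leb"
    if "G \<in> borel_measurable PK" for G :: "('w \<times> real) \<times> 'k \<Rightarrow> real"
    using kernel_pre_section[of "\<lambda>p. ennreal (G p)", OF _ om] that by simp
  have mZ2: "(\<lambda>r. \<integral>\<^sup>+y. sqr (Z w r y) \<partial>?N r) \<in> borel_measurable Leb"
    using sec_nn[of "\<lambda>p. ((\<lambda>((w, s), y). Z w s y) p)\<^sup>2"] Zm by simp
  have mZa: "(\<lambda>r. \<integral>\<^sup>+y. ennreal \<bar>Z w r y\<bar> \<partial>?N r) \<in> borel_measurable Leb"
    using sec_nn[of "\<lambda>p. \<bar>(\<lambda>((w, s), y). Z w s y) p\<bar>"] Zm by simp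
  have "(\<integral>\<^sup>+r. (\<integral>\<^sup>+y. ennreal \<bar>Z w r y\<bar> \<partial>?N r) \<partial>Leb) \<le> (\<integral>\<^sup>+r. ennreal rate_bound + (\<integral>\<^sup>+y. sqr (Z w r y) \<partial>?N r) \<partial>Leb)"
  proof (rule nn_integral_mono)
    fix r assume "r \<in> space Leb"
    then have r: "r \<in> {t..T}" by simp
    have "(\<integral>\<^sup>+y. ennreal \<bar>Z w r y\<bar> \<partial>?N r) \<le> (\<integral>\<^sup>+y. 1 + sqr (Z w r y) \<partial>?N r)"
    proof (rule nn_integral_mono)
      fix y
      have "\<bar>Z w r y\<bar> \<le> 1 + (Z w r y)\<^sup>2"
        using sum_squares_bound[of "\<bar>Z w r y\<bar>" 1] by simp
      from ennreal_leI[OF this] show "ennreal \<bar>Z w r y\<bar> \<le> 1 + sqr (Z w r y)" by simp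
    qed
    also have "\<dots> = emeasure (?N r) (space (?N r)) + (\<integral>\<^sup>+y. sqr (Z w r y) \<partial>?N r)"
      using sec[OF r] by (subst nn_integral_add) auto
    also have "\<dots> \<le> ennreal rate_bound + (\<integral>\<^sup>+y. sqr (Z w r y) \<partial>?N r)"
      using emeasure_nu_le[of r "pre r w"] pre_space[OF om] r t_nonneg by (intro add_right_mono) auto
    finally show "(\<integral>\<^sup>+y. ennreal \<bar>Z w r y\<bar> \<partial>?N r) \<le> ennreal rate_bound + (\<integral>\<^sup>+y. sqr (Z w r y) \<partial>?N r)" .
  qed
  also have "\<dots> = ennreal rate_bound * emeasure Leb (space Leb) + rate_integral (square_field Z) w"
    using mZ2 by (subst nn_integral_add) (auto simp: rate_integral_def)
  also have "\<dots> < \<infinity>"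
    using Z2 finite_measure.emeasure_finite[OF finite_measure_Leb, of "space Leb"]
    by (simp add: ennreal_mult_less_top less_top)
  finally have fin: "(\<integral>\<^sup>+r. (\<integral>\<^sup>+y. ennreal \<bar>Z w r y\<bar> \<partial>?N r) \<partial>Leb) < \<infinity>" .
  then have "AE r in Leb. (\<integral>\<^sup>+y. ennreal \<bar>Z w r y\<bar> \<partial>?N r) \<noteq> \<infinity>"
    using mZa by (intro nn_integral_PInf_AE) auto
  with AE_space show "AE r in Leb. integrable (?N r) (Z w r)"
    by eventually_elim (use sec in \<open>auto simp: integrable_iff_bounded less_top\<close>)
  show i: "integrable Leb (\<lambda>r. LINT y|?N r. Z w r y)"
  proof (rule iterated_integral_pos_neg(1)[OF _ _ _ _ fin])
    show "(\<lambda>r. \<integral>\<^sup>+y. ennreal (Z w r y) \<partial>?N r) \<in> borel_measurable Leb"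
      using sec_nn[of "\<lambda>((w, s), y). Z w s y"] Zm by simp
    show "(\<lambda>r. \<integral>\<^sup>+y. ennreal (- Z w r y) \<partial>?N r) \<in> borel_measurable Leb"
      using sec_nn[of "\<lambda>p. - (\<lambda>((w, s), y). Z w s y) p"] Zm by simp
    show "(\<lambda>r. LINT y|?N r. Z w r y) \<in> borel_measurable Leb"
      using kernel_real_section[OF om Zm] by simp
  qed (use sec in simp)
  show "set_integrable lborel {s<..T} (\<lambda>r. LINT y|?N r. Z w r y)" if "s \<in> {t..T}"
  proof -
    have "integrable Leb (\<lambda>r. indicator {s<..T} r * (LINT y|?N r. Z w r y))"
      using integrable_mult_indicator[OF _ i, of "{s<..T}"] that
      by (simp add: sets_restrict_space_iff subset_iff)
    then show ?thesis using that by (subst (asm) set_integral_Leb(2)) auto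
  qed
qed

text \<open>The identity of \<open>square_backward\<close> contains \<open>2 U Z\<close>, with
  \<open>U\<close> the left limit of \<open>Y\<close>, once summed over jumps and once integrated
  against the rates. Its positive parts (\<open>H 1\<close>) and negative parts
  (\<open>H (-1)\<close>) are moved to the side where they are added, which makes the relation
  meaningful in \<open>ennreal\<close>. The two bounds ensure that these parts have finite
  expectation and can be cancelled there.\<close>

lemma ito_pathwise:
  fixes Y U :: "'w \<Rightarrow> real \<Rightarrow> real" and Z :: "'w \<Rightarrow> real \<Rightarrow> 'k \<Rightarrow> real" and \<phi> :: "real \<Rightarrow> real"
  assumes om: "w \<in> Om"
    and Zm: "predictable_field Z"
    and Um: "(\<lambda>(w, s). U w s) \<in> borel_measurable Prd"
    and U: "\<And>r. U w r = lim (\<lambda>n. Y w (grid (1 / real (Suc n)) t r))"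
    and Ys: "Y w \<in> borel_measurable Leb"
    and Y2: "(\<I> r. sqr (Y w r)) < \<infinity>"
    and Z2: "rate_integral (square_field Z) w < \<infinity>"
    and \<phi>: "set_integrable lborel {t<..T} \<phi>"
    and eq: "\<And>s. s \<in> {t..T} \<Longrightarrow> Y w s + compensated_integral K nu X t s T Z w = \<xi> + (LINT r:{s<..T}|lborel. \<phi> r)"
    and s: "s \<in> {t..T}"
  defines "H \<equiv> \<lambda>\<sigma> ((w, r), y). ennreal (indicator {s<..T} r * (\<sigma> * (2 * U w r * Z w r y)))"
  shows "rate_integral (H 1) w \<le> ennreal (4 * rate_bound) * (\<I> r. sqr (Y w r)) +
      rate_integral (square_field Z) w"
    and "rate_integral (H (-1)) w \<le> ennreal (4 * rate_bound) * (\<I> r. sqr (Y w r)) +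
      rate_integral (square_field Z) w"
    and "sqr (Y w s) + jump_integral (\<lambda>((w, r), y). ennreal (indicator {s<..T} r * (Z w r y)\<^sup>2)) w +
      (jump_integral (H 1) w + rate_integral (H (-1)) w) \<le>
    sqr \<xi> + (\<integral>\<^sup>+r\<in>{s<..T}. ennreal (2 * \<bar>\<phi> r\<bar> * \<bar>Y w r\<bar>) \<partial>lborel) +
      (jump_integral (H (-1)) w + rate_integral (H 1) w)"
proof -
  define c where "c \<tau> = Z w \<tau> (X \<tau> w)" for \<tau>
  define \<kappa> where "\<kappa> r = (LINT y|nu r (pre r w). Z w r y)" for r
  define a where "a r = \<phi> r + \<kappa> r" for r
  define J where "J = jumps w \<inter> {s<..T}"
  let ?N = "\<lambda>r. nu r (pre r w)"
  have finJ: "finite J" unfolding J_def using s by (intro finite_jumps_Ioc[OF om]) (use t_nonneg in auto)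
  have Zsec: "(\<lambda>y. Z w r y) \<in> borel_measurable (?N r)" if "r \<in> {t..T}" for r
    using section_measurable_nu[OF Zm om that] by simp
  have sec_nn: "(\<lambda>r. \<integral>\<^sup>+y. ennreal (G ((w, r), y)) \<partial>?N r) \<in> borel_measurable Leb"
    if "G \<in> borel_measurable PK" for G :: "('w \<times> real) \<times> 'k \<Rightarrow> real"
    using kernel_pre_section[of "\<lambda>p. ennreal (G p)", OF _ om] that by simp
  have N1: "emeasure (?N r) (space (?N r)) \<le> ennreal rate_bound" if "r \<in> {t..T}" for r
    using emeasure_nu_le[of r "pre r w"] pre_space[OF om] that t_nonneg by auto
  have Z2': "(\<integral>\<^sup>+r. (\<integral>\<^sup>+y. sqr (Z w r y) \<partial>?N r) \<partial>Leb) < \<infinity>"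
    using Z2 by (simp add: rate_integral_def)
  have mZ2: "(\<lambda>r. \<integral>\<^sup>+y. sqr (Z w r y) \<partial>?N r) \<in> borel_measurable Leb"
    using sec_nn[of "\<lambda>p. ((\<lambda>((w, s), y). Z w s y) p)\<^sup>2"] Zm by simp
  \<comment> \<open>Young's inequality for \<open>u r * Z w r y\<close>; the term without
    \<open>y\<close> integrates to at most \<open>rate_bound\<close> times its value.\<close>
  have bnd_le: "(\<integral>\<^sup>+r. (\<integral>\<^sup>+y. ennreal \<bar>u r * Z w r y\<bar> \<partial>?N r) \<partial>Leb) \<le>
      ennreal rate_bound * (\<integral>\<^sup>+r. sqr (u r) \<partial>Leb) + (\<integral>\<^sup>+r. (\<integral>\<^sup>+y. sqr (Z w r y) \<partial>?N r) \<partial>Leb)"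
    if u: "u \<in> borel_measurable Leb" for u
  proof -
    have "(\<integral>\<^sup>+y. ennreal \<bar>u r * Z w r y\<bar> \<partial>?N r) \<le>
        ennreal rate_bound * sqr (u r) + (\<integral>\<^sup>+y. sqr (Z w r y) \<partial>?N r)" if r: "r \<in> {t..T}" for r
    proof -
      have "(\<integral>\<^sup>+y. ennreal \<bar>u r * Z w r y\<bar> \<partial>?N r) \<le> (\<integral>\<^sup>+y. sqr (u r) + sqr (Z w r y) \<partial>?N r)"
      proof (rule nn_integral_mono)
        fix y
        have "2 * \<bar>u r * Z w r y\<bar> \<le> (u r)\<^sup>2 + (Z w r y)\<^sup>2"
          using sum_squares_bound[of "\<bar>u r\<bar>" "\<bar>Z w r y\<bar>"] by (simp add: abs_mult)
        then have "\<bar>u r * Z w r y\<bar> \<le> (u r)\<^sup>2 + (Z w r y)\<^sup>2" by (smt (verit) abs_ge_zero)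
        from ennreal_leI[OF this]
        show "ennreal \<bar>u r * Z w r y\<bar> \<le> sqr (u r) + sqr (Z w r y)"
          by simp
      qed
      also have "\<dots> = sqr (u r) * emeasure (?N r) (space (?N r)) + (\<integral>\<^sup>+y. sqr (Z w r y) \<partial>?N r)"
        using Zsec[OF r] by (subst nn_integral_add) auto
      also have "\<dots> \<le> ennreal rate_bound * sqr (u r) + (\<integral>\<^sup>+y. sqr (Z w r y) \<partial>?N r)"
        using N1[OF r] by (subst mult.commute) (intro add_right_mono mult_right_mono, auto)
      finally show ?thesis .
    qed
    then have "(\<integral>\<^sup>+r. (\<integral>\<^sup>+y. ennreal \<bar>u r * Z w r y\<bar> \<partial>?N r) \<partial>Leb) \<le>
        (\<integral>\<^sup>+r. ennreal rate_bound * sqr (u r) + (\<integral>\<^sup>+y. sqr (Z w r y) \<partial>?N r) \<partial>Leb)"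
      by (intro nn_integral_mono) simp
    also have "\<dots> = ennreal rate_bound * (\<integral>\<^sup>+r. sqr (u r) \<partial>Leb) + (\<integral>\<^sup>+r. (\<integral>\<^sup>+y. sqr (Z w r y) \<partial>?N r) \<partial>Leb)"
      using u mZ2 by (subst nn_integral_add) (auto simp: nn_integral_cmult)
    finally show ?thesis .
  qed
  have bnd: "(\<integral>\<^sup>+r. (\<integral>\<^sup>+y. ennreal \<bar>u r * Z w r y\<bar> \<partial>?N r) \<partial>Leb) < \<infinity>"
    if "u \<in> borel_measurable Leb" "(\<integral>\<^sup>+r. sqr (u r) \<partial>Leb) < \<infinity>" for u
    using le_less_trans[OF bnd_le[OF that(1)]] that(2) Z2' by (simp add: ennreal_mult_less_top)
  have m\<kappa>: "\<kappa> \<in> borel_measurable Leb"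
    using kernel_real_section[OF om Zm] by (simp add: \<kappa>_def[abs_def])
  have s\<kappa>: "set_integrable lborel {t<..T} \<kappa>"
    using compensator_integrable(3)[OF om Zm Z2, of t] t_le_T by (simp add: \<kappa>_def[abs_def])
  have sa: "set_integrable lborel {t<..T} a" unfolding a_def[abs_def] using \<phi> s\<kappa> by (rule set_integral_add)
  have sub: "set_integrable lborel {r<..T} f" if "set_integrable lborel {t<..T} f" "r \<in> {t..T}" for r and f :: "real \<Rightarrow> real"
    using that(2) by (intro set_integrable_subset[OF that(1)]) (simp_all add: subset_iff)
  have yform: "Y w r = \<xi> + (LINT q:{r<..T}|lborel. a q) - (\<Sum>\<tau>\<in>jumps w \<inter> {r<..T}. c \<tau>)" if r: "r \<in> {t..T}" for r
  proof -
    have "(LINT q:{r<..T}|lborel. a q) = (LINT q:{r<..T}|lborel. \<phi> q) + (LINT q:{r<..T}|lborel. \<kappa> q)"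
      unfolding a_def by (rule set_integral_add(2)[OF sub[OF \<phi> r] sub[OF s\<kappa> r]])
    then show ?thesis
      using eq[OF r] unfolding compensated_integral_eq[OF Zm om r] c_def \<kappa>_def by simp
  qed
  have Jr: "J \<inter> {r<..} = jumps w \<inter> {r<..T}" if "r \<in> {s..T}" for r using that by (auto simp: J_def)
  have "s \<le> T" using s by simp
  have sub_s: "r \<in> {s..T} \<Longrightarrow> r \<in> {t..T}" for r using s by auto
  have Jsub: "J \<subseteq> {s<..T}" by (simp add: J_def)
  have yJ: "Y w r = \<xi> + (LINT q:{r<..T}|lborel. a q) - (\<Sum>\<tau>\<in>J \<inter> {r<..}. c \<tau>)" if "r \<in> {s..T}" for r
    using yform[OF sub_s[OF that]] Jr[OF that] by simp
  note sb = square_backward[of J s T a "Y w" \<xi> c, OF finJ Jsub \<open>s \<le> T\<close> sub[OF sa s] yJ]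
  \<comment> \<open>The equation along this trajectory supplies the left limit that the grid limit
    \<open>U\<close> was meant to capture: the value of \<open>Y\<close> without its jump at
    \<open>r\<close>.\<close>
  have UY: "U w r = Y w r - (if r \<in> jumps w then c r else 0)" if r: "r \<in> {t<..T}" for r
  proof -
    have "(\<lambda>n. Y w (grid (1 / real (Suc n)) t r)) \<longlonglongrightarrow> Y w r - (if r \<in> jumps w \<inter> {t<..T} then c r else 0)"
    proof (rule left_limit_backward[where u = "\<lambda>n. grid (1 / real (Suc n)) t r", OF finite_jumps_tT[OF om] _ sa])
      show "Y w r = \<xi> + (LINT q:{r<..T}|lborel. a q) - (\<Sum>\<tau>\<in>jumps w \<inter> {t<..T} \<inter> {r<..}. c \<tau>)" if "r \<in> {t..T}" for r
      proof -
        have "jumps w \<inter> {t<..T} \<inter> {r<..} = jumps w \<inter> {r<..T}" using that by auto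
        then show ?thesis using yform[OF that] by simp
      qed
      show "grid (1 / real (Suc n)) t r \<in> {t..<r}" for n
        using grid_bounds[of "1 / real (Suc n)" t r] r by auto
      show "(\<lambda>n. grid (1 / real (Suc n)) t r) \<longlonglongrightarrow> r"
        using grid_tendsto[OF _ inverse_Suc_tendsto, of t r] r by (auto simp: filterlim_at)
    qed (use r in auto)
    then show ?thesis using r unfolding U by (auto dest: limI)
  qed
  have UY_AE: "AE r in Leb. U w r = Y w r"
  proof -
    have "AE r in lborel. r \<notin> insert t (jumps w \<inter> {t<..T})"
      using finite_jumps_tT[OF om] by (intro AE_not_in finite_imp_null_set_lborel) simp
    then have "AE r in lborel. r \<in> {t..T} \<longrightarrow> U w r = Y w r"
      by eventually_elim (use UY in force)
    then show ?thesis by (subst AE_restrict_space_iff) auto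
  qed
  have mU: "U w \<in> borel_measurable Leb"
    using measurable_Pair2[OF Prd_QL[OF Um], of w] om by simp
  \<comment> \<open>Squaring the factor 2 of \<open>2 * U * Z\<close> produces the 4 in
    \<open>4 * rate_bound\<close>.\<close>
  have U2_le: "(\<integral>\<^sup>+r. sqr (2 * (indicator {s<..T} r * U w r)) \<partial>Leb) \<le> 4 * (\<I> r. sqr (Y w r))"
  proof -
    have "(\<integral>\<^sup>+r. sqr (2 * (indicator {s<..T} r * U w r)) \<partial>Leb) \<le> (\<integral>\<^sup>+r. 4 * sqr (U w r) \<partial>Leb)"
      by (intro nn_integral_mono) (auto simp: indicator_def power_mult_distrib ennreal_mult)
    also have "\<dots> = 4 * (\<integral>\<^sup>+r. sqr (U w r) \<partial>Leb)" using mU by (intro nn_integral_cmult) simp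
    also have "(\<integral>\<^sup>+r. sqr (U w r) \<partial>Leb) = (\<integral>\<^sup>+r. sqr (Y w r) \<partial>Leb)"
      using UY_AE by (intro nn_integral_cong_AE) auto
    also have "\<dots> = (\<I> r. sqr (Y w r))" by (rule nn_integral_restrict_space) simp
    finally show ?thesis .
  qed
  then have U2: "(\<integral>\<^sup>+r. sqr (2 * (indicator {s<..T} r * U w r)) \<partial>Leb) < \<infinity>"
    by (rule le_less_trans) (use Y2 in \<open>simp add: ennreal_mult_less_top\<close>)
  have mind: "(indicator {s<..T} :: real \<Rightarrow> real) \<in> borel_measurable Leb" by (intro measurable_restrict_space1) simp
  let ?h = "\<lambda>r y. indicator {s<..T} r * (2 * U w r * Z w r y)"
  have mU': "(\<lambda>p. U (fst (fst p)) (snd (fst p))) \<in> borel_measurable PK"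
    using measurable_compose[OF measurable_fst Um] by (simp add: case_prod_beta')
  note mind' = predictable_indicator_Ioc[OF s]
  have mh: "(\<lambda>((w, r), y). indicator {s<..T} r * (2 * U w r * Z w r y)) \<in> borel_measurable PK"
    using mU' mind' Zm by (simp add: case_prod_beta')
  have mu: "(\<lambda>r. 2 * (indicator {s<..T} r * U w r)) \<in> borel_measurable Leb"
    using borel_measurable_times[OF mind mU] by simp
  have hfin: "(\<integral>\<^sup>+r. (\<integral>\<^sup>+y. ennreal \<bar>?h r y\<bar> \<partial>?N r) \<partial>Leb) < \<infinity>"
    using bnd[OF mu U2] by (simp add: mult_ac)
  have hle: "(\<integral>\<^sup>+r. (\<integral>\<^sup>+y. ennreal \<bar>?h r y\<bar> \<partial>?N r) \<partial>Leb) \<le>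
      ennreal (4 * rate_bound) * (\<I> r. sqr (Y w r)) +
      rate_integral (square_field Z) w"
  proof -
    have heq: "?h r y = 2 * (indicator {s<..T} r * U w r) * Z w r y" for r y by simp
    have "(\<integral>\<^sup>+r. (\<integral>\<^sup>+y. ennreal \<bar>?h r y\<bar> \<partial>?N r) \<partial>Leb) \<le>
      ennreal rate_bound * (\<integral>\<^sup>+r. sqr (2 * (indicator {s<..T} r * U w r)) \<partial>Leb) +
        (\<integral>\<^sup>+r. (\<integral>\<^sup>+y. sqr (Z w r y) \<partial>?N r) \<partial>Leb)"
      unfolding heq by (rule bnd_le[OF mu])
    also have "\<dots> \<le> ennreal rate_bound * (4 * (\<I> r. sqr (Y w r))) +
        (\<integral>\<^sup>+r. (\<integral>\<^sup>+y. sqr (Z w r y) \<partial>?N r) \<partial>Leb)"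
      by (intro add_right_mono mult_left_mono U2_le) simp
    also have "\<dots> = ennreal (4 * rate_bound) * (\<I> r. sqr (Y w r)) +
      rate_integral (square_field Z) w"
      using rate_bound_nonneg by (simp add: ennreal_mult rate_integral_def mult_ac)
    finally show ?thesis .
  qed
  have h\<kappa>: "(LINT y|?N r. ?h r y) = indicator {s<..T} r * (2 * U w r * \<kappa> r)" for r
    by (simp add: \<kappa>_def)
  have hsec: "?h r \<in> borel_measurable (?N r)" if "r \<in> space Leb" for r
    using Zsec that by simp
  have hp: "(\<lambda>r. \<integral>\<^sup>+y. ennreal (?h r y) \<partial>?N r) \<in> borel_measurable Leb"
    using sec_nn[OF mh] by simp
  have hn: "(\<lambda>r. \<integral>\<^sup>+y. ennreal (- ?h r y) \<partial>?N r) \<in> borel_measurable Leb"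
    using sec_nn[OF borel_measurable_uminus[OF mh]] by (simp add: case_prod_beta')
  have hi: "(\<lambda>r. LINT y|?N r. ?h r y) \<in> borel_measurable Leb"
    unfolding h\<kappa> using mind mU m\<kappa> by simp
  note ipn = iterated_integral_pos_neg[of Leb ?h ?N, OF hsec hp hn hi hfin]
  have RH: "rate_integral (H 1) w = (\<integral>\<^sup>+r. (\<integral>\<^sup>+y. ennreal (?h r y) \<partial>?N r) \<partial>Leb)"
    "rate_integral (H (-1)) w = (\<integral>\<^sup>+r. (\<integral>\<^sup>+y. ennreal (- ?h r y) \<partial>?N r) \<partial>Leb)"
    by (simp_all add: rate_integral_def H_def)
  have "rate_integral (H 1) w \<le> (\<integral>\<^sup>+r. (\<integral>\<^sup>+y. ennreal \<bar>?h r y\<bar> \<partial>?N r) \<partial>Leb)"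
    unfolding RH by (intro nn_integral_mono ennreal_leI) (rule abs_ge_self)
  from order_trans[OF this hle]
  show "rate_integral (H 1) w \<le> ennreal (4 * rate_bound) * (\<I> r. sqr (Y w r)) +
      rate_integral (square_field Z) w" .
  have "rate_integral (H (-1)) w \<le> (\<integral>\<^sup>+r. (\<integral>\<^sup>+y. ennreal \<bar>?h r y\<bar> \<partial>?N r) \<partial>Leb)"
    unfolding RH by (intro nn_integral_mono ennreal_leI) (rule abs_ge_minus_self)
  from order_trans[OF this hle]
  show "rate_integral (H (-1)) w \<le> ennreal (4 * rate_bound) * (\<I> r. sqr (Y w r)) +
      rate_integral (square_field Z) w" .
  obtain Rp Rm where R: "rate_integral (H 1) w = ennreal Rp" "0 \<le> Rp" "rate_integral (H (-1)) w = ennreal Rm" "0 \<le> Rm"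
    using ipn(3,4) unfolding RH[symmetric] by (cases "rate_integral (H 1) w"; cases "rate_integral (H (-1)) w") auto
  \<comment> \<open>The drift contributed by the compensator is the rate integral of
    \<open>2 U Z\<close>, split into its two parts; \<open>Y\<close> and \<open>U\<close> agree at
    almost every time.\<close>
  have I\<kappa>: "set_integrable lborel {s<..T} (\<lambda>r. Y w r * \<kappa> r)" "2 * (LINT r:{s<..T}|lborel. Y w r * \<kappa> r) = Rp - Rm"
  proof -
    have AEeq: "AE r in Leb. (LINT y|?N r. ?h r y) = indicator {s<..T} r * (2 * (Y w r * \<kappa> r))"
      unfolding h\<kappa> using UY_AE by eventually_elim simp
    have m: "(\<lambda>r. indicator {s<..T} r * (2 * (Y w r * \<kappa> r))) \<in> borel_measurable Leb"
      using mind Ys m\<kappa> by simp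
    have "integrable Leb (\<lambda>r. indicator {s<..T} r * (2 * (Y w r * \<kappa> r)))"
      using ipn(1) integrable_cong_AE[OF hi m AEeq] by simp
    then have i2: "set_integrable lborel {s<..T} (\<lambda>r. 2 * (Y w r * \<kappa> r))"
      using s by (subst (asm) set_integral_Leb(2)) auto
    then show "set_integrable lborel {s<..T} (\<lambda>r. Y w r * \<kappa> r)" by simp
    have "(LINT r:{s<..T}|lborel. 2 * (Y w r * \<kappa> r)) = (LINT r|Leb. indicator {s<..T} r * (2 * (Y w r * \<kappa> r)))"
      using s by (subst set_integral_Leb(1)) auto
    also have "\<dots> = (LINT r|Leb. LINT y|?N r. ?h r y)"
      using AEeq by (intro integral_cong_AE m hi) (auto elim: eventually_mono)
    also have "\<dots> = enn2real (rate_integral (H 1) w) - enn2real (rate_integral (H (-1)) w)"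
      unfolding RH by (rule ipn(2))
    also have "\<dots> = Rp - Rm" using R by simp
    finally show "2 * (LINT r:{s<..T}|lborel. Y w r * \<kappa> r) = Rp - Rm" by simp
  qed
  have I\<phi>: "set_integrable lborel {s<..T} (\<lambda>r. \<phi> r * Y w r)"
    "(LINT r:{s<..T}|lborel. a r * Y w r) = (LINT r:{s<..T}|lborel. \<phi> r * Y w r) + (LINT r:{s<..T}|lborel. Y w r * \<kappa> r)"
  proof -
    have eq: "\<phi> r * Y w r = a r * Y w r - Y w r * \<kappa> r" for r by (simp add: a_def algebra_simps)
    show i: "set_integrable lborel {s<..T} (\<lambda>r. \<phi> r * Y w r)"
      unfolding eq by (rule set_integral_diff(1)[OF sb(1) I\<kappa>(1)])
    show "(LINT r:{s<..T}|lborel. a r * Y w r) = (LINT r:{s<..T}|lborel. \<phi> r * Y w r) + (LINT r:{s<..T}|lborel. Y w r * \<kappa> r)"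
      using set_integral_diff(2)[OF sb(1) I\<kappa>(1)] unfolding eq by linarith
  qed
  let ?I = "\<integral>\<^sup>+r\<in>{s<..T}. ennreal (2 * \<bar>\<phi> r\<bar> * \<bar>Y w r\<bar>) \<partial>lborel"
  have I: "ennreal (2 * (LINT r:{s<..T}|lborel. \<bar>\<phi> r * Y w r\<bar>)) = ?I"
  proof -
    have "integrable lborel (\<lambda>r. 2 * (indicator {s<..T} r *\<^sub>R \<bar>\<phi> r * Y w r\<bar>))"
      using set_integrable_abs[OF I\<phi>(1)] by (simp add: set_integrable_def)
    then have "ennreal (LINT r|lborel. 2 * (indicator {s<..T} r *\<^sub>R \<bar>\<phi> r * Y w r\<bar>)) =
        (\<integral>\<^sup>+r. ennreal (2 * (indicator {s<..T} r *\<^sub>R \<bar>\<phi> r * Y w r\<bar>)) \<partial>lborel)"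
      by (intro nn_integral_eq_integral[symmetric]) auto
    also have "\<dots> = ?I" by (intro nn_integral_cong) (auto simp: indicator_def abs_mult mult.assoc)
    finally show ?thesis by (simp add: set_lebesgue_integral_def)
  qed
  define Ir where "Ir = 2 * (LINT r:{s<..T}|lborel. \<bar>\<phi> r * Y w r\<bar>)"
  have Ir: "2 * (LINT r:{s<..T}|lborel. \<phi> r * Y w r) \<le> Ir" "0 \<le> Ir"
  proof -
    show "2 * (LINT r:{s<..T}|lborel. \<phi> r * Y w r) \<le> Ir"
      unfolding Ir_def using set_integrable_abs[OF I\<phi>(1)] I\<phi>(1)
      by (intro mult_left_mono set_integral_mono) auto
    show "0 \<le> Ir" unfolding Ir_def set_lebesgue_integral_def by (intro mult_nonneg_nonneg integral_nonneg) auto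
  qed
  have jsum: "jump_integral G w = ennreal (\<Sum>\<tau>\<in>J. g \<tau>)"
    if "\<And>\<tau>. \<tau> \<in> {s<..T} \<Longrightarrow> G ((w, \<tau>), X \<tau> w) = ennreal (g \<tau>)" "\<And>\<tau>. \<tau> \<notin> {s<..T} \<Longrightarrow> G ((w, \<tau>), X \<tau> w) = 0"
      "\<And>\<tau>. 0 \<le> g \<tau>" for G g
  proof -
    have "jump_integral G w = (\<Sum>\<tau>\<in>J. G ((w, \<tau>), X \<tau> w))"
      unfolding jump_integral_sum[OF om] J_def
    proof (rule sum.mono_neutral_right[OF finite_jumps_tT[OF om]])
      show "jumps w \<inter> {s<..T} \<subseteq> jumps w \<inter> {t<..T}" using s by auto
      show "\<forall>\<tau>\<in>jumps w \<inter> {t<..T} - jumps w \<inter> {s<..T}. G ((w, \<tau>), X \<tau> w) = 0"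
        using that(2) by blast
    qed
    also have "\<dots> = (\<Sum>\<tau>\<in>J. ennreal (g \<tau>))" using that(1) by (intro sum.cong) (auto simp: J_def)
    also have "\<dots> = ennreal (\<Sum>\<tau>\<in>J. g \<tau>)" using that(3) by (intro sum_ennreal)
    finally show ?thesis .
  qed
  have jc: "jump_integral (\<lambda>((w, r), y). ennreal (indicator {s<..T} r * (Z w r y)\<^sup>2)) w = ennreal (\<Sum>\<tau>\<in>J. (c \<tau>)\<^sup>2)"
    by (rule jsum) (auto simp: c_def)
  have jp: "jump_integral (H 1) w = ennreal (\<Sum>\<tau>\<in>J. max 0 (2 * U w \<tau> * c \<tau>))"
    by (rule jsum) (auto simp: c_def H_def max_def ennreal_neg)
  have jm: "jump_integral (H (-1)) w = ennreal (\<Sum>\<tau>\<in>J. max 0 (- (2 * U w \<tau> * c \<tau>)))"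
    by (rule jsum) (auto simp: c_def H_def max_def ennreal_neg)
  have "2 * (\<Sum>\<tau>\<in>J. (Y w \<tau> - c \<tau>) * c \<tau>) = (\<Sum>\<tau>\<in>J. 2 * U w \<tau> * c \<tau>)"
    unfolding sum_distrib_left using s UY by (intro sum.cong) (auto simp: J_def)
  also have "\<dots> = (\<Sum>\<tau>\<in>J. max 0 (2 * U w \<tau> * c \<tau>)) - (\<Sum>\<tau>\<in>J. max 0 (- (2 * U w \<tau> * c \<tau>)))"
    unfolding sum_subtractf[symmetric] by (intro sum.cong) (auto simp: max_def)
  finally have real_ineq: "(Y w s)\<^sup>2 + (\<Sum>\<tau>\<in>J. (c \<tau>)\<^sup>2) + ((\<Sum>\<tau>\<in>J. max 0 (2 * U w \<tau> * c \<tau>)) + Rm) \<le>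
      \<xi>\<^sup>2 + Ir + ((\<Sum>\<tau>\<in>J. max 0 (- (2 * U w \<tau> * c \<tau>))) + Rp)"
    using sb(2) I\<kappa>(2) Ir(1) unfolding I\<phi>(2) by simp
  have nn: "0 \<le> (\<Sum>\<tau>\<in>J. (c \<tau>)\<^sup>2)" "0 \<le> (\<Sum>\<tau>\<in>J. max 0 (2 * U w \<tau> * c \<tau>))" "0 \<le> (\<Sum>\<tau>\<in>J. max 0 (- (2 * U w \<tau> * c \<tau>)))"
    by (auto intro: sum_nonneg)
  from ennreal_leI[OF real_ineq]
  show "sqr (Y w s) + jump_integral (\<lambda>((w, r), y). ennreal (indicator {s<..T} r * (Z w r y)\<^sup>2)) w +
      (jump_integral (H 1) w + rate_integral (H (-1)) w) \<le>
    sqr \<xi> + (\<integral>\<^sup>+r\<in>{s<..T}. ennreal (2 * \<bar>\<phi> r\<bar> * \<bar>Y w r\<bar>) \<partial>lborel) +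
      (jump_integral (H (-1)) w + rate_integral (H 1) w)"
    unfolding jc jp jm R(1,3) I[symmetric] Ir_def[symmetric]
    using nn R(2,4) Ir(2) by (simp add: ennreal_plus)
qed

section \<open>A priori estimate\<close>

text \<open>The coefficient of \<open>y^2\<close> in \<open>driver_product_bound\<close>:
  \<open>2 L'\<close> from the dependence of the driver on \<open>y\<close>, \<open>2 L^2\<close>
  from Young's inequality that leaves only \<open>q / 2\<close>, and 1 from the inhomogeneity
  \<open>d\<close>.\<close>

definition growth_const :: "real \<Rightarrow> real \<Rightarrow> real" where
  "growth_const L L' = 2 * L' + 2 * L\<^sup>2 + 1"

text \<open>With \<open>G\<close> the constant of \<open>gronwall_backward\<close> for
  \<open>c = growth_const L L'\<close>, the \<open>Y\<close>-part of the norm is bounded by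
  \<open>G\<close> and the \<open>Z\<close>-part by \<open>2 (1 + c G)\<close>, both times the size
  of the data; the constant is their sum.\<close>

definition estimate_const :: "real \<Rightarrow> real \<Rightarrow> real" where
  "estimate_const L L' = (1 + 2 * growth_const L L') *
     (2 * exp (2 * growth_const L L' * (T - t)) * (T - t)) + 2"

lemma growth_const_pos: "0 \<le> L' \<Longrightarrow> 0 < growth_const L L'"
  unfolding growth_const_def by (intro add_nonneg_pos add_nonneg_nonneg) auto

lemma estimate_const_nonneg: "0 \<le> L' \<Longrightarrow> 0 \<le> estimate_const L L'"
  unfolding estimate_const_def using growth_const_pos[of L' L] t_le_T
  by (intro add_nonneg_nonneg mult_nonneg_nonneg) auto

lemma bsde_norm_sq_eq:
  "norm_sq Y Z = (\<E> w. (\<I> s. sqr (Y w s))) +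
    (\<E> w. rate_integral (square_field Z) w)"
  unfolding bsde_norm_sq_def
  by (intro arg_cong2[where f = "(+)"] refl nn_integral_cong) (simp add: rate_integral_X)

lemma nn_integral_Leb:
  fixes f :: "real \<Rightarrow> ennreal"
  assumes "A \<subseteq> {t..T}"
  shows "(\<integral>\<^sup>+r\<in>A. f r \<partial>lborel) = (\<integral>\<^sup>+r. f r * indicator A r \<partial>Leb)"
  using assms by (subst nn_integral_restrict_space) (auto intro!: nn_integral_cong split: split_indicator)

lemma borel_measurable_Leb_indicator:
  fixes f :: "real \<Rightarrow> ennreal"
  assumes f: "f \<in> borel_measurable Leb" and A: "A \<in> sets borel" "A \<subseteq> {t..T}"
  shows "(\<lambda>r. f r * indicator A r) \<in> borel_measurable lborel"
proof -
  have "(\<lambda>r. f r * indicator {t..T} r) \<in> borel_measurable borel"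
    using f by (subst (asm) borel_measurable_restrict_space_iff_ennreal) auto
  then have "(\<lambda>r. f r * indicator {t..T} r * indicator A r) \<in> borel_measurable borel"
    using A(1) by simp
  moreover have "f r * indicator {t..T} r * indicator A r = f r * indicator A r" for r
    using A(2) by (auto split: split_indicator)
  ultimately show ?thesis by simp
qed

lemma measurable_set_nn_integral_QL:
  fixes f :: "'w \<Rightarrow> real \<Rightarrow> ennreal"
  assumes f: "(\<lambda>(w, r). f w r) \<in> borel_measurable QT" and A: "A \<in> sets borel" "A \<subseteq> {t..T}"
  shows "(\<lambda>w. \<integral>\<^sup>+r\<in>A. f w r \<partial>lborel) \<in> borel_measurable \<Q>"
    and "(\<E> w. (\<integral>\<^sup>+r\<in>A. f w r \<partial>lborel)) = (\<integral>\<^sup>+r\<in>A. (\<E> w. f w r) \<partial>lborel)"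
    and "(\<lambda>r. (\<E> w. f w r) * indicator {t..T} r) \<in> borel_measurable borel"
proof -
  have "(indicator A :: real \<Rightarrow> ennreal) \<in> borel_measurable Leb" using A by (intro measurable_restrict_space1) simp
  from measurable_compose[OF measurable_snd this]
  have "(\<lambda>p. indicator A (snd p) :: ennreal) \<in> borel_measurable QT" .
  then have fA: "(\<lambda>(w, r). f w r * indicator A r) \<in> borel_measurable QT"
    using f unfolding case_prod_beta' by (intro borel_measurable_times_ennreal)
  show "(\<lambda>w. \<integral>\<^sup>+r\<in>A. f w r \<partial>lborel) \<in> borel_measurable \<Q>"
    unfolding nn_integral_Leb[OF A(2)] by (rule L.borel_measurable_nn_integral[OF fA])
  have "(\<E> w. (\<integral>\<^sup>+r\<in>A. f w r \<partial>lborel)) = (\<integral>\<^sup>+r. (\<E> w. f w r * indicator A r) \<partial>Leb)"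
    unfolding nn_integral_Leb[OF A(2)] using QL.Fubini'[OF fA] by simp
  also have "\<dots> = (\<integral>\<^sup>+r. (\<E> w. f w r) * indicator A r \<partial>Leb)"
    using measurable_Pair1[OF f] by (intro nn_integral_cong nn_integral_multc) simp
  finally show "(\<E> w. (\<integral>\<^sup>+r\<in>A. f w r \<partial>lborel)) = (\<integral>\<^sup>+r\<in>A. (\<E> w. f w r) \<partial>lborel)"
    unfolding nn_integral_Leb[OF A(2)] .
  have "(\<lambda>r. \<integral>\<^sup>+w. f w r \<partial>\<Q>) \<in> borel_measurable Leb"
    using measurable_pair_swap[OF f] by (intro Q.borel_measurable_nn_integral) (simp add: case_prod_beta')
  then show "(\<lambda>r. (\<E> w. f w r) * indicator {t..T} r) \<in> borel_measurable borel"
    by (subst (asm) borel_measurable_restrict_space_iff_ennreal) auto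
qed

text \<open>Young's inequality is balanced so that \<open>q\<close> receives the coefficient
  \<open>1/2\<close>: the square formula provides the full \<open>Z\<close>-norm on the other side,
  so half of it survives.\<close>

lemma driver_product_bound:
  fixes y z d L L' :: real
  assumes "0 \<le> L" "0 \<le> L'" "\<bar>u\<bar> \<le> L' * \<bar>y\<bar> + L * sqrt q + \<bar>d\<bar>" "0 \<le> q"
  shows "2 * \<bar>u\<bar> * \<bar>y\<bar> \<le> growth_const L L' * y\<^sup>2 + d\<^sup>2 + q / 2"
proof -
  have "2 * \<bar>u\<bar> * \<bar>y\<bar> \<le> 2 * (L' * \<bar>y\<bar> + L * sqrt q + \<bar>d\<bar>) * \<bar>y\<bar>"
    using assms(3) by (intro mult_right_mono) auto
  also have "\<dots> = 2 * L' * \<bar>y\<bar>\<^sup>2 + 2 * (L * \<bar>y\<bar>) * sqrt q + 2 * \<bar>d\<bar> * \<bar>y\<bar>"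
    by (simp add: power2_eq_square algebra_simps)
  also have "2 * \<bar>d\<bar> * \<bar>y\<bar> \<le> \<bar>d\<bar>\<^sup>2 + \<bar>y\<bar>\<^sup>2" by (rule sum_squares_bound)
  also have "2 * (L * \<bar>y\<bar>) * sqrt q \<le> 2 * (L * \<bar>y\<bar>)\<^sup>2 + (sqrt q)\<^sup>2 / 2"
    using sum_squares_bound[of "2 * (L * \<bar>y\<bar>)" "sqrt q"] by (simp add: power2_eq_square)
  finally show ?thesis
    using assms by (simp add: growth_const_def power_mult_distrib algebra_simps)
qed

text \<open>In expectation the compensation formula cancels the parts of the martingale term and
  turns the jump sum of \<open>Z^2\<close> into the \<open>Z\<close>-norm. The driver enters only
  through the bound on \<open>\<phi>\<close>, so that the estimate also covers differences of
  solutions, which solve no equation with a driver of their own.\<close>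

theorem a_priori_estimate:
  fixes Y :: "'w \<Rightarrow> real \<Rightarrow> real" and Z :: "'w \<Rightarrow> real \<Rightarrow> 'k \<Rightarrow> real"
    and \<phi> \<delta> :: "'w \<Rightarrow> real \<Rightarrow> real" and \<xi> :: "'w \<Rightarrow> real"
  assumes L: "0 \<le> L" "0 \<le> L'"
    and Ym: "progressive_field Y"
    and Zm: "predictable_field Z"
    and fin: "norm_sq Y Z < \<infinity>"
    and \<xi>m: "\<xi> \<in> borel_measurable \<Q>"
    and \<delta>m: "(\<lambda>(w, r). \<delta> w r) \<in> borel_measurable QT"
    and \<phi>i: "AE w in \<Q>. set_integrable lebesgue {t<..T} (\<phi> w)"
    and eq: "AE w in \<Q>. \<forall>s\<in>{t..T}. Y w s + compensated_integral K nu X t s T Z w =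
      \<xi> w + (LINT r:{s<..T}|lebesgue. \<phi> w r)"
    and bd: "AE w in \<Q>. AE r in lborel. r \<in> {t<..T} \<longrightarrow>
      \<bar>\<phi> w r\<bar> \<le> L' * \<bar>Y w r\<bar> + L * sqrt (LINT y|nu r (X r w). \<bar>Z w r y\<bar>\<^sup>2) + \<bar>\<delta> w r\<bar>"
  shows "norm_sq Y Z \<le> ennreal (estimate_const L L') *
    ((\<E> w. sqr (\<xi> w)) + (\<E> w. (\<I> r. sqr (\<delta> w r))))"
proof -
  define c where "c = growth_const L L'"
  have c: "0 < c" using growth_const_pos[OF L(2)] by (simp add: c_def)
  define Zsq where "Zsq = (\<lambda>((w :: 'w, r :: real), y :: 'k). sqr (Z w r y))"
  define Zs where "Zs s = (\<lambda>((w :: 'w, r :: real), y :: 'k). ennreal (indicator {s<..T} r * (Z w r y)\<^sup>2))" for s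
  define U where "U w r = lim (\<lambda>n. Y w (grid (1 / real (Suc n)) t r))" for w r
  define H where "H s \<sigma> = (\<lambda>((w :: 'w, r), y). ennreal (indicator {s<..T} r * (\<sigma> * (2 * U w r * Z w r y))))" for s \<sigma>
  define A where "A w = (\<I> s. sqr (Y w s))" for w
  define E where "E s = (\<E> w. sqr (Y w s))" for s
  define D where "D = (\<E> w. sqr (\<xi> w)) + (\<E> w. (\<I> r. sqr (\<delta> w r)))"
  have YQL: "(\<lambda>(w, s). sqr (Y w s)) \<in> borel_measurable QT"
    using Prg_QL[OF Ym] by (simp add: case_prod_beta')
  have \<delta>QL: "(\<lambda>(w, s). sqr (\<delta> w s)) \<in> borel_measurable QT"
    using \<delta>m by (simp add: case_prod_beta')
  have Um: "(\<lambda>(w, s). U w s) \<in> borel_measurable Prd"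
    using grid_lim_predictable[OF Ym] by (simp add: U_def)
  have Zsqm: "Zsq \<in> borel_measurable PK"
    using Zm by (simp add: Zsq_def case_prod_beta')
  have Zsm: "Zs s \<in> borel_measurable PK" if "s \<in> {t..T}" for s
    using Zm predictable_indicator_Ioc[OF that] by (simp add: Zs_def case_prod_beta')
  have Um': "(\<lambda>p. U (fst (fst p)) (snd (fst p))) \<in> borel_measurable PK"
    using measurable_compose[OF measurable_fst Um] by (simp add: case_prod_beta')
  have Hm: "H s \<sigma> \<in> borel_measurable PK" if "s \<in> {t..T}" for s \<sigma>
    using Zm predictable_indicator_Ioc[OF that] Um' by (simp add: H_def case_prod_beta')
  have mA: "A \<in> borel_measurable \<Q>"
    unfolding A_def[abs_def] by (rule measurable_set_nn_integral_QL(1)[OF YQL]) auto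
  have norm: "norm_sq Y Z = (\<E> w. A w) + (\<E> w. rate_integral Zsq w)"
    unfolding bsde_norm_sq_eq A_def Zsq_def ..
  then have finA: "(\<E> w. A w) < \<infinity>" and finZ: "(\<E> w. rate_integral Zsq w) < \<infinity>" using fin by auto
  have Zs_le: "Zs s p \<le> Zsq p" for s p by (auto simp: Zs_def Zsq_def indicator_def split: prod.split)
  have finZs: "(\<E> w. rate_integral (Zs s) w) < \<infinity>" for s
    by (rule le_less_trans[OF nn_integral_mono finZ]) (rule rate_integral_mono[OF Zs_le])
  have good: "AE w in \<Q>. A w < \<infinity> \<and> rate_integral Zsq w < \<infinity> \<and> w \<in> Om"
    using nn_integral_PInf_AE[OF mA] nn_integral_PInf_AE[OF rate_integral_measurable[OF Zsqm]] finA finZ AE_space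
    by (auto simp: less_top)
  have pathwise: "AE w in \<Q>.
      (rate_integral (H s 1) w \<le> ennreal (4 * rate_bound) * A w + rate_integral Zsq w \<and>
       rate_integral (H s (-1)) w \<le> ennreal (4 * rate_bound) * A w + rate_integral Zsq w) \<and>
      sqr (Y w s) + jump_integral (Zs s) w + (jump_integral (H s 1) w + rate_integral (H s (-1)) w) \<le>
      sqr (\<xi> w) + (ennreal c * (\<integral>\<^sup>+r\<in>{s<..T}. sqr (Y w r) \<partial>lborel) +
        (\<integral>\<^sup>+r\<in>{s<..T}. sqr (\<delta> w r) \<partial>lborel) + rate_integral (Zs s) w / 2) +
      (jump_integral (H s (-1)) w + rate_integral (H s 1) w)"
    if s: "s \<in> {t..T}" for s
    using good \<phi>i eq bd
  proof eventually_elim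
    case (elim w)
    then have om: "w \<in> Om" by simp
    \<comment> \<open>The Borel version depends on the trajectory. This does no harm, since the
      resulting inequality no longer contains it when expectations are taken.\<close>
    obtain \<phi>' where \<phi>': "set_integrable lborel {t<..T} \<phi>'" "AE r in lborel. r \<in> {t<..T} \<longrightarrow> \<phi>' r = \<phi> w r"
      "\<And>B. B \<in> sets borel \<Longrightarrow> B \<subseteq> {t<..T} \<Longrightarrow> (LINT r:B|lebesgue. \<phi> w r) = (LINT r:B|lborel. \<phi>' r)"
      using set_integrable_lebesgue_borel[OF _ elim(2)] by auto
    have Ys: "Y w \<in> borel_measurable Leb"
      using measurable_Pair2[OF Prg_QL[OF Ym], of w] om by simp
    have eq': "Y w s + compensated_integral K nu X t s T Z w = \<xi> w + (LINT r:{s<..T}|lborel. \<phi>' r)"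
      if "s \<in> {t..T}" for s
      using elim(3) that \<phi>'(3)[of "{s<..T}"] by (simp add: subset_iff)
    have A': "(\<I> s. sqr (Y w s)) < \<infinity>"
      "rate_integral (square_field Z) w < \<infinity>"
      using elim(1) by (auto simp: A_def Zsq_def)
    note ito = ito_pathwise[where w = w and Y = Y and Z = Z and U = U and s = s and \<phi> = \<phi>' and \<xi> = "\<xi> w",
      OF om Zm Um U_def Ys A' \<phi>'(1) eq' s, folded Zs_def H_def A_def, folded Zsq_def]
    let ?n = "\<lambda>r. \<integral>\<^sup>+y. Zs s ((w, r), y) \<partial>nu r (X r w)"
    have n: "rate_integral (Zs s) w = (\<I> r. ?n r)" by (rule rate_integral_X[OF om])
    have mn: "(\<lambda>r. ?n r * indicator {t..T} r) \<in> borel_measurable lborel"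
    proof -
      have "?n \<in> borel_measurable Leb"
        using section_Prd[OF om, of "\<lambda>p. enn2real (Zs s p)"] Zsm[OF s] 
        by (intro nn_integral_nu_measurable[OF id_Leb X_section[OF om]])
          (use measurable_compose[OF measurable_Pair[OF measurable_compose[OF measurable_fst measurable_Pair1'[THEN measurable_compose[OF _ id_Prd]]] measurable_snd] Zsm[OF s]] om in \<open>auto simp: case_prod_beta'\<close>)
      then show ?thesis by (subst (asm) borel_measurable_restrict_space_iff_ennreal) auto
    qed
    have mY: "(\<lambda>r. sqr (Y w r) * indicator {s<..T} r) \<in> borel_measurable lborel"
      using Ys s by (intro borel_measurable_Leb_indicator) (auto simp: subset_iff)
    have "\<delta> w \<in> borel_measurable Leb" using measurable_Pair2[OF \<delta>m, of w] om by simp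
    then have m\<delta>: "(\<lambda>r. sqr (\<delta> w r) * indicator {s<..T} r) \<in> borel_measurable lborel"
      using s by (intro borel_measurable_Leb_indicator) (auto simp: subset_iff)
    have "(\<integral>\<^sup>+r\<in>{s<..T}. ennreal (2 * \<bar>\<phi>' r\<bar> * \<bar>Y w r\<bar>) \<partial>lborel) \<le>
        (\<integral>\<^sup>+r. (ennreal c * (sqr (Y w r) * indicator {s<..T} r) + sqr (\<delta> w r) * indicator {s<..T} r) +
          ?n r * indicator {t..T} r / 2 \<partial>lborel)"
    proof (rule nn_integral_mono_AE)
      show "AE r in lborel. ennreal (2 * \<bar>\<phi>' r\<bar> * \<bar>Y w r\<bar>) * indicator {s<..T} r \<le>
        (ennreal c * (sqr (Y w r) * indicator {s<..T} r) + sqr (\<delta> w r) * indicator {s<..T} r) +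
          ?n r * indicator {t..T} r / 2"
        using elim(4) \<phi>'(2)
      proof eventually_elim
        case (elim r)
        show ?case
        proof (cases "r \<in> {s<..T}")
          case True
          let ?q = "LINT y|nu r (X r w). \<bar>Z w r y\<bar>\<^sup>2"
          have "0 \<le> ?q" by simp
          with True elim s have "2 * \<bar>\<phi>' r\<bar> * \<bar>Y w r\<bar> \<le> c * (Y w r)\<^sup>2 + (\<delta> w r)\<^sup>2 + ?q / 2"
            unfolding c_def by (intro driver_product_bound L) auto
          then have "ennreal (2 * \<bar>\<phi>' r\<bar> * \<bar>Y w r\<bar>) \<le> ennreal (c * (Y w r)\<^sup>2 + (\<delta> w r)\<^sup>2 + ?q / 2)"
            by (rule ennreal_leI)
          also have "\<dots> = ennreal c * sqr (Y w r) + sqr (\<delta> w r) + ennreal ?q / 2"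
            using c by (simp add: ennreal_mult divide_ennreal[symmetric])
          \<comment> \<open>If the square is not integrable, the real integral is 0 by convention
            and the inequality remains true.\<close>
          also have "ennreal ?q \<le> ?n r"
          proof (cases "integrable (nu r (X r w)) (\<lambda>y. \<bar>Z w r y\<bar>\<^sup>2)")
            case int: True
            have "ennreal ?q = (\<integral>\<^sup>+y. sqr \<bar>Z w r y\<bar> \<partial>nu r (X r w))"
              by (rule nn_integral_eq_integral[OF int, symmetric]) simp
            then show ?thesis using True by (simp add: Zs_def)
          qed (simp add: not_integrable_integral_eq)
          finally show ?thesis using True s by (simp add: add_left_mono divide_right_mono_ennreal)
        qed simp
      qed
    qed
    also have "\<dots> = ennreal c * (\<integral>\<^sup>+r\<in>{s<..T}. sqr (Y w r) \<partial>lborel) +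
        (\<integral>\<^sup>+r\<in>{s<..T}. sqr (\<delta> w r) \<partial>lborel) + rate_integral (Zs s) w / 2"
      unfolding n using mn mY m\<delta>
      by (subst nn_integral_add, simp, simp, subst nn_integral_add) (auto simp: nn_integral_cmult nn_integral_divide)
    finally have le: "sqr (\<xi> w) + (\<integral>\<^sup>+r\<in>{s<..T}. ennreal (2 * \<bar>\<phi>' r\<bar> * \<bar>Y w r\<bar>) \<partial>lborel) +
        (jump_integral (H s (-1)) w + rate_integral (H s 1) w) \<le>
      sqr (\<xi> w) + (ennreal c * (\<integral>\<^sup>+r\<in>{s<..T}. sqr (Y w r) \<partial>lborel) +
        (\<integral>\<^sup>+r\<in>{s<..T}. sqr (\<delta> w r) \<partial>lborel) + rate_integral (Zs s) w / 2) +
        (jump_integral (H s (-1)) w + rate_integral (H s 1) w)"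
      by (intro add_mono order_refl)
    show ?case by (intro conjI ito(1,2) order_trans[OF ito(3) le])
  qed
  have sub: "{s<..T} \<subseteq> {t..T}" if "s \<in> {t..T}" for s using that by auto
  have energy: "E s + (\<E> w. rate_integral (Zs s) w) / 2 \<le> D + ennreal c * (\<integral>\<^sup>+r\<in>{s<..T}. E r \<partial>lborel)"
    if s: "s \<in> {t..T}" for s
  proof -
    let ?z = "\<integral>\<^sup>+w. rate_integral (Zs s) w \<partial>\<Q>"
    let ?F = "(\<E> w. rate_integral (H s 1) w) + (\<E> w. rate_integral (H s (-1)) w)"
    have mYs: "(\<lambda>w. sqr (Y w s)) \<in> borel_measurable \<Q>"
      using Prg_Q[OF Ym s] by simp
    note ms = mYs jump_integral_measurable[OF Zsm[OF s]] jump_integral_measurable[OF Hm[OF s]]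
      rate_integral_measurable[OF Zsm[OF s]] rate_integral_measurable[OF Hm[OF s]] \<xi>m
      measurable_set_nn_integral_QL(1)[OF YQL _ sub[OF s]] measurable_set_nn_integral_QL(1)[OF \<delta>QL _ sub[OF s]]
    have fin1: "(\<E> w. rate_integral (H s \<sigma>) w) < \<infinity>" if "\<sigma> = 1 \<or> \<sigma> = -1" for \<sigma>
    proof -
      have "(\<E> w. rate_integral (H s \<sigma>) w) \<le> (\<E> w. ennreal (4 * rate_bound) * A w + rate_integral Zsq w)"
        by (rule nn_integral_mono_AE, rule AE_mp[OF pathwise[OF s]], rule AE_I2) (use that in auto)
      also have "\<dots> = ennreal (4 * rate_bound) * (\<E> w. A w) + (\<E> w. rate_integral Zsq w)"
        using mA rate_integral_measurable[OF Zsqm] by (subst nn_integral_add) (auto simp: nn_integral_cmult)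
      also have "\<dots> < \<infinity>" using finA finZ by (simp add: ennreal_mult_less_top)
      finally show ?thesis .
    qed
    then have finF: "?F < \<infinity>" by simp
    \<comment> \<open>Jump and rate integrals of \<open>H s 1\<close> and \<open>H s (-1)\<close>
      sit crosswise on the two sides, but by compensation each side contributes the same amount
      \<open>?F\<close>. Its finiteness permits the cancellation.\<close>
    have "E s + ?z + ?F = (\<E> w. sqr (Y w s) + jump_integral (Zs s) w + (jump_integral (H s 1) w + rate_integral (H s (-1)) w))"
      unfolding E_def using ms
      by (simp add: nn_integral_add jump_integral_expectation[OF Zsm[OF s]] jump_integral_expectation[OF Hm[OF s]])
    also have "\<dots> \<le> (\<E> w. sqr (\<xi> w) + (ennreal c * (\<integral>\<^sup>+r\<in>{s<..T}. sqr (Y w r) \<partial>lborel) +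
        (\<integral>\<^sup>+r\<in>{s<..T}. sqr (\<delta> w r) \<partial>lborel) + rate_integral (Zs s) w / 2) +
      (jump_integral (H s (-1)) w + rate_integral (H s 1) w))"
      by (rule nn_integral_mono_AE, rule AE_mp[OF pathwise[OF s]], rule AE_I2) simp
    also have "\<dots> = (\<E> w. sqr (\<xi> w)) + (ennreal c * (\<E> w. (\<integral>\<^sup>+r\<in>{s<..T}. sqr (Y w r) \<partial>lborel)) +
        (\<E> w. (\<integral>\<^sup>+r\<in>{s<..T}. sqr (\<delta> w r) \<partial>lborel)) + ?z / 2) + ?F"
      using ms
      by (simp add: nn_integral_add nn_integral_cmult nn_integral_divide jump_integral_expectation[OF Hm[OF s]] add_ac)
    also have "(\<E> w. (\<integral>\<^sup>+r\<in>{s<..T}. sqr (Y w r) \<partial>lborel)) = (\<integral>\<^sup>+r\<in>{s<..T}. E r \<partial>lborel)"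
      unfolding E_def using sub[OF s] by (intro measurable_set_nn_integral_QL(2)[OF YQL]) auto
    finally have "?F + (E s + ?z) \<le> ?F + ((\<E> w. sqr (\<xi> w)) + (ennreal c * (\<integral>\<^sup>+r\<in>{s<..T}. E r \<partial>lborel) +
        (\<E> w. (\<integral>\<^sup>+r\<in>{s<..T}. sqr (\<delta> w r) \<partial>lborel)) + ?z / 2))"
      by (simp add: add_ac)
    then have "E s + ?z \<le> (\<E> w. sqr (\<xi> w)) + (ennreal c * (\<integral>\<^sup>+r\<in>{s<..T}. E r \<partial>lborel) +
        (\<E> w. (\<integral>\<^sup>+r\<in>{s<..T}. sqr (\<delta> w r) \<partial>lborel)) + ?z / 2)"
      using finF by (auto simp: ennreal_add_left_cancel_le)
    also have "\<dots> \<le> (\<E> w. sqr (\<xi> w)) + (ennreal c * (\<integral>\<^sup>+r\<in>{s<..T}. E r \<partial>lborel) +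
        (\<E> w. (\<I> r. sqr (\<delta> w r))) + ?z / 2)"
      using s by (intro add_mono order_refl nn_integral_mono) (auto split: split_indicator)
    finally have ineq: "E s + ?z \<le> (D + ennreal c * (\<integral>\<^sup>+r\<in>{s<..T}. E r \<partial>lborel)) + ?z / 2"
      by (simp add: D_def add_ac)
    \<comment> \<open>Half of the \<open>Z\<close>-norm is moved to the left, which again requires
      that it be finite.\<close>
    obtain z where z: "?z = ennreal z" "0 \<le> z" using finZs[of s] by (cases ?z) auto
    have "ennreal (z / 2) + (E s + ennreal (z / 2)) \<le> ennreal (z / 2) + (D + ennreal c * (\<integral>\<^sup>+r\<in>{s<..T}. E r \<partial>lborel))"
    proof -
      have "ennreal z = ennreal (z / 2) + ennreal (z / 2)" using z(2) by (simp flip: ennreal_plus)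
      moreover have "ennreal z / 2 = ennreal (z / 2)" using z(2) by (simp add: divide_ennreal[symmetric])
      ultimately show ?thesis using ineq unfolding z(1) by (simp add: add_ac)
    qed
    then have "E s + ennreal (z / 2) \<le> D + ennreal c * (\<integral>\<^sup>+r\<in>{s<..T}. E r \<partial>lborel)"
      by (simp add: ennreal_add_left_cancel_le)
    then show ?thesis unfolding z(1) using z(2) by (simp add: divide_ennreal[symmetric])
  qed
  let ?C = "2 * exp (2 * c * (T - t)) * (T - t)"
  have AE_eq: "(\<E> w. A w) = (\<I> s. E s * indicator {t..T} s)"
  proof -
    have "(\<E> w. A w) = (\<I> s. E s)"
      unfolding A_def E_def by (intro measurable_set_nn_integral_QL(2)[OF YQL]) auto
    also have "\<dots> = (\<I> s. E s * indicator {t..T} s)"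
      by (intro nn_integral_cong) (simp split: split_indicator)
    finally show ?thesis .
  qed
  have EA: "(\<integral>\<^sup>+r\<in>{s<..T}. E r * indicator {t..T} r \<partial>lborel) = (\<integral>\<^sup>+r\<in>{s<..T}. E r \<partial>lborel)" if "s \<in> {t..T}" for s
    using that by (intro nn_integral_cong) (auto split: split_indicator)
  have bA: "(\<E> w. A w) \<le> ennreal ?C * D"
    unfolding AE_eq
  proof (rule gronwall_backward[OF _ c t_le_T])
    show "(\<lambda>s. E s * indicator {t..T} s) \<in> borel_measurable borel"
      unfolding E_def by (rule measurable_set_nn_integral_QL(3)[OF YQL, of "{}"]) auto
    show "(\<I> s. E s * indicator {t..T} s) < \<infinity>" using finA unfolding AE_eq .
    show "E s * indicator {t..T} s \<le> D + ennreal c * (\<integral>\<^sup>+r\<in>{s<..T}. E r * indicator {t..T} r \<partial>lborel)"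
      if s: "s \<in> {t..T}" for s
    proof -
      have "E s \<le> E s + (\<E> w. rate_integral (Zs s) w) / 2" by simp
      also note energy[OF s]
      finally show ?thesis using s by (simp add: EA)
    qed
  qed
  \<comment> \<open>The energy inequality at \<open>s = t\<close> controls \<open>Z\<close> on
    \<open>{t<..T}\<close>; the time \<open>t\<close> itself is null.\<close>
  have "(\<E> w. rate_integral Zsq w) = (\<E> w. rate_integral (Zs t) w)"
  proof (rule nn_integral_cong)
    fix w assume "w \<in> space \<Q>"
    show "rate_integral Zsq w = rate_integral (Zs t) w"
      unfolding rate_integral_def
    proof (rule nn_integral_cong_AE)
      have "AE s in lborel. s \<noteq> t" by (rule AE_lborel_singleton)
      then have "AE s in lborel. s \<in> {t..T} \<longrightarrow> (\<integral>\<^sup>+y. Zsq ((w, s), y) \<partial>nu s (pre s w)) = (\<integral>\<^sup>+y. Zs t ((w, s), y) \<partial>nu s (pre s w))"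
        by eventually_elim (auto simp: Zsq_def Zs_def)
      then show "AE s in Leb. (\<integral>\<^sup>+y. Zsq ((w, s), y) \<partial>nu s (pre s w)) = (\<integral>\<^sup>+y. Zs t ((w, s), y) \<partial>nu s (pre s w))"
        by (subst AE_restrict_space_iff) auto
    qed
  qed
  also have "\<dots> = 2 * ((\<E> w. rate_integral (Zs t) w) / 2)"
  proof -
    obtain z where z: "(\<E> w. rate_integral (Zs t) w) = ennreal z" "0 \<le> z"
      using finZs[of t] by (cases "\<integral>\<^sup>+w. rate_integral (Zs t) w \<partial>\<Q>") auto
    have "ennreal z = ennreal (z / 2) + ennreal (z / 2)" using z(2) by (simp flip: ennreal_plus)
    moreover have "ennreal z / 2 = ennreal (z / 2)" using z(2) by (simp add: divide_ennreal[symmetric])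
    ultimately show ?thesis unfolding z(1) by (simp add: mult_2)
  qed
  also have "\<dots> \<le> 2 * (D + ennreal c * (\<integral>\<^sup>+r\<in>{t<..T}. E r \<partial>lborel))"
  proof (rule mult_left_mono)
    have "(\<E> w. rate_integral (Zs t) w) / 2 \<le> E t + (\<E> w. rate_integral (Zs t) w) / 2" by simp
    also have "\<dots> \<le> D + ennreal c * (\<integral>\<^sup>+r\<in>{t<..T}. E r \<partial>lborel)" by (rule energy) (use t_le_T in simp)
    finally show "(\<E> w. rate_integral (Zs t) w) / 2 \<le> D + ennreal c * (\<integral>\<^sup>+r\<in>{t<..T}. E r \<partial>lborel)" .
  qed simp
  also have "\<dots> \<le> 2 * (D + ennreal c * (ennreal ?C * D))"
  proof (intro mult_left_mono add_left_mono)
    have "(\<integral>\<^sup>+r\<in>{t<..T}. E r \<partial>lborel) \<le> (\<E> w. A w)"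
      unfolding AE_eq by (intro nn_integral_mono) (auto split: split_indicator)
    then show "(\<integral>\<^sup>+r\<in>{t<..T}. E r \<partial>lborel) \<le> ennreal ?C * D" using bA by (rule order_trans)
  qed auto
  finally have bZ: "(\<E> w. rate_integral Zsq w) \<le> 2 * (D + ennreal c * (ennreal ?C * D))" .
  have C0: "0 \<le> ?C" using t_le_T by simp
  have "norm_sq Y Z \<le> ennreal ?C * D + 2 * (D + ennreal c * (ennreal ?C * D))"
    unfolding norm using bA bZ by (rule add_mono)
  also have "\<dots> = (ennreal ?C + 2 * (1 + ennreal c * ennreal ?C)) * D"
    by (simp add: distrib_left distrib_right mult_ac)
  also have "ennreal ?C + 2 * (1 + ennreal c * ennreal ?C) = ennreal (?C + 2 * (1 + c * ?C))"
  proof -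
    have "ennreal a + 2 * (1 + ennreal c * ennreal a) = ennreal (a + 2 * (1 + c * a))" if "0 \<le> a" for a
      using that c by (simp add: ennreal_plus ennreal_mult distrib_left)
    from this[OF C0] show ?thesis .
  qed
  also have "?C + 2 * (1 + c * ?C) = estimate_const L L'"
    by (simp add: estimate_const_def c_def algebra_simps)
  finally show ?thesis unfolding D_def .
qed

end

section \<open>Bounded data\<close>

text \<open>A geometric series. The telescoping bound keeps the subtracted tail
  \<open>2 B / 2^(n + k)\<close>, which is what makes the induction on \<open>k\<close>
  close.\<close>

lemma dyadic_increments_limit:
  fixes a :: "nat \<Rightarrow> real"
  assumes d: "\<And>n. \<bar>a (Suc n) - a n\<bar> \<le> B / 2 ^ n"
  shows "a \<longlonglongrightarrow> lim a" "\<bar>lim a - a n\<bar> \<le> 2 * B / 2 ^ n"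
proof -
  have B: "0 \<le> B" using d[of 0] by simp
  have le: "\<bar>a (n + k) - a n\<bar> \<le> 2 * B / 2 ^ n - 2 * B / 2 ^ (n + k)" for n k
  proof (induction k)
    case (Suc k)
    have "\<bar>a (n + Suc k) - a n\<bar> \<le> \<bar>a (Suc (n + k)) - a (n + k)\<bar> + \<bar>a (n + k) - a n\<bar>" by simp
    also have "\<dots> \<le> B / 2 ^ (n + k) + (2 * B / 2 ^ n - 2 * B / 2 ^ (n + k))"
      by (intro add_mono d Suc)
    also have "\<dots> = 2 * B / 2 ^ n - 2 * B / 2 ^ (n + Suc k)" by (simp add: field_simps)
    finally show ?case .
  qed simp
  have le': "\<bar>a m - a n\<bar> \<le> 2 * B / 2 ^ n" if "n \<le> m" for m n
  proof -
    have "\<bar>a (n + (m - n)) - a n\<bar> \<le> 2 * B / 2 ^ n - 2 * B / 2 ^ (n + (m - n))" by (rule le)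
    also have "\<dots> \<le> 2 * B / 2 ^ n" using B by simp
    finally show ?thesis using that by simp
  qed
  have "Cauchy a"
  proof (rule CauchyI')
    fix e :: real assume e: "0 < e"
    have "(\<lambda>n. 2 * B * (1 / 2) ^ n) \<longlonglongrightarrow> 2 * B * 0"
      by (intro tendsto_mult tendsto_const LIMSEQ_power_zero) simp
    then have "\<forall>\<^sub>F n in sequentially. 2 * B * (1 / 2) ^ n < e" using e by (intro order_tendstoD) auto
    then obtain M where M: "\<And>n. n \<ge> M \<Longrightarrow> 2 * B * (1 / 2) ^ n < e" by (auto simp: eventually_sequentially)
    show "\<exists>M. \<forall>m\<ge>M. \<forall>n>m. dist (a m) (a n) < e"
    proof (intro exI allI impI)
      fix m n assume "M \<le> m" "m < n"
      then show "dist (a m) (a n) < e"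
        using le'[of m n] M[of m] by (simp add: dist_real_def abs_minus_commute power_one_over)
    qed
  qed
  then have "convergent a" by (rule Cauchy_convergent)
  then show lim: "a \<longlonglongrightarrow> lim a" by (simp add: convergent_LIMSEQ_iff)
  have "(\<lambda>m. \<bar>a m - a n\<bar>) \<longlonglongrightarrow> \<bar>lim a - a n\<bar>" by (intro tendsto_intros lim)
  then show "\<bar>lim a - a n\<bar> \<le> 2 * B / 2 ^ n"
    by (rule LIMSEQ_le_const2) (use le' in \<open>auto intro!: exI[of _ n]\<close>)
qed

section \<open>Picard iteration for the deterministic equation\<close>

context markov_jump_process
begin

abbreviation "Time \<equiv> restrict_space borel {0..T}"

lemma space_Time [simp]: "space Time = {0..T}"
  by (simp add: space_restrict_space)

definition admissible :: "(real \<Rightarrow> 'k \<Rightarrow> real) \<Rightarrow> bool" where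
  "admissible v \<longleftrightarrow> (\<lambda>(r, y). v r y) \<in> borel_measurable (Time \<Otimes>\<^sub>M K) \<and>
     (\<exists>c. \<forall>r\<in>{0..T}. \<forall>y\<in>space K. \<bar>v r y\<bar> \<le> c)"

text \<open>The jump generator applied to \<open>v(r, .)\<close> plus the driver at \<open>v\<close>
  and its increments, that is, the integrand of a semilinear backward Kolmogorov equation.\<close>

definition backward_field :: "(real \<Rightarrow> 'k \<Rightarrow> real \<Rightarrow> ('k \<Rightarrow> real) \<Rightarrow> real) \<Rightarrow> (real \<Rightarrow> 'k \<Rightarrow> real) \<Rightarrow> real \<Rightarrow> 'k \<Rightarrow> real" where
  "backward_field f v r y = (LINT z|nu r y. v r z - v r y) + f r y (v r y) (\<lambda>z. v r z - v r y)"

definition picard_map :: "(real \<Rightarrow> 'k \<Rightarrow> real \<Rightarrow> ('k \<Rightarrow> real) \<Rightarrow> real) \<Rightarrow> ('k \<Rightarrow> real) \<Rightarrow> (real \<Rightarrow> 'k \<Rightarrow> real) \<Rightarrow> real \<Rightarrow> 'k \<Rightarrow> real" where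
  "picard_map f g v s y = g y + (LINT r:{s<..T}|lborel. backward_field f v r y)"

text \<open>A Lipschitz constant of \<open>backward_field\<close> in the supremum norm. Increments
  of \<open>v\<close> vary by twice the norm, which costs \<open>2 * rate_bound\<close> in the
  integral and \<open>2 * L * sqrt rate_bound\<close> in the square norm; \<open>L'\<close> is the
  direct dependence and the 1 ensures positivity.\<close>

definition field_const :: "real \<Rightarrow> real \<Rightarrow> real" where
  "field_const L L' = 2 * rate_bound + L' + 2 * L * sqrt rate_bound + 1"

lemma admissible_section: "admissible v \<Longrightarrow> r \<in> {0..T} \<Longrightarrow> v r \<in> borel_measurable K"
  unfolding admissible_def using measurable_Pair2[of "\<lambda>(r, y). v r y" Time K borel r] by simp

lemma measure_nu_le: "s \<in> {0..T} \<Longrightarrow> y \<in> space K \<Longrightarrow> measure (nu s y) (space (nu s y)) \<le> rate_bound"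
  using emeasure_nu_le[of s y "space (nu s y)"] rate_bound_nonneg
  by (simp add: measure_def enn2real_leI)

lemma integrable_nu_bounded:
  assumes "s \<in> {0..T}" "y \<in> space K" "z \<in> borel_measurable K" "\<And>y. y \<in> space K \<Longrightarrow> \<bar>z y\<bar> \<le> c"
  shows "integrable (nu s y) z" "\<bar>LINT y|nu s y. z y\<bar> \<le> c * rate_bound"
proof -
  interpret N: finite_measure "nu s y" using assms by (intro finite_measure_nu)
  have sp: "space (nu s y) = space K" using assms space_nu by simp
  show i: "integrable (nu s y) z"
    using assms(3,4) sp by (intro N.integrable_const_bound[where B = c]) (auto simp: measurable_nu_iff[OF assms(1,2)])
  have c: "0 \<le> c" using assms(4)[OF assms(2)] by simp
  have "\<bar>LINT y|nu s y. z y\<bar> \<le> (LINT y|nu s y. \<bar>z y\<bar>)" by (rule integral_abs_bound)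
  also have "\<dots> \<le> (LINT y'|nu s y. c)"
    using assms(4) sp i by (intro integral_mono) auto
  also have "\<dots> \<le> c * rate_bound" using measure_nu_le[OF assms(1,2)] c by (simp add: mult.commute mult_left_mono)
  finally show "\<bar>LINT y|nu s y. z y\<bar> \<le> c * rate_bound" .
qed

lemma backward_field_measurable:
  assumes gen: "generator L L' f" and v: "admissible v"
  shows "(\<lambda>(r, y). backward_field f v r y) \<in> borel_measurable (Time \<Otimes>\<^sub>M K)"
proof -
  have vm: "(\<lambda>p. v (fst p) (snd p)) \<in> borel_measurable (Time \<Otimes>\<^sub>M K)"
    using v by (simp add: admissible_def case_prod_beta')
  obtain c where c: "\<forall>r\<in>{0..T}. \<forall>y\<in>space K. \<bar>v r y\<bar> \<le> c" using v by (auto simp: admissible_def)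
  let ?Z = "\<lambda>p z. v (fst p) z - v (fst p) (snd p)"
  have Zm: "(\<lambda>(p, z). ?Z p z) \<in> borel_measurable ((Time \<Otimes>\<^sub>M K) \<Otimes>\<^sub>M K)"
  proof -
    have "(\<lambda>q. (fst (fst q), snd q)) \<in> (Time \<Otimes>\<^sub>M K) \<Otimes>\<^sub>M K \<rightarrow>\<^sub>M Time \<Otimes>\<^sub>M K"
      by (intro measurable_Pair measurable_snd measurable_compose[OF measurable_fst measurable_fst])
    from measurable_compose[OF this vm] measurable_compose[OF measurable_fst vm]
    show ?thesis unfolding case_prod_beta' by (intro borel_measurable_diff) auto
  qed
  have "(\<lambda>p. LINT z|nu (fst p) (snd p). ?Z p z) \<in> borel_measurable (Time \<Otimes>\<^sub>M K)"
    by (rule integral_nu_measurable[OF measurable_fst measurable_snd Zm])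
  moreover have "(\<lambda>p. f (fst p) (snd p) (v (fst p) (snd p)) (?Z p)) \<in> borel_measurable (Time \<Otimes>\<^sub>M K)"
  proof (rule generator_measurable_bounded[OF gen measurable_fst measurable_snd vm Zm, where c = "2 * c"])
    fix p z assume p: "p \<in> space (Time \<Otimes>\<^sub>M K)" and z: "z \<in> space K"
    then have "\<bar>v (fst p) z\<bar> \<le> c" "\<bar>v (fst p) (snd p)\<bar> \<le> c" using c by (auto simp: space_pair_measure)
    then show "\<bar>v (fst p) z - v (fst p) (snd p)\<bar> \<le> 2 * c" by simp
  qed
  ultimately show ?thesis by (simp add: backward_field_def case_prod_beta')
qed

lemma backward_field_lipschitz:
  assumes gen: "generator L L' f" and v: "admissible v" and w: "admissible w"
    and r: "r \<in> {0..T}" and y: "y \<in> space K" and e: "\<And>z. z \<in> space K \<Longrightarrow> \<bar>v r z - w r z\<bar> \<le> e"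
  shows "\<bar>backward_field f v r y - backward_field f w r y\<bar> \<le> field_const L L' * e"
proof -
  have e0: "0 \<le> e" using e[OF y] by simp
  have L: "0 \<le> L" "0 \<le> L'" using generatorD[OF gen] by auto
  have inc: "(\<lambda>z. u r z - u r y) \<in> borel_measurable K \<and> (\<exists>c. \<forall>z\<in>space K. \<bar>u r z - u r y\<bar> \<le> c)"
    if u: "admissible u" for u
  proof -
    obtain c where c: "\<forall>z\<in>space K. \<bar>u r z\<bar> \<le> c" using u r unfolding admissible_def by blast
    have "\<bar>u r z - u r y\<bar> \<le> c + c" if "z \<in> space K" for z
      using c[rule_format, OF that] c[rule_format, OF y] by linarith
    then show ?thesis using admissible_section[OF u r] by auto
  qed
  let ?v = "\<lambda>z. v r z - v r y" and ?w = "\<lambda>z. w r z - w r y"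
  obtain cv cw where cv: "\<forall>z\<in>space K. \<bar>?v z\<bar> \<le> cv" and cw: "\<forall>z\<in>space K. \<bar>?w z\<bar> \<le> cw"
    using inc[OF v] inc[OF w] by blast
  note mv = inc[OF v, THEN conjunct1] and mw = inc[OF w, THEN conjunct1]
  have d: "\<bar>?v z - ?w z\<bar> \<le> 2 * e" if "z \<in> space K" for z
    using e[OF that] e[OF y] by linarith
  have i: "integrable (nu r y) ?v" "integrable (nu r y) ?w"
    using cv cw by (auto intro!: integrable_nu_bounded(1) r y mv mw)
  have "\<bar>(LINT z|nu r y. ?v z) - (LINT z|nu r y. ?w z)\<bar> = \<bar>LINT z|nu r y. ?v z - ?w z\<bar>"
    using i by simp
  also have "\<dots> \<le> 2 * e * rate_bound"
    using d mv mw by (intro integrable_nu_bounded(2) r y) auto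
  finally have 1: "\<bar>(LINT z|nu r y. ?v z) - (LINT z|nu r y. ?w z)\<bar> \<le> 2 * e * rate_bound" .
  have "\<bar>LINT z|nu r y. \<bar>?v z - ?w z\<bar>\<^sup>2\<bar> \<le> (2 * e)\<^sup>2 * rate_bound"
  proof (rule integrable_nu_bounded(2)[OF r y])
    show "\<bar>\<bar>?v z - ?w z\<bar>\<^sup>2\<bar> \<le> (2 * e)\<^sup>2" if "z \<in> space K" for z
      using power_mono[OF d[OF that], of 2] by simp
  qed (use mv mw in simp)
  then have "sqrt (LINT z|nu r y. \<bar>?v z - ?w z\<bar>\<^sup>2) \<le> sqrt ((2 * e)\<^sup>2 * rate_bound)"
    by (intro real_sqrt_le_mono) simp
  also have "\<dots> = 2 * e * sqrt rate_bound" using e0 by (simp add: real_sqrt_mult)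
  finally have s: "sqrt (LINT z|nu r y. \<bar>?v z - ?w z\<bar>\<^sup>2) \<le> 2 * e * sqrt rate_bound" .
  have "\<bar>f r y (v r y) ?v - f r y (w r y) ?w\<bar> \<le> L' * \<bar>v r y - w r y\<bar> + L * sqrt (LINT z|nu r y. \<bar>?v z - ?w z\<bar>\<^sup>2)"
    using cv cw by (intro generatorD(4)[OF gen r y] square_integrable_bounded r y mv mw) auto
  also have "\<dots> \<le> L' * e + L * (2 * e * sqrt rate_bound)"
    using s e[OF y] L by (intro add_mono mult_left_mono)
  finally have 2: "\<bar>f r y (v r y) ?v - f r y (w r y) ?w\<bar> \<le> L' * e + L * (2 * e * sqrt rate_bound)" .
  have "\<bar>backward_field f v r y - backward_field f w r y\<bar> \<le> 2 * e * rate_bound + (L' * e + L * (2 * e * sqrt rate_bound))"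
    unfolding backward_field_def using 1 2 by linarith
  also have "\<dots> \<le> field_const L L' * e" using e0 by (simp add: field_const_def algebra_simps)
  finally show ?thesis .
qed

lemma admissible_zero: "admissible (\<lambda>_ _. 0)"
  by (auto simp: admissible_def)

lemma field_const_pos: "0 \<le> L \<Longrightarrow> 0 \<le> L' \<Longrightarrow> 0 < field_const L L'"
  unfolding field_const_def using rate_bound_nonneg by (intro add_nonneg_pos add_nonneg_nonneg mult_nonneg_nonneg) auto

text \<open>Comparison with \<open>v = 0\<close>, where the field reduces to the driver at
  zero.\<close>

lemma backward_field_bounded:
  assumes gen: "generator L L' f" and v: "admissible v"
    and f0: "\<And>r y. r \<in> {0..T} \<Longrightarrow> y \<in> space K \<Longrightarrow> \<bar>f r y 0 (\<lambda>_. 0)\<bar> \<le> b"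
  obtains c where "\<And>r y. r \<in> {0..T} \<Longrightarrow> y \<in> space K \<Longrightarrow> \<bar>backward_field f v r y\<bar> \<le> c"
proof -
  obtain c where c: "\<forall>r\<in>{0..T}. \<forall>y\<in>space K. \<bar>v r y\<bar> \<le> c" using v by (auto simp: admissible_def)
  show thesis
  proof (rule that)
    fix r y assume r: "r \<in> {0..T}" and y: "y \<in> space K"
    have "\<bar>backward_field f v r y - backward_field f (\<lambda>_ _. 0) r y\<bar> \<le> field_const L L' * c"
      using c r by (intro backward_field_lipschitz[OF gen v admissible_zero r y]) auto
    moreover have "backward_field f (\<lambda>_ _. 0) r y = f r y 0 (\<lambda>_. 0)" by (simp add: backward_field_def)
    ultimately show "\<bar>backward_field f v r y\<bar> \<le> field_const L L' * c + b"
      using f0[OF r y] by linarith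
  qed
qed

lemma measurable_clamp: "(\<lambda>r. max 0 (min T r)) \<in> borel \<rightarrow>\<^sub>M Time"
  using T_pos by (intro measurable_restrict_space2) auto

lemma set_integrable_backward_field:
  assumes gen: "generator L L' f" and v: "admissible v" and y: "y \<in> space K"
    and f0: "\<And>r y. r \<in> {0..T} \<Longrightarrow> y \<in> space K \<Longrightarrow> \<bar>f r y 0 (\<lambda>_. 0)\<bar> \<le> b" and s: "0 \<le> s" "u \<le> T"
  shows "set_integrable lborel {s<..u} (\<lambda>r. backward_field f v r y)"
proof -
  obtain c where c: "\<And>r y. r \<in> {0..T} \<Longrightarrow> y \<in> space K \<Longrightarrow> \<bar>backward_field f v r y\<bar> \<le> c"
    using backward_field_bounded[OF gen v f0] by blast
  have "(\<lambda>r. backward_field f v (max 0 (min T r)) y) \<in> borel_measurable borel"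
    using measurable_compose[OF measurable_Pair[OF measurable_clamp measurable_const] backward_field_measurable[OF gen v]] y by simp
  then have "(\<lambda>r. indicator {s<..u} r * backward_field f v (max 0 (min T r)) y) \<in> borel_measurable borel"
    by simp
  moreover have eq: "indicator {s<..u} r * backward_field f v (max 0 (min T r)) y = indicator {s<..u} r * backward_field f v r y" for r
    using s by (auto simp: indicator_def)
  ultimately have m: "(\<lambda>r. indicator {s<..u} r * backward_field f v r y) \<in> borel_measurable lborel" by simp
  have i: "integrable lborel (\<lambda>r. c * indicator {s<..u} r)"
    by (intro integrable_mult_right integrable_real_indicator) (cases "s \<le> u"; auto)+
  have le: "norm (indicator {s<..u} r * backward_field f v r y) \<le> norm (c * indicator {s<..u} r)" for r
    using c[of r y] y s by (auto simp: indicator_def)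
  show ?thesis
    unfolding set_integrable_def real_scaleR_def
    by (rule Bochner_Integration.integrable_bound[OF i m]) (rule AE_I2, rule le)
qed

lemma picard_map_admissible:
  assumes gen: "generator L L' f" and v: "admissible v"
    and f0: "\<And>r y. r \<in> {0..T} \<Longrightarrow> y \<in> space K \<Longrightarrow> \<bar>f r y 0 (\<lambda>_. 0)\<bar> \<le> b"
    and g: "g \<in> borel_measurable K" "\<And>y. y \<in> space K \<Longrightarrow> \<bar>g y\<bar> \<le> a"
  shows "admissible (picard_map f g v)"
proof -
  obtain c where c: "\<And>r y. r \<in> {0..T} \<Longrightarrow> y \<in> space K \<Longrightarrow> \<bar>backward_field f v r y\<bar> \<le> c"
    using backward_field_bounded[OF gen v f0] by blast
  have "(\<lambda>q. (max 0 (min T (snd q)), snd (fst q))) \<in> (Time \<Otimes>\<^sub>M K) \<Otimes>\<^sub>M lborel \<rightarrow>\<^sub>M Time \<Otimes>\<^sub>M K"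
    using measurable_clamp
    by (intro measurable_Pair measurable_compose[OF measurable_fst measurable_snd] measurable_compose[OF measurable_snd]) simp
  from measurable_compose[OF this backward_field_measurable[OF gen v]]
  have m1: "(\<lambda>q. backward_field f v (max 0 (min T (snd q))) (snd (fst q))) \<in> borel_measurable ((Time \<Otimes>\<^sub>M K) \<Otimes>\<^sub>M lborel)"
    by simp
  have m2: "(\<lambda>q. indicator {p. fst p < snd p \<and> snd p \<le> T} (fst (fst q), snd q) :: real) \<in> borel_measurable ((Time \<Otimes>\<^sub>M K) \<Otimes>\<^sub>M lborel)"
  proof -
    have "(\<lambda>q. (fst (fst q), snd q)) \<in> (Time \<Otimes>\<^sub>M K) \<Otimes>\<^sub>M lborel \<rightarrow>\<^sub>M borel \<Otimes>\<^sub>M borel"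
      by (intro measurable_Pair measurable_compose[OF measurable_compose[OF measurable_fst measurable_fst]] measurable_restrict_space1)
        (auto intro: measurable_snd[THEN measurable_compose])
    moreover have "(indicator {p. fst p < snd p \<and> snd p \<le> T} :: real \<times> real \<Rightarrow> real) \<in> borel_measurable (borel \<Otimes>\<^sub>M borel)"
      by measurable
    ultimately show ?thesis by (rule measurable_compose)
  qed
  have "(\<lambda>q. indicator {p. fst p < snd p \<and> snd p \<le> T} (fst (fst q), snd q) * backward_field f v (max 0 (min T (snd q))) (snd (fst q)))
      \<in> borel_measurable ((Time \<Otimes>\<^sub>M K) \<Otimes>\<^sub>M lborel)"
    using m1 m2 by (rule borel_measurable_times[rotated])
  then have "(\<lambda>p. LINT r|lborel. indicator {q. fst q < snd q \<and> snd q \<le> T} (fst p, r) * backward_field f v (max 0 (min T r)) (snd p))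
      \<in> borel_measurable (Time \<Otimes>\<^sub>M K)"
    by (intro lborel.borel_measurable_lebesgue_integral) (simp add: case_prod_beta')
  moreover have "(LINT r|lborel. indicator {q. fst q < snd q \<and> snd q \<le> T} (fst p, r) * backward_field f v (max 0 (min T r)) (snd p)) =
      (LINT r:{fst p<..T}|lborel. backward_field f v r (snd p))" if "p \<in> space (Time \<Otimes>\<^sub>M K)" for p
    unfolding set_lebesgue_integral_def
    using that by (intro Bochner_Integration.integral_cong) (auto simp: indicator_def space_pair_measure)
  ultimately have "(\<lambda>p. LINT r:{fst p<..T}|lborel. backward_field f v r (snd p)) \<in> borel_measurable (Time \<Otimes>\<^sub>M K)"
    by (subst (asm) measurable_cong[of "Time \<Otimes>\<^sub>M K" _ "\<lambda>p. LINT r:{fst p<..T}|lborel. backward_field f v r (snd p)"]) auto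
  with measurable_compose[OF measurable_snd g(1)]
  have "(\<lambda>(s, y). picard_map f g v s y) \<in> borel_measurable (Time \<Otimes>\<^sub>M K)"
    unfolding picard_map_def case_prod_beta' by (intro borel_measurable_add)
  moreover have "\<bar>picard_map f g v s y\<bar> \<le> a + c * T" if s: "s \<in> {0..T}" and y: "y \<in> space K" for s y
  proof -
    have c0: "0 \<le> c" using c[OF s y] by simp
    have i: "set_integrable lborel {s<..T} (\<lambda>r. backward_field f v r y)"
      using s by (intro set_integrable_backward_field[OF gen v y f0]) auto
    have "\<bar>LINT r:{s<..T}|lborel. backward_field f v r y\<bar> \<le> (LINT r:{s<..T}|lborel. \<bar>backward_field f v r y\<bar>)"
      unfolding set_lebesgue_integral_def using integral_abs_bound[of lborel "\<lambda>r. indicator {s<..T} r *\<^sub>R backward_field f v r y"]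
      by (simp add: abs_mult)
    also have "\<dots> \<le> (LINT r:{s<..T}|lborel. c)"
      using i c y s by (intro set_integral_mono set_integrable_abs) (auto simp: set_integrable_def)
    also have "\<dots> = c * (T - s)" using s by (simp add: set_lebesgue_integral_def)
    also have "\<dots> \<le> c * T" using c0 s by (intro mult_left_mono) auto
    finally show ?thesis using g(2)[OF y] by (simp add: picard_map_def)
  qed
  ultimately show ?thesis unfolding admissible_def by blast
qed

text \<open>The weight \<open>exp (2 * C * (T - r))\<close> with \<open>C = field_const L L'\<close>
  yields contraction by 1/2 on the whole interval at once: \<open>C\<close> times its integral over
  \<open>{s<..T}\<close> is at most half of its value at \<open>s\<close>.\<close>

lemma picard_map_diff:
  assumes gen: "generator L L' f" and v: "admissible v" and w: "admissible w"
    and f0: "\<And>r y. r \<in> {0..T} \<Longrightarrow> y \<in> space K \<Longrightarrow> \<bar>f r y 0 (\<lambda>_. 0)\<bar> \<le> b"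
    and e: "\<And>r z. r \<in> {0..T} \<Longrightarrow> z \<in> space K \<Longrightarrow> \<bar>v r z - w r z\<bar> \<le> B * exp (2 * field_const L L' * (T - r))"
    and s: "s \<in> {0..T}" and y: "y \<in> space K"
  shows "\<bar>picard_map f g v s y - picard_map f g w s y\<bar> \<le> B / 2 * exp (2 * field_const L L' * (T - s))"
proof -
  define C where "C = field_const L L'"
  have C: "0 < C" using field_const_pos generatorD(1,2)[OF gen] by (simp add: C_def)
  have B: "0 \<le> B" using e[OF s y] by (smt (verit) exp_gt_zero zero_le_mult_iff)
  have iv: "set_integrable lborel {s<..T} (\<lambda>r. backward_field f v r y)"
    and iw: "set_integrable lborel {s<..T} (\<lambda>r. backward_field f w r y)"
    using s by (auto intro!: set_integrable_backward_field[OF gen _ y f0] v w)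
  let ?E = "\<lambda>r. C * B * exp (2 * C * (T - r))"
  have FTC: "has_bochner_integral lborel (\<lambda>r. ?E r * indicator {s..T} r) (- (B / 2) * exp (2 * C * (T - T)) - - (B / 2) * exp (2 * C * (T - s)))"
    using s by (intro has_bochner_integral_FTC_Icc_real) (auto intro!: derivative_eq_intros continuous_intros)
  have iE': "integrable lborel (\<lambda>r. ?E r * indicator {s..T} r)" using FTC by (simp add: has_bochner_integral_iff)
  have "set_integrable lborel {s..T} ?E"
    unfolding set_integrable_def using iE' by (simp add: mult.commute)
  then have iE: "set_integrable lborel {s<..T} ?E" by (rule set_integrable_subset) auto
  have "\<bar>picard_map f g v s y - picard_map f g w s y\<bar> =
      \<bar>LINT r:{s<..T}|lborel. backward_field f v r y - backward_field f w r y\<bar>"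
    using set_integral_diff(2)[OF iv iw] by (simp add: picard_map_def)
  also have "\<dots> \<le> (LINT r:{s<..T}|lborel. \<bar>backward_field f v r y - backward_field f w r y\<bar>)"
    unfolding set_lebesgue_integral_def
    using integral_abs_bound[of lborel "\<lambda>r. indicator {s<..T} r *\<^sub>R (backward_field f v r y - backward_field f w r y)"]
    by (simp add: abs_mult)
  also have "\<dots> \<le> (LINT r:{s<..T}|lborel. ?E r)"
  proof (rule set_integral_mono[OF set_integrable_abs[OF set_integral_diff(1)[OF iv iw]] iE])
    fix r assume "r \<in> {s<..T}"
    then have r: "r \<in> {0..T}" using s by auto
    have "\<bar>backward_field f v r y - backward_field f w r y\<bar> \<le> C * (B * exp (2 * C * (T - r)))"
      unfolding C_def using e[OF r] by (intro backward_field_lipschitz[OF gen v w r y]) auto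
    then show "\<bar>backward_field f v r y - backward_field f w r y\<bar> \<le> ?E r" by (simp add: mult_ac)
  qed
  also have "\<dots> \<le> (LINT r|lborel. ?E r * indicator {s..T} r)"
    unfolding set_lebesgue_integral_def using iE iE' B C
    by (intro integral_mono) (auto simp: set_integrable_def indicator_def)
  also have "\<dots> = - (B / 2) * exp (2 * C * (T - T)) - - (B / 2) * exp (2 * C * (T - s))"
    using FTC by (rule has_bochner_integral_integral_eq)
  also have "\<dots> \<le> B / 2 * exp (2 * C * (T - s))" using B by simp
  finally show ?thesis by (simp add: C_def)
qed

text \<open>Weighted distances of successive iterates halve, so the iterates converge uniformly
  whatever the length \<open>T\<close> of the interval.\<close>

theorem bounded_backward_solution:
  assumes gen: "generator L L' f"
    and f0: "\<And>r y. r \<in> {0..T} \<Longrightarrow> y \<in> space K \<Longrightarrow> \<bar>f r y 0 (\<lambda>_. 0)\<bar> \<le> b"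
    and g: "g \<in> borel_measurable K" "\<And>y. y \<in> space K \<Longrightarrow> \<bar>g y\<bar> \<le> a"
  obtains v where "admissible v"
    "\<And>s y. s \<in> {0..T} \<Longrightarrow> y \<in> space K \<Longrightarrow> v s y = g y + (LINT r:{s<..T}|lborel. backward_field f v r y)"
proof -
  define C where "C = field_const L L'"
  have C: "0 < C" using field_const_pos generatorD(1,2)[OF gen] by (simp add: C_def)
  define u where "u n = (picard_map f g ^^ n) (\<lambda>_ _. 0)" for n
  have u_Suc: "u (Suc n) = picard_map f g (u n)" for n by (simp add: u_def)
  have u_adm: "admissible (u n)" for n
  proof (induction n)
    case (Suc n)
    show ?case unfolding u_Suc by (rule picard_map_admissible[OF gen Suc f0 g])
  qed (simp add: u_def admissible_zero)
  obtain M where M: "\<forall>s\<in>{0..T}. \<forall>y\<in>space K. \<bar>u 1 s y\<bar> \<le> M" using u_adm[of 1] by (auto simp: admissible_def)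
  have diff: "\<bar>u (Suc n) s y - u n s y\<bar> \<le> M / 2 ^ n * exp (2 * C * (T - s))"
    if "s \<in> {0..T}" "y \<in> space K" for n s y
    using that
  proof (induction n arbitrary: s y)
    case 0
    have "\<bar>u 1 s y\<bar> \<le> M * 1" using M 0 by simp
    also have "\<dots> \<le> M * exp (2 * C * (T - s))"
    proof (rule mult_left_mono)
      show "0 \<le> M" using M 0 by force
      show "1 \<le> exp (2 * C * (T - s))" using C 0 by simp
    qed
    finally show ?case by (simp add: u_def)
  next
    case (Suc n)
    have "\<bar>picard_map f g (u (Suc n)) s y - picard_map f g (u n) s y\<bar> \<le> M / 2 ^ n / 2 * exp (2 * field_const L L' * (T - s))"
      using Suc unfolding C_def by (intro picard_map_diff[OF gen u_adm u_adm f0]) auto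
    then show ?case by (simp add: u_Suc C_def mult_ac)
  qed
  \<comment> \<open>The initial increment is bounded by \<open>M\<close>, and
    \<open>exp (2 * C * T)\<close> is the largest value of the weight; their product removes the
    weight from the increments.\<close>
  define B where "B = M * exp (2 * C * T)"
  have dyadic: "\<bar>u (Suc n) s y - u n s y\<bar> \<le> B / 2 ^ n" if s: "s \<in> {0..T}" and y: "y \<in> space K" for n s y
  proof -
    have M0: "0 \<le> M" using M s y by force
    have "\<bar>u (Suc n) s y - u n s y\<bar> \<le> M / 2 ^ n * exp (2 * C * (T - s))" by (rule diff[OF s y])
    also have "\<dots> \<le> M / 2 ^ n * exp (2 * C * T)"
      using M0 C s by (intro mult_left_mono) auto
    finally show ?thesis by (simp add: B_def)
  qed
  define v where "v s y = lim (\<lambda>n. u n s y)" for s y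
  have lim: "(\<lambda>n. u n s y) \<longlonglongrightarrow> v s y" and near: "\<bar>v s y - u n s y\<bar> \<le> 2 * B / 2 ^ n"
    if "s \<in> {0..T}" "y \<in> space K" for n s y
    using dyadic_increments_limit[of "\<lambda>n. u n s y" B] dyadic[OF that] unfolding v_def by auto
  have v: "admissible v"
    unfolding admissible_def
  proof
    show "(\<lambda>(r, y). v r y) \<in> borel_measurable (Time \<Otimes>\<^sub>M K)"
      by (rule borel_measurable_LIMSEQ_real[of _ "\<lambda>n (r, y). u n r y"])
        (use lim u_adm in \<open>auto simp: space_pair_measure admissible_def\<close>)
    show "\<exists>c. \<forall>r\<in>{0..T}. \<forall>y\<in>space K. \<bar>v r y\<bar> \<le> c"
      using near[of _ _ 0] by (intro exI[of _ "2 * B"]) (simp add: u_def)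
  qed
  show thesis
  proof (rule that[OF v])
    fix s y assume s: "s \<in> {0..T}" and y: "y \<in> space K"
    \<comment> \<open>The uniform distance of \<open>u n\<close> and \<open>v\<close> is at most
      \<open>2 * B / 2^n\<close>, and \<open>picard_map_diff\<close> transfers this rate to their
      images; both sides of the recursion then have limits.\<close>
    have "(\<lambda>n. u (Suc n) s y - picard_map f g v s y) \<longlonglongrightarrow> 0"
    proof (rule Lim_null_comparison)
      show "\<forall>\<^sub>F n in sequentially. norm (u (Suc n) s y - picard_map f g v s y) \<le> (B * exp (2 * C * T)) * (1 / 2) ^ n"
      proof (intro always_eventually allI)
        fix n
        have B0: "0 \<le> 2 * B / 2 ^ n" using near[OF s y, of n] by simp
        have "\<bar>picard_map f g (u n) s y - picard_map f g v s y\<bar> \<le> 2 * B / 2 ^ n / 2 * exp (2 * field_const L L' * (T - s))"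
        proof (rule picard_map_diff[OF gen u_adm v f0 _ s y])
          fix r z assume r: "r \<in> {0..T}" and z: "z \<in> space K"
          have "\<bar>u n r z - v r z\<bar> \<le> 2 * B / 2 ^ n * 1" using near[OF r z, of n] by (simp add: abs_minus_commute)
          also have "\<dots> \<le> 2 * B / 2 ^ n * exp (2 * field_const L L' * (T - r))"
            using C r B0 by (intro mult_left_mono) (auto simp: C_def)
          finally show "\<bar>u n r z - v r z\<bar> \<le> 2 * B / 2 ^ n * exp (2 * field_const L L' * (T - r))" .
        qed
        also have "\<dots> \<le> 2 * B / 2 ^ n / 2 * exp (2 * C * T)"
          using B0 C s by (intro mult_left_mono) (auto simp: C_def)
        finally show "norm (u (Suc n) s y - picard_map f g v s y) \<le> (B * exp (2 * C * T)) * (1 / 2) ^ n"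
          by (simp add: u_Suc power_one_over mult_ac)
      qed
      show "(\<lambda>n. (B * exp (2 * C * T)) * (1 / 2) ^ n) \<longlonglongrightarrow> 0"
        using tendsto_mult[OF tendsto_const LIMSEQ_power_zero[of "1 / 2 :: real"]] by simp
    qed
    then have "(\<lambda>n. u (Suc n) s y) \<longlonglongrightarrow> picard_map f g v s y" by (rule LIM_zero_cancel)
    with LIMSEQ_Suc[OF lim[OF s y]] have "v s y = picard_map f g v s y" by (rule LIMSEQ_unique)
    then show "v s y = g y + (LINT r:{s<..T}|lborel. backward_field f v r y)" by (simp add: picard_map_def)
  qed
qed

end

section \<open>Integrals against completed measures\<close>

lemma completion_measurable_cong_AE:
  assumes h: "h \<in> completion M \<rightarrow>\<^sub>M N" and eq: "AE x in completion M. h x = k x"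
    and sp: "\<And>x. x \<in> space M \<Longrightarrow> k x \<in> space N"
  shows "k \<in> completion M \<rightarrow>\<^sub>M N"
proof (rule measurableI)
  fix B assume B: "B \<in> sets N"
  show "k -` B \<inter> space (completion M) \<in> sets (completion M)"
  proof (rule completion.in_sets_AE[OF _ measurable_sets[OF h B]])
    show "AE x in completion M. (x \<in> h -` B \<inter> space (completion M)) = (x \<in> k -` B \<inter> space (completion M))"
      using eq by eventually_elim auto
  qed simp
qed (use sp in simp)

text \<open>By completeness either both functions are measurable or neither is, and in the second
  case both integrals are 0. A driver with arbitrary values on a null set can thus be replaced
  without further checks.\<close>

lemma completion_integral_cong_AE:
  fixes h k :: "'a \<Rightarrow> real"
  assumes "AE x in completion M. h x = k x"
  shows "integral\<^sup>L (completion M) h = integral\<^sup>L (completion M) k"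
proof (cases "h \<in> borel_measurable (completion M)")
  case True
  moreover from True assms have "k \<in> borel_measurable (completion M)"
    by (rule completion_measurable_cong_AE) simp
  ultimately show ?thesis using assms by (intro integral_cong_AE)
next
  case False
  have "AE x in completion M. k x = h x" using assms by eventually_elim simp
  with False have "k \<notin> borel_measurable (completion M)"
    using completion_measurable_cong_AE[of k M borel h] by auto
  with False have "\<not> integrable (completion M) h" "\<not> integrable (completion M) k"
    by (auto dest: borel_measurable_integrable)
  then show ?thesis by (simp add: not_integrable_integral_eq)
qed

text \<open>The reverse of \<open>set_integrable_lebesgue_borel\<close>: a Borel integrable function
  may be altered on a null set.\<close>

lemma set_integral_lebesgue_AE:
  fixes \<phi> \<phi>' :: "real \<Rightarrow> real"
  assumes A: "A \<in> sets borel" and i: "set_integrable lborel A \<phi>'" and eq: "AE r in lborel. r \<in> A \<longrightarrow> \<phi> r = \<phi>' r"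
  shows "set_integrable lebesgue A \<phi>" "(LINT r:A|lebesgue. \<phi> r) = (LINT r:A|lborel. \<phi>' r)"
proof -
  let ?h = "\<lambda>r. indicator A r *\<^sub>R \<phi> r" and ?k = "\<lambda>r. indicator A r *\<^sub>R \<phi>' r"
  have i': "integrable lborel ?k" using i by (simp add: set_integrable_def)
  note m' = borel_measurable_integrable[OF i']
  have "AE r in lborel. ?k r = ?h r" using eq by eventually_elim (auto simp: indicator_def)
  then have eq': "AE r in lebesgue. ?k r = ?h r" by (rule AE_completion)
  have m: "?h \<in> borel_measurable lebesgue"
    by (rule completion_measurable_cong_AE[OF measurable_completion[OF m'] eq']) simp
  have i'': "integrable lebesgue ?k" using integrable_completion[OF m'] i' by simp
  show "set_integrable lebesgue A \<phi>"
    unfolding set_integrable_def by (rule integrable_cong_AE_imp[OF i'' m eq'])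
  show "(LINT r:A|lebesgue. \<phi> r) = (LINT r:A|lborel. \<phi>' r)"
    unfolding set_lebesgue_integral_def using completion_integral_cong_AE[OF eq'] integral_completion[OF m'] by simp
qed

section \<open>Stability of solutions\<close>

context started_process
begin

lemma Z_section_square_integrable:
  assumes om: "w \<in> Om" and Zm: "predictable_field Z"
    and r: "r \<in> {t..T}"
  shows "square_integrable (nu r (X r w)) (Z w r) \<longleftrightarrow> (\<integral>\<^sup>+y. sqr (Z w r y) \<partial>nu r (X r w)) < \<infinity>"
proof -
  have "Z w r \<in> borel_measurable K"
    using measurable_Pair2[OF section_Prd[OF om Zm], of r] r by simp
  then have m: "Z w r \<in> borel_measurable (nu r (X r w))"
    using r om t_nonneg by (subst measurable_nu_iff) (auto intro: X_space)
  then show ?thesis by (simp add: square_integrable_def integrable_iff_bounded)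
qed

lemma kernel_X_section:
  assumes om: "w \<in> Om" and H: "H \<in> borel_measurable PK"
  shows "(\<lambda>r. \<integral>\<^sup>+y. H ((w, r), y) \<partial>nu r (X r w)) \<in> borel_measurable Leb"
    and "rate_integral H w = (\<integral>\<^sup>+r. (\<integral>\<^sup>+y. H ((w, r), y) \<partial>nu r (X r w)) \<partial>Leb)"
proof -
  have "(\<lambda>p. (w, fst p)) \<in> Leb \<Otimes>\<^sub>M K \<rightarrow>\<^sub>M QT"
    using om by (intro measurable_Pair measurable_const measurable_fst) simp
  then have "(\<lambda>p. (w, fst p)) \<in> Leb \<Otimes>\<^sub>M K \<rightarrow>\<^sub>M Prd"
    by (rule measurable_compose[OF _ id_Prd])
  from measurable_compose[OF measurable_Pair[OF this measurable_snd] H]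
  have "(\<lambda>(r, y). H ((w, r), y)) \<in> borel_measurable (Leb \<Otimes>\<^sub>M K)" by (simp add: case_prod_beta')
  then show "(\<lambda>r. \<integral>\<^sup>+y. H ((w, r), y) \<partial>nu r (X r w)) \<in> borel_measurable Leb"
    by (rule nn_integral_nu_measurable[OF id_Leb X_section[OF om]])
  show "rate_integral H w = (\<integral>\<^sup>+r. (\<integral>\<^sup>+y. H ((w, r), y) \<partial>nu r (X r w)) \<partial>Leb)"
    unfolding rate_integral_X[OF om] by (rule nn_integral_restrict_space[symmetric]) simp
qed

lemma AE_square_integrable:
  assumes om: "w \<in> Om" and Zm: "predictable_field Z"
    and Z2: "rate_integral (square_field Z) w < \<infinity>"
  shows "AE r in Leb. square_integrable (nu r (X r w)) (Z w r)"
proof -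
  have m: "(square_field Z) \<in> borel_measurable PK"
    using Zm by (simp add: case_prod_beta')
  have "AE r in Leb. (\<integral>\<^sup>+y. sqr (Z w r y) \<partial>nu r (X r w)) \<noteq> \<infinity>"
    using kernel_X_section[OF om m] Z2 by (intro nn_integral_PInf_AE) auto
  with AE_space show ?thesis
    by eventually_elim (use Z_section_square_integrable[OF om Zm] in \<open>auto simp: less_top\<close>)
qed

text \<open>Linearity is not automatic, because inner integrals that fail to exist are set to 0.
  Finite square norms make them exist at almost every time.\<close>

lemma compensated_integral_diff:
  assumes om: "w \<in> Om" and s: "s \<in> {t..T}"
    and Zm: "predictable_field Z"
    and Zm': "predictable_field Z'"
    and Z2: "rate_integral (square_field Z) w < \<infinity>"
    and Z2': "rate_integral (square_field Z') w < \<infinity>"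
  shows "compensated_integral K nu X t s T (\<lambda>w s y. Z w s y - Z' w s y) w =
    compensated_integral K nu X t s T Z w - compensated_integral K nu X t s T Z' w"
proof -
  have Dm: "(\<lambda>((w, s), y). Z w s y - Z' w s y) \<in> borel_measurable PK"
    using Zm Zm' by (simp add: case_prod_beta')
  let ?N = "\<lambda>r. nu r (pre r w)"
  let ?k = "\<lambda>W r. LINT y|?N r. W w r y"
  have "AE r in Leb. ?k (\<lambda>w s y. Z w s y - Z' w s y) r = ?k Z r - ?k Z' r"
    using compensator_integrable(1)[OF om Zm Z2] compensator_integrable(1)[OF om Zm' Z2']
    by eventually_elim simp
  then have "(LINT r|Leb. indicator {s<..T} r * ?k (\<lambda>w s y. Z w s y - Z' w s y) r) =
      (LINT r|Leb. indicator {s<..T} r * (?k Z r - ?k Z' r))"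
    using kernel_real_section[OF om Zm] kernel_real_section[OF om Zm'] kernel_real_section[OF om Dm]
    by (intro integral_cong_AE borel_measurable_times borel_measurable_diff) (auto intro: measurable_restrict_space1 elim: eventually_mono)
  then have "(LINT r:{s<..T}|lborel. ?k (\<lambda>w s y. Z w s y - Z' w s y) r) = (LINT r:{s<..T}|lborel. ?k Z r - ?k Z' r)"
    using s by (subst (asm) (1 2) set_integral_Leb(1)) auto
  also have "\<dots> = (LINT r:{s<..T}|lborel. ?k Z r) - (LINT r:{s<..T}|lborel. ?k Z' r)"
    by (rule set_integral_diff(2)[OF compensator_integrable(3)[OF om Zm Z2 s] compensator_integrable(3)[OF om Zm' Z2' s]])
  finally show ?thesis
    unfolding compensated_integral_eq[OF Zm om s] compensated_integral_eq[OF Zm' om s] compensated_integral_eq[OF Dm om s]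
    by (simp add: sum_subtractf)
qed

lemma bsde_spaceD:
  assumes "(Y, Z) \<in> \<M>"
  shows "progressive_field Y"
    "predictable_field Z"
    "norm_sq Y Z < \<infinity>"
  using assms by (auto simp: bsde_space_def)

lemma Prg_nn_integral_measurable:
  assumes Ym: "progressive_field Y"
  shows "(\<lambda>w. \<integral>\<^sup>+s\<in>{t..T}. sqr (Y w s) \<partial>lborel) \<in> borel_measurable \<Q>"
proof -
  have "(\<lambda>(w, s). sqr (Y w s)) \<in> borel_measurable QT"
    using Prg_QL[OF Ym] by (simp add: case_prod_beta')
  then show ?thesis by (rule measurable_set_nn_integral_QL(1)) auto
qed

lemma bsde_space_AE:
  assumes "(Y, Z) \<in> \<M>"
  shows "AE w in \<Q>. w \<in> Om \<and> (\<I> s. sqr (Y w s)) < \<infinity> \<and>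
    rate_integral (square_field Z) w < \<infinity>"
proof -
  note D = bsde_spaceD[OF assms]
  have Zsq: "(square_field Z) \<in> borel_measurable PK"
    using D(2) by (simp add: case_prod_beta')
  have "(\<E> w. (\<I> s. sqr (Y w s))) < \<infinity>"
    "(\<E> w. rate_integral (square_field Z) w) < \<infinity>"
    using D(3) unfolding bsde_norm_sq_eq by auto
  then show ?thesis
    using nn_integral_PInf_AE[OF Prg_nn_integral_measurable[OF D(1)]]
      nn_integral_PInf_AE[OF rate_integral_measurable[OF Zsq]] AE_space
    by (auto simp: less_top)
qed

lemma square_diff_le: "sqr (a - b) \<le> 2 * sqr a + 2 * sqr b"
proof -
  have "(a - b)\<^sup>2 \<le> 2 * a\<^sup>2 + 2 * b\<^sup>2"
    using zero_le_power2[of "a + b"] by (simp add: power2_sum power2_diff)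
  from ennreal_leI[OF this] show ?thesis by (simp add: ennreal_mult)
qed

lemma bsde_space_diff:
  assumes "(Y, Z) \<in> \<M>" "(Y', Z') \<in> \<M>"
  shows "(\<lambda>w s. Y w s - Y' w s, \<lambda>w s y. Z w s y - Z' w s y) \<in> \<M>"
proof -
  note D = bsde_spaceD[OF assms(1)] and D' = bsde_spaceD[OF assms(2)]
  have Zsq: "(square_field Z) \<in> borel_measurable PK"
    "(square_field Z') \<in> borel_measurable PK"
    using D(2) D'(2) by (simp_all add: case_prod_beta')
  let ?zs = "\<lambda>Z. square_field Z"
  have fin: "(\<E> w. (\<I> s. sqr (Y w s))) < \<infinity>"
    "(\<E> w. rate_integral (?zs Z) w) < \<infinity>"
    "(\<E> w. (\<I> s. sqr (Y' w s))) < \<infinity>"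
    "(\<E> w. rate_integral (?zs Z') w) < \<infinity>"
    using D(3) D'(3) unfolding bsde_norm_sq_eq by auto
  have "(\<E> w. (\<I> s. sqr (Y w s - Y' w s))) \<le>
      (\<E> w. 2 * (\<I> s. sqr (Y w s)) + 2 * (\<I> s. sqr (Y' w s)))"
  proof (rule nn_integral_mono)
    fix w assume om: "w \<in> space \<Q>"
    have m: "(\<lambda>s. sqr (W w s)) \<in> borel_measurable Leb" if "progressive_field W" for W :: "'w \<Rightarrow> real \<Rightarrow> real"
      using measurable_Pair2[OF Prg_QL[OF that], of w] om by simp
    have "(\<integral>\<^sup>+s. sqr (Y w s - Y' w s) \<partial>Leb) \<le> (\<integral>\<^sup>+s. 2 * sqr (Y w s) + 2 * sqr (Y' w s) \<partial>Leb)"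
      by (intro nn_integral_mono square_diff_le)
    also have "\<dots> = 2 * (\<integral>\<^sup>+s. sqr (Y w s) \<partial>Leb) + 2 * (\<integral>\<^sup>+s. sqr (Y' w s) \<partial>Leb)"
      using m[OF D(1)] m[OF D'(1)] by (subst nn_integral_add) (auto simp: nn_integral_cmult)
    finally show "(\<I> s. sqr (Y w s - Y' w s)) \<le>
        2 * (\<I> s. sqr (Y w s)) + 2 * (\<I> s. sqr (Y' w s))"
      by (simp add: nn_integral_restrict_space)
  qed
  also have "\<dots> < \<infinity>"
    using fin Prg_nn_integral_measurable[OF D(1)] Prg_nn_integral_measurable[OF D'(1)]
    by (subst nn_integral_add) (auto simp: nn_integral_cmult ennreal_mult_less_top)
  finally have 1: "(\<E> w. (\<I> s. sqr (Y w s - Y' w s))) < \<infinity>" .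
  have "(\<E> w. rate_integral (?zs (\<lambda>w s y. Z w s y - Z' w s y)) w) \<le>
      (\<E> w. 2 * rate_integral (?zs Z) w + 2 * rate_integral (?zs Z') w)"
  proof (rule nn_integral_mono)
    fix w assume om: "w \<in> space \<Q>"
    have "rate_integral (?zs (\<lambda>w s y. Z w s y - Z' w s y)) w \<le> rate_integral (\<lambda>p. 2 * ?zs Z p + 2 * ?zs Z' p) w"
      by (intro rate_integral_mono) (simp add: case_prod_beta' square_diff_le)
    also have "\<dots> = 2 * rate_integral (?zs Z) w + 2 * rate_integral (?zs Z') w"
      using om Zsq by (subst rate_integral_add) (auto simp: rate_integral_cmult)
    finally show "rate_integral (?zs (\<lambda>w s y. Z w s y - Z' w s y)) w \<le> 2 * rate_integral (?zs Z) w + 2 * rate_integral (?zs Z') w" .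
  qed
  also have "\<dots> < \<infinity>"
    using fin rate_integral_measurable[OF Zsq(1)] rate_integral_measurable[OF Zsq(2)]
    by (subst nn_integral_add) (auto simp: nn_integral_cmult ennreal_mult_less_top)
  finally have 2: "(\<E> w. rate_integral (?zs (\<lambda>w s y. Z w s y - Z' w s y)) w) < \<infinity>" .
  show ?thesis
    using D(1,2) D'(1,2) 1 2 unfolding bsde_space_def bsde_norm_sq_eq by (simp add: case_prod_beta')
qed

lemma zero_driver_measurable:
  assumes gen: "generator L L' f"
  shows "(\<lambda>(s, y). f s y 0 (\<lambda>_. 0)) \<in> borel_measurable (Time \<Otimes>\<^sub>M K)"
proof -
  have "(\<lambda>p. (fst p, snd p, 0 :: real)) \<in> Time \<Otimes>\<^sub>M K \<rightarrow>\<^sub>M Time \<Otimes>\<^sub>M K \<Otimes>\<^sub>M borel"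
    by (intro measurable_Pair measurable_fst measurable_snd measurable_const) simp
  moreover have "bounded ((\<lambda>_. 0 :: real) ` space K)"
    by (rule bounded_subset[of "{0}"]) auto
  then have "(\<lambda>(s, y, r). f s y r (\<lambda>_. 0)) \<in> borel_measurable (Time \<Otimes>\<^sub>M K \<Otimes>\<^sub>M borel)"
    by (intro generatorD(3)[OF gen]) simp_all
  ultimately have "(\<lambda>p. (\<lambda>(s, y, r). f s y r (\<lambda>_. 0)) (fst p, snd p, 0 :: real)) \<in> borel_measurable (Time \<Otimes>\<^sub>M K)"
    by (rule measurable_compose)
  then show ?thesis by (simp add: case_prod_beta')
qed

lemma time_space_section:
  assumes h: "(\<lambda>(s, y). h s y) \<in> borel_measurable (Time \<Otimes>\<^sub>M K)"
  shows "(\<lambda>(w, s). h s (X s w)) \<in> borel_measurable QT"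
    and "w \<in> Om \<Longrightarrow> (\<lambda>s. h s (X s w)) \<in> borel_measurable Leb"
proof -
  have "(\<lambda>p. (snd p, X (snd p) (fst p))) \<in> QT \<rightarrow>\<^sub>M Time \<Otimes>\<^sub>M K"
    using X_QL by (intro measurable_Pair measurable_compose[OF measurable_snd id_Leb]) (simp add: case_prod_beta')
  from measurable_compose[OF this h] show 1: "(\<lambda>(w, s). h s (X s w)) \<in> borel_measurable QT"
    by (simp add: case_prod_beta')
  show "(\<lambda>s. h s (X s w)) \<in> borel_measurable Leb" if "w \<in> Om"
    using measurable_Pair2[OF 1, of w] that by simp
qed

text \<open>\<open>Z w r\<close> may fail to be square integrable on a null set of times, where the
  driver is not controlled. Setting it to 0 there gives a measurable function of \<open>r\<close>,
  and linear growth of the driver with \<open>\<bar>a\<bar> \<le> 1 + a^2\<close> bounds it; the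
  original driver agrees with it almost everywhere.\<close>

lemma driver_integrable_pathwise:
  assumes gen: "generator L L' f" and om: "w \<in> Om"
    and Ys: "Y w \<in> borel_measurable Leb"
    and Zm: "predictable_field Z"
    and Y2: "(\<I> s. sqr (Y w s)) < \<infinity>"
    and Z2: "rate_integral (square_field Z) w < \<infinity>"
    and f2: "(\<I> s. sqr \<bar>f s (X s w) 0 (\<lambda>_. 0)\<bar>) < \<infinity>"
  shows "set_integrable lebesgue {t<..T} (\<lambda>r. f r (X r w) (Y w r) (Z w r))"
proof -
  define n where "n r = (\<integral>\<^sup>+y. sqr (Z w r y) \<partial>nu r (X r w))" for r
  have Zsq: "(square_field Z) \<in> borel_measurable PK"
    using Zm by (simp add: case_prod_beta')
  have nm[measurable]: "n \<in> borel_measurable Leb" and nint: "(\<integral>\<^sup>+r. n r \<partial>Leb) < \<infinity>"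
    using kernel_X_section[OF om Zsq] Z2 by (simp_all add: n_def[abs_def])
  define W where "W r y = (if n r < \<infinity> then Z w r y else 0)" for r y
  have Wm: "(\<lambda>(r, y). W r y) \<in> borel_measurable (Leb \<Otimes>\<^sub>M K)"
  proof -
    have "{r \<in> space Leb. n r < \<infinity>} \<in> sets Leb" by measurable
    then have "{p \<in> space (Leb \<Otimes>\<^sub>M K). n (fst p) < \<infinity>} \<in> sets (Leb \<Otimes>\<^sub>M K)"
      using measurable_compose[OF measurable_fst nm] by measurable
    then show ?thesis
      unfolding W_def using section_Prd[OF om Zm] by (simp add: case_prod_beta' measurable_If)
  qed
  have Wsq: "square_integrable (nu r (X r w)) (W r)" if "r \<in> space Leb" for r
  proof (cases "n r < \<infinity>")
    case True
    then have "W r = Z w r" by (auto simp: W_def)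
    then show ?thesis using True Z_section_square_integrable[OF om Zm, of r] that by (simp add: n_def)
  qed (simp add: W_def[abs_def] square_integrable_def)
  let ?\<phi> = "\<lambda>r. f r (X r w) (Y w r) (W r)"
  have m: "?\<phi> \<in> borel_measurable Leb"
    by (rule generator_measurable[OF gen id_Leb X_section[OF om] Ys Wm Wsq])
  have f0m: "(\<lambda>r. f r (X r w) 0 (\<lambda>_. 0)) \<in> borel_measurable Leb"
    by (rule time_space_section(2)[OF zero_driver_measurable[OF gen] om])
  have L: "0 \<le> L" "0 \<le> L'" using generatorD[OF gen] by auto
  have bound: "ennreal \<bar>?\<phi> r\<bar> \<le> (ennreal (1 + L + L') + sqr \<bar>f r (X r w) 0 (\<lambda>_. 0)\<bar>) + (ennreal L' * sqr (Y w r) + ennreal L * n r)"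
    if r: "r \<in> {t..T}" for r
  proof -
    have rT: "r \<in> {0..T}" and Xr: "X r w \<in> space K" using r t_nonneg X_space[of r w] om by auto
    let ?q = "LINT y|nu r (X r w). \<bar>W r y - 0\<bar>\<^sup>2"
    have z0: "square_integrable (nu r (X r w)) (\<lambda>_. 0)" by (simp add: square_integrable_def)
    have "\<bar>?\<phi> r - f r (X r w) 0 (\<lambda>_. 0)\<bar> \<le> L' * \<bar>Y w r - 0\<bar> + L * sqrt ?q"
      using Wsq r by (intro generatorD(4)[OF gen rT Xr _ z0]) simp
    moreover have "\<bar>a\<bar> \<le> 1 + a\<^sup>2" for a :: real
      using sum_squares_bound[of "\<bar>a\<bar>" 1] by simp
    note this[of "Y w r"] this[of "f r (X r w) 0 (\<lambda>_. 0)"] this[of "sqrt ?q"]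
    moreover have "(sqrt ?q)\<^sup>2 = ?q" by simp
    moreover have "0 \<le> sqrt ?q" by simp
    ultimately have "\<bar>?\<phi> r\<bar> \<le> (1 + (f r (X r w) 0 (\<lambda>_. 0))\<^sup>2) + (L' * (1 + (Y w r)\<^sup>2) + L * (1 + ?q))"
      using L mult_left_mono[of "\<bar>Y w r\<bar>" "1 + (Y w r)\<^sup>2" L'] mult_left_mono[of "sqrt ?q" "1 + ?q" L] by simp
    from ennreal_leI[OF this] have "ennreal \<bar>?\<phi> r\<bar> \<le> ennreal ((1 + L + L' + (f r (X r w) 0 (\<lambda>_. 0))\<^sup>2) + (L' * (Y w r)\<^sup>2 + L * ?q))"
      by (simp add: algebra_simps)
    also have "\<dots> = (ennreal (1 + L + L') + sqr \<bar>f r (X r w) 0 (\<lambda>_. 0)\<bar>) + (ennreal L' * sqr (Y w r) + ennreal L * ennreal ?q)"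
      using L by (simp add: ennreal_mult)
    also have "ennreal ?q \<le> n r"
    proof (cases "n r < \<infinity>")
      case True
      then have "W r = Z w r" by (auto simp: W_def)
      moreover have "integrable (nu r (X r w)) (\<lambda>y. (Z w r y)\<^sup>2)"
        using True Z_section_square_integrable[OF om Zm r] by (simp add: n_def square_integrable_def)
      ultimately show ?thesis unfolding n_def by (simp add: nn_integral_eq_integral)
    qed (simp add: W_def)
    finally show ?thesis by (simp add: add_left_mono mult_left_mono)
  qed
  have "(\<integral>\<^sup>+r. ennreal \<bar>?\<phi> r\<bar> \<partial>Leb) \<le> (\<integral>\<^sup>+r. (ennreal (1 + L + L') + sqr \<bar>f r (X r w) 0 (\<lambda>_. 0)\<bar>) + (ennreal L' * sqr (Y w r) + ennreal L * n r) \<partial>Leb)"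
    using bound by (intro nn_integral_mono) simp
  also have "\<dots> = (ennreal (1 + L + L') * emeasure Leb (space Leb) + (\<I> s. sqr \<bar>f s (X s w) 0 (\<lambda>_. 0)\<bar>)) +
      (ennreal L' * (\<I> s. sqr (Y w s)) + ennreal L * (\<integral>\<^sup>+r. n r \<partial>Leb))"
    using Ys f0m nm by (simp add: nn_integral_add nn_integral_cmult nn_integral_restrict_space)
  also have "\<dots> < \<infinity>"
    using Y2 f2 nint finite_measure.emeasure_finite[OF finite_measure_Leb, of "space Leb"]
    by (simp add: ennreal_mult_less_top less_top[symmetric] ennreal_mult_eq_top_iff)
  finally have "integrable Leb ?\<phi>" using m by (simp add: integrable_iff_bounded)
  from integrable_mult_indicator[OF _ this, of "{t<..T}"]
  have "integrable Leb (\<lambda>r. indicator {t<..T} r * ?\<phi> r)"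
    by (simp add: sets_restrict_space_iff subset_iff)
  then have i: "set_integrable lborel {t<..T} ?\<phi>"
    by (subst (asm) set_integral_Leb(2)) auto
  have "AE r in Leb. n r \<noteq> \<infinity>" using nint by (intro nn_integral_PInf_AE nm) auto
  then have "AE r in lborel. r \<in> {t..T} \<longrightarrow> n r \<noteq> \<infinity>" by (subst (asm) AE_restrict_space_iff) auto
  then have "AE r in lborel. r \<in> {t<..T} \<longrightarrow> f r (X r w) (Y w r) (Z w r) = ?\<phi> r"
    by eventually_elim (auto simp: W_def[abs_def] less_top)
  from set_integral_lebesgue_AE(1)[OF _ i this] show ?thesis by simp
qed

text \<open>Perturbations \<open>d\<close> depending on time and state alone are the relevant ones,
  as truncation acts on the driver at zero only.\<close>

lemma driver_difference:
  assumes gen: "generator L L' f" and om: "w \<in> Om"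
    and Z: "predictable_field Z" "rate_integral (square_field Z) w < \<infinity>"
    and Z': "predictable_field Z'" "rate_integral (square_field Z') w < \<infinity>"
    and f': "\<And>r y u z. f' r y u z = f r y u z + d r y"
  shows "AE r in lborel. r \<in> {t..T} \<longrightarrow>
    \<bar>f' r (X r w) (Y' w r) (Z' w r) - f r (X r w) (Y w r) (Z w r)\<bar> \<le>
      L' * \<bar>Y' w r - Y w r\<bar> + L * sqrt (LINT y|nu r (X r w). \<bar>Z' w r y - Z w r y\<bar>\<^sup>2) + \<bar>d r (X r w)\<bar>"
proof -
  have "AE r in Leb. square_integrable (nu r (X r w)) (Z w r) \<and> square_integrable (nu r (X r w)) (Z' w r)"
    using AE_square_integrable[OF om Z] AE_square_integrable[OF om Z'] by auto
  then have "AE r in lborel. r \<in> {t..T} \<longrightarrow> square_integrable (nu r (X r w)) (Z w r) \<and> square_integrable (nu r (X r w)) (Z' w r)"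
    by (subst (asm) AE_restrict_space_iff) auto
  then show ?thesis
  proof eventually_elim
    case (elim r)
    show ?case
    proof
      assume r: "r \<in> {t..T}"
      then have "r \<in> {0..T}" "X r w \<in> space K" using t_nonneg X_space[of r w] om by auto
      then have "\<bar>f r (X r w) (Y' w r) (Z' w r) - f r (X r w) (Y w r) (Z w r)\<bar> \<le>
          L' * \<bar>Y' w r - Y w r\<bar> + L * sqrt (LINT y|nu r (X r w). \<bar>Z' w r y - Z w r y\<bar>\<^sup>2)"
        using elim r by (intro generatorD(4)[OF gen]) auto
      then show "\<bar>f' r (X r w) (Y' w r) (Z' w r) - f r (X r w) (Y w r) (Z w r)\<bar> \<le>
          L' * \<bar>Y' w r - Y w r\<bar> + L * sqrt (LINT y|nu r (X r w). \<bar>Z' w r y - Z w r y\<bar>\<^sup>2) + \<bar>d r (X r w)\<bar>"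
        unfolding f' by linarith
    qed
  qed
qed

text \<open>The two sides of the equation are linear in the pair, the terminal value and the driver
  process. The difference therefore satisfies an equation whose driver process is the difference
  along the two solutions, and \<open>a_priori_estimate\<close> applies with the Lipschitz constants
  of \<open>f\<close>.\<close>

lemma solution_stability:
  assumes gen: "generator L L' f"
    and S: "(Y, Z) \<in> \<M>" "(Y', Z') \<in> \<M>"
    and f': "\<And>r y u z. f' r y u z = f r y u z + d r y"
    and d: "(\<lambda>(s, y). d s y) \<in> borel_measurable (Time \<Otimes>\<^sub>M K)"
    and i: "AE w in \<Q>. set_integrable lebesgue {t<..T} (\<lambda>r. f r (X r w) (Y w r) (Z w r))"
    and i': "AE w in \<Q>. set_integrable lebesgue {t<..T} (\<lambda>r. f' r (X r w) (Y' w r) (Z' w r))"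
    and sol: "solves_bsde K nu X \<Q> t T g f Y Z" and sol': "solves_bsde K nu X \<Q> t T g' f' Y' Z'"
    and g: "g \<in> borel_measurable K" "g' \<in> borel_measurable K"
  shows "norm_sq (\<lambda>w s. Y' w s - Y w s) (\<lambda>w s y. Z' w s y - Z w s y) \<le>
    ennreal (estimate_const L L') * ((\<E> w. sqr (g' (X T w) - g (X T w))) +
      (\<E> w. (\<I> r. sqr (d r (X r w)))))"
proof (rule a_priori_estimate)
  note D = bsde_spaceD[OF bsde_space_diff[OF S(2,1)]]
  show "0 \<le> L" "0 \<le> L'" using generatorD[OF gen] by auto
  show "(\<lambda>(w, s). Y' w s - Y w s) \<in> borel_measurable Prg" by (rule D(1))
  show "(\<lambda>((w, s), y). Z' w s y - Z w s y) \<in> borel_measurable PK" by (rule D(2))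
  show "norm_sq (\<lambda>w s. Y' w s - Y w s) (\<lambda>w s y. Z' w s y - Z w s y) < \<infinity>" by (rule D(3))
  show "(\<lambda>w. g' (X T w) - g (X T w)) \<in> borel_measurable \<Q>"
    using measurable_compose[OF X_Q[OF t_le_T] g(1)] measurable_compose[OF X_Q[OF t_le_T] g(2)] by simp
  show "(\<lambda>(w, r). d r (X r w)) \<in> borel_measurable QT" by (rule time_space_section(1)[OF d])
  show "AE w in \<Q>. set_integrable lebesgue {t<..T} (\<lambda>r. f' r (X r w) (Y' w r) (Z' w r) - f r (X r w) (Y w r) (Z w r))"
    using i i' by eventually_elim (rule set_integral_diff(1))
  show "AE w in \<Q>. \<forall>s\<in>{t..T}. Y' w s - Y w s + compensated_integral K nu X t s T (\<lambda>w s y. Z' w s y - Z w s y) w =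
      g' (X T w) - g (X T w) + (LINT r:{s<..T}|lebesgue. f' r (X r w) (Y' w r) (Z' w r) - f r (X r w) (Y w r) (Z w r))"
    using bsde_space_AE[OF S(1)] bsde_space_AE[OF S(2)] i i' sol[unfolded solves_bsde_def] sol'[unfolded solves_bsde_def]
  proof eventually_elim
    case (elim w)
    show ?case
    proof
      fix s assume s: "s \<in> {t..T}"
      have sub: "set_integrable lebesgue {s<..T} h" if "set_integrable lebesgue {t<..T} h" for h :: "real \<Rightarrow> real"
        using s by (intro set_integrable_subset[OF that]) (auto simp: subset_iff)
      have "compensated_integral K nu X t s T (\<lambda>w s y. Z' w s y - Z w s y) w =
          compensated_integral K nu X t s T Z' w - compensated_integral K nu X t s T Z w"
        using elim(1,2) by (intro compensated_integral_diff s bsde_spaceD(2)[OF S(1)] bsde_spaceD(2)[OF S(2)]) auto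
      moreover have "(LINT r:{s<..T}|lebesgue. f' r (X r w) (Y' w r) (Z' w r) - f r (X r w) (Y w r) (Z w r)) =
          (LINT r:{s<..T}|lebesgue. f' r (X r w) (Y' w r) (Z' w r)) - (LINT r:{s<..T}|lebesgue. f r (X r w) (Y w r) (Z w r))"
        by (rule set_integral_diff(2)[OF sub[OF elim(4)] sub[OF elim(3)]])
      ultimately show "Y' w s - Y w s + compensated_integral K nu X t s T (\<lambda>w s y. Z' w s y - Z w s y) w =
        g' (X T w) - g (X T w) + (LINT r:{s<..T}|lebesgue. f' r (X r w) (Y' w r) (Z' w r) - f r (X r w) (Y w r) (Z w r))"
        using bspec[OF elim(5) s] bspec[OF elim(6) s] by linarith
    qed
  qed
  show "AE w in \<Q>. AE r in lborel. r \<in> {t<..T} \<longrightarrow>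
      \<bar>f' r (X r w) (Y' w r) (Z' w r) - f r (X r w) (Y w r) (Z w r)\<bar> \<le>
      L' * \<bar>Y' w r - Y w r\<bar> + L * sqrt (LINT y|nu r (X r w). \<bar>Z' w r y - Z w r y\<bar>\<^sup>2) + \<bar>d r (X r w)\<bar>"
    using bsde_space_AE[OF S(1)] bsde_space_AE[OF S(2)]
  proof eventually_elim
    case (elim w)
    then have "AE r in lborel. r \<in> {t..T} \<longrightarrow>
      \<bar>f' r (X r w) (Y' w r) (Z' w r) - f r (X r w) (Y w r) (Z w r)\<bar> \<le>
        L' * \<bar>Y' w r - Y w r\<bar> + L * sqrt (LINT y|nu r (X r w). \<bar>Z' w r y - Z w r y\<bar>\<^sup>2) + \<bar>d r (X r w)\<bar>"
      by (intro driver_difference[OF gen _ bsde_spaceD(2)[OF S(1)] _ bsde_spaceD(2)[OF S(2)] _ f']) auto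
    then show ?case by eventually_elim auto
  qed
qed

section \<open>Solutions given by a function of time and state\<close>

lemma snd_Prd: "snd \<in> Prd \<rightarrow>\<^sub>M Time"
proof -
  have "snd \<in> borel_measurable Prd"
  proof (rule borel_measurableI_le)
    fix a :: real
    have "{p \<in> space Prd. snd p \<le> a} = (if a < t then {} else Om \<times> {t} \<union> Om \<times> {t<..min a T})"
      using t_le_T by auto
    also have "\<dots> \<in> sets Prd"
      using Prd_t[of Om] Prd_Ioc[of Om t "min a T"] sets.top[of "history Om K X {t}"] sets.top[of "Hist t"] by auto
    finally show "{p \<in> space Prd. snd p \<le> a} \<in> sets Prd" .
  qed
  then show ?thesis using t_nonneg by (auto simp: measurable_restrict_space2_iff)
qed

lemma snd_Prg: "snd \<in> Prg \<rightarrow>\<^sub>M Time"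
proof -
  have "snd \<in> borel_measurable Prg"
  proof (rule borel_measurableI_le)
    fix a :: real
    have "{p \<in> space Prg. snd p \<le> a} \<inter> (Om \<times> {t..s}) \<in> sets (Hist s \<Otimes>\<^sub>M restrict_space borel {t..s})"
      if "s \<in> {t..T}" for s
    proof -
      have "{p \<in> space Prg. snd p \<le> a} \<inter> (Om \<times> {t..s}) = Om \<times> ({..a} \<inter> {t..s})"
        using that by auto
      moreover have "{..a} \<inter> {t..s} \<in> sets (restrict_space borel {t..s})" by (auto simp: sets_restrict_space)
      ultimately show ?thesis using sets.top[of "Hist s"] by auto
    qed
    then have "{p \<in> space Prg. snd p \<le> a} \<in> {A. A \<subseteq> Om \<times> {t..T} \<and> (\<forall>s\<in>{t..T}. A \<inter> (Om \<times> {t..s}) \<in>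
        sets (Hist s \<Otimes>\<^sub>M restrict_space borel {t..s}))}"
      by auto
    moreover have "sets Prg = sigma_sets (Om \<times> {t..T}) {A. A \<subseteq> Om \<times> {t..T} \<and> (\<forall>s\<in>{t..T}. A \<inter> (Om \<times> {t..s}) \<in>
        sets (Hist s \<Otimes>\<^sub>M restrict_space borel {t..s}))}"
      unfolding progressive_def by (subst sets_measure_of) auto
    ultimately show "{p \<in> space Prg. snd p \<le> a} \<in> sets Prg"
      by (simp only:) (rule sigma_sets.Basic)
  qed
  then show ?thesis using t_nonneg by (auto simp: measurable_restrict_space2_iff)
qed

lemma set_integrable_time_space:
  assumes h: "(\<lambda>(s, y). h s y) \<in> borel_measurable (Time \<Otimes>\<^sub>M K)" and om: "w \<in> Om" and s: "s \<in> {t..T}" "u \<le> T"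
    and b: "\<And>r y. r \<in> {0..T} \<Longrightarrow> y \<in> space K \<Longrightarrow> \<bar>h r y\<bar> \<le> (c :: real)"
  shows "set_integrable lborel {s<..u} (\<lambda>r. h r (X r w))"
proof -
  interpret finite_measure Leb by (rule finite_measure_Leb)
  have "\<bar>h r (X r w)\<bar> \<le> c" if "r \<in> {t..T}" for r using that t_nonneg om by (intro b X_space) auto
  then have "integrable Leb (\<lambda>r. h r (X r w))"
    using time_space_section(2)[OF h om] by (intro integrable_const_bound[where B = c]) auto
  from integrable_mult_indicator[OF _ this, of "{s<..u}"]
  have "integrable Leb (\<lambda>r. indicator {s<..u} r * h r (X r w))"
    using s by (simp add: sets_restrict_space_iff subset_iff)
  then show ?thesis using s by (subst (asm) set_integral_Leb(2)) auto
qed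

lemma set_integral_cong_AE:
  fixes h k :: "real \<Rightarrow> real"
  assumes "set_integrable lborel A h" "set_integrable lborel A k" "AE r in lborel. r \<in> A \<longrightarrow> h r = k r"
  shows "(LINT r:A|lborel. h r) = (LINT r:A|lborel. k r)"
  unfolding set_lebesgue_integral_def
  using assms(1,2)[unfolded set_integrable_def, THEN borel_measurable_integrable] assms(3)
  by (intro integral_cong_AE) (auto elim!: eventually_mono simp: indicator_def)

lemma set_integral_Ioc_split:
  fixes h :: "real \<Rightarrow> real"
  assumes "set_integrable lborel {s<..T} h" "s \<le> u" "u \<le> T"
  shows "(LINT r:{s<..T}|lborel. h r) = (LINT r:{s<..u}|lborel. h r) + (LINT r:{u<..T}|lborel. h r)"
proof -
  have "{s<..T} = {s<..u} \<union> {u<..T}" using assms by auto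
  moreover have "(LINT r:{s<..u} \<union> {u<..T}|lborel. h r) = (LINT r:{s<..u}|lborel. h r) + (LINT r:{u<..T}|lborel. h r)"
    using assms by (intro set_integral_Un set_integrable_subset[OF assms(1)]) auto
  ultimately show ?thesis by simp
qed

text \<open>Induction on the number of jumps after \<open>s\<close>. Up to the next jump the state
  is constant, so the integral equation for \<open>v\<close> applies with that state held fixed; at
  a jump \<open>\<tau>\<close> the value changes by
  \<open>v \<tau> (X \<tau> w) - v \<tau> (left_limit X \<tau> w)\<close>, the summand on the
  left.\<close>

lemma backward_field_along_path:
  assumes gen: "generator L L' f" and v: "admissible v"
    and f0: "\<And>r y. r \<in> {0..T} \<Longrightarrow> y \<in> space K \<Longrightarrow> \<bar>f r y 0 (\<lambda>_. 0)\<bar> \<le> b"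
    and eq: "\<And>s y. s \<in> {0..T} \<Longrightarrow> y \<in> space K \<Longrightarrow> v s y = g y + (LINT r:{s<..T}|lborel. backward_field f v r y)"
    and om: "w \<in> Om" and s: "s \<in> {t..T}"
  shows "v s (X s w) + (\<Sum>\<tau>\<in>jumps w \<inter> {s<..T}. v \<tau> (X \<tau> w) - v \<tau> (left_limit X \<tau> w)) =
    g (X T w) + (LINT r:{s<..T}|lborel. backward_field f v r (X r w))"
proof -
  obtain c where c: "\<And>r y. r \<in> {0..T} \<Longrightarrow> y \<in> space K \<Longrightarrow> \<bar>backward_field f v r y\<bar> \<le> c"
    using backward_field_bounded[OF gen v f0] by blast
  let ?F = "\<lambda>r. backward_field f v r (X r w)"
  have Fi: "set_integrable lborel {s<..u} ?F" if "s \<in> {t..T}" "u \<le> T" for s u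
    by (rule set_integrable_time_space[OF backward_field_measurable[OF gen v] om that c])
  have "\<And>s. s \<in> {t..T} \<Longrightarrow> card (jumps w \<inter> {s<..T}) = n \<Longrightarrow>
    v s (X s w) + (\<Sum>\<tau>\<in>jumps w \<inter> {s<..T}. v \<tau> (X \<tau> w) - v \<tau> (left_limit X \<tau> w)) =
    g (X T w) + (LINT r:{s<..T}|lborel. ?F r)" for n
  proof (induction n)
    case (0 s)
    have s: "0 \<le> s" "s \<le> T" using 0 t_nonneg by auto
    have none: "jumps w \<inter> {s<..T} = {}" using 0 finite_jumps_Ioc[OF om s(1), of T] by simp
    have const: "X r w = X s w" if "s \<le> r" "r \<le> T" for r
      using no_jumps_const[OF om s(1) none that] .
    have "(LINT r:{s<..T}|lborel. ?F r) = (LINT r:{s<..T}|lborel. backward_field f v r (X s w))"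
    proof (intro set_lebesgue_integral_cong allI impI)
      show "?F r = backward_field f v r (X s w)" if "r \<in> {s<..T}" for r
        using that by (subst const) auto
    qed simp
    then show ?case using eq[of s "X s w"] s X_space[OF s(1) om] const[OF s(2) order_refl] none by simp
  next
    case (Suc n s)
    let ?J = "jumps w \<inter> {s<..T}"
    have s: "0 \<le> s" "s \<le> T" "t \<le> s" using Suc.prems t_nonneg by auto
    have fin: "finite ?J" by (rule finite_jumps_Ioc[OF om s(1)])
    have ne: "?J \<noteq> {}" using Suc.prems by auto
    define \<tau> where "\<tau> = Min ?J"
    have \<tau>: "\<tau> \<in> ?J" "\<And>\<sigma>. \<sigma> \<in> ?J \<Longrightarrow> \<tau> \<le> \<sigma>" using Min_in[OF fin ne] Min_le[OF fin] by (auto simp: \<tau>_def)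
    then have \<tau>T: "s < \<tau>" "\<tau> \<le> T" by auto
    have J: "?J = insert \<tau> (jumps w \<inter> {\<tau><..T})"
    proof (intro set_eqI iffI)
      show "\<sigma> \<in> insert \<tau> (jumps w \<inter> {\<tau><..T})" if "\<sigma> \<in> ?J" for \<sigma>
        using \<tau>(2)[OF that] that by (cases "\<sigma> = \<tau>") auto
      show "\<sigma> \<in> ?J" if "\<sigma> \<in> insert \<tau> (jumps w \<inter> {\<tau><..T})" for \<sigma>
        using \<tau>(1) \<tau>T that by auto
    qed
    have card: "card (jumps w \<inter> {\<tau><..T}) = n" using Suc.prems(2) fin unfolding J by (subst (asm) card_insert_disjoint) auto
    have none: "jumps w \<inter> {s<..<\<tau>} = {}"
    proof (rule ccontr)
      assume "jumps w \<inter> {s<..<\<tau>} \<noteq> {}"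
      then obtain \<sigma> where "\<sigma> \<in> jumps w" "s < \<sigma>" "\<sigma> < \<tau>" by auto
      with \<tau>(2)[of \<sigma>] \<tau>T show False by auto
    qed
    have left: "left_limit X \<tau> w = X s w" by (rule left_limit_no_jumps[OF om s(1) none \<tau>T(1)])
    have const: "X r w = X s w" if "s \<le> r" "r < \<tau>" for r
    proof (rule no_jumps_const[OF om s(1) _ that(1) order_refl])
      show "jumps w \<inter> {s<..r} = {}" using none that by auto
    qed
    let ?y = "X s w"
    have y: "?y \<in> space K" by (rule X_space[OF s(1) om])
    have Bi: "set_integrable lborel {s<..u} (\<lambda>r. backward_field f v r ?y)" if "u \<le> T" for u
      by (rule set_integrable_backward_field[OF gen v y f0 s(1) that])
    have "v s ?y - v \<tau> ?y = (LINT r:{s<..\<tau>}|lborel. backward_field f v r ?y)"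
      using eq[of s ?y] eq[of \<tau> ?y] s \<tau>T y set_integral_Ioc_split[OF Bi[OF order_refl], of \<tau>] by auto
    also have "\<dots> = (LINT r:{s<..\<tau>}|lborel. ?F r)"
    proof (rule set_integral_cong_AE[OF Bi[OF \<tau>T(2)] Fi])
      show "AE r in lborel. r \<in> {s<..\<tau>} \<longrightarrow> backward_field f v r ?y = ?F r"
        using AE_lborel_singleton[of \<tau>]
      proof eventually_elim
        case (elim r)
        show ?case
        proof
          assume "r \<in> {s<..\<tau>}"
          then have "X r w = ?y" using elim by (intro const) auto
          then show "backward_field f v r ?y = ?F r" by (simp only:)
        qed
      qed
    qed (use Suc.prems \<tau>T in auto)
    finally have "v s ?y - v \<tau> ?y = (LINT r:{s<..\<tau>}|lborel. ?F r)" .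
    moreover have "v \<tau> (X \<tau> w) + (\<Sum>\<tau>\<in>jumps w \<inter> {\<tau><..T}. v \<tau> (X \<tau> w) - v \<tau> (left_limit X \<tau> w)) =
        g (X T w) + (LINT r:{\<tau><..T}|lborel. ?F r)"
      using \<tau>T s by (intro Suc.IH card) auto
    moreover have "(\<Sum>\<tau>\<in>?J. v \<tau> (X \<tau> w) - v \<tau> (left_limit X \<tau> w)) = (v \<tau> (X \<tau> w) - v \<tau> ?y) +
        (\<Sum>\<tau>\<in>jumps w \<inter> {\<tau><..T}. v \<tau> (X \<tau> w) - v \<tau> (left_limit X \<tau> w))"
      using fin unfolding J left[symmetric] by (subst sum.insert) auto
    ultimately show ?case
      using set_integral_Ioc_split[OF Fi[OF Suc.prems(1) order_refl], of \<tau>] \<tau>T by linarith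
  qed
  from this[OF s refl] show ?thesis .
qed

text \<open>Writing \<open>Z\<close> with \<open>pre\<close> makes it predictable; bounded
  \<open>v\<close> and bounded rates give a finite norm.\<close>

lemma markovian_pair:
  assumes v: "admissible v"
  shows "(\<lambda>w s. v s (X s w), \<lambda>w s y. v s y - v s (pre s w)) \<in> \<M>"
proof -
  obtain c where c: "\<And>r y. r \<in> {0..T} \<Longrightarrow> y \<in> space K \<Longrightarrow> \<bar>v r y\<bar> \<le> c" using v unfolding admissible_def by blast
  have vm: "(\<lambda>(s, y). v s y) \<in> borel_measurable (Time \<Otimes>\<^sub>M K)" using v by (simp add: admissible_def)
  have "(\<lambda>p. (snd p, X (snd p) (fst p))) \<in> Prg \<rightarrow>\<^sub>M Time \<Otimes>\<^sub>M K"
    using X_progressive snd_Prg by (intro measurable_Pair) (simp_all add: case_prod_beta')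
  from measurable_compose[OF this vm] have Ym: "(\<lambda>(w, s). v s (X s w)) \<in> borel_measurable Prg"
    by (simp add: case_prod_beta')
  have sm: "(\<lambda>q. snd (fst q)) \<in> PK \<rightarrow>\<^sub>M Time" by (rule measurable_compose[OF measurable_fst snd_Prd])
  have pm: "(\<lambda>q. pre (snd (fst q)) (fst (fst q))) \<in> PK \<rightarrow>\<^sub>M K"
    using measurable_compose[OF measurable_fst pre_predictable, of K] by (simp add: case_prod_beta')
  have "(\<lambda>q. (snd (fst q), snd q)) \<in> PK \<rightarrow>\<^sub>M Time \<Otimes>\<^sub>M K"
    using sm by (intro measurable_Pair) auto
  note 1 = measurable_compose[OF this vm]
  have "(\<lambda>q. (snd (fst q), pre (snd (fst q)) (fst (fst q)))) \<in> PK \<rightarrow>\<^sub>M Time \<Otimes>\<^sub>M K"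
    using sm pm by (intro measurable_Pair) auto
  note 2 = measurable_compose[OF this vm]
  have Zm: "(\<lambda>((w, s), y). v s y - v s (pre s w)) \<in> borel_measurable PK"
    using borel_measurable_diff[OF 1 2] by (simp add: case_prod_beta')
  have len: "emeasure lborel {t..T} < \<infinity>" using t_le_T by simp
  have sq: "sqr a \<le> sqr d" if "\<bar>a\<bar> \<le> d" for a d :: real
    using that power_mono[of "\<bar>a\<bar>" d 2] by (simp add: ennreal_leI)
  have "(\<E> w. (\<I> s. sqr (v s (X s w)))) \<le> (\<E> w. sqr c * emeasure lborel {t..T})"
  proof (rule nn_integral_mono)
    fix w assume "w \<in> space \<Q>"
    then have om: "w \<in> Om" by simp
    have "\<bar>v s (X s w)\<bar> \<le> c" if "s \<in> {t..T}" for s using that t_nonneg om by (intro c X_space) auto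
    from sq[OF this] have "(\<I> s. sqr (v s (X s w))) \<le> (\<integral>\<^sup>+s. sqr c * indicator {t..T} s \<partial>lborel)"
      by (intro nn_integral_mono) (auto simp: indicator_def)
    then show "(\<I> s. sqr (v s (X s w))) \<le> sqr c * emeasure lborel {t..T}"
      by (subst (asm) nn_integral_cmult_indicator) auto
  qed
  also have "\<dots> < \<infinity>" using len Q.emeasure_space_1 by (simp add: ennreal_mult_less_top)
  finally have Yf: "(\<E> w. (\<I> s. sqr (v s (X s w)))) < \<infinity>" .
  have "(\<E> w. rate_integral (\<lambda>((w, r), y). sqr (v r y - v r (pre r w))) w) \<le>
      (\<E> w. sqr (2 * c) * ennreal rate_bound * emeasure Leb (space Leb))"
  proof (rule nn_integral_mono)
    fix w assume "w \<in> space \<Q>"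
    then have om: "w \<in> Om" by simp
    have inner: "(\<integral>\<^sup>+y. sqr (v r y - v r (pre r w)) \<partial>nu r (pre r w)) \<le> sqr (2 * c) * ennreal rate_bound"
      if r: "r \<in> {t..T}" for r
    proof -
      have r': "r \<in> {0..T}" and p: "pre r w \<in> space K" using r t_nonneg pre_space[OF om] by auto
      have "(\<integral>\<^sup>+y. sqr (v r y - v r (pre r w)) \<partial>nu r (pre r w)) \<le> (\<integral>\<^sup>+y. sqr (2 * c) \<partial>nu r (pre r w))"
      proof (rule nn_integral_mono)
        fix y assume "y \<in> space (nu r (pre r w))"
        then have "y \<in> space K" using r' p by (simp add: space_nu)
        then show "sqr (v r y - v r (pre r w)) \<le> sqr (2 * c)"
          using c[OF r' \<open>y \<in> space K\<close>] c[OF r' p] by (intro sq) linarith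
      qed
      also have "\<dots> = sqr (2 * c) * emeasure (nu r (pre r w)) (space (nu r (pre r w)))" by simp
      also have "\<dots> \<le> sqr (2 * c) * ennreal rate_bound"
        using emeasure_nu_le[OF r' p] by (intro mult_left_mono) auto
      finally show ?thesis .
    qed
    have "rate_integral (\<lambda>((w, r), y). sqr (v r y - v r (pre r w))) w \<le> (\<integral>\<^sup>+r. sqr (2 * c) * ennreal rate_bound \<partial>Leb)"
      unfolding rate_integral_def using inner by (intro nn_integral_mono) simp
    then show "rate_integral (\<lambda>((w, r), y). sqr (v r y - v r (pre r w))) w \<le>
        sqr (2 * c) * ennreal rate_bound * emeasure Leb (space Leb)" by simp
  qed
  also have "\<dots> < \<infinity>"
    using finite_measure.emeasure_finite[OF finite_measure_Leb, of "space Leb"] Q.emeasure_space_1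
    by (simp add: ennreal_mult_less_top less_top)
  finally show ?thesis
    using Ym Zm Yf unfolding bsde_space_def bsde_norm_sq_eq by simp
qed

theorem bounded_solution:
  assumes gen: "generator L L' f"
    and f0: "\<And>r y. r \<in> {0..T} \<Longrightarrow> y \<in> space K \<Longrightarrow> \<bar>f r y 0 (\<lambda>_. 0)\<bar> \<le> b"
    and g: "g \<in> borel_measurable K" "\<And>y. y \<in> space K \<Longrightarrow> \<bar>g y\<bar> \<le> a"
  obtains Y Z where "(Y, Z) \<in> \<M>" "solves_bsde K nu X \<Q> t T g f Y Z"
proof -
  obtain v where v: "admissible v"
    and eq: "\<And>s y. s \<in> {0..T} \<Longrightarrow> y \<in> space K \<Longrightarrow> v s y = g y + (LINT r:{s<..T}|lborel. backward_field f v r y)"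
    using bounded_backward_solution[OF gen f0 g] by blast
  define Y where "Y w s = v s (X s w)" for w s
  define Z where "Z w s y = v s y - v s (pre s w)" for w s y
  have YZ: "(Y, Z) \<in> \<M>"
    using markovian_pair[OF v] by (simp add: Y_def[abs_def] Z_def[abs_def])
  \<comment> \<open>The compensator of \<open>Z\<close> as the backward field with driver 0, so that
    its measurability and boundedness are instances of results already proved. Subtracting it from
    the full field leaves the driver.\<close>
  define \<kappa> where "\<kappa> = backward_field (\<lambda>_ _ _ _. 0) v"
  have gen0: "generator 0 0 (\<lambda>_ _ _ _. 0)" by (simp add: generator_def)
  obtain c where c: "\<And>r y. r \<in> {0..T} \<Longrightarrow> y \<in> space K \<Longrightarrow> \<bar>backward_field f v r y\<bar> \<le> c"
    using backward_field_bounded[OF gen v f0] by blast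
  obtain k where k: "\<And>r y. r \<in> {0..T} \<Longrightarrow> y \<in> space K \<Longrightarrow> \<bar>\<kappa> r y\<bar> \<le> k"
    unfolding \<kappa>_def using backward_field_bounded[OF gen0 v, of 0] by auto
  have "AE w in \<Q>. \<forall>s\<in>{t..T}. Y w s + compensated_integral K nu X t s T Z w =
    g (X T w) + (LINT r:{s<..T}|lebesgue. f r (X r w) (Y w r) (Z w r))"
    using bsde_space_AE[OF YZ]
  proof eventually_elim
    case (elim w)
    then have om: "w \<in> Om" and Z2: "rate_integral (square_field Z) w < \<infinity>" by auto
    show ?case
    proof
      fix s assume s: "s \<in> {t..T}"
      let ?F = "\<lambda>r. backward_field f v r (X r w)" and ?\<kappa> = "\<lambda>r. \<kappa> r (X r w)"
      have Fi: "set_integrable lborel {s<..T} ?F"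
        by (rule set_integrable_time_space[OF backward_field_measurable[OF gen v] om s order_refl c])
      have \<kappa>i: "set_integrable lborel {s<..T} ?\<kappa>"
        by (rule set_integrable_time_space[OF backward_field_measurable[OF gen0 v, folded \<kappa>_def] om s order_refl k])
      have pre: "AE r in lborel. r \<in> {s<..T} \<longrightarrow> pre r w = X r w"
        using AE_pre_eq[OF om] by eventually_elim (use s in auto)
      have "(LINT r:{s<..T}|lborel. (LINT y|nu r (pre r w). Z w r y)) = (LINT r:{s<..T}|lborel. ?\<kappa> r)"
      proof (rule set_integral_cong_AE[OF compensator_integrable(3)[OF om bsde_spaceD(2)[OF YZ] Z2 s] \<kappa>i])
        show "AE r in lborel. r \<in> {s<..T} \<longrightarrow> (LINT y|nu r (pre r w). Z w r y) = ?\<kappa> r"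
          using pre by eventually_elim (simp add: \<kappa>_def backward_field_def Z_def[abs_def])
      qed
      moreover have "(LINT r:{s<..T}|lebesgue. f r (X r w) (Y w r) (Z w r)) = (LINT r:{s<..T}|lborel. ?F r - ?\<kappa> r)"
      proof (rule set_integral_lebesgue_AE(2)[OF _ set_integral_diff(1)[OF Fi \<kappa>i]])
        show "AE r in lborel. r \<in> {s<..T} \<longrightarrow> f r (X r w) (Y w r) (Z w r) = ?F r - ?\<kappa> r"
          using pre by eventually_elim (simp add: \<kappa>_def backward_field_def Z_def[abs_def] Y_def)
      qed simp
      moreover have "\<dots> = (LINT r:{s<..T}|lborel. ?F r) - (LINT r:{s<..T}|lborel. ?\<kappa> r)"
        by (rule set_integral_diff(2)[OF Fi \<kappa>i])
      moreover have "(\<Sum>\<tau>\<in>jumps w \<inter> {s<..T}. Z w \<tau> (X \<tau> w)) =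
          (\<Sum>\<tau>\<in>jumps w \<inter> {s<..T}. v \<tau> (X \<tau> w) - v \<tau> (left_limit X \<tau> w))"
        using s by (intro sum.cong) (auto simp: Z_def pre_def)
      ultimately show "Y w s + compensated_integral K nu X t s T Z w =
        g (X T w) + (LINT r:{s<..T}|lebesgue. f r (X r w) (Y w r) (Z w r))"
        using backward_field_along_path[OF gen v f0 eq om s]
        unfolding compensated_integral_eq[OF bsde_spaceD(2)[OF YZ] om s] Y_def by simp
    qed
  qed
  with YZ show thesis by (intro that) (simp_all add: solves_bsde_def)
qed

end

section \<open>Square integrable data\<close>

text \<open>What truncation removes: subtracting it leaves \<open>u\<close> where
  \<open>\<bar>u\<bar> \<le> c\<close> and 0 elsewhere. The removed part is the perturbation of the
  data whose norm has to be small.\<close>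

definition excess :: "real \<Rightarrow> real \<Rightarrow> real" where
  "excess c u = (if \<bar>u\<bar> \<le> c then 0 else u)"

lemma borel_measurable_excess [measurable]: "excess c \<in> borel_measurable borel"
  unfolding excess_def[abs_def] by measurable

lemma excess_tail:
  assumes h: "h \<in> borel_measurable M" and i: "(\<integral>\<^sup>+x. sqr (h x) \<partial>M) < \<infinity>"
  shows "(\<lambda>n. \<integral>\<^sup>+x. sqr (excess (real n) (h x)) \<partial>M) \<longlonglongrightarrow> 0"
proof -
  have "(\<lambda>n. \<integral>\<^sup>+x. sqr (excess (real n) (h x)) \<partial>M) \<longlonglongrightarrow> (\<integral>\<^sup>+x. 0 \<partial>M)"
  proof (rule nn_integral_dominated_convergence[where w = "\<lambda>x. sqr (h x)"])
    show "(\<lambda>x. sqr (excess (real n) (h x))) \<in> borel_measurable M" for n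
      using measurable_compose[OF h borel_measurable_excess] by simp
    show "AE x in M. (\<lambda>n. sqr (excess (real n) (h x))) \<longlonglongrightarrow> 0"
    proof (rule AE_I2)
      fix x
      obtain n where "\<bar>h x\<bar> \<le> real n" using real_arch_simple by blast
      then have "\<forall>\<^sub>F m in sequentially. sqr (excess (real m) (h x)) = 0"
        unfolding eventually_sequentially by (intro exI[of _ n]) (auto simp: excess_def)
      then show "(\<lambda>n. sqr (excess (real n) (h x))) \<longlonglongrightarrow> 0" by (rule tendsto_eventually)
    qed
  qed (use h i in \<open>auto simp: excess_def\<close>)
  then show ?thesis by simp
qed

text \<open>Young's inequality with a free parameter: a small \<open>\<delta>\<close> makes the
  constant part vanish at the price of \<open>1 / \<delta>\<close> before a square, which is
  affordable when the squares decay faster.\<close>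

lemma abs_le_young:
  fixes a \<delta> :: real
  assumes "0 < \<delta>"
  shows "\<bar>a\<bar> \<le> \<delta> + 1 / \<delta> * a\<^sup>2"
proof -
  have "2 * \<bar>a\<bar> * \<delta> \<le> \<bar>a\<bar>\<^sup>2 + \<delta>\<^sup>2" by (rule sum_squares_bound)
  moreover have "0 \<le> \<bar>a\<bar> * \<delta>" using assms by simp
  ultimately have "\<bar>a\<bar> * \<delta> \<le> \<delta> * \<delta> + a\<^sup>2" by (simp add: power2_eq_square)
  then show ?thesis using assms by (simp add: field_simps)
qed

text \<open>For integrable \<open>h\<close> this is the usual bound; otherwise the left side is
  0.\<close>

lemma ennreal_abs_integral_le:
  fixes h :: "'a \<Rightarrow> real"
  shows "ennreal \<bar>integral\<^sup>L M h\<bar> \<le> (\<integral>\<^sup>+x. ennreal \<bar>h x\<bar> \<partial>M)"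
proof (cases "integrable M h")
  case True
  then show ?thesis using integral_norm_bound_ennreal[of M h] by simp
qed (simp add: not_integrable_integral_eq)

text \<open>A Borel-Cantelli argument through the monotone convergence theorem: the series with
  weights \<open>2^n\<close> has expectation at most \<open>\<Sum> C / 2^n\<close>, so it is finite
  almost surely and its terms tend to 0.\<close>

lemma rapid_decay_AE:
  assumes m: "\<And>n. a n \<in> borel_measurable M" and C: "0 \<le> C"
    and b: "\<And>n. (\<integral>\<^sup>+x. a n x \<partial>M) \<le> ennreal (C / 4 ^ n)"
  shows "AE x in M. (\<lambda>n. ennreal (2 ^ n) * a n x) \<longlonglongrightarrow> 0"
proof -
  have "(\<integral>\<^sup>+x. (\<Sum>n. ennreal (2 ^ n) * a n x) \<partial>M) = (\<Sum>n. ennreal (2 ^ n) * (\<integral>\<^sup>+x. a n x \<partial>M))"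
    using m by (subst nn_integral_suminf) (auto simp: nn_integral_cmult)
  also have "\<dots> \<le> (\<Sum>n. ennreal (C * (1 / 2) ^ n))"
  proof (intro suminf_le summableI)
    fix n
    have "ennreal (2 ^ n) * (\<integral>\<^sup>+x. a n x \<partial>M) \<le> ennreal (2 ^ n) * ennreal (C / 4 ^ n)"
      by (intro mult_left_mono b) simp
    also have "\<dots> = ennreal (2 ^ n * (C / 4 ^ n))" by (rule ennreal_mult'[symmetric]) simp
    also have "2 ^ n * (C / 4 ^ n) = C * (1 / 2) ^ n"
      using power_mult_distrib[of "2 :: real" 2 n] by (simp add: field_simps)
    finally show "ennreal (2 ^ n) * (\<integral>\<^sup>+x. a n x \<partial>M) \<le> ennreal (C * (1 / 2) ^ n)" .
  qed
  also have "\<dots> = ennreal (\<Sum>n. C * (1 / 2) ^ n)"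
    using C by (intro suminf_ennreal2 summable_mult summable_geometric) auto
  finally have "(\<integral>\<^sup>+x. (\<Sum>n. ennreal (2 ^ n) * a n x) \<partial>M) \<noteq> \<infinity>" by (auto simp: top_unique)
  then have "AE x in M. (\<Sum>n. ennreal (2 ^ n) * a n x) \<noteq> \<infinity>"
    using m by (intro nn_integral_PInf_AE) auto
  then show ?thesis
  proof eventually_elim
    case (elim x)
    define c where "c n = enn2real (ennreal (2 ^ n) * a n x)" for n
    have "(\<Sum>n. ennreal (2 ^ n) * a n x) < top" using elim by (simp add: less_top)
    then have "ennreal (2 ^ n) * a n x < top" for n by (rule ennreal_suminf_lessD)
    then have eq: "ennreal (2 ^ n) * a n x = ennreal (c n)" for n
      unfolding c_def by (rule ennreal_enn2real[symmetric])
    have "summable c" using elim unfolding eq by (intro summable_suminf_not_top) (auto simp: c_def)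
    then have "(\<lambda>n. ennreal (c n)) \<longlonglongrightarrow> ennreal 0" by (intro tendsto_ennrealI summable_LIMSEQ_zero)
    then show ?case unfolding eq by simp
  qed
qed

text \<open>Where the weighted sum of the squared increments is infinite, the pointwise bound is trivial, so
  no null sets have to be removed; this keeps the limit measurable for any \<open>\<sigma>\<close>-algebra and any
  functional \<open>I\<close>.\<close>

lemma fast_limit:
  fixes h :: "nat \<Rightarrow> 'a \<Rightarrow> real" and I :: "('a \<Rightarrow> ennreal) \<Rightarrow> ennreal"
  assumes hm: "\<And>k. h k \<in> borel_measurable M"
    and mono: "\<And>H G. (\<And>p. H p \<le> G p) \<Longrightarrow> I H \<le> I G"
    and suminf: "\<And>H. (\<And>k. H k \<in> borel_measurable M) \<Longrightarrow> I (\<lambda>p. \<Sum>k. H k p) = (\<Sum>k. I (H k))"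
    and cmult: "\<And>c H. H \<in> borel_measurable M \<Longrightarrow> I (\<lambda>p. c * H p) = c * I H"
    and inc: "\<And>k. I (\<lambda>p. sqr (h (Suc k) p - h k p)) \<le> ennreal (1 / 16 ^ k)"
  shows "I (\<lambda>p. sqr (lim (\<lambda>k. h k p) - h n p)) \<le> ennreal (8 / 4 ^ n)"
proof -
  let ?d = "\<lambda>k p. sqr (h (Suc k) p - h k p)"
  \<comment> \<open>Weights \<open>4^k\<close> against \<open>1 / 16^k\<close> leave the summable
    \<open>1 / 4^k\<close>, with sum at most 2. A finite value \<open>B\<close> of \<open>S\<close>
    forces increments below \<open>sqrt B / 2^k\<close>, hence a distance to the limit of at most
    \<open>2 * sqrt B / 2^n\<close>. Its square contributes the 4 and the sum the 2 of
    \<open>8 / 4^n\<close>.\<close>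
  define S where "S p = (\<Sum>k. ennreal (4 ^ k) * ?d k p)" for p
  have dm: "?d k \<in> borel_measurable M" for k using hm by simp
  have Sm: "S \<in> borel_measurable M"
    unfolding S_def[abs_def] by (intro borel_measurable_suminf_order borel_measurable_times_ennreal dm borel_measurable_const)
  have "I S = (\<Sum>k. I (\<lambda>p. ennreal (4 ^ k) * ?d k p))"
    unfolding S_def[abs_def] by (intro suminf borel_measurable_times_ennreal dm borel_measurable_const)
  also have "\<dots> = (\<Sum>k. ennreal (4 ^ k) * I (?d k))" using cmult[OF dm] by simp
  also have "\<dots> \<le> (\<Sum>k. ennreal ((1 / 4) ^ k))"
  proof (intro suminf_le summableI)
    fix k
    have "ennreal (4 ^ k) * I (?d k) \<le> ennreal (4 ^ k) * ennreal (1 / 16 ^ k)" by (intro mult_left_mono inc) simp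
    also have "\<dots> = ennreal (4 ^ k * (1 / 16 ^ k))" by (rule ennreal_mult'[symmetric]) simp
    also have "4 ^ k * (1 / 16 ^ k) = (1 / 4 :: real) ^ k"
      using power_mult_distrib[of "4 :: real" 4 k] by (simp add: field_simps)
    finally show "ennreal (4 ^ k) * I (?d k) \<le> ennreal ((1 / 4) ^ k)" .
  qed
  also have "\<dots> = ennreal (\<Sum>k. (1 / 4) ^ k)" by (intro suminf_ennreal2 summable_geometric) auto
  also have "\<dots> \<le> ennreal 2" using suminf_geometric[of "1 / 4 :: real"] by (intro ennreal_leI) simp
  finally have IS: "I S \<le> ennreal 2" .
  have pw: "sqr (lim (\<lambda>k. h k p) - h n p) \<le> ennreal (4 / 4 ^ n) * S p" for p
  proof (cases "S p = \<infinity>")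
    case True
    then show ?thesis by (simp add: ennreal_mult_top)
  next
    case False
    then obtain B where B: "S p = ennreal B" "0 \<le> B" by (cases "S p") auto
    have inc': "\<bar>h (Suc k) p - h k p\<bar> \<le> sqrt B / 2 ^ k" for k
    proof -
      have "ennreal (4 ^ k) * ?d k p \<le> S p"
        unfolding S_def using sum_le_suminf[of "\<lambda>k. ennreal (4 ^ k) * ?d k p" "{k}"] by (simp add: summableI)
      then have "4 ^ k * (h (Suc k) p - h k p)\<^sup>2 \<le> B" using B by (simp add: ennreal_mult'[symmetric])
      then have "(2 ^ k * \<bar>h (Suc k) p - h k p\<bar>)\<^sup>2 \<le> B"
        by (simp add: power_mult_distrib power_mult[symmetric] mult.commute[of k] power_mult)
      then have "2 ^ k * \<bar>h (Suc k) p - h k p\<bar> \<le> sqrt B" by (rule real_le_rsqrt)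
      then show ?thesis by (simp add: field_simps)
    qed
    have "\<bar>lim (\<lambda>k. h k p) - h n p\<bar> \<le> 2 * sqrt B / 2 ^ n" by (rule dyadic_increments_limit(2)[OF inc'])
    from power_mono[OF this, of 2] have "(lim (\<lambda>k. h k p) - h n p)\<^sup>2 \<le> (2 * sqrt B / 2 ^ n)\<^sup>2" by simp
    also have "\<dots> = 4 / 4 ^ n * B"
      using B(2) by (simp add: power_mult_distrib power_divide power_mult[symmetric] mult.commute[of n] power_mult)
    finally show ?thesis using B by (simp add: ennreal_mult'[symmetric] ennreal_leI)
  qed
  have "I (\<lambda>p. sqr (lim (\<lambda>k. h k p) - h n p)) \<le> I (\<lambda>p. ennreal (4 / 4 ^ n) * S p)" by (rule mono[OF pw])
  also have "\<dots> = ennreal (4 / 4 ^ n) * I S" by (rule cmult[OF Sm])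
  also have "\<dots> \<le> ennreal (4 / 4 ^ n) * ennreal 2" by (intro mult_left_mono IS) simp
  also have "\<dots> = ennreal (8 / 4 ^ n)" by (subst ennreal_mult'[symmetric]) auto
  finally show ?thesis .
qed

context started_process
begin

lemma rate_integral_suminf:
  assumes "\<And>k. H k \<in> borel_measurable PK" "w \<in> Om"
  shows "rate_integral (\<lambda>p. \<Sum>k. H k p) w = (\<Sum>k. rate_integral (H k) w)"
  using assms unfolding rate_integral_def
  by (subst nn_integral_suminf[symmetric])
    (auto intro!: nn_integral_cong nn_integral_suminf kernel_pre_section section_measurable_nu)

lemma nn_integral_QL:
  assumes f: "(\<lambda>(w, s). f w s) \<in> borel_measurable QT"
  shows "(\<E> w. (\<I> s. f w s)) = (\<integral>\<^sup>+(w, s). f w s \<partial>QT)"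
  using L.nn_integral_fst[OF f] by (simp add: nn_integral_restrict_space)

text \<open>\<open>fast_limit\<close> is used with two functionals: the integral over the product
  measure for \<open>Y\<close>, and the expectation of \<open>rate_integral\<close> for
  \<open>Z\<close>, whose reference measure depends on the trajectory. The two bounds
  \<open>8 / 4^n\<close> add up to \<open>16 / 4^n\<close>.\<close>

lemma bsde_space_limit:
  assumes S: "\<And>k. (Y k, Z k) \<in> \<M>"
    and inc: "\<And>k. norm_sq (\<lambda>w s. Y (Suc k) w s - Y k w s)
      (\<lambda>w s y. Z (Suc k) w s y - Z k w s y) \<le> ennreal (1 / 16 ^ k)"
  shows "(\<lambda>w s. lim (\<lambda>k. Y k w s), \<lambda>w s y. lim (\<lambda>k. Z k w s y)) \<in> \<M>"
    and "norm_sq (\<lambda>w s. lim (\<lambda>k. Y k w s) - Y n w s)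
      (\<lambda>w s y. lim (\<lambda>k. Z k w s y) - Z n w s y) \<le> ennreal (16 / 4 ^ n)"
proof -
  define y where "y k p = (case p of (w, s) \<Rightarrow> Y k w s)" for k p
  define z where "z k p = (case p of ((w, s), x) \<Rightarrow> Z k w s x)" for k p
  have ym: "y k \<in> borel_measurable Prg" for k using bsde_spaceD(1)[OF S] by (simp add: y_def[abs_def])
  have zm: "z k \<in> borel_measurable PK" for k using bsde_spaceD(2)[OF S] by (simp add: z_def[abs_def] case_prod_beta')
  have norm: "norm_sq (\<lambda>w s. a (w, s) - b (w, s)) (\<lambda>w s x. c ((w, s), x) - d ((w, s), x)) =
      (\<integral>\<^sup>+p. sqr (a p - b p) \<partial>QT) + (\<E> w. rate_integral (\<lambda>p. sqr (c p - d p)) w)"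
    if "a \<in> borel_measurable Prg" "b \<in> borel_measurable Prg" for a b c d
    unfolding bsde_norm_sq_eq
  proof (intro arg_cong2[where f = "(+)"])
    have "(\<lambda>(w, s). sqr (a (w, s) - b (w, s))) \<in> borel_measurable QT"
      using Prg_QL[OF that(1)] Prg_QL[OF that(2)] by simp
    from nn_integral_QL[OF this]
    show "(\<E> w. (\<I> s. sqr (a (w, s) - b (w, s)))) =
        (\<integral>\<^sup>+p. sqr (a p - b p) \<partial>QT)" by (simp add: case_prod_beta')
  qed (simp add: case_prod_beta')
  have inc': "(\<integral>\<^sup>+p. sqr (y (Suc k) p - y k p) \<partial>QT) +
      (\<E> w. rate_integral (\<lambda>p. sqr (z (Suc k) p - z k p)) w) \<le> ennreal (1 / 16 ^ k)" for k
    using inc[of k] unfolding norm[OF ym ym, symmetric] by (simp add: y_def z_def)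
  have 1: "(\<integral>\<^sup>+p. sqr (lim (\<lambda>k. y k p) - y n p) \<partial>QT) \<le> ennreal (8 / 4 ^ n)" for n
  proof (rule fast_limit[where M = Prg and I = "\<lambda>H. \<integral>\<^sup>+p. H p \<partial>QT"])
    fix k show "(\<integral>\<^sup>+p. sqr (y (Suc k) p - y k p) \<partial>QT) \<le> ennreal (1 / 16 ^ k)"
      using inc'[of k] by (rule order_trans[rotated]) simp
  qed (auto intro!: ym nn_integral_mono nn_integral_suminf nn_integral_cmult Prg_QL)
  have 2: "(\<E> w. rate_integral (\<lambda>p. sqr (lim (\<lambda>k. z k p) - z n p)) w) \<le> ennreal (8 / 4 ^ n)" for n
  proof (rule fast_limit[where M = "PK" and I = "\<lambda>H. \<integral>\<^sup>+w. rate_integral H w \<partial>\<Q>"])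
    fix k show "(\<E> w. rate_integral (\<lambda>p. sqr (z (Suc k) p - z k p)) w) \<le> ennreal (1 / 16 ^ k)"
      using inc'[of k] by (rule order_trans[rotated]) simp
  next
    fix H :: "nat \<Rightarrow> ('w \<times> real) \<times> 'k \<Rightarrow> ennreal" assume H: "\<And>k. H k \<in> borel_measurable PK"
    have "(\<E> w. rate_integral (\<lambda>p. \<Sum>k. H k p) w) = (\<E> w. (\<Sum>k. rate_integral (H k) w))"
      using rate_integral_suminf[OF H] by (intro nn_integral_cong) simp
    also have "\<dots> = (\<Sum>k. \<integral>\<^sup>+w. rate_integral (H k) w \<partial>\<Q>)"
      by (intro nn_integral_suminf rate_integral_measurable H)
    finally show "(\<E> w. rate_integral (\<lambda>p. \<Sum>k. H k p) w) = (\<Sum>k. \<integral>\<^sup>+w. rate_integral (H k) w \<partial>\<Q>)" .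
  next
    fix c and H :: "('w \<times> real) \<times> 'k \<Rightarrow> ennreal" assume H: "H \<in> borel_measurable PK"
    have "(\<E> w. rate_integral (\<lambda>p. c * H p) w) = (\<E> w. c * rate_integral H w)"
      using rate_integral_cmult[OF H] by (intro nn_integral_cong) simp
    also have "\<dots> = c * (\<E> w. rate_integral H w)"
      by (intro nn_integral_cmult rate_integral_measurable H)
    finally show "(\<E> w. rate_integral (\<lambda>p. c * H p) w) = c * (\<E> w. rate_integral H w)" .
  qed (auto intro!: zm nn_integral_mono rate_integral_mono)
  have lm: "(\<lambda>p. lim (\<lambda>k. y k p)) \<in> borel_measurable Prg" "(\<lambda>p. lim (\<lambda>k. z k p)) \<in> borel_measurable PK"
    using ym zm by (auto intro: borel_measurable_lim_metric)
  let ?Y = "\<lambda>w s. lim (\<lambda>k. Y k w s)" and ?Z = "\<lambda>w s x. lim (\<lambda>k. Z k w s x)"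
  have lY: "?Y w s = (\<lambda>p. lim (\<lambda>k. y k p)) (w, s)" and lZ: "?Z w s x = (\<lambda>p. lim (\<lambda>k. z k p)) ((w, s), x)" for w s x
    by (simp_all add: y_def z_def)
  have est: "norm_sq (\<lambda>w s. ?Y w s - Y n w s) (\<lambda>w s x. ?Z w s x - Z n w s x) \<le> ennreal (16 / 4 ^ n)" for n
  proof -
    have "norm_sq (\<lambda>w s. ?Y w s - Y n w s) (\<lambda>w s x. ?Z w s x - Z n w s x) \<le> ennreal (8 / 4 ^ n) + ennreal (8 / 4 ^ n)"
      using norm[OF lm(1) ym, of n "\<lambda>p. lim (\<lambda>k. z k p)" "z n"] add_mono[OF 1 2, of n n] by (simp add: y_def z_def)
    also have "\<dots> = ennreal (16 / 4 ^ n)" by (simp add: ennreal_plus[symmetric] del: ennreal_plus)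
    finally show ?thesis .
  qed
  then show "norm_sq (\<lambda>w s. ?Y w s - Y n w s) (\<lambda>w s x. ?Z w s x - Z n w s x) \<le> ennreal (16 / 4 ^ n)" .
  have "(\<lambda>w s. ?Y w s - Y 0 w s, \<lambda>w s x. ?Z w s x - Z 0 w s x) \<in> \<M>"
    unfolding bsde_space_def
  proof (clarify, intro conjI)
    show "(\<lambda>(w, s). ?Y w s - Y 0 w s) \<in> borel_measurable Prg"
      using borel_measurable_diff[OF lm(1) ym[of 0]] by (simp add: y_def case_prod_beta')
    show "(\<lambda>((w, s), x). ?Z w s x - Z 0 w s x) \<in> borel_measurable PK"
      using borel_measurable_diff[OF lm(2) zm[of 0]] by (simp add: z_def case_prod_beta')
    show "norm_sq (\<lambda>w s. ?Y w s - Y 0 w s) (\<lambda>w s x. ?Z w s x - Z 0 w s x) < \<infinity>"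
      using est[of 0] by (rule le_less_trans) simp
  qed
  \<comment> \<open>Only differences are known to stay in the space;
    \<open>a = (a - b) - ((b - b) - b)\<close> adds the initial member back.\<close>
  from bsde_space_diff[OF this bsde_space_diff[OF bsde_space_diff[OF S[of 0] S[of 0]] S[of 0]]]
  show "(?Y, ?Z) \<in> \<M>" by simp
qed

text \<open>\<open>abs_le_young\<close> is applied at every jump and every time, which gives a bound
  uniform in \<open>s\<close>. The random number of jumps multiplies \<open>\<delta>\<close> only,
  so it is harmless as \<open>\<delta>\<close> tends to 0.\<close>

lemma compensated_integral_bound:
  assumes om: "w \<in> Om" and s: "s \<in> {t..T}" and \<delta>: "0 < \<delta>"
    and Zm: "predictable_field Z"
  defines "Zsq \<equiv> square_field Z"
  shows "ennreal \<bar>compensated_integral K nu X t s T Z w\<bar> \<le>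
    ennreal (\<delta> * (real (card (jumps w \<inter> {t<..T})) + rate_bound * (T - t))) +
    ennreal (1 / \<delta>) * (jump_integral Zsq w + rate_integral Zsq w)"
proof -
  let ?J = "jumps w \<inter> {t<..T}" and ?N = "\<lambda>r. nu r (pre r w)"
  have Zsqm: "Zsq \<in> borel_measurable PK" using Zm by (simp add: Zsq_def case_prod_beta')
  have "\<bar>\<Sum>\<tau>\<in>jumps w \<inter> {s<..T}. Z w \<tau> (X \<tau> w)\<bar> \<le> (\<Sum>\<tau>\<in>jumps w \<inter> {s<..T}. \<bar>Z w \<tau> (X \<tau> w)\<bar>)" by (rule sum_abs)
  also have "\<dots> \<le> (\<Sum>\<tau>\<in>?J. \<bar>Z w \<tau> (X \<tau> w)\<bar>)"
    using s by (intro sum_mono2 finite_jumps_tT[OF om]) auto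
  also have "\<dots> \<le> (\<Sum>\<tau>\<in>?J. \<delta> + 1 / \<delta> * (Z w \<tau> (X \<tau> w))\<^sup>2)" by (intro sum_mono abs_le_young \<delta>)
  also have "\<dots> = \<delta> * real (card ?J) + 1 / \<delta> * (\<Sum>\<tau>\<in>?J. (Z w \<tau> (X \<tau> w))\<^sup>2)"
    by (simp add: sum.distrib sum_distrib_left mult.commute)
  finally have "ennreal \<bar>\<Sum>\<tau>\<in>jumps w \<inter> {s<..T}. Z w \<tau> (X \<tau> w)\<bar> \<le>
      ennreal (\<delta> * real (card ?J) + 1 / \<delta> * (\<Sum>\<tau>\<in>?J. (Z w \<tau> (X \<tau> w))\<^sup>2))" by (rule ennreal_leI)
  also have "\<dots> = ennreal (\<delta> * real (card ?J)) + ennreal (1 / \<delta>) * ennreal (\<Sum>\<tau>\<in>?J. (Z w \<tau> (X \<tau> w))\<^sup>2)"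
    using \<delta> by (subst ennreal_plus) (auto simp: sum_nonneg ennreal_mult'[symmetric])
  also have "ennreal (\<Sum>\<tau>\<in>?J. (Z w \<tau> (X \<tau> w))\<^sup>2) = jump_integral Zsq w"
    unfolding jump_integral_sum[OF om] Zsq_def by (simp add: sum_ennreal)
  finally have 1: "ennreal \<bar>\<Sum>\<tau>\<in>jumps w \<inter> {s<..T}. Z w \<tau> (X \<tau> w)\<bar> \<le>
      ennreal (\<delta> * real (card ?J)) + ennreal (1 / \<delta>) * jump_integral Zsq w" .
  have "ennreal \<bar>LINT r:{s<..T}|lborel. (LINT y|?N r. Z w r y)\<bar> =
      ennreal \<bar>LINT r|Leb. indicator {s<..T} r * (LINT y|?N r. Z w r y)\<bar>"
    using s by (subst set_integral_Leb(1)) auto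
  also have "\<dots> \<le> (\<integral>\<^sup>+r. ennreal \<bar>indicator {s<..T} r * (LINT y|?N r. Z w r y)\<bar> \<partial>Leb)"
    by (rule ennreal_abs_integral_le)
  also have "\<dots> \<le> (\<integral>\<^sup>+r. ennreal (\<delta> * rate_bound) + ennreal (1 / \<delta>) * (\<integral>\<^sup>+y. Zsq ((w, r), y) \<partial>?N r) \<partial>Leb)"
  proof (rule nn_integral_mono)
    fix r assume "r \<in> space Leb"
    then have r: "r \<in> {t..T}" by simp
    have Zr: "(\<lambda>y. Zsq ((w, r), y)) \<in> borel_measurable (?N r)" by (rule section_measurable_nu[OF Zsqm om r])
    have "ennreal \<bar>indicator {s<..T} r * (LINT y|?N r. Z w r y)\<bar> \<le> ennreal \<bar>LINT y|?N r. Z w r y\<bar>"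
      by (intro ennreal_leI) (simp add: indicator_def)
    also have "\<dots> \<le> (\<integral>\<^sup>+y. ennreal \<bar>Z w r y\<bar> \<partial>?N r)" by (rule ennreal_abs_integral_le)
    also have "\<dots> \<le> (\<integral>\<^sup>+y. ennreal \<delta> + ennreal (1 / \<delta>) * Zsq ((w, r), y) \<partial>?N r)"
    proof (rule nn_integral_mono)
      fix y
      have "ennreal \<bar>Z w r y\<bar> \<le> ennreal (\<delta> + 1 / \<delta> * (Z w r y)\<^sup>2)" by (intro ennreal_leI abs_le_young \<delta>)
      also have "\<dots> = ennreal \<delta> + ennreal (1 / \<delta>) * Zsq ((w, r), y)"
        using \<delta> by (subst ennreal_plus) (auto simp: Zsq_def ennreal_mult'[symmetric])
      finally show "ennreal \<bar>Z w r y\<bar> \<le> ennreal \<delta> + ennreal (1 / \<delta>) * Zsq ((w, r), y)" .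
    qed
    also have "\<dots> = ennreal \<delta> * emeasure (?N r) (space (?N r)) + ennreal (1 / \<delta>) * (\<integral>\<^sup>+y. Zsq ((w, r), y) \<partial>?N r)"
      using Zr by (subst nn_integral_add) (auto simp: nn_integral_cmult)
    also have "\<dots> \<le> ennreal \<delta> * ennreal rate_bound + ennreal (1 / \<delta>) * (\<integral>\<^sup>+y. Zsq ((w, r), y) \<partial>?N r)"
      using emeasure_nu_le[of r "pre r w"] pre_space[OF om] r t_nonneg by (intro add_right_mono mult_left_mono) auto
    also have "ennreal \<delta> * ennreal rate_bound = ennreal (\<delta> * rate_bound)"
      using \<delta> by (intro ennreal_mult'[symmetric]) simp
    finally show "ennreal \<bar>indicator {s<..T} r * (LINT y|?N r. Z w r y)\<bar> \<le>
        ennreal (\<delta> * rate_bound) + ennreal (1 / \<delta>) * (\<integral>\<^sup>+y. Zsq ((w, r), y) \<partial>?N r)" .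
  qed
  also have "\<dots> = ennreal (\<delta> * rate_bound) * emeasure Leb (space Leb) + ennreal (1 / \<delta>) * rate_integral Zsq w"
    using kernel_pre_section[OF Zsqm om]
    by (subst nn_integral_add) (auto simp: nn_integral_cmult rate_integral_def)
  also have "ennreal (\<delta> * rate_bound) * emeasure Leb (space Leb) = ennreal (\<delta> * (rate_bound * (T - t)))"
    using t_le_T by (simp add: emeasure_restrict_space ennreal_mult''[symmetric] mult.assoc)
  finally have 2: "ennreal \<bar>LINT r:{s<..T}|lborel. (LINT y|?N r. Z w r y)\<bar> \<le>
      ennreal (\<delta> * (rate_bound * (T - t))) + ennreal (1 / \<delta>) * rate_integral Zsq w" .
  have R: "0 \<le> rate_bound * (T - t)" using rate_bound_nonneg t_le_T by simp
  have "ennreal \<bar>compensated_integral K nu X t s T Z w\<bar> \<le>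
      ennreal (\<bar>\<Sum>\<tau>\<in>jumps w \<inter> {s<..T}. Z w \<tau> (X \<tau> w)\<bar> + \<bar>LINT r:{s<..T}|lborel. (LINT y|?N r. Z w r y)\<bar>)"
    unfolding compensated_integral_eq[OF Zm om s] by (intro ennreal_leI) linarith
  also have "\<dots> \<le> (ennreal (\<delta> * real (card ?J)) + ennreal (1 / \<delta>) * jump_integral Zsq w) +
      (ennreal (\<delta> * (rate_bound * (T - t))) + ennreal (1 / \<delta>) * rate_integral Zsq w)"
    using add_mono[OF 1 2] by simp
  also have "\<dots> = (ennreal (\<delta> * real (card ?J)) + ennreal (\<delta> * (rate_bound * (T - t)))) +
      ennreal (1 / \<delta>) * (jump_integral Zsq w + rate_integral Zsq w)"
    by (simp add: distrib_left ac_simps)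
  also have "ennreal (\<delta> * real (card ?J)) + ennreal (\<delta> * (rate_bound * (T - t))) =
      ennreal (\<delta> * (real (card ?J) + rate_bound * (T - t)))"
    using \<delta> R by (subst ennreal_plus[symmetric]) (auto simp: distrib_left)
  finally show ?thesis .
qed

text \<open>The same device for the driver: the Lipschitz condition splits the difference into three
  terms, each at most \<open>\<delta>\<close> plus \<open>1 / \<delta>\<close> times a common sum of
  squares, whence the factor \<open>L + L' + 1\<close>.\<close>

lemma driver_integral_bound:
  assumes gen: "generator L L' f" and om: "w \<in> Om" and s: "s \<in> {t..T}" and \<delta>: "0 < \<delta>"
    and Z: "predictable_field Z" "rate_integral (square_field Z) w < \<infinity>"
    and Z': "predictable_field Z'" "rate_integral (square_field Z') w < \<infinity>"
    and Y: "Y w \<in> borel_measurable Leb" "Y' w \<in> borel_measurable Leb"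
    and d: "(\<lambda>r. d r (X r w)) \<in> borel_measurable Leb"
    and f': "\<And>r y u z. f' r y u z = f r y u z + d r y"
  shows "ennreal \<bar>LINT r:{s<..T}|lebesgue. f' r (X r w) (Y' w r) (Z' w r) - f r (X r w) (Y w r) (Z w r)\<bar> \<le>
    ennreal (L + L' + 1) * (ennreal (\<delta> * (T - t)) + ennreal (1 / \<delta>) *
      ((\<I> r. sqr (Y' w r - Y w r)) +
       rate_integral (\<lambda>((w, r), y). sqr (Z' w r y - Z w r y)) w +
       (\<I> r. sqr (d r (X r w)))))"
proof -
  let ?h = "\<lambda>r. f' r (X r w) (Y' w r) (Z' w r) - f r (X r w) (Y w r) (Z w r)"
  let ?D = "\<lambda>((w, r), y). sqr (Z' w r y - Z w r y)"
  define n where "n r = (\<integral>\<^sup>+y. sqr (Z' w r y - Z w r y) \<partial>nu r (X r w))" for r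
  define y where "y r = sqr (Y' w r - Y w r)" for r
  define e where "e r = sqr (d r (X r w))" for r
  define G where "G r = ennreal (L + L' + 1) * (ennreal \<delta> + ennreal (1 / \<delta>) * (y r + n r + e r))" for r
  have Dm: "?D \<in> borel_measurable PK" using Z(1) Z'(1) by (simp add: case_prod_beta')
  have nm: "n \<in> borel_measurable Leb" and nint: "(\<integral>\<^sup>+r. n r \<partial>Leb) = rate_integral ?D w"
    using kernel_X_section[OF om Dm] by (simp_all add: n_def[abs_def])
  have ym: "y \<in> borel_measurable Leb" and em: "e \<in> borel_measurable Leb"
    using Y d by (simp_all add: y_def[abs_def] e_def[abs_def])
  have L: "0 \<le> L" "0 \<le> L'" using generatorD[OF gen] by auto
  have "AE r in lborel. r \<in> {t..T} \<longrightarrow> ennreal \<bar>?h r\<bar> \<le> G r"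
    using driver_difference[OF gen om Z Z' f', of Y' Y]
  proof eventually_elim
    case (elim r)
    show ?case
    proof
      assume r: "r \<in> {t..T}"
      let ?q = "LINT y|nu r (X r w). \<bar>Z' w r y - Z w r y\<bar>\<^sup>2"
      let ?S = "(Y' w r - Y w r)\<^sup>2 + ?q + (d r (X r w))\<^sup>2"
      have q: "0 \<le> ?q" by simp
      have single: "\<bar>Y' w r - Y w r\<bar> \<le> \<delta> + 1 / \<delta> * ?S" "sqrt ?q \<le> \<delta> + 1 / \<delta> * ?S" "\<bar>d r (X r w)\<bar> \<le> \<delta> + 1 / \<delta> * ?S"
      proof -
        have "1 / \<delta> * a \<le> 1 / \<delta> * ?S" if "a \<le> ?S" for a using \<delta> that by (intro mult_left_mono) auto
        from this[of "(Y' w r - Y w r)\<^sup>2"] this[of "(sqrt ?q)\<^sup>2"] this[of "(d r (X r w))\<^sup>2"]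
          abs_le_young[OF \<delta>, of "Y' w r - Y w r"] abs_le_young[OF \<delta>, of "sqrt ?q"] abs_le_young[OF \<delta>, of "d r (X r w)"] q
        show "\<bar>Y' w r - Y w r\<bar> \<le> \<delta> + 1 / \<delta> * ?S" "sqrt ?q \<le> \<delta> + 1 / \<delta> * ?S" "\<bar>d r (X r w)\<bar> \<le> \<delta> + 1 / \<delta> * ?S"
          by simp_all
      qed
      have "\<bar>?h r\<bar> \<le> L' * (\<delta> + 1 / \<delta> * ?S) + L * (\<delta> + 1 / \<delta> * ?S) + (\<delta> + 1 / \<delta> * ?S)"
        using elim r mult_left_mono[OF single(1) L(2)] mult_left_mono[OF single(2) L(1)] single(3) by simp
      also have "\<dots> = (L + L' + 1) * (\<delta> + 1 / \<delta> * ?S)" by (simp add: distrib_right)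
      finally have "ennreal \<bar>?h r\<bar> \<le> ennreal ((L + L' + 1) * (\<delta> + 1 / \<delta> * ?S))" by (rule ennreal_leI)
      also have "\<dots> = ennreal (L + L' + 1) * (ennreal \<delta> + ennreal (1 / \<delta>) * (y r + ennreal ?q + e r))"
        using \<delta> L q by (simp add: y_def e_def ennreal_mult' ennreal_plus del: times_divide_eq_left)
      also have "\<dots> \<le> G r"
      proof -
        have "ennreal ?q \<le> n r"
          using ennreal_abs_integral_le[of "nu r (X r w)" "\<lambda>y. \<bar>Z' w r y - Z w r y\<bar>\<^sup>2"] q by (simp add: n_def)
        then show ?thesis unfolding G_def by (intro mult_left_mono add_left_mono add_right_mono) auto
      qed
      finally show "ennreal \<bar>?h r\<bar> \<le> G r" .
    qed
  qed
  then have AE: "AE r in lborel. ennreal \<bar>indicator {s<..T} r * ?h r\<bar> \<le> G r * indicator {t..T} r"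
    by eventually_elim (use s in \<open>auto simp: indicator_def\<close>)
  have "ennreal \<bar>LINT r:{s<..T}|lebesgue. ?h r\<bar> \<le> (\<integral>\<^sup>+r. ennreal \<bar>indicator {s<..T} r * ?h r\<bar> \<partial>lebesgue)"
    unfolding set_lebesgue_integral_def real_scaleR_def by (rule ennreal_abs_integral_le)
  also have "\<dots> \<le> (\<I> r. G r)"
    unfolding nn_integral_completion by (rule nn_integral_mono_AE[OF AE])
  also have "\<dots> = (\<integral>\<^sup>+r. G r \<partial>Leb)" by (simp add: nn_integral_restrict_space)
  also have "\<dots> = ennreal (L + L' + 1) * (ennreal \<delta> * emeasure Leb (space Leb) +
      ennreal (1 / \<delta>) * ((\<integral>\<^sup>+r. y r \<partial>Leb) + (\<integral>\<^sup>+r. n r \<partial>Leb) + (\<integral>\<^sup>+r. e r \<partial>Leb)))"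
    unfolding G_def using ym nm em by (simp add: nn_integral_add nn_integral_cmult)
  also have "ennreal \<delta> * emeasure Leb (space Leb) = ennreal (\<delta> * (T - t))"
    using t_le_T \<delta> by (simp add: emeasure_restrict_space ennreal_mult')
  finally show ?thesis by (simp add: nint y_def e_def nn_integral_restrict_space)
qed

lemma driver_integrable:
  assumes gen: "generator L L' f" and S: "(Y, Z) \<in> \<M>"
    and f2: "(\<E> w. (\<I> s. sqr \<bar>f s (X s w) 0 (\<lambda>_. 0)\<bar>)) < \<infinity>"
  shows "AE w in \<Q>. set_integrable lebesgue {t<..T} (\<lambda>r. f r (X r w) (Y w r) (Z w r))"
proof -
  have "(\<lambda>(w, s). f s (X s w) 0 (\<lambda>_. 0)) \<in> borel_measurable QT"
    by (rule time_space_section(1)[OF zero_driver_measurable[OF gen]])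
  then have "(\<lambda>(w, s). sqr \<bar>f s (X s w) 0 (\<lambda>_. 0)\<bar>) \<in> borel_measurable QT"
    by (simp add: case_prod_beta')
  from measurable_set_nn_integral_QL(1)[OF this, of "{t..T}"]
  have "AE w in \<Q>. (\<I> s. sqr \<bar>f s (X s w) 0 (\<lambda>_. 0)\<bar>) \<noteq> \<infinity>"
    using f2 by (intro nn_integral_PInf_AE) auto
  with bsde_space_AE[OF S] show ?thesis
  proof eventually_elim
    case (elim w)
    then show ?case
      using measurable_Pair2[OF Prg_QL[OF bsde_spaceD(1)[OF S]], of w]
      by (intro driver_integrable_pathwise[OF gen _ _ bsde_spaceD(2)[OF S]]) (auto simp: less_top)
  qed
qed

text \<open>The equation is passed to the limit with \<open>\<bar>a\<bar> \<le> \<delta> + a\<^sup>2 / \<delta>\<close> for \<open>\<delta> = 2\<^sup>-\<^sup>n\<close>, which turns the square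
  norms into bounds for the integrals. The limit \<open>Y'\<close> in norm is replaced by the pointwise
  limit \<open>Y\<close>, which satisfies the equation at every time.\<close>

lemma solution_limit:
  assumes gen: "generator L L' f" and C: "0 \<le> C"
    and S: "\<And>n. (U n, V n) \<in> \<M>" and S': "(Y', Z) \<in> \<M>"
    and norm: "\<And>n. norm_sq (\<lambda>w s. Y' w s - U n w s) (\<lambda>w s y. Z w s y - V n w s y) \<le> ennreal (C / 4 ^ n)"
    and d: "\<And>n. (\<lambda>(s, y). d n s y) \<in> borel_measurable (Time \<Otimes>\<^sub>M K)"
      "\<And>n. (\<E> w. (\<I> r. sqr (d n r (X r w)))) \<le> ennreal (C / 4 ^ n)"
    and e: "\<And>n. e n \<in> borel_measurable K" "\<And>n. (\<E> w. sqr (e n (X T w))) \<le> ennreal (C / 4 ^ n)"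
    and i: "\<And>n. AE w in \<Q>. set_integrable lebesgue {t<..T} (\<lambda>r. f r (X r w) (U n w r) (V n w r) + d n r (X r w))"
    and i': "AE w in \<Q>. set_integrable lebesgue {t<..T} (\<lambda>r. f r (X r w) (Y' w r) (Z w r))"
    and sol: "\<And>n. solves_bsde K nu X \<Q> t T (\<lambda>y. g y + e n y) (\<lambda>r y u z. f r y u z + d n r y) (U n) (V n)"
  obtains Y where "(Y, Z) \<in> \<M>" "solves_bsde K nu X \<Q> t T g f Y Z"
proof -
  define Y where "Y w s = lim (\<lambda>n. U n w s)" for w s
  note Um = bsde_spaceD(1)[OF S] and Vm = bsde_spaceD(2)[OF S]
    and Y'm = bsde_spaceD(1)[OF S'] and Zm = bsde_spaceD(2)[OF S']
  let ?D = "\<lambda>n. \<lambda>((w, r), y). sqr (Z w r y - V n w r y)"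
  let ?y = "\<lambda>n w. \<integral>\<^sup>+r\<in>{t..T}. sqr (Y' w r - U n w r) \<partial>lborel"
  let ?d = "\<lambda>n w. \<integral>\<^sup>+r\<in>{t..T}. sqr (d n r (X r w)) \<partial>lborel"
  let ?e = "\<lambda>n w. sqr (e n (X T w))"
  \<comment> \<open>All squared errors of stage \<open>n\<close> in one random variable. The jump
    integral is included since pathwise bounds need it; its expectation equals that of the rate
    integral. The four groups bounded by \<open>C / 4^n\<close> account for
    \<open>4 * C / 4^n\<close>.\<close>
  define a where "a n w = (?y n w + rate_integral (?D n) w) + jump_integral (?D n) w + ?d n w + ?e n w" for n w
  note diff = bsde_space_diff[OF S' S]
  have Dm: "?D n \<in> borel_measurable PK" for n using bsde_spaceD(2)[OF diff, of n] by (simp add: case_prod_beta')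
  have ym: "?y n \<in> borel_measurable \<Q>" for n by (rule Prg_nn_integral_measurable[OF bsde_spaceD(1)[OF diff]])
  have dm: "?d n \<in> borel_measurable \<Q>" for n
  proof -
    have "(\<lambda>(w, r). sqr (d n r (X r w))) \<in> borel_measurable QT"
      using time_space_section(1)[OF d(1), of n] by (simp add: case_prod_beta')
    then show ?thesis by (rule measurable_set_nn_integral_QL(1)) auto
  qed
  have em: "?e n \<in> borel_measurable \<Q>" for n using measurable_compose[OF X_Q[OF t_le_T] e(1), of n] by simp
  note ms = ym dm em rate_integral_measurable[OF Dm] jump_integral_measurable[OF Dm]
  have "(\<E> w. a n w) \<le> ennreal (4 * C / 4 ^ n)" for n
  proof -
    have 1: "(\<E> w. ?y n w) + (\<E> w. rate_integral (?D n) w) \<le> ennreal (C / 4 ^ n)"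
      using norm[of n] unfolding bsde_norm_sq_eq .
    then have 2: "(\<E> w. jump_integral (?D n) w) \<le> ennreal (C / 4 ^ n)"
      unfolding jump_integral_expectation[OF Dm] by (rule order_trans[rotated]) simp
    have "(\<E> w. a n w) = ((\<E> w. ?y n w) + (\<E> w. rate_integral (?D n) w)) +
        (\<E> w. jump_integral (?D n) w) + (\<E> w. ?d n w) + (\<E> w. ?e n w)"
      unfolding a_def by (simp only: nn_integral_add ms borel_measurable_add)
    also have "\<dots> \<le> ennreal (C / 4 ^ n) + ennreal (C / 4 ^ n) + ennreal (C / 4 ^ n) + ennreal (C / 4 ^ n)"
      by (intro add_mono 1 2 d(2) e(2))
    also have "\<dots> = ennreal (4 * C / 4 ^ n)" using C by (simp add: ennreal_plus[symmetric] del: ennreal_plus)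
    finally show ?thesis .
  qed
  moreover have "a n \<in> borel_measurable \<Q>" for n unfolding a_def[abs_def] by (intro borel_measurable_add ms)
  ultimately have lim0: "AE w in \<Q>. (\<lambda>n. ennreal (2 ^ n) * a n w) \<longlonglongrightarrow> 0"
    using C by (intro rapid_decay_AE[where C = "4 * C"]) auto
  have good: "AE w in \<Q>. \<forall>n. (w \<in> Om \<and> (\<I> s. sqr (U n w s)) < \<infinity> \<and>
      rate_integral (square_field (V n)) w < \<infinity>) \<and>
      set_integrable lebesgue {t<..T} (\<lambda>r. f r (X r w) (U n w r) (V n w r) + d n r (X r w)) \<and>
      (\<forall>s\<in>{t..T}. U n w s + compensated_integral K nu X t s T (V n) w = g (X T w) + e n (X T w) +
        (LINT r:{s<..T}|lebesgue. f r (X r w) (U n w r) (V n w r) + d n r (X r w)))"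
    unfolding AE_all_countable
    by (intro allI AE_conjI bsde_space_AE[OF S] i sol[unfolded solves_bsde_def])
  have main: "AE w in \<Q>. (AE r in lborel. r \<in> {t..T} \<longrightarrow> Y' w r = Y w r) \<and>
      (\<forall>s\<in>{t..T}. Y w s + compensated_integral K nu X t s T Z w =
        g (X T w) + (LINT r:{s<..T}|lebesgue. f r (X r w) (Y' w r) (Z w r)))"
    using lim0 good i' bsde_space_AE[OF S']
  proof eventually_elim
    case (elim w)
    then have om: "w \<in> Om" and Z2: "rate_integral (square_field Z) w < \<infinity>" by auto
    have V2: "rate_integral (square_field (V n)) w < \<infinity>"
      and in': "set_integrable lebesgue {t<..T} (\<lambda>r. f r (X r w) (U n w r) (V n w r) + d n r (X r w))" for n
      using elim(2) by auto
    have eq: "U n w s + compensated_integral K nu X t s T (V n) w = g (X T w) + e n (X T w) +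
        (LINT r:{s<..T}|lebesgue. f r (X r w) (U n w r) (V n w r) + d n r (X r w))" if "s \<in> {t..T}" for n s
      using elim(2) that by blast
    have Us: "U n w \<in> borel_measurable Leb" and Y's: "Y' w \<in> borel_measurable Leb" for n
      using measurable_Pair2[OF Prg_QL[OF Um], of w n] measurable_Pair2[OF Prg_QL[OF Y'm], of w] om by simp_all
    have conv: "(\<lambda>n. U n w s) \<longlonglongrightarrow> g (X T w) + (LINT r:{s<..T}|lebesgue. f r (X r w) (Y' w r) (Z w r)) -
        compensated_integral K nu X t s T Z w" (is "_ \<longlonglongrightarrow> ?R") if s: "s \<in> {t..T}" for s
    proof -
      define c where "c = L + L' + 1"
      define k where "k = real (card (jumps w \<inter> {t<..T})) + rate_bound * (T - t)"
      define b where "b = 1 + c * (T - t) + k"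
      have c: "0 \<le> c" using generatorD(1,2)[OF gen] by (simp add: c_def)
      have k: "0 \<le> k" using rate_bound_nonneg t_le_T by (simp add: k_def)
      \<comment> \<open>With \<open>\<delta> = 1 / 2^n\<close> the parts free of errors are of order
        \<open>1 / 2^n\<close>, and the errors enter as \<open>2^n * a n w\<close>, which tends to 0
        on this trajectory.\<close>
      have bound: "ennreal \<bar>U n w s - ?R\<bar> \<le> ennreal (b / 2 ^ n) + ennreal (c + 2) * (ennreal (2 ^ n) * a n w)" for n
      proof -
        let ?\<delta> = "1 / 2 ^ n :: real"
        let ?F = "LINT r:{s<..T}|lebesgue. (f r (X r w) (U n w r) (V n w r) + d n r (X r w)) - f r (X r w) (Y' w r) (Z w r)"
        let ?G = "compensated_integral K nu X t s T (\<lambda>w s y. Z w s y - V n w s y) w"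
        have sub: "set_integrable lebesgue {s<..T} h" if "set_integrable lebesgue {t<..T} h" for h :: "real \<Rightarrow> real"
          using s by (intro set_integrable_subset[OF that]) (auto simp: subset_iff)
        have "U n w s - ?R = e n (X T w) + ?F + ?G"
          using eq[OF s, of n] set_integral_diff(2)[OF sub[OF in'[of n]] sub[OF elim(3)]]
            compensated_integral_diff[OF om s Zm Vm Z2 V2, of n] by linarith
        then have "ennreal \<bar>U n w s - ?R\<bar> \<le> ennreal (\<bar>e n (X T w)\<bar> + \<bar>?F\<bar> + \<bar>?G\<bar>)" by (intro ennreal_leI) linarith
        also have "\<dots> = ennreal \<bar>e n (X T w)\<bar> + ennreal \<bar>?F\<bar> + ennreal \<bar>?G\<bar>" by simp
        also have "\<dots> \<le> (ennreal ?\<delta> + ennreal (2 ^ n) * a n w) + ennreal c * (ennreal (?\<delta> * (T - t)) + ennreal (2 ^ n) * a n w) +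
            (ennreal (?\<delta> * k) + ennreal (2 ^ n) * a n w)"
        proof (intro add_mono)
          have "ennreal \<bar>e n (X T w)\<bar> \<le> ennreal (?\<delta> + 1 / ?\<delta> * (e n (X T w))\<^sup>2)" by (intro ennreal_leI abs_le_young) simp
          also have "\<dots> = ennreal ?\<delta> + ennreal (2 ^ n) * ?e n w" by (subst ennreal_plus) (auto simp: ennreal_mult')
          also have "\<dots> \<le> ennreal ?\<delta> + ennreal (2 ^ n) * a n w"
            unfolding a_def by (intro add_left_mono mult_left_mono) auto
          finally show "ennreal \<bar>e n (X T w)\<bar> \<le> ennreal ?\<delta> + ennreal (2 ^ n) * a n w" .
          have "ennreal \<bar>?F\<bar> \<le> ennreal c * (ennreal (?\<delta> * (T - t)) + ennreal (1 / ?\<delta>) *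
            ((\<I> r. sqr (U n w r - Y' w r)) +
             rate_integral (\<lambda>((w, r), y). sqr (V n w r y - Z w r y)) w + ?d n w))"
            unfolding c_def
            by (rule driver_integral_bound[where Y = Y' and Y' = "U n" and Z = Z and Z' = "V n" and d = "d n"
              and f' = "\<lambda>r y u z. f r y u z + d n r y", OF gen om s _ Zm Z2 Vm V2 Y's Us time_space_section(2)[OF d(1) om]]) auto
          also have "\<dots> \<le> ennreal c * (ennreal (?\<delta> * (T - t)) + ennreal (2 ^ n) * a n w)"
            unfolding power2_commute[of "U n _ _"] power2_commute[of "V n _ _ _"]
          proof (intro mult_left_mono add_left_mono)
            have "?y n w + rate_integral (?D n) w + ?d n w \<le>
                (?y n w + rate_integral (?D n) w + ?d n w) + (jump_integral (?D n) w + ?e n w)" by simp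
            also have "\<dots> = a n w" by (simp add: a_def ac_simps)
            finally show "ennreal (1 / ?\<delta>) * (?y n w + rate_integral (?D n) w + ?d n w) \<le> ennreal (2 ^ n) * a n w"
              by (simp add: mult_left_mono)
          qed simp
          finally show "ennreal \<bar>?F\<bar> \<le> ennreal c * (ennreal (?\<delta> * (T - t)) + ennreal (2 ^ n) * a n w)" .
          have "ennreal \<bar>?G\<bar> \<le> ennreal (?\<delta> * k) + ennreal (1 / ?\<delta>) * (jump_integral (?D n) w + rate_integral (?D n) w)"
            unfolding k_def by (rule compensated_integral_bound[OF om s _ bsde_spaceD(2)[OF diff]]) simp
          also have "\<dots> \<le> ennreal (?\<delta> * k) + ennreal (2 ^ n) * a n w"
          proof (intro add_left_mono)
            have "jump_integral (?D n) w + rate_integral (?D n) w \<le> a n w"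
            proof -
              have "jump_integral (?D n) w + rate_integral (?D n) w \<le>
                  (jump_integral (?D n) w + rate_integral (?D n) w) + (?y n w + ?d n w + ?e n w)" by simp
              also have "\<dots> = a n w" by (simp add: a_def ac_simps)
              finally show ?thesis .
            qed
            then show "ennreal (1 / ?\<delta>) * (jump_integral (?D n) w + rate_integral (?D n) w) \<le> ennreal (2 ^ n) * a n w"
              by (simp add: mult_left_mono)
          qed
          finally show "ennreal \<bar>?G\<bar> \<le> ennreal (?\<delta> * k) + ennreal (2 ^ n) * a n w" .
        qed
        also have "\<dots> = (ennreal ?\<delta> + ennreal c * ennreal (?\<delta> * (T - t)) + ennreal (?\<delta> * k)) +
            (ennreal c + 2) * (ennreal (2 ^ n) * a n w)"
          by (simp add: distrib_left distrib_right ac_simps mult_2)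
        also have "ennreal ?\<delta> + ennreal c * ennreal (?\<delta> * (T - t)) + ennreal (?\<delta> * k) = ennreal (?\<delta> + c * (?\<delta> * (T - t)) + ?\<delta> * k)"
          using c k t_le_T by (simp add: ennreal_mult' ennreal_plus del: times_divide_eq_left)
        also have "?\<delta> + c * (?\<delta> * (T - t)) + ?\<delta> * k = b / 2 ^ n" by (simp add: b_def field_simps)
        also have "ennreal c + 2 = ennreal (c + 2)" using c by (simp add: ennreal_plus)
        finally show ?thesis .
      qed
      have "(\<lambda>n. b * (1 / 2) ^ n) \<longlonglongrightarrow> b * 0" by (intro tendsto_mult tendsto_const LIMSEQ_power_zero) simp
      then have "(\<lambda>n. ennreal (b / 2 ^ n)) \<longlonglongrightarrow> ennreal 0"
        by (intro tendsto_ennrealI) (simp add: power_one_over)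
      moreover have "(\<lambda>n. ennreal (c + 2) * (ennreal (2 ^ n) * a n w)) \<longlonglongrightarrow> ennreal (c + 2) * 0"
        by (intro ennreal_tendsto_cmult elim(1)) simp
      ultimately have "(\<lambda>n. ennreal (b / 2 ^ n) + ennreal (c + 2) * (ennreal (2 ^ n) * a n w)) \<longlonglongrightarrow> ennreal 0 + ennreal (c + 2) * 0"
        by (rule tendsto_add)
      then have "(\<lambda>n. ennreal (b / 2 ^ n) + ennreal (c + 2) * (ennreal (2 ^ n) * a n w)) \<longlonglongrightarrow> 0" by simp
      then have "(\<lambda>n. ennreal \<bar>U n w s - ?R\<bar>) \<longlonglongrightarrow> 0"
        by (rule tendsto_sandwich[OF always_eventually always_eventually tendsto_const, rotated 2]) (auto intro: bound)
      then have "(\<lambda>n. \<bar>U n w s - ?R\<bar>) \<longlonglongrightarrow> 0" by (subst (asm) ennreal_tendsto_0_iff) auto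
      then show ?thesis by (simp add: tendsto_rabs_zero_iff LIM_zero_iff)
    qed
    have Yeq: "Y w s = g (X T w) + (LINT r:{s<..T}|lebesgue. f r (X r w) (Y' w r) (Z w r)) -
        compensated_integral K nu X t s T Z w" if "s \<in> {t..T}" for s
      unfolding Y_def by (rule limI[OF conv[OF that]])
    \<comment> \<open>Prepares Fatou's lemma, by which the pointwise limit \<open>Y\<close> equals
      the norm limit \<open>Y'\<close> at almost every time; \<open>Y\<close> may then take the
      place of \<open>Y'\<close> inside the driver.\<close>
    have yle: "(\<integral>\<^sup>+r. sqr (Y' w r - U n w r) \<partial>Leb) \<le> ennreal (2 ^ n) * a n w" for n
    proof -
      have "(\<integral>\<^sup>+r. sqr (Y' w r - U n w r) \<partial>Leb) = 1 * ?y n w" by (simp add: nn_integral_restrict_space)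
      also have "\<dots> \<le> ennreal (2 ^ n) * a n w"
        unfolding a_def by (intro mult_mono) (auto simp: add.assoc)
      finally show ?thesis .
    qed
    have yconv: "(\<lambda>n. sqr (Y' w r - U n w r)) \<longlonglongrightarrow> sqr (Y' w r - Y w r)" if "r \<in> {t..T}" for r
      using conv[OF that] unfolding Yeq[OF that] by (intro tendsto_ennrealI tendsto_intros)
    have "(\<integral>\<^sup>+r. sqr (Y' w r - Y w r) \<partial>Leb) = (\<integral>\<^sup>+r. liminf (\<lambda>n. sqr (Y' w r - U n w r)) \<partial>Leb)"
      using lim_imp_Liminf[OF sequentially_bot yconv] by (intro nn_integral_cong) simp
    also have "\<dots> \<le> liminf (\<lambda>n. \<integral>\<^sup>+r. sqr (Y' w r - U n w r) \<partial>Leb)"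
      using Us Y's by (intro nn_integral_liminf) simp
    also have "\<dots> \<le> liminf (\<lambda>n. ennreal (2 ^ n) * a n w)" by (intro Liminf_mono always_eventually allI yle)
    also have "\<dots> = 0" using lim_imp_Liminf[OF sequentially_bot elim(1)] .
    finally have "(\<integral>\<^sup>+r. sqr (Y' w r - Y w r) \<partial>Leb) = 0" by simp
    moreover have "Y w \<in> borel_measurable Leb"
      unfolding Y_def[abs_def] by (rule borel_measurable_lim_metric[OF Us])
    ultimately have "AE r in Leb. sqr (Y' w r - Y w r) = 0"
      using Y's by (subst (asm) nn_integral_0_iff_AE) auto
    then have "AE r in lborel. r \<in> {t..T} \<longrightarrow> Y' w r = Y w r" by (subst (asm) AE_restrict_space_iff) auto
    with Yeq show ?case by simp
  qed
  have "(\<lambda>p. lim (\<lambda>n. case p of (w, s) \<Rightarrow> U n w s)) \<in> borel_measurable Prg"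
    using Um by (rule borel_measurable_lim_metric)
  then have Ym: "progressive_field Y" by (simp add: Y_def case_prod_beta')
  have "(\<E> w. (\<I> s. sqr (Y w s))) = (\<E> w. (\<I> s. sqr (Y' w s)))"
  proof (rule nn_integral_cong_AE)
    show "AE w in \<Q>. (\<I> s. sqr (Y w s)) = (\<I> s. sqr (Y' w s))"
      using main
    proof eventually_elim
      case (elim w)
      then have "AE r in lborel. r \<in> {t..T} \<longrightarrow> Y' w r = Y w r" by simp
      then show ?case by (intro nn_integral_cong_AE) (auto elim!: eventually_mono simp: indicator_def)
    qed
  qed
  then have S'': "(Y, Z) \<in> \<M>"
    using Ym Zm bsde_spaceD(3)[OF S'] unfolding bsde_space_def bsde_norm_sq_def by simp
  have "solves_bsde K nu X \<Q> t T g f Y Z"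
    unfolding solves_bsde_def using main
  proof eventually_elim
    case (elim w)
    then have ae: "AE r in lborel. r \<in> {t..T} \<longrightarrow> Y' w r = Y w r" by simp
    show ?case
    proof
      fix s assume s: "s \<in> {t..T}"
      have "AE r in lborel. indicator {s<..T} r *\<^sub>R f r (X r w) (Y' w r) (Z w r) = indicator {s<..T} r *\<^sub>R f r (X r w) (Y w r) (Z w r)"
        using ae by eventually_elim (use s in \<open>auto simp: indicator_def\<close>)
      from completion_integral_cong_AE[OF AE_completion[OF this]]
      show "Y w s + compensated_integral K nu X t s T Z w = g (X T w) + (LINT r:{s<..T}|lebesgue. f r (X r w) (Y w r) (Z w r))"
        using elim s by (simp add: set_lebesgue_integral_def)
    qed
  qed
  with S'' show thesis by (rule that)
qed

end

lemma (in markov_jump_process) generator_add: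
  assumes gen: "generator L L' f" and d: "(\<lambda>(s, y). d s y) \<in> borel_measurable (Time \<Otimes>\<^sub>M K)"
  shows "generator L L' (\<lambda>s y u z. f s y u z + d s y)"
proof -
  have "(\<lambda>(s, y, u). f s y u z + d s y) \<in> borel_measurable (Time \<Otimes>\<^sub>M K \<Otimes>\<^sub>M borel)"
    if z: "z \<in> borel_measurable K" "bounded (z ` space K)" for z
  proof -
    have "(\<lambda>p. (fst p, fst (snd p))) \<in> Time \<Otimes>\<^sub>M K \<Otimes>\<^sub>M borel \<rightarrow>\<^sub>M Time \<Otimes>\<^sub>M K"
      by (intro measurable_Pair measurable_fst measurable_compose[OF measurable_snd measurable_fst])
    from borel_measurable_add[OF generatorD(3)[OF gen z] measurable_compose[OF this d]]
    show ?thesis by (simp add: case_prod_beta')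
  qed
  then show ?thesis using gen by (simp add: generator_def)
qed

context started_process
begin

text \<open>The truncation levels are selected after the stability constant is known, so that the
  increments decay like \<open>1 / 16^n\<close> from the outset, as \<open>bsde_space_limit\<close>
  demands. The tails of the data serve a second time as the vanishing perturbations in
  \<open>solution_limit\<close>.\<close>

theorem solution_exists:
  assumes gen: "generator L L' f" and g: "g \<in> borel_measurable K"
    and g2: "(\<E> w. sqr \<bar>g (X T w)\<bar>) < \<infinity>"
    and f2: "(\<E> w. (\<I> s. sqr \<bar>f s (X s w) 0 (\<lambda>_. 0)\<bar>)) < \<infinity>"
  obtains Y Z where "(Y, Z) \<in> \<M>" "solves_bsde K nu X \<Q> t T g f Y Z"
proof -
  let ?f0 = "\<lambda>s y. f s y 0 (\<lambda>_. 0)"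
  define C where "C = estimate_const L L'"
  have C: "0 \<le> C" using generatorD(2)[OF gen] by (simp add: C_def estimate_const_nonneg)
  \<comment> \<open>Two uses of \<open>(a - b)^2 \<le> 2 a^2 + 2 b^2\<close>, one for the terminal
    value and one for the driver, produce \<open>8 * \<eta> n\<close>, which the stability estimate
    multiplies by \<open>C\<close>. Since \<open>C / (C + 1) \<le> 1\<close>, the result is at most
    \<open>1 / 16^n\<close>.\<close>
  define \<eta> where "\<eta> n = 1 / (C + 1) / 16 ^ n / 8" for n :: nat
  have \<eta>: "0 < \<eta> n" "\<eta> n \<le> 16 / 4 ^ n" "\<eta> (Suc n) \<le> \<eta> n" for n
  proof -
    show "0 < \<eta> n" using C by (simp add: \<eta>_def)
    show "\<eta> (Suc n) \<le> \<eta> n" unfolding \<eta>_def using C by (intro divide_right_mono divide_left_mono) simp_all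
    have "1 / (C + 1) / 16 ^ n / 8 \<le> 1 / 1 / 16 ^ n / 1"
      using C by (intro frac_le divide_right_mono) simp_all
    then have "\<eta> n \<le> 1 / 16 ^ n" unfolding \<eta>_def by simp
    also have "\<dots> \<le> 16 / 4 ^ n" by (intro frac_le power_increasing order_trans[OF power_mono[of 4 16 n]]) auto
    finally show "\<eta> n \<le> 16 / 4 ^ n" .
  qed
  have f0m: "(\<lambda>(w, s). ?f0 s (X s w)) \<in> borel_measurable QT"
    by (rule time_space_section(1)[OF zero_driver_measurable[OF gen]])
  have QL_eq: "(\<E> w. (\<I> s. sqr (k (?f0 s (X s w))))) =
      (\<integral>\<^sup>+p. sqr (k ((\<lambda>(w, s). ?f0 s (X s w)) p)) \<partial>QT)"
    if "k \<in> borel_measurable borel" for k :: "real \<Rightarrow> real"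
  proof -
    have "(\<lambda>(w, s). sqr (k (?f0 s (X s w)))) \<in> borel_measurable QT"
      using measurable_compose[OF f0m that] by (simp add: case_prod_beta')
    from nn_integral_QL[OF this] show ?thesis by (simp add: case_prod_beta')
  qed
  have "(\<lambda>u::real. u) \<in> borel_measurable borel" by simp
  from QL_eq[OF this] f2
  have f2': "(\<integral>\<^sup>+p. sqr ((\<lambda>(w, s). ?f0 s (X s w)) p) \<partial>QT) < \<infinity>"
    by (simp only: power2_abs)
  have "\<forall>n. \<exists>N::nat. (\<E> w. sqr (excess (real N) (g (X T w)))) \<le> ennreal (\<eta> n) \<and>
      (\<E> w. (\<I> s. sqr (excess (real N) (?f0 s (X s w))))) \<le> ennreal (\<eta> n)"
  proof
    fix n
    have A: "(\<lambda>N. \<integral>\<^sup>+w. sqr (excess (real N) (g (X T w))) \<partial>\<Q>) \<longlonglongrightarrow> 0"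
      using measurable_compose[OF X_Q[OF t_le_T] g] g2 by (intro excess_tail) simp_all
    have B: "(\<lambda>N. \<integral>\<^sup>+w. (\<I> s. sqr (excess (real N) (?f0 s (X s w)))) \<partial>\<Q>) \<longlonglongrightarrow> 0"
      unfolding QL_eq[OF borel_measurable_excess] by (rule excess_tail[OF f0m f2'])
    have pos: "0 < ennreal (\<eta> n)" using \<eta>(1) by simp
    from eventually_happens'[OF sequentially_bot eventually_conj[OF order_tendstoD(2)[OF A pos] order_tendstoD(2)[OF B pos]]]
    obtain N where N: "(\<E> w. sqr (excess (real N) (g (X T w)))) < ennreal (\<eta> n)"
      "(\<E> w. (\<I> s. sqr (excess (real N) (?f0 s (X s w))))) < ennreal (\<eta> n)"
      by blast
    show "\<exists>N::nat. (\<E> w. sqr (excess (real N) (g (X T w)))) \<le> ennreal (\<eta> n) \<and>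
      (\<E> w. (\<I> s. sqr (excess (real N) (?f0 s (X s w))))) \<le> ennreal (\<eta> n)"
      using N[THEN less_imp_le] by blast
  qed
  from choice[OF this] obtain N where N: "\<forall>n. (\<E> w. sqr (excess (real (N n)) (g (X T w)))) \<le> ennreal (\<eta> n) \<and>
      (\<E> w. (\<I> s. sqr (excess (real (N n)) (?f0 s (X s w))))) \<le> ennreal (\<eta> n)"
    by (elim exE)
  note Ng = N[THEN spec, THEN conjunct1] and Nf = N[THEN spec, THEN conjunct2]
  define e where "e n y = - excess (real (N n)) (g y)" for n y
  define d where "d n s y = - excess (real (N n)) (?f0 s y)" for n s y
  have em: "e n \<in> borel_measurable K" for n using measurable_compose[OF g borel_measurable_excess] by (simp add: e_def[abs_def])
  have dm: "(\<lambda>(s, y). d n s y) \<in> borel_measurable (Time \<Otimes>\<^sub>M K)" for n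
    using measurable_compose[OF zero_driver_measurable[OF gen] borel_measurable_excess] by (simp add: d_def case_prod_beta')
  define F where "F n s y u z = f s y u z + d n s y" for n s y u z
  have genF: "generator L L' (F n)" for n unfolding F_def[abs_def] by (rule generator_add[OF gen dm])
  have "\<forall>n. \<exists>p. p \<in> \<M> \<and> solves_bsde K nu X \<Q> t T (\<lambda>y. g y + e n y) (F n) (fst p) (snd p)"
  proof
    fix n
    have 1: "\<bar>F n r y 0 (\<lambda>_. 0)\<bar> \<le> real (N n)" for r y by (simp add: F_def d_def excess_def)
    have 2: "(\<lambda>y. g y + e n y) \<in> borel_measurable K" using g em by simp
    have 3: "\<bar>g y + e n y\<bar> \<le> real (N n)" for y by (simp add: e_def excess_def)
    obtain U V where "(U, V) \<in> \<M>" "solves_bsde K nu X \<Q> t T (\<lambda>y. g y + e n y) (F n) U V"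
      by (rule bounded_solution[OF genF 1 2 3])
    then show "\<exists>p. p \<in> \<M> \<and> solves_bsde K nu X \<Q> t T (\<lambda>y. g y + e n y) (F n) (fst p) (snd p)"
      by (intro exI[of _ "(U, V)"]) simp
  qed
  from choice[OF this] obtain W where W: "\<forall>n. W n \<in> \<M> \<and>
      solves_bsde K nu X \<Q> t T (\<lambda>y. g y + e n y) (F n) (fst (W n)) (snd (W n))"
    by (elim exE)
  define U where "U n = fst (W n)" for n
  define V where "V n = snd (W n)" for n
  have S: "(U n, V n) \<in> \<M>" for n using W by (simp add: U_def V_def)
  have sol: "solves_bsde K nu X \<Q> t T (\<lambda>y. g y + e n y) (F n) (U n) (V n)" for n using W by (simp add: U_def V_def)
  \<comment> \<open>Truncation only decreases the modulus of the driver at zero, so square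
    integrability carries over from \<open>f\<close>.\<close>
  have F2: "(\<E> w. (\<I> s. sqr \<bar>F n s (X s w) 0 (\<lambda>_. 0)\<bar>)) < \<infinity>" for n
  proof (rule le_less_trans[OF _ f2], intro nn_integral_mono mult_right_mono ennreal_leI)
    show "\<bar>F n s (X s w) 0 (\<lambda>_. 0)\<bar>\<^sup>2 \<le> \<bar>?f0 s (X s w)\<bar>\<^sup>2" for s w by (simp add: F_def d_def excess_def)
  qed simp
  note i = driver_integrable[OF genF S F2]
  have sq: "sqr (a - b) \<le> 2 * sqr a + 2 * sqr b" for a b :: real by (rule square_diff_le)
  have inc: "norm_sq (\<lambda>w s. U (Suc n) w s - U n w s) (\<lambda>w s y. V (Suc n) w s y - V n w s y) \<le> ennreal (1 / 16 ^ n)" for n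
  proof -
    have eg: "(\<E> w. sqr (e m (X T w))) \<le> ennreal (\<eta> n)" if "m = n \<or> m = Suc n" for m
      using Ng[of m] order_trans[OF Ng[of "Suc n"] ennreal_leI[OF \<eta>(3)]] that by (auto simp: e_def)
    have ed: "(\<E> w. (\<I> s. sqr (d m s (X s w)))) \<le> ennreal (\<eta> n)" if "m = n \<or> m = Suc n" for m
      using Nf[of m] order_trans[OF Nf[of "Suc n"] ennreal_leI[OF \<eta>(3)]] that by (auto simp: d_def)
    have eQ: "(\<lambda>w. sqr (e m (X T w))) \<in> borel_measurable \<Q>" for m
      using measurable_compose[OF X_Q[OF t_le_T] em, of m] by simp
    have dQL: "(\<lambda>(w, s). sqr (d m s (X s w))) \<in> borel_measurable QT" for m
      using time_space_section(1)[OF dm, of m] by (simp add: case_prod_beta')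
    have "(\<E> w. sqr (g (X T w) + e (Suc n) (X T w) - (g (X T w) + e n (X T w)))) \<le>
        (\<E> w. 2 * sqr (e (Suc n) (X T w)) + 2 * sqr (e n (X T w)))"
      using sq by (intro nn_integral_mono) simp
    also have "\<dots> = 2 * (\<E> w. sqr (e (Suc n) (X T w))) + 2 * (\<E> w. sqr (e n (X T w)))"
      using eQ by (simp add: nn_integral_add nn_integral_cmult)
    also have "\<dots> \<le> 2 * ennreal (\<eta> n) + 2 * ennreal (\<eta> n)" by (intro add_mono mult_left_mono eg) auto
    finally have 1: "(\<E> w. sqr (g (X T w) + e (Suc n) (X T w) - (g (X T w) + e n (X T w)))) \<le>
        2 * ennreal (\<eta> n) + 2 * ennreal (\<eta> n)" .
    have "(\<E> w. (\<I> s. sqr (d (Suc n) s (X s w) - d n s (X s w)))) =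
        (\<integral>\<^sup>+(w, s). sqr (d (Suc n) s (X s w) - d n s (X s w)) \<partial>QT)"
      using time_space_section(1)[OF dm, of n] time_space_section(1)[OF dm, of "Suc n"]
      by (intro nn_integral_QL) (simp add: case_prod_beta')
    also have "\<dots> \<le> (\<integral>\<^sup>+p. 2 * (\<lambda>(w, s). sqr (d (Suc n) s (X s w))) p + 2 * (\<lambda>(w, s). sqr (d n s (X s w))) p \<partial>QT)"
      using sq by (intro nn_integral_mono) (simp add: case_prod_beta')
    also have "\<dots> = 2 * (\<integral>\<^sup>+(w, s). sqr (d (Suc n) s (X s w)) \<partial>QT) + 2 * (\<integral>\<^sup>+(w, s). sqr (d n s (X s w)) \<partial>QT)"
      using dQL[of n] dQL[of "Suc n"] by (subst nn_integral_add) (simp_all add: nn_integral_cmult)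
    also have "\<dots> \<le> 2 * ennreal (\<eta> n) + 2 * ennreal (\<eta> n)"
      unfolding nn_integral_QL[OF dQL, symmetric] by (intro add_mono mult_left_mono ed) auto
    finally have 2: "(\<E> w. (\<I> s. sqr (d (Suc n) s (X s w) - d n s (X s w)))) \<le>
        2 * ennreal (\<eta> n) + 2 * ennreal (\<eta> n)" .
    have "norm_sq (\<lambda>w s. U (Suc n) w s - U n w s) (\<lambda>w s y. V (Suc n) w s y - V n w s y) \<le>
      ennreal C * ((\<E> w. sqr (g (X T w) + e (Suc n) (X T w) - (g (X T w) + e n (X T w)))) +
        (\<E> w. (\<I> s. sqr (d (Suc n) s (X s w) - d n s (X s w)))))"
      unfolding C_def
    proof (rule solution_stability[where d = "\<lambda>s y. d (Suc n) s y - d n s y", OF genF S S _ _ i i sol sol])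
      show "(\<lambda>(s, y). d (Suc n) s y - d n s y) \<in> borel_measurable (Time \<Otimes>\<^sub>M K)"
        using borel_measurable_diff[OF dm dm] by (simp add: case_prod_beta')
    qed (use g em in \<open>simp_all add: F_def\<close>)
    also have "\<dots> \<le> ennreal C * ((2 * ennreal (\<eta> n) + 2 * ennreal (\<eta> n)) + (2 * ennreal (\<eta> n) + 2 * ennreal (\<eta> n)))"
      by (intro mult_left_mono add_mono 1 2) simp
    also have "\<dots> = ennreal (C * (8 * \<eta> n))"
    proof -
      have "(2 * ennreal (\<eta> n) + 2 * ennreal (\<eta> n)) + (2 * ennreal (\<eta> n) + 2 * ennreal (\<eta> n)) = ennreal 8 * ennreal (\<eta> n)"
        by (simp add: distrib_right[symmetric])
      then show ?thesis using C by (simp add: ennreal_mult')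
    qed
    also have "\<dots> \<le> ennreal (1 / 16 ^ n)"
    proof (rule ennreal_leI)
      have "C / (C + 1) \<le> 1" using C by simp
      then have "C / (C + 1) / 16 ^ n \<le> 1 / 16 ^ n" by (intro divide_right_mono) simp_all
      moreover have "8 * (u / 8) = u" for u :: real by simp
      from this[of "1 / (C + 1) / 16 ^ n"] have "C * (8 * \<eta> n) = C / (C + 1) / 16 ^ n" by (simp only: \<eta>_def) simp
      ultimately show "C * (8 * \<eta> n) \<le> 1 / 16 ^ n" by simp
    qed
    finally show ?thesis .
  qed
  note lim = bsde_space_limit[where Y = U and Z = V, OF S inc]
  obtain Y where "(Y, \<lambda>w s y. lim (\<lambda>k. V k w s y)) \<in> \<M>"
    "solves_bsde K nu X \<Q> t T g f Y (\<lambda>w s y. lim (\<lambda>k. V k w s y))"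
  proof (rule solution_limit[where C = 16 and d = d and e = e and U = U and V = V, OF gen _ S lim(1,2) dm _ em _ _ _ sol[unfolded F_def[abs_def]]])
    show "(\<E> w. (\<I> r. sqr (d n r (X r w)))) \<le> ennreal (16 / 4 ^ n)" for n
      using order_trans[OF Nf ennreal_leI[OF \<eta>(2)]] by (simp add: d_def)
    show "(\<E> w. sqr (e n (X T w))) \<le> ennreal (16 / 4 ^ n)" for n
      using order_trans[OF Ng ennreal_leI[OF \<eta>(2)]] by (simp add: e_def)
    show "AE w in \<Q>. set_integrable lebesgue {t<..T} (\<lambda>r. f r (X r w) (U n w r) (V n w r) + d n r (X r w))" for n
      using i[of n] by (simp add: F_def)
    show "AE w in \<Q>. set_integrable lebesgue {t<..T} (\<lambda>r. f r (X r w) (lim (\<lambda>k. U k w r)) (\<lambda>y. lim (\<lambda>k. V k w r y)))"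
      by (rule driver_integrable[OF gen lim(1) f2])
  qed simp
  then show thesis by (rule that)
qed

text \<open>Stability with equal data: the bound is a multiple of 0.\<close>

theorem solution_unique:
  assumes gen: "generator L L' f" and g: "g \<in> borel_measurable K"
    and f2: "(\<E> w. (\<I> s. sqr \<bar>f s (X s w) 0 (\<lambda>_. 0)\<bar>)) < \<infinity>"
    and S: "(Y, Z) \<in> \<M>" "(Y', Z') \<in> \<M>"
    and sol: "solves_bsde K nu X \<Q> t T g f Y Z" "solves_bsde K nu X \<Q> t T g f Y' Z'"
  shows "norm_sq (\<lambda>w s. Y' w s - Y w s) (\<lambda>w s y. Z' w s y - Z w s y) = 0"
proof -
  note i = driver_integrable[OF gen S(1) f2] driver_integrable[OF gen S(2) f2]
  have "norm_sq (\<lambda>w s. Y' w s - Y w s) (\<lambda>w s y. Z' w s y - Z w s y) \<le>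
    ennreal (estimate_const L L') * ((\<E> w. sqr (g (X T w) - g (X T w))) +
      (\<E> w. (\<I> r. ennreal (0\<^sup>2))))"
    by (rule solution_stability[where d = "\<lambda>_ _. 0", OF gen S _ _ i sol g g]) simp_all
  then show ?thesis by simp
qed

end

theorem theorem3p4:
  fixes T t :: real and K :: "'k measure" and nu :: "real \<Rightarrow> 'k \<Rightarrow> 'k measure"
    and Om :: "'w set" and X :: "real \<Rightarrow> 'w \<Rightarrow> 'k" and P :: "real \<Rightarrow> 'k \<Rightarrow> 'w measure"
    and x :: 'k and g :: "'k \<Rightarrow> real"
    and f :: "real \<Rightarrow> 'k \<Rightarrow> real \<Rightarrow> ('k \<Rightarrow> real) \<Rightarrow> real"
  assumes "markov_jump_process T K nu Om X P"
    and "t \<in> {0..T}" and "x \<in> space K"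
    and "g \<in> borel_measurable K"
    and "(\<integral>\<^sup>+\<omega>. ennreal (\<bar>g (X T \<omega>)\<bar>\<^sup>2) \<partial>P t x) < \<infinity>"
    and "\<And>z. z \<in> borel_measurable K \<Longrightarrow> bounded (z ` space K) \<Longrightarrow>
      (\<lambda>(s, x', r). f s x' r z) \<in>
        borel_measurable (restrict_space borel {0..T} \<Otimes>\<^sub>M K \<Otimes>\<^sub>M borel)"
    and "\<exists>L\<ge>0. \<exists>L'\<ge>0. \<forall>s\<in>{0..T}. \<forall>x'\<in>space K. \<forall>r r' z z'.
      square_integrable (nu s x') z \<longrightarrow> square_integrable (nu s x') z' \<longrightarrow>
      \<bar>f s x' r z - f s x' r' z'\<bar> \<le>
        L' * \<bar>r - r'\<bar> + L * sqrt (LINT y|nu s x'. \<bar>z y - z' y\<bar>\<^sup>2)"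
    and "(\<integral>\<^sup>+\<omega>. (\<integral>\<^sup>+s\<in>{t..T}. ennreal (\<bar>f s (X s \<omega>) 0 (\<lambda>_. 0)\<bar>\<^sup>2) \<partial>lborel) \<partial>P t x) < \<infinity>"
  shows "\<exists>Y Z. (Y, Z) \<in> bsde_space Om K nu X (P t x) t T \<and>
      solves_bsde K nu X (P t x) t T g f Y Z \<and>
      (\<forall>Y' Z'. (Y', Z') \<in> bsde_space Om K nu X (P t x) t T \<and>
               solves_bsde K nu X (P t x) t T g f Y' Z' \<longrightarrow>
         bsde_norm_sq nu X (P t x) t T (\<lambda>\<omega> s. Y' \<omega> s - Y \<omega> s) (\<lambda>\<omega> s y. Z' \<omega> s y - Z \<omega> s y) = 0)"
proof -
  obtain L L' where gen: "markov_jump_process.generator T K nu L L' f"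
    using assms(6,7) markov_jump_process.generator_def[OF assms(1)] by blast
  interpret started_process T K nu Om X P t x
    using assms(1-3) by (intro started_process.intro started_process_axioms.intro)
  obtain Y Z where S: "(Y, Z) \<in> bsde_space Om K nu X \<Q> t T" and sol: "solves_bsde K nu X \<Q> t T g f Y Z"
    using solution_exists[OF gen assms(4,5,8)] .
  with solution_unique[OF gen assms(4,8) S _ sol] show ?thesis by blast
qed

end
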